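(* Let $0\le\alpha<1$ and let $(U,\mu)$ be a conformal transformation from the order-$\frac{1}{1-\alpha}$ cycle $(A,E_B,D_1)$ to the order-$\frac{1}{1-\alpha}$ cycle $(A,E'_B,D_2)$. Then the bounded transforms $(A,E_B,F_{D_1})$ and $(A,E'_B,F_{D_2})$ are unitarily equivalent up to locally compact perturbation via the unitary $U$; that is, $(U^*F_{D_2}U-F_{D_1})a\in\operatorname{End}^0(E)$ for all $a\in A$. Hence $[(A,E_B,F_{D_1})]=[(A,E'_B,F_{D_2})]\in KK(A,B)$ (and also $[(A,E_B,D_1)]=[(A,E'_B,D_2)]$).
   Context: All C*-algebras are complex and trivially graded. For a right Hilbert $B$-module $E$, $\operatorname{End}^*(E)$ is the C*-algebra of adjointable operators and $\operatorname{End}^0(E)$ the ideal of compact operators in the Hilbert-module sense. An $A$-$B$-correspondence is a right Hilbert $B$-module $E$ with a $*$-homomorphism $A\to\operatorname{End}^*(E)$; elements of $A$ are identified with their images. Saying that a densely defined operator is bounded means that it extends to an adjointable operator. For a self-adjoint regular operator $D$ put $\langle D\rangle=(1+D^2)^{1/2}$ and $F_D=D(1+D^2)^{-1/2}$. $\overline{\operatorname{span}}$ denotes the norm-closed linear span. Bounded Kasparov module: an $A$-$B$-correspondence $E$ and $F\in\operatorname{End}^*(E)$ such that $(F^*-F)a$, $(1-F^2)a$, $[F,a]$ are compact for all $a\in A$. It is even if $E$ is $\mathbb{Z}/2$-graded, $A$ acts by even operators and $F$ is odd; it is odd if $E$ is ungraded. $KK(A,B)$ denotes $KK_0(A,B)$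 for even modules and $KK_1(A,B)$ for odd modules. $\operatorname{Lip}^*_\alpha(D)$ ($0\le\alpha\le1$): the $*$-algebra of $a\in\operatorname{End}^*(E)$ with $a\operatorname{dom}D\subseteq\operatorname{dom}D$ such that $[D,a]\langle D\rangle^{-\alpha}$ and $\langle D\rangle^{-\alpha}[D,a]$ extend to adjointable operators. Order-$\frac{1}{1-\alpha}$ cycle ($0\le\alpha<1$): $(A,E_B,D)$ where $E$ is an $A$-$B$-correspondence and $D$ is a regular operator on $E$ such that $D$ is self-adjoint, $(1+D^2)^{-1}a$ is compact for all $a\in A$, and $A$ is contained in the norm closure of $\operatorname{Lip}^*_\alpha(D)$. It is even if $E$ is $\mathbb{Z}/2$-graded, $A$ acts by even operators and $D$ is odd; it is odd if $E$ is ungraded. The bounded transform $(A,E_B,F_D)$ of a cycle is a bounded Kasparov module of the same parity, and $[(A,E_B,D)]$ denotes its class in $KK(A,B)$. Conformal transformation $(U,\mu)$ from $(A,E_B,D_1)$ to $(A,E'_B,D_2)$ (cycles of the same parity): a unitary $U:E\to E'$ intertwining the representations of $A$ (grading-preserving if the modules are graded), and an invertible $\mu\in\operatorname{End}^*(E)$ (even if the module is graded), such that $A\subseteq\overline{\operatorname{span}}(A\mathscr M)\cap\overline{\operatorname{span}}(\mathscr M A)$, where $\mathscr M$ is the set of $a\in\operatorname{End}^*(E)$ such that $(U^*D_2Ua-a\mu D_1\mu^* )\mu^{-1*}\langle D_1\rangle^{-\alpha}$ and $\langle D_2\rangle^{-\alpha}U(U^*D_2Ua-a\mu D_1\mu^*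 )$ are bounded and $a,\ a\mu,\ a\mu^{-1*}\in\operatorname{Lip}^*_\alpha(D_1)$. Here $\mu^{-1*}=(\mu^{-1})^*$.
   Formalization: Elements a of 𝓜 are also required to map dom(D₁μ* ) into dom(D₂U); with boundedness on a merely dense natural domain the claim fails, e.g. for −i d/dx on L²[0,1] with two different quasi-periodic boundary conditions. *)

theory Defs
  imports "HOL-Analysis.Analysis" "HOL-Library.Function_Algebras"
begin

section \<open>Complex vector spaces and C*-algebras\<close>

class complex_vector = ab_group_add +
  fixes scaleC :: "complex \<Rightarrow> 'a \<Rightarrow> 'a"  (infixr \<open>*\<^sub>C\<close> 75)
  assumes scaleC_add_right: "c *\<^sub>C (x + y) = c *\<^sub>C x + c *\<^sub>C y"
    and scaleC_add_left: "(c + d) *\<^sub>C x = c *\<^sub>C x + d *\<^sub>C x"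
    and scaleC_scaleC: "c *\<^sub>C d *\<^sub>C x = (c * d) *\<^sub>C x"
    and scaleC_one: "1 *\<^sub>C x = x"

interpretation complex_vector: vector_space "scaleC :: complex \<Rightarrow> 'a \<Rightarrow> 'a::complex_vector"
  by unfold_locales (simp_all add: scaleC_add_right scaleC_add_left scaleC_scaleC scaleC_one)

instantiation "fun" :: (type, complex_vector) complex_vector
begin
definition "c *\<^sub>C f = (\<lambda>x. c *\<^sub>C f x)"
instance
  by standard
    (simp_all add: scaleC_fun_def fun_eq_iff scaleC_add_right scaleC_add_left scaleC_scaleC scaleC_one)
end

instantiation prod :: (complex_vector, complex_vector) complex_vector
begin
definition "c *\<^sub>C p = (c *\<^sub>C fst p, c *\<^sub>C snd p)"
instance
  by standard
    (simp_all add: scaleC_prod_def prod_eq_iff scaleC_add_right scaleC_add_left scaleC_scaleC scaleC_one)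
end

text \<open>C*-algebras need not be unital. The norm of the library class \<^class>\<open>real_normed_algebra\<close>
  is submultiplicative, and \<^class>\<open>banach\<close> gives completeness.\<close>

class cstar_algebra = real_normed_algebra + banach + complex_vector +
  fixes star :: "'a \<Rightarrow> 'a"  (\<open>_\<^sup>\<star>\<close> [1000] 999)
  assumes scaleR_scaleC: "r *\<^sub>R x = complex_of_real r *\<^sub>C x"
    and mult_scaleC_left: "(c *\<^sub>C x) * y = c *\<^sub>C (x * y)"
    and mult_scaleC_right: "x * (c *\<^sub>C y) = c *\<^sub>C (x * y)"
    and norm_scaleC: "norm (c *\<^sub>C x) = cmod c * norm x"
    and star_star: "(x\<^sup>\<star>)\<^sup>\<star> = x"
    and star_add: "(x + y)\<^sup>\<star> = x\<^sup>\<star> + y\<^sup>\<star>"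
    and star_scaleC: "(c *\<^sub>C x)\<^sup>\<star> = cnj c *\<^sub>C x\<^sup>\<star>"
    and star_mult: "(x * y)\<^sup>\<star> = y\<^sup>\<star> * x\<^sup>\<star>"
    and cstar_identity: "norm (x\<^sup>\<star> * x) = (norm x)\<^sup>2"

definition cstar_positive :: "'b::cstar_algebra \<Rightarrow> bool" where
  "cstar_positive x \<longleftrightarrow> (\<exists>y. x = y\<^sup>\<star> * y)"


section \<open>The C*-algebra of continuous functions on the unit interval\<close>

lemma star_diff: "(x - y)\<^sup>\<star> = x\<^sup>\<star> - y\<^sup>\<star>" for x y :: "'b::cstar_algebra"
  using star_add[of "x - y" y] by (simp add: algebra_simps)

lemma norm_star: "norm (x\<^sup>\<star>) = norm x" for x :: "'b::cstar_algebra"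
proof -
  have le: "norm y \<le> norm (y\<^sup>\<star>)" for y :: 'b
  proof (cases "norm y = 0")
    case False
    have "norm y * norm y = norm (y\<^sup>\<star> * y)"
      by (simp add: cstar_identity power2_eq_square)
    also have "\<dots> \<le> norm (y\<^sup>\<star>) * norm y"
      by (rule norm_mult_ineq)
    finally show ?thesis
      using False by simp
  qed simp
  from le[of x] le[of "x\<^sup>\<star>"] show ?thesis
    by (simp add: star_star)
qed

lemma bounded_linear_star: "bounded_linear (star :: 'b \<Rightarrow> 'b::cstar_algebra)"
  by (rule bounded_linear_intro[where K = 1])
    (simp_all add: star_add scaleR_scaleC star_scaleC norm_star)

lemma bounded_linear_scaleC: "bounded_linear ((*\<^sub>C) c :: 'b \<Rightarrow> 'b::cstar_algebra)"
  by (rule bounded_linear_intro[where K = "cmod c"])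
    (simp_all add: scaleC_add_right scaleR_scaleC norm_scaleC scaleC_scaleC mult.commute)

setup_lifting type_definition_bcontfun

instantiation bcontfun :: (metric_space, cstar_algebra) cstar_algebra
begin

lift_definition times_bcontfun :: "('a \<Rightarrow>\<^sub>C 'b) \<Rightarrow> ('a \<Rightarrow>\<^sub>C 'b) \<Rightarrow> 'a \<Rightarrow>\<^sub>C 'b"
  is "\<lambda>f g x. f x * g x"
proof -
  fix f g :: "'a \<Rightarrow> 'b"
  assume f: "f \<in> bcontfun" and g: "g \<in> bcontfun"
  from f obtain K where K: "\<And>x. norm (f x) \<le> K"
    by (auto simp: bcontfun_def bounded_iff)
  from g obtain L where L: "\<And>x. norm (g x) \<le> L"
    by (auto simp: bcontfun_def bounded_iff)
  show "(\<lambda>x. f x * g x) \<in> bcontfun"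
  proof (rule bcontfun_normI)
    show "continuous_on UNIV (\<lambda>x. f x * g x)"
      using f g by (auto simp: bcontfun_def intro: continuous_intros)
    show "norm (f x * g x) \<le> K * L" for x
      by (rule order_trans[OF norm_mult_ineq mult_mono])
        (use K L order_trans[OF norm_ge_zero K] in auto)
  qed
qed

lift_definition star_bcontfun :: "('a \<Rightarrow>\<^sub>C 'b) \<Rightarrow> 'a \<Rightarrow>\<^sub>C 'b" is "\<lambda>f x. (f x)\<^sup>\<star>"
  by (auto simp: bcontfun_def bounded_iff norm_star
      intro: bounded_linear.continuous_on[OF bounded_linear_star])

lift_definition scaleC_bcontfun :: "complex \<Rightarrow> ('a \<Rightarrow>\<^sub>C 'b) \<Rightarrow> 'a \<Rightarrow>\<^sub>C 'b" is "\<lambda>c f x. c *\<^sub>C f x"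
proof -
  fix c and f :: "'a \<Rightarrow> 'b"
  assume f: "f \<in> bcontfun"
  then obtain K where K: "\<And>x. norm (f x) \<le> K"
    by (auto simp: bcontfun_def bounded_iff)
  show "(\<lambda>x. c *\<^sub>C f x) \<in> bcontfun"
  proof (rule bcontfun_normI)
    show "continuous_on UNIV (\<lambda>x. c *\<^sub>C f x)"
      using f by (auto simp: bcontfun_def
          intro: bounded_linear.continuous_on[OF bounded_linear_scaleC])
    show "norm (c *\<^sub>C f x) \<le> cmod c * K" for x
      by (simp add: norm_scaleC K mult_left_mono)
  qed
qed

lemmas [simp] = times_bcontfun.rep_eq star_bcontfun.rep_eq scaleC_bcontfun.rep_eq

instance
proof
  fix f g h :: "'a \<Rightarrow>\<^sub>C 'b" and r :: real and c d :: complex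
  show "f * g * h = f * (g * h)" "(f + g) * h = f * h + g * h" "f * (g + h) = f * g + f * h"
    by (auto intro!: bcontfun_eqI simp: algebra_simps)
  show "r *\<^sub>R f * g = r *\<^sub>R (f * g)" "f * r *\<^sub>R g = r *\<^sub>R (f * g)"
    by (auto intro!: bcontfun_eqI)
  show "norm (f * g) \<le> norm f * norm g"
    by (rule norm_bound)
      (auto intro!: order_trans[OF norm_mult_ineq mult_mono] norm_bounded)
  show "c *\<^sub>C (f + g) = c *\<^sub>C f + c *\<^sub>C g" "(c + d) *\<^sub>C f = c *\<^sub>C f + d *\<^sub>C f"
    "c *\<^sub>C d *\<^sub>C f = (c * d) *\<^sub>C f" "1 *\<^sub>C f = f"
    by (auto intro!: bcontfun_eqI simp: scaleC_add_right scaleC_add_left)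
  show "r *\<^sub>R f = complex_of_real r *\<^sub>C f"
    by (auto intro!: bcontfun_eqI simp: scaleR_scaleC)
  show "c *\<^sub>C f * g = c *\<^sub>C (f * g)" "f * c *\<^sub>C g = c *\<^sub>C (f * g)"
    by (auto intro!: bcontfun_eqI simp: mult_scaleC_left mult_scaleC_right)
  show "(f\<^sup>\<star>)\<^sup>\<star> = f" "(f + g)\<^sup>\<star> = f\<^sup>\<star> + g\<^sup>\<star>" "(c *\<^sub>C f)\<^sup>\<star> = cnj c *\<^sub>C f\<^sup>\<star>"
    "(f * g)\<^sup>\<star> = g\<^sup>\<star> * f\<^sup>\<star>"
    by (auto intro!: bcontfun_eqI simp: star_star star_add star_scaleC star_mult)
  have norm_le: "norm (c *\<^sub>C f) \<le> cmod c * norm f" for c and f :: "'a \<Rightarrow>\<^sub>C 'b"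
    by (rule norm_bound) (auto simp: norm_scaleC intro!: mult_left_mono norm_bounded)
  show "norm (c *\<^sub>C f) = cmod c * norm f"
  proof (cases "c = 0")
    case True
    then show ?thesis
      using norm_le[of 0 f] by simp
  next
    case False
    have "norm f = norm (inverse c *\<^sub>C c *\<^sub>C f)"
      using False by (auto intro!: arg_cong[where f = norm] bcontfun_eqI)
    also have "\<dots> \<le> inverse (cmod c) * norm (c *\<^sub>C f)"
      using norm_le[of "inverse c" "c *\<^sub>C f"] by (simp add: norm_inverse)
    finally have "cmod c * norm f \<le> norm (c *\<^sub>C f)"
      using False by (simp add: field_simps)
    with norm_le[of c f] show ?thesis
      by simp
  qed
  show "norm (f\<^sup>\<star> * f) = (norm f)\<^sup>2"
  proof (rule antisym)
    show "norm (f\<^sup>\<star> * f) \<le> (norm f)\<^sup>2"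
      by (rule norm_bound) (auto simp: cstar_identity intro!: power_mono norm_bounded)
    have "norm (f x) \<le> sqrt (norm (f\<^sup>\<star> * f))" for x
      using norm_bounded[of "f\<^sup>\<star> * f" x] by (intro real_le_rsqrt) (simp add: cstar_identity)
    then have "norm f \<le> sqrt (norm (f\<^sup>\<star> * f))"
      by (rule norm_bound)
    then show "(norm f)\<^sup>2 \<le> norm (f\<^sup>\<star> * f)"
      by (metis norm_ge_zero power_mono real_sqrt_pow2)
  qed
qed

end

typedef unit_interval = "{0..1::real}"
  by auto

text \<open>The unit interval as a type; since it is compact,
  \<^typ>\<open>unit_interval \<Rightarrow>\<^sub>C 'b\<close> is \<open>C([0,1], B)\<close>.\<close>

instantiation unit_interval :: metric_space
begin
definition dist_unit_interval :: "unit_interval \<Rightarrow> unit_interval \<Rightarrow> real" where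
  "dist_unit_interval s t = dist (Rep_unit_interval s) (Rep_unit_interval t)"
definition uniformity_unit_interval :: "(unit_interval \<times> unit_interval) filter" where
  "uniformity_unit_interval = (INF e\<in>{0<..}. principal {(x, y). dist x y < e})"
definition open_unit_interval :: "unit_interval set \<Rightarrow> bool" where
  "open_unit_interval S = (\<forall>x\<in>S. \<forall>\<^sub>F (x', y) in uniformity. x' = x \<longrightarrow> y \<in> S)"
instance
  by standard
    (auto simp: dist_unit_interval_def uniformity_unit_interval_def open_unit_interval_def
      Rep_unit_interval_inject intro: dist_triangle2)
end


section \<open>Hilbert modules and adjointable operators\<close>

text \<open>The carrier of a Hilbert module is a complex subspace of an ambient vector space \<^typ>\<open>'e\<close>,
  which carries no topology and serves as a universe of modules: any two Hilbert modules can be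
  realised inside a common one, for instance inside their algebraic direct sum.\<close>

record ('e, 'b) hmod =
  hcarrier :: "'e set"
  hip :: "'e \<Rightarrow> 'e \<Rightarrow> 'b"
  hact :: "'e \<Rightarrow> 'b \<Rightarrow> 'e"

definition hnorm :: "('e, 'b::cstar_algebra, 'z) hmod_scheme \<Rightarrow> 'e \<Rightarrow> real" where
  "hnorm E x = sqrt (norm (hip E x x))"

locale hilbert_module =
  fixes E :: "('e::complex_vector, 'b::cstar_algebra, 'z) hmod_scheme"
  assumes subspace: "complex_vector.subspace (hcarrier E)"
    and act_closed: "x \<in> hcarrier E \<Longrightarrow> hact E x b \<in> hcarrier E"
    and act_add_left:
      "\<lbrakk>x \<in> hcarrier E; y \<in> hcarrier E\<rbrakk> \<Longrightarrow> hact E (x + y) b = hact E x b + hact E y b"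
    and act_add_right: "x \<in> hcarrier E \<Longrightarrow> hact E x (b + c) = hact E x b + hact E x c"
    and act_mult: "x \<in> hcarrier E \<Longrightarrow> hact E x (b * c) = hact E (hact E x b) c"
    and act_scaleC_left: "x \<in> hcarrier E \<Longrightarrow> hact E (k *\<^sub>C x) b = k *\<^sub>C hact E x b"
    and act_scaleC_right: "x \<in> hcarrier E \<Longrightarrow> hact E x (k *\<^sub>C b) = k *\<^sub>C hact E x b"
    and ip_add: "\<lbrakk>x \<in> hcarrier E; y \<in> hcarrier E; z \<in> hcarrier E\<rbrakk>
      \<Longrightarrow> hip E x (y + z) = hip E x y + hip E x z"
    and ip_scaleC: "\<lbrakk>x \<in> hcarrier E; y \<in> hcarrier E\<rbrakk> \<Longrightarrow> hip E x (k *\<^sub>C y) = k *\<^sub>C hip E x y"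
    and ip_act: "\<lbrakk>x \<in> hcarrier E; y \<in> hcarrier E\<rbrakk> \<Longrightarrow> hip E x (hact E y b) = hip E x y * b"
    and ip_star: "\<lbrakk>x \<in> hcarrier E; y \<in> hcarrier E\<rbrakk> \<Longrightarrow> hip E y x = (hip E x y)\<^sup>\<star>"
    and ip_positive: "x \<in> hcarrier E \<Longrightarrow> cstar_positive (hip E x x)"
    and ip_definite: "\<lbrakk>x \<in> hcarrier E; hip E x x = 0\<rbrakk> \<Longrightarrow> x = 0"
    and complete: "\<lbrakk>\<And>n::nat. X n \<in> hcarrier E;
        \<forall>e>0. \<exists>N. \<forall>m\<ge>N. \<forall>n\<ge>N. hnorm E (X m - X n) < e\<rbrakk>
      \<Longrightarrow> \<exists>x\<in>hcarrier E. (\<lambda>n. hnorm E (X n - x)) \<longlonglongrightarrow> 0"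

text \<open>Operators are functions on the ambient space that vanish off the carrier of their source;
  this makes equality of operators equality of functions. Adjointable maps are
  automatically \<open>B\<close>-linear and bounded.\<close>

definition is_adjoint ::
  "('e, 'b, 'y) hmod_scheme \<Rightarrow> ('f, 'b, 'z) hmod_scheme \<Rightarrow> ('e \<Rightarrow> 'f) \<Rightarrow> ('f \<Rightarrow> 'e) \<Rightarrow> bool" where
  "is_adjoint E E' T S \<longleftrightarrow>
     (\<forall>x\<in>hcarrier E. \<forall>y\<in>hcarrier E'. hip E' (T x) y = hip E x (S y))"

definition op_maps ::
  "('e, 'b, 'y) hmod_scheme \<Rightarrow> ('f::zero, 'b, 'z) hmod_scheme \<Rightarrow> ('e \<Rightarrow> 'f) set" where
  "op_maps E E' = {T. (\<forall>x\<in>hcarrier E. T x \<in> hcarrier E') \<and> (\<forall>x. x \<notin> hcarrier E \<longrightarrow> T x = 0)}"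

definition adjointable ::
  "('e::zero, 'b, 'y) hmod_scheme \<Rightarrow> ('f::zero, 'b, 'z) hmod_scheme \<Rightarrow> ('e \<Rightarrow> 'f) set" where
  "adjointable E E' = {T \<in> op_maps E E'. \<exists>S\<in>op_maps E' E. is_adjoint E E' T S}"

definition adj ::
  "('e::zero, 'b, 'y) hmod_scheme \<Rightarrow> ('f::zero, 'b, 'z) hmod_scheme \<Rightarrow> ('e \<Rightarrow> 'f) \<Rightarrow> ('f \<Rightarrow> 'e)" where
  "adj E E' T = (THE S. S \<in> op_maps E' E \<and> is_adjoint E E' T S)"

abbreviation End_ops :: "('e::zero, 'b, 'z) hmod_scheme \<Rightarrow> ('e \<Rightarrow> 'e) set" where
  "End_ops E \<equiv> adjointable E E"

definition id_op :: "('e::zero, 'b, 'z) hmod_scheme \<Rightarrow> 'e \<Rightarrow> 'e" where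
  "id_op E = (\<lambda>x. if x \<in> hcarrier E then x else 0)"

definition unitary ::
  "('e::zero, 'b, 'y) hmod_scheme \<Rightarrow> ('f::zero, 'b, 'z) hmod_scheme \<Rightarrow> ('e \<Rightarrow> 'f) \<Rightarrow> bool" where
  "unitary E E' U \<longleftrightarrow> U \<in> adjointable E E' \<and>
     adj E E' U \<circ> U = id_op E \<and> U \<circ> adj E E' U = id_op E'"

definition op_invertible :: "('e::zero, 'b, 'z) hmod_scheme \<Rightarrow> ('e \<Rightarrow> 'e) \<Rightarrow> bool" where
  "op_invertible E T \<longleftrightarrow> T \<in> End_ops E \<and> (\<exists>S\<in>End_ops E. T \<circ> S = id_op E \<and> S \<circ> T = id_op E)"

definition op_inv :: "('e::zero, 'b, 'z) hmod_scheme \<Rightarrow> ('e \<Rightarrow> 'e) \<Rightarrow> ('e \<Rightarrow> 'e)" where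
  "op_inv E T = (THE S. S \<in> End_ops E \<and> T \<circ> S = id_op E \<and> S \<circ> T = id_op E)"

definition op_norm :: "('e, 'b::cstar_algebra, 'z) hmod_scheme \<Rightarrow> ('e \<Rightarrow> 'e) \<Rightarrow> real" where
  "op_norm E T = (SUP x\<in>{x \<in> hcarrier E. hnorm E x \<le> 1}. hnorm E (T x))"

definition op_closure ::
  "('e::ab_group_add, 'b::cstar_algebra, 'z) hmod_scheme \<Rightarrow> ('e \<Rightarrow> 'e) set \<Rightarrow> ('e \<Rightarrow> 'e) set" where
  "op_closure E S = {T \<in> End_ops E. \<forall>e>0. \<exists>R\<in>S. op_norm E (T - R) < e}"

definition closed_span ::
  "('e::complex_vector, 'b::cstar_algebra, 'z) hmod_scheme \<Rightarrow> ('e \<Rightarrow> 'e) set \<Rightarrow> ('e \<Rightarrow> 'e) set" where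
  "closed_span E S = op_closure E (complex_vector.span S)"

definition rank_one :: "('e::zero, 'b, 'z) hmod_scheme \<Rightarrow> 'e \<Rightarrow> 'e \<Rightarrow> ('e \<Rightarrow> 'e)" where
  "rank_one E x y = (\<lambda>z. if z \<in> hcarrier E then hact E x (hip E y z) else 0)"

definition compact_ops ::
  "('e::complex_vector, 'b::cstar_algebra, 'z) hmod_scheme \<Rightarrow> ('e \<Rightarrow> 'e) set" where
  "compact_ops E = closed_span E {rank_one E x y | x y. x \<in> hcarrier E \<and> y \<in> hcarrier E}"


section \<open>Functional calculus of a positive operator\<close>

definition op_poly ::
  "('e::complex_vector, 'b, 'z) hmod_scheme \<Rightarrow> real poly \<Rightarrow> ('e \<Rightarrow> 'e) \<Rightarrow> ('e \<Rightarrow> 'e)" where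
  "op_poly E p P = (\<Sum>i\<le>degree p. complex_of_real (coeff p i) *\<^sub>C ((P ^^ i) \<circ> id_op E))"

text \<open>For positive \<open>P\<close> the interval \<open>[0, \<parallel>P\<parallel>]\<close> contains the spectrum of \<open>P\<close>, so for \<open>f\<close> continuous on
  that interval \<open>f(P)\<close> is the norm limit of \<open>p\<^sub>n(P)\<close> for any real polynomials \<open>p\<^sub>n\<close> converging to \<open>f\<close>
  uniformly there.\<close>

definition fun_calc ::
  "('e::complex_vector, 'b::cstar_algebra, 'z) hmod_scheme \<Rightarrow> (real \<Rightarrow> real) \<Rightarrow> ('e \<Rightarrow> 'e) \<Rightarrow> ('e \<Rightarrow> 'e)"
  where
  "fun_calc E f P = (THE T. T \<in> End_ops E \<and>
     (\<exists>p :: nat \<Rightarrow> real poly.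
        uniform_limit {0..op_norm E P} (\<lambda>n x. poly (p n) x) f sequentially \<and>
        (\<lambda>n. op_norm E (T - op_poly E (p n) P)) \<longlonglongrightarrow> 0))"


section \<open>Unbounded operators\<close>

record ('e, 'f) unbounded_op =
  udom :: "'e set"
  uapp :: "'e \<Rightarrow> 'f"

text \<open>Compositions and differences of unbounded operators have their natural domains. Values of
  \<^const>\<open>uapp\<close> off \<^const>\<open>udom\<close> are meaningless.\<close>

definition of_op :: "('e, 'b, 'z) hmod_scheme \<Rightarrow> ('e \<Rightarrow> 'f) \<Rightarrow> ('e, 'f) unbounded_op" where
  "of_op E T = \<lparr>udom = hcarrier E, uapp = T\<rparr>"

definition ucomp ::
  "('f, 'g) unbounded_op \<Rightarrow> ('e, 'f) unbounded_op \<Rightarrow> ('e, 'g) unbounded_op"  (infixr \<open>\<circ>\<^sub>u\<close> 70) where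
  "S \<circ>\<^sub>u T = \<lparr>udom = {x \<in> udom T. uapp T x \<in> udom S}, uapp = uapp S \<circ> uapp T\<rparr>"

definition udiff ::
  "('e, 'f::minus) unbounded_op \<Rightarrow> ('e, 'f) unbounded_op \<Rightarrow> ('e, 'f) unbounded_op"  (infixl \<open>-\<^sub>u\<close> 65)
  where
  "S -\<^sub>u T = \<lparr>udom = udom S \<inter> udom T, uapp = (\<lambda>x. uapp S x - uapp T x)\<rparr>"

definition hdense :: "('e::minus, 'b::cstar_algebra, 'z) hmod_scheme \<Rightarrow> 'e set \<Rightarrow> bool" where
  "hdense E W \<longleftrightarrow> W \<subseteq> hcarrier E \<and> (\<forall>x\<in>hcarrier E. \<forall>e>0. \<exists>w\<in>W. hnorm E (x - w) < e)"

definition bounded_op ::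
  "('e::complex_vector, 'b::cstar_algebra, 'y) hmod_scheme \<Rightarrow> ('f::complex_vector, 'b, 'z) hmod_scheme \<Rightarrow>
    ('e, 'f) unbounded_op \<Rightarrow> bool" where
  "bounded_op E E' S \<longleftrightarrow> hdense E (udom S) \<and> (\<exists>T\<in>adjointable E E'. \<forall>x\<in>udom S. T x = uapp S x)"

definition uadj :: "('e, 'b, 'z) hmod_scheme \<Rightarrow> ('e, 'e) unbounded_op \<Rightarrow> ('e, 'e) unbounded_op" where
  "uadj E D =
     (let adj_at = (\<lambda>y z. z \<in> hcarrier E \<and> (\<forall>x\<in>udom D. hip E (uapp D x) y = hip E x z))
      in \<lparr>udom = {y \<in> hcarrier E. \<exists>z. adj_at y z}, uapp = (\<lambda>y. THE z. adj_at y z)\<rparr>)"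

definition one_plus ::
  "('e::plus, 'e) unbounded_op \<Rightarrow> ('e, 'e) unbounded_op" where
  "one_plus S = \<lparr>udom = udom S, uapp = (\<lambda>x. x + uapp S x)\<rparr>"

definition regular ::
  "('e::complex_vector, 'b::cstar_algebra, 'z) hmod_scheme \<Rightarrow> ('e, 'e) unbounded_op \<Rightarrow> bool" where
  "regular E D \<longleftrightarrow>
     hdense E (udom D) \<and> complex_vector.subspace (udom D) \<and>
     (\<forall>x\<in>udom D. \<forall>b. hact E x b \<in> udom D) \<and>
     (\<forall>x\<in>udom D. uapp D x \<in> hcarrier E) \<and>
     (\<forall>x\<in>udom D. \<forall>y\<in>udom D. uapp D (x + y) = uapp D x + uapp D y) \<and>
     (\<forall>x\<in>udom D. \<forall>c. uapp D (c *\<^sub>C x) = c *\<^sub>C uapp D x) \<and>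
     (\<forall>x\<in>udom D. \<forall>b. uapp D (hact E x b) = hact E (uapp D x) b) \<and>
     (\<forall>X x y. (\<forall>n::nat. X n \<in> udom D) \<and> x \<in> hcarrier E \<and> y \<in> hcarrier E \<and>
        (\<lambda>n. hnorm E (X n - x)) \<longlonglongrightarrow> 0 \<and> (\<lambda>n. hnorm E (uapp D (X n) - y)) \<longlonglongrightarrow> 0
        \<longrightarrow> x \<in> udom D \<and> uapp D x = y) \<and>
     hdense E (udom (uadj E D)) \<and>
     hdense E (uapp (one_plus (uadj E D \<circ>\<^sub>u D)) ` udom (one_plus (uadj E D \<circ>\<^sub>u D)))"

definition self_adjoint :: "('e, 'b, 'z) hmod_scheme \<Rightarrow> ('e, 'e) unbounded_op \<Rightarrow> bool" where
  "self_adjoint E D \<longleftrightarrow>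
     udom (uadj E D) = udom D \<and> (\<forall>x\<in>udom D. uapp (uadj E D) x = uapp D x)"

definition uinverse :: "('e::zero, 'b, 'z) hmod_scheme \<Rightarrow> ('e, 'e) unbounded_op \<Rightarrow> ('e \<Rightarrow> 'e)" where
  "uinverse E S = (\<lambda>y. if y \<in> hcarrier E then (THE x. x \<in> udom S \<and> uapp S x = y) else 0)"

abbreviation resolvent_sq ::
  "('e::monoid_add, 'b, 'z) hmod_scheme \<Rightarrow> ('e, 'e) unbounded_op \<Rightarrow> ('e \<Rightarrow> 'e)" where
  "resolvent_sq E D \<equiv> uinverse E (one_plus (D \<circ>\<^sub>u D))"

text \<open>\<open>\<langle>D\<rangle>\<^bsup>-\<alpha>\<^esup> = (1 + D\<^sup>2)\<^bsup>-\<alpha>/2\<^esup>\<close> is the power \<open>\<alpha>/2\<close> of \<open>(1 + D\<^sup>2)\<^bsup>-1\<^esup>\<close>.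
  The case distinction is needed because \<^prop>\<open>(0::real) powr 0 = 0\<close> in the library, whereas
  \<open>\<langle>D\<rangle>\<^bsup>0\<^esup>\<close> is the identity.\<close>

definition bracket_power ::
  "('e::complex_vector, 'b::cstar_algebra, 'z) hmod_scheme \<Rightarrow> ('e, 'e) unbounded_op \<Rightarrow> real \<Rightarrow> ('e \<Rightarrow> 'e)"
  where
  "bracket_power E D \<alpha> =
     fun_calc E (\<lambda>x. if \<alpha> = 0 then 1 else x powr (\<alpha> / 2)) (resolvent_sq E D)"

definition bounded_transform ::
  "('e::complex_vector, 'b::cstar_algebra, 'z) hmod_scheme \<Rightarrow> ('e, 'e) unbounded_op \<Rightarrow> ('e \<Rightarrow> 'e)" where
  "bounded_transform E D =
     (\<lambda>x. if x \<in> hcarrier E then uapp D (bracket_power E D 1 x) else 0)"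


section \<open>Correspondences and cycles\<close>

text \<open>The field \<open>grading\<close> is \<^const>\<open>None\<close> for ungraded modules (odd cycles) and \<open>Some \<gamma>\<close> for
  \<open>\<int>/2\<close>-graded ones (even cycles), \<open>\<gamma>\<close> being the grading operator, with eigenspaces for \<open>1\<close> and \<open>-1\<close>
  the even and the odd part. As \<open>B\<close> is trivially graded, these are orthogonal, i.e.
  \<open>\<gamma>\<close> is a self-adjoint unitary.\<close>

record ('e, 'b, 'a) corr = "('e, 'b) hmod" +
  rep :: "'a \<Rightarrow> 'e \<Rightarrow> 'e"
  grading :: "('e \<Rightarrow> 'e) option"

abbreviation is_even :: "('e, 'b, 'a) corr \<Rightarrow> bool" where
  "is_even X \<equiv> grading X \<noteq> None"

definition even_op :: "('e, 'b, 'a) corr \<Rightarrow> ('e \<Rightarrow> 'e) \<Rightarrow> bool" where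
  "even_op X T \<longleftrightarrow> (\<forall>\<gamma>. grading X = Some \<gamma> \<longrightarrow> T \<circ> \<gamma> = \<gamma> \<circ> T)"

definition odd_op :: "('e::uminus, 'b, 'a) corr \<Rightarrow> ('e \<Rightarrow> 'e) \<Rightarrow> bool" where
  "odd_op X T \<longleftrightarrow> (\<forall>\<gamma>. grading X = Some \<gamma> \<longrightarrow> T \<circ> \<gamma> = - (\<gamma> \<circ> T))"

definition odd_unbounded :: "('e::uminus, 'b, 'a) corr \<Rightarrow> ('e, 'e) unbounded_op \<Rightarrow> bool" where
  "odd_unbounded X D \<longleftrightarrow> (\<forall>\<gamma>. grading X = Some \<gamma> \<longrightarrow>
     (\<forall>x\<in>udom D. \<gamma> x \<in> udom D \<and> uapp D (\<gamma> x) = - \<gamma> (uapp D x)))"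

definition correspondence ::
  "('e::complex_vector, 'b::cstar_algebra, 'a::cstar_algebra) corr \<Rightarrow> bool" where
  "correspondence X \<longleftrightarrow> hilbert_module X \<and>
     (\<forall>a. rep X a \<in> End_ops X) \<and>
     (\<forall>a b. rep X (a + b) = rep X a + rep X b) \<and>
     (\<forall>c a. rep X (c *\<^sub>C a) = c *\<^sub>C rep X a) \<and>
     (\<forall>a b. rep X (a * b) = rep X a \<circ> rep X b) \<and>
     (\<forall>a. rep X (a\<^sup>\<star>) = adj X X (rep X a)) \<and>
     (\<forall>\<gamma>. grading X = Some \<gamma> \<longrightarrow> unitary X X \<gamma> \<and> adj X X \<gamma> = \<gamma>) \<and>
     (\<forall>a. even_op X (rep X a))"

definition commutator ::
  "('e, 'b, 'z) hmod_scheme \<Rightarrow> ('e::minus, 'e) unbounded_op \<Rightarrow> ('e \<Rightarrow> 'e) \<Rightarrow> ('e, 'e) unbounded_op" where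
  "commutator E D a = D \<circ>\<^sub>u of_op E a -\<^sub>u of_op E a \<circ>\<^sub>u D"

definition Lip ::
  "('e::complex_vector, 'b::cstar_algebra, 'z) hmod_scheme \<Rightarrow> real \<Rightarrow> ('e, 'e) unbounded_op \<Rightarrow> ('e \<Rightarrow> 'e) set"
  where
  "Lip E \<alpha> D = {a \<in> End_ops E. a ` udom D \<subseteq> udom D \<and>
     bounded_op E E (commutator E D a \<circ>\<^sub>u of_op E (bracket_power E D \<alpha>)) \<and>
     bounded_op E E (of_op E (bracket_power E D \<alpha>) \<circ>\<^sub>u commutator E D a)}"

text \<open>\<open>cycle \<alpha> X D\<close> says that \<open>(A, X, D)\<close> is a cycle of order \<open>1/(1-\<alpha>)\<close>.\<close>

definition cycle ::
  "real \<Rightarrow> ('e::complex_vector, 'b::cstar_algebra, 'a::cstar_algebra) corr \<Rightarrow> ('e, 'e) unbounded_op \<Rightarrow> bool"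
  where
  "cycle \<alpha> X D \<longleftrightarrow> correspondence X \<and> regular X D \<and> self_adjoint X D \<and>
     (\<forall>a. resolvent_sq X D \<circ> rep X a \<in> compact_ops X) \<and>
     range (rep X) \<subseteq> op_closure X (Lip X \<alpha> D) \<and>
     odd_unbounded X D"


section \<open>Conformal transformations\<close>

definition conformal_defect ::
  "('e::complex_vector, 'b::cstar_algebra, 'a::cstar_algebra) corr \<Rightarrow> ('e, 'e) unbounded_op \<Rightarrow>
   ('f::complex_vector, 'b, 'a) corr \<Rightarrow> ('f, 'f) unbounded_op \<Rightarrow>
   ('e \<Rightarrow> 'f) \<Rightarrow> ('e \<Rightarrow> 'e) \<Rightarrow> ('e \<Rightarrow> 'e) \<Rightarrow> ('e, 'e) unbounded_op" where
  "conformal_defect X1 D1 X2 D2 U \<mu> a =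
     of_op X2 (adj X1 X2 U) \<circ>\<^sub>u D2 \<circ>\<^sub>u of_op X1 U \<circ>\<^sub>u of_op X1 a
     -\<^sub>u of_op X1 a \<circ>\<^sub>u of_op X1 \<mu> \<circ>\<^sub>u D1 \<circ>\<^sub>u of_op X1 (adj X1 X1 \<mu>)"

text \<open>The set \<open>\<M>\<close>. As in the definition of \<^const>\<open>Lip\<close>, the
  difference \<open>U\<^sup>*D\<^sub>2Ua - a\<mu>D\<^sub>1\<mu>\<^sup>*\<close> is required to be defined on all of \<open>dom(a\<mu>D\<^sub>1\<mu>\<^sup>*)\<close>, i.e.
  \<open>a\<close> maps \<open>dom(\<mu>D\<^sub>1\<mu>\<^sup>*)\<close> into \<open>dom(U\<^sup>*D\<^sub>2U)\<close>. Density of its natural domain alone would be too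
  weak: with \<open>a = \<mu> = 1\<close> it would allow two unrelated self-adjoint extensions of one symmetric operator.\<close>

definition conformal_set ::
  "real \<Rightarrow> ('e::complex_vector, 'b::cstar_algebra, 'a::cstar_algebra) corr \<Rightarrow> ('e, 'e) unbounded_op \<Rightarrow>
   ('f::complex_vector, 'b, 'a) corr \<Rightarrow> ('f, 'f) unbounded_op \<Rightarrow>
   ('e \<Rightarrow> 'f) \<Rightarrow> ('e \<Rightarrow> 'e) \<Rightarrow> ('e \<Rightarrow> 'e) set" where
  "conformal_set \<alpha> X1 D1 X2 D2 U \<mu> = {a \<in> End_ops X1.
     udom (D1 \<circ>\<^sub>u of_op X1 (adj X1 X1 \<mu>)) \<subseteq> udom (D2 \<circ>\<^sub>u of_op X1 U \<circ>\<^sub>u of_op X1 a) \<and>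
     bounded_op X1 X1 (conformal_defect X1 D1 X2 D2 U \<mu> a
       \<circ>\<^sub>u of_op X1 (adj X1 X1 (op_inv X1 \<mu>)) \<circ>\<^sub>u of_op X1 (bracket_power X1 D1 \<alpha>)) \<and>
     bounded_op X1 X2 (of_op X2 (bracket_power X2 D2 \<alpha>) \<circ>\<^sub>u of_op X1 U
       \<circ>\<^sub>u conformal_defect X1 D1 X2 D2 U \<mu> a) \<and>
     a \<in> Lip X1 \<alpha> D1 \<and> a \<circ> \<mu> \<in> Lip X1 \<alpha> D1 \<and> a \<circ> adj X1 X1 (op_inv X1 \<mu>) \<in> Lip X1 \<alpha> D1}"

definition conformal_transformation ::
  "real \<Rightarrow> ('e::complex_vector, 'b::cstar_algebra, 'a::cstar_algebra) corr \<Rightarrow> ('e, 'e) unbounded_op \<Rightarrow>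
   ('f::complex_vector, 'b, 'a) corr \<Rightarrow> ('f, 'f) unbounded_op \<Rightarrow>
   ('e \<Rightarrow> 'f) \<Rightarrow> ('e \<Rightarrow> 'e) \<Rightarrow> bool" where
  "conformal_transformation \<alpha> X1 D1 X2 D2 U \<mu> \<longleftrightarrow>
     (is_even X1 \<longleftrightarrow> is_even X2) \<and>
     unitary X1 X2 U \<and> (\<forall>a. U \<circ> rep X1 a = rep X2 a \<circ> U) \<and>
     (\<forall>\<gamma>1 \<gamma>2. grading X1 = Some \<gamma>1 \<and> grading X2 = Some \<gamma>2 \<longrightarrow> U \<circ> \<gamma>1 = \<gamma>2 \<circ> U) \<and>
     op_invertible X1 \<mu> \<and> even_op X1 \<mu> \<and>
     range (rep X1) \<subseteq>
       closed_span X1 {rep X1 a \<circ> m | a m. m \<in> conformal_set \<alpha> X1 D1 X2 D2 U \<mu>} \<inter>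
       closed_span X1 {m \<circ> rep X1 a | a m. m \<in> conformal_set \<alpha> X1 D1 X2 D2 U \<mu>}"


section \<open>Bounded Kasparov modules and KK-theory\<close>

definition kasparov_module ::
  "('e::complex_vector, 'b::cstar_algebra, 'a::cstar_algebra) corr \<Rightarrow> ('e \<Rightarrow> 'e) \<Rightarrow> bool" where
  "kasparov_module X F \<longleftrightarrow> correspondence X \<and> F \<in> End_ops X \<and> odd_op X F \<and>
     (\<forall>a. (adj X X F - F) \<circ> rep X a \<in> compact_ops X \<and>
          (id_op X - (F \<circ> F)) \<circ> rep X a \<in> compact_ops X \<and>
          (F \<circ> rep X a) - (rep X a \<circ> F) \<in> compact_ops X)"

text \<open>Unitary equivalence of \<open>(X, F)\<close> with the evaluation at \<open>t\<close>, i.e. the localisation along the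
  surjection \<open>ev\<^sub>t\<close>, of a Kasparov module \<open>(H, G)\<close> over \<open>C([0,1], B)\<close>. The localised module
  \<open>H \<otimes> B\<close> (tensor product over \<open>ev\<^sub>t\<close>) is the quotient of \<open>H\<close> by \<open>{x. \<langle>x, x\<rangle>(t) = 0}\<close>, so a unitary from it
  onto \<open>X\<close> is given by the map \<open>\<pi>\<close> that it induces on \<open>H\<close>.\<close>

definition evaluates_to ::
  "unit_interval \<Rightarrow>
   ('h::complex_vector, unit_interval \<Rightarrow>\<^sub>C 'b, 'a::cstar_algebra) corr \<Rightarrow> ('h \<Rightarrow> 'h) \<Rightarrow>
   ('e::complex_vector, 'b::cstar_algebra, 'a) corr \<Rightarrow> ('e \<Rightarrow> 'e) \<Rightarrow> bool" where
  "evaluates_to t H G X F \<longleftrightarrow> (is_even H \<longleftrightarrow> is_even X) \<and> (\<exists>\<pi>.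
     \<pi> ` hcarrier H = hcarrier X \<and>
     (\<forall>x\<in>hcarrier H. \<forall>y\<in>hcarrier H. \<pi> (x + y) = \<pi> x + \<pi> y) \<and>
     (\<forall>x\<in>hcarrier H. \<forall>c. \<pi> (c *\<^sub>C x) = c *\<^sub>C \<pi> x) \<and>
     (\<forall>x\<in>hcarrier H. \<forall>f. \<pi> (hact H x f) = hact X (\<pi> x) (apply_bcontfun f t)) \<and>
     (\<forall>x\<in>hcarrier H. \<forall>y\<in>hcarrier H. hip X (\<pi> x) (\<pi> y) = apply_bcontfun (hip H x y) t) \<and>
     (\<forall>x\<in>hcarrier H. \<forall>a. \<pi> (rep H a x) = rep X a (\<pi> x)) \<and>
     (\<forall>x\<in>hcarrier H. \<pi> (G x) = F (\<pi> x)) \<and>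
     (\<forall>\<gamma> \<gamma>'. grading H = Some \<gamma> \<and> grading X = Some \<gamma>' \<longrightarrow>
        (\<forall>x\<in>hcarrier H. \<pi> (\<gamma> x) = \<gamma>' (\<pi> x))))"

text \<open>HOL cannot quantify over all types of homotopies; the one used is large enough for any
  homotopy to be cut down to it.\<close>

type_synonym ('e, 'b, 'a) homotopy_corr =
  "(real \<Rightarrow> 'a \<times> 'b \<times> 'e, unit_interval \<Rightarrow>\<^sub>C 'b, 'a) corr"

definition homotopic ::
  "('e::complex_vector, 'b::cstar_algebra, 'a::cstar_algebra) corr \<times> ('e \<Rightarrow> 'e) \<Rightarrow>
   ('e, 'b, 'a) corr \<times> ('e \<Rightarrow> 'e) \<Rightarrow> bool" where
  "homotopic = (\<lambda>(X0, F0) (X1, F1).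
     kasparov_module X0 F0 \<and> kasparov_module X1 F1 \<and>
     (\<exists>(H :: ('e, 'b, 'a) homotopy_corr) G. kasparov_module H G \<and>
        evaluates_to (Abs_unit_interval 0) H G X0 F0 \<and>
        evaluates_to (Abs_unit_interval 1) H G X1 F1))"

definition kasparov_modules ::
  "bool \<Rightarrow> (('e::complex_vector, 'b::cstar_algebra, 'a::cstar_algebra) corr \<times> ('e \<Rightarrow> 'e)) set" where
  "kasparov_modules p = {(X, F). kasparov_module X F \<and> (is_even X \<longleftrightarrow> p)}"

text \<open>The equivalence relation generated by homotopy (which is itself already transitive).\<close>

definition kk_rel ::
  "((('e::complex_vector, 'b::cstar_algebra, 'a::cstar_algebra) corr \<times> ('e \<Rightarrow> 'e)) \<times>
    (('e, 'b, 'a) corr \<times> ('e \<Rightarrow> 'e))) set" where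
  "kk_rel = {(M, N). equivclp homotopic M N}"

text \<open>\<open>KK True\<close> is \<open>KK\<^sub>0(A, B)\<close> and \<open>KK False\<close> is \<open>KK\<^sub>1(A, B)\<close>.\<close>

definition KK ::
  "bool \<Rightarrow> (('e::complex_vector, 'b::cstar_algebra, 'a::cstar_algebra) corr \<times> ('e \<Rightarrow> 'e)) set set" where
  "KK p = kasparov_modules p // kk_rel"

definition kk_class ::
  "('e::complex_vector, 'b::cstar_algebra, 'a::cstar_algebra) corr \<Rightarrow> ('e \<Rightarrow> 'e) \<Rightarrow>
   (('e, 'b, 'a) corr \<times> ('e \<Rightarrow> 'e)) set" where
  "kk_class X F = kk_rel `` {(X, F)}"

definition cycle_class ::
  "('e::complex_vector, 'b::cstar_algebra, 'a::cstar_algebra) corr \<Rightarrow> ('e, 'e) unbounded_op \<Rightarrow>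
   (('e, 'b, 'a) corr \<times> ('e \<Rightarrow> 'e)) set" where
  "cycle_class X D = kk_class X (bounded_transform X D)"

end

theory Submission
  imports Defs
begin

text \<open>
  Write \<open>r\<^sub>i = \<langle>D\<^sub>i\<rangle>\<^bsup>-1\<^esup>\<close> and \<open>F\<^sub>i = D\<^sub>i r\<^sub>i\<close>, and identify \<open>E'\<close> with \<open>E\<close> by means of \<open>U\<close>. For \<open>m \<in> \<M>\<close> put \<open>p = m \<mu>\<^bsup>-1*\<^esup>\<close> and
  \<open>q = m \<mu>\<close>. The hypothesis on \<open>m\<close> says that \<open>D\<^sub>2 p - q D\<^sub>1\<close> is an operator on the domain of \<open>D\<^sub>1\<close> of order \<open>\<alpha> < 1\<close>;
  multiplied by \<open>r\<^sub>2\<close> and \<open>r\<^sub>1\<close> it becomes a statement about bounded operators, \<open>F\<^sub>2 p r\<^sub>1 - r\<^sub>2 q F\<^sub>1 = r\<^sub>2 K r\<^sub>1\<^bsup>1-\<alpha>\<^esup>\<close> and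
  likewise on the other side (\<open>intertwines\<close>; \<open>Lip_intertwines\<close> and \<open>conformal_intertwines\<close> translate the
  hypotheses). From there on unbounded operators are not mentioned.

  The point is that \<open>x = (F\<^sub>2 p - p F\<^sub>1) q\<^sup>* p\<close> satisfies a Sylvester equation \<open>x r\<^sub>1 \<omega> + r\<^sub>2 x = N\<close> with \<open>\<omega> = (\<mu>\<^sup>* \<mu>)\<^bsup>-1\<^esup>\<close>, whose
  right-hand side \<open>N\<close> is small: this uses that \<open>q\<^sup>* p - p\<^sup>* q\<close>, which vanishes for \<open>\<mu> = 1\<close>, gains a power of \<open>r\<^sub>1\<close> because
  \<open>p\<^sup>* D\<^sub>2 p\<close> is symmetric (\<open>defect_commutator\<close>). The equation is solved by the series \<open>\<Sum> a\<^sup>n N' b\<^sup>n\<close> with \<open>a = 1 - k r\<^sub>2\<close> and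
  \<open>b = 1 - k r\<^sub>1 \<omega>\<close> for a small constant \<open>k\<close>; it converges since \<open>\<parallel>r\<^sup>s (1 - k r)\<^sup>n\<parallel> = O(n\<^sup>-\<^sup>s)\<close>. Such series do the work of the usual integral formulas for
  fractional powers. If \<open>c r\<^sub>1\<close> and \<open>c r\<^sub>2\<close> are compact, each term multiplied by \<open>c\<close> on the left is compact; with
  \<open>p q\<^sup>* p \<mu>\<^sup>* = m m\<^sup>* m\<close> it follows that \<open>c (F\<^sub>2 - F\<^sub>1) m m\<^sup>* m\<close> is compact (\<open>perturbation_in_ideal\<close>).

  Now \<open>m\<close> is a limit of elements \<open>m m\<^sup>* m y\<close>, and \<open>A\<close> lies in the closed span of \<open>\<M> A\<close>; so \<open>a (F\<^sub>2 - F\<^sub>1) b\<close> is compact for \<open>a, b \<in> A\<close>.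
  As \<open>F\<^sub>1\<close> and \<open>F\<^sub>2\<close> commute with \<open>A\<close> modulo compacts (\<open>kasparov_bounded_transform\<close>), so is \<open>(F\<^sub>2 - F\<^sub>1) a\<close> (\<open>Delta_rep_compact\<close>).
  Therefore the path \<open>F\<^sub>1 + t (F\<^sub>2 - F\<^sub>1)\<close>, acting pointwise on the module of continuous paths in \<open>E\<close>, is a Kasparov module
  over \<open>C([0,1], B)\<close> that connects the two bounded transforms (\<open>kasparov_G\<close>, \<open>evaluates\<close>).

  The estimates are carried out in abstract unital C*-algebras, for which positivity and the continuous functional calculus
  of a positive element are developed first. They apply to the operators on a Hilbert module \<open>E\<close> because these form a
  corner of the unitization of a C*-algebra (\<open>opalg\<close>) that contains the operators on all Hilbert modules at once
  (\<open>corner_embedding_emb\<close>).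
\<close>

section \<open>Positive elements of a unital C*-algebra\<close>

class unital_cstar_algebra = cstar_algebra + real_normed_algebra_1

lemma star_zero [simp]: "(0::'b::cstar_algebra)\<^sup>\<star> = 0"
  using star_diff[of 0 "0::'b"] by simp

lemma star_uminus: "(- x)\<^sup>\<star> = - x\<^sup>\<star>" for x :: "'b::cstar_algebra"
  using star_diff[of 0 x] by simp

lemma star_scaleR: "(r *\<^sub>R x)\<^sup>\<star> = r *\<^sub>R x\<^sup>\<star>" for x :: "'b::cstar_algebra"
  by (simp add: scaleR_scaleC star_scaleC)

lemma star_one [simp]: "(1::'c::unital_cstar_algebra)\<^sup>\<star> = 1"
  by (metis mult_1 mult_1_right star_mult star_star)

lemma star_power: "(x ^ n)\<^sup>\<star> = (x\<^sup>\<star>) ^ n" for x :: "'c::unital_cstar_algebra"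
  by (induction n) (simp_all add: star_mult power_commutes)

lemmas star_simps = star_add star_diff star_mult star_star star_scaleR star_uminus

lemma norm_selfadjoint_square: "x\<^sup>\<star> = x \<Longrightarrow> norm (x * x) = (norm x)\<^sup>2" for x :: "'b::cstar_algebra"
  using cstar_identity[of x] by simp

lemma norm_selfadjoint_power:
  fixes x :: "'c::unital_cstar_algebra"
  assumes "x\<^sup>\<star> = x"
  shows "norm (x ^ (2 ^ k)) = norm x ^ (2 ^ k)"
proof (induction k)
  case (Suc k)
  have "norm (x ^ (2 ^ Suc k)) = norm (x ^ (2^k) * x ^ (2^k))"
    by (simp add: mult_2 power_add)
  also have "\<dots> = (norm (x ^ (2^k)))\<^sup>2"
    using assms by (intro norm_selfadjoint_square) (simp add: star_power)
  finally show ?case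
    using Suc by (simp add: power_mult[symmetric] mult.commute)
qed simp

text \<open>Membership of \<open>z\<close> in the double commutant of \<open>g\<close>: square roots of commuting elements have to commute.\<close>

definition commutes_with :: "'c::times \<Rightarrow> 'c \<Rightarrow> bool" where
  "commutes_with g z \<longleftrightarrow> (\<forall>y. y * g = g * y \<longrightarrow> y * z = z * y)"

text \<open>The square root is \<open>1 - z\<close> for the fixed point of the contraction \<open>z \<mapsto> (g + z\<^sup>2) / 2\<close> on a ball of radius \<open>\<rho> < 1\<close>.\<close>

lemma sqrt_one_minus:
  fixes g :: "'c::unital_cstar_algebra"
  assumes g: "g\<^sup>\<star> = g" "norm g < 1"
  obtains s where "s\<^sup>\<star> = s" "s * s = 1 - g" "norm (1 - s) \<le> 1" "commutes_with g s"
proof -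
  define \<rho> where "\<rho> = 1 - sqrt (1 - norm g)"
  have \<rho>: "0 \<le> \<rho>" "\<rho> < 1" "(norm g + \<rho>\<^sup>2) / 2 = \<rho>"
    using g(2) by (auto simp: \<rho>_def power2_eq_square algebra_simps add_divide_distrib diff_divide_distrib)
  define S where "S = {z::'c. norm z \<le> \<rho> \<and> z\<^sup>\<star> = z \<and> commutes_with g z}"
  have cont_star: "continuous_on UNIV (\<lambda>z::'c. z\<^sup>\<star>)"
    using bounded_linear_star by (rule linear_continuous_on)
  have "closed S"
    unfolding S_def commutes_with_def
    by (intro closed_Collect_conj closed_Collect_le closed_Collect_eq closed_Collect_all
        closed_Collect_imp continuous_intros cont_star) auto
  then have "complete S"
    by (simp add: complete_eq_closed)
  have S: "norm z \<le> \<rho>" "z\<^sup>\<star> = z" "commutes_with g z" if "z \<in> S" for z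
    using that by (auto simp: S_def)
  define f where "f z = (1/2) *\<^sub>R (g + z * z)" for z :: 'c
  have fS: "f z \<in> S" if z: "z \<in> S" for z
  proof -
    have "norm (g + z * z) \<le> norm g + \<rho>\<^sup>2"
      unfolding power2_eq_square
      by (intro norm_triangle_le add_left_mono order_trans[OF norm_mult_ineq] mult_mono S z)
        (use \<rho> S[OF z] in auto)
    then have "norm (f z) \<le> \<rho>"
      using \<rho>(3) by (simp add: f_def)
    moreover have "commutes_with g (f z)"
      unfolding commutes_with_def
    proof (intro allI impI)
      fix y assume y: "y * g = g * y"
      then have "y * z = z * y"
        using S(3)[OF z] by (auto simp: commutes_with_def)
      then have "y * (z * z) = z * z * y"
        by (metis mult.assoc)
      with y show "y * f z = f z * y"
        by (simp add: f_def algebra_simps)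
    qed
    ultimately show ?thesis
      using g S[OF z] by (auto simp: S_def f_def star_simps)
  qed
  have contr: "dist (f z) (f z') \<le> \<rho> * dist z z'" if z: "z \<in> S" "z' \<in> S" for z z'
  proof -
    have eq: "f z - f z' = (1/2) *\<^sub>R (z * (z - z') + (z - z') * z')"
      by (simp add: f_def algebra_simps)
    have "norm (z * (z - z')) \<le> \<rho> * norm (z - z')" "norm ((z - z') * z') \<le> norm (z - z') * \<rho>"
      using S z \<rho> by (auto intro!: order_trans[OF norm_mult_ineq] mult_mono)
    then have "norm (z * (z - z') + (z - z') * z') \<le> 2 * (\<rho> * norm (z - z'))"
      by (intro norm_triangle_le) (simp add: mult.commute)
    then show ?thesis
      unfolding dist_norm eq by simp
  qed
  have "0 \<in> S"
    using \<rho> by (auto simp: S_def commutes_with_def)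
  then have "\<exists>!z\<in>S. f z = z"
    using fS contr by (intro Banach_fix[OF \<open>complete S\<close>]) (use \<rho> in auto)
  then obtain z where z: "z \<in> S" "f z = z"
    by auto
  have "g + z * z = 2 *\<^sub>R z"
    using arg_cong[OF z(2), of "\<lambda>x. 2 *\<^sub>R x"] by (simp add: f_def)
  then have gz: "g = z + z - z * z"
    by (simp add: algebra_simps scaleR_2)
  show ?thesis
  proof (rule that[of "1 - z"])
    show "(1 - z) * (1 - z) = 1 - g"
      by (subst gz) (simp add: algebra_simps)
    show "commutes_with g (1 - z)"
      using S(3)[OF z(1)] by (auto simp: commutes_with_def algebra_simps)
  qed (use S[OF z(1)] \<rho> in \<open>auto simp: star_simps\<close>)
qed

text \<open>In spectral terms: the spectrum of the self-adjoint element \<open>h\<close> lies in a disc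
  of radius \<open>t\<close> around \<open>t\<close>.\<close>

definition pos :: "'c::unital_cstar_algebra \<Rightarrow> bool" where
  "pos h \<longleftrightarrow> h\<^sup>\<star> = h \<and> (\<exists>t\<ge>0. norm (t *\<^sub>R 1 - h) \<le> t)"

lemma pos_selfadjoint: "pos h \<Longrightarrow> h\<^sup>\<star> = h"
  by (simp add: pos_def)

lemma norm_shift_mono:
  fixes h :: "'c::unital_cstar_algebra"
  assumes "norm (t *\<^sub>R 1 - h) \<le> t + e" "t \<le> s"
  shows "norm (s *\<^sub>R 1 - h) \<le> s + e"
proof -
  have "norm (s *\<^sub>R 1 - h) \<le> norm ((s - t) *\<^sub>R (1::'c)) + norm (t *\<^sub>R 1 - h)"
    by (rule order_trans[OF _ norm_triangle_ineq]) (simp add: algebra_simps)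
  then show ?thesis
    using assms by simp
qed

lemma pos_add: "pos h \<Longrightarrow> pos k \<Longrightarrow> pos (h + k)"
proof -
  assume "pos h" "pos k"
  then obtain t s where *: "t \<ge> 0" "s \<ge> 0" "norm (t *\<^sub>R 1 - h) \<le> t" "norm (s *\<^sub>R 1 - k) \<le> s"
    and sa: "h\<^sup>\<star> = h" "k\<^sup>\<star> = k"
    by (auto simp: pos_def)
  have "norm ((t + s) *\<^sub>R 1 - (h + k)) \<le> norm (t *\<^sub>R 1 - h) + norm (s *\<^sub>R 1 - k)"
    by (rule order_trans[OF _ norm_triangle_ineq]) (simp add: algebra_simps)
  with * sa show "pos (h + k)"
    unfolding pos_def by (auto simp: star_simps intro!: exI[of _ "t + s"])
qed

lemma pos_scaleR: "pos h \<Longrightarrow> r \<ge> 0 \<Longrightarrow> pos (r *\<^sub>R h)"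
proof -
  assume "pos h" and r: "r \<ge> 0"
  then obtain t where *: "t \<ge> 0" "norm (t *\<^sub>R 1 - h) \<le> t" "h\<^sup>\<star> = h"
    by (auto simp: pos_def)
  have "norm ((r * t) *\<^sub>R 1 - r *\<^sub>R h) = r * norm (t *\<^sub>R 1 - h)"
    using r by (metis abs_of_nonneg norm_scaleR scaleR_right_diff_distrib scaleR_scaleR)
  with * r show "pos (r *\<^sub>R h)"
    unfolding pos_def by (auto simp: star_simps mult_left_mono intro!: exI[of _ "r * t"])
qed

lemma pos_of_scaleR: "t \<ge> 0 \<Longrightarrow> pos (t *\<^sub>R 1)"
  unfolding pos_def by (auto simp: star_simps intro!: exI[of _ t])

lemma pos_0 [simp]: "pos 0"
  using pos_of_scaleR[of 0] by simp

lemma pos_1 [simp]: "pos 1"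
  using pos_of_scaleR[of 1] by simp

lemma pos_of_norm_le:
  assumes "h\<^sup>\<star> = h" "norm h \<le> t"
  shows "pos (t *\<^sub>R 1 - h)"
  using assms order_trans[OF norm_ge_zero assms(2)]
  unfolding pos_def by (auto simp: star_simps intro!: exI[of _ t])

lemma pos_sum: "(\<And>i. i \<in> A \<Longrightarrow> pos (f i)) \<Longrightarrow> pos (sum f A)"
  by (induction A rule: infinite_finite_induct) (auto intro: pos_add)

text \<open>With \<open>s = (1 - c\<^sup>2)\<^bsup>1/2\<^esup>\<close>, the element \<open>u = c + i s\<close> is unitary, and \<open>2 c\<^sup>2 - 1\<close> is the real part
  of \<open>u\<^sup>2\<close>.\<close>

lemma norm_one_minus_square:
  fixes c :: "'c::unital_cstar_algebra"
  assumes c: "c\<^sup>\<star> = c" "norm c < 1"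
  shows "norm (1 - 2 *\<^sub>R (c * c)) \<le> 1"
proof -
  have "norm (c * c) < 1"
    using c norm_selfadjoint_square[OF c(1)] by (simp add: power_less_one_iff abs_square_less_1)
  then obtain s where s: "s\<^sup>\<star> = s" "s * s = 1 - c * c" "commutes_with (c * c) s"
    using c by (auto simp: star_simps intro: sqrt_one_minus[of "c * c"])
  have cs: "c * s = s * c"
    using s(3) by (auto simp: commutes_with_def mult.assoc)
  define u where "u = c + \<i> *\<^sub>C s"
  have us: "u\<^sup>\<star> = c - \<i> *\<^sub>C s"
    by (simp add: u_def star_simps star_scaleC c s)
  have ii: "\<i> *\<^sub>C \<i> *\<^sub>C x = - x" for x :: 'c
    by (metis scaleC_scaleC i_squared complex_vector.scale_minus_left scaleC_one)
  have "u\<^sup>\<star> * u = 1"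
    using s(2) cs
    by (simp only: us) (simp add: u_def algebra_simps mult_scaleC_left mult_scaleC_right ii scaleC_add_right)
  then have "norm u = 1"
    using cstar_identity[of u] norm_ge_zero[of u] by (auto simp: power2_eq_1_iff)
  then have nu: "norm (u * u) \<le> 1"
    using norm_mult_ineq[of u u] by simp
  have "2 *\<^sub>R (1 - 2 *\<^sub>R (c * c)) = - (u * u + (u * u)\<^sup>\<star>)"
    using s(2) cs
    by (simp only: star_mult us)
      (simp add: u_def algebra_simps mult_scaleC_left mult_scaleC_right ii scaleR_2)
  then have "2 * norm (1 - 2 *\<^sub>R (c * c)) \<le> norm (u * u) + norm ((u * u)\<^sup>\<star>)"
    by (metis norm_minus_cancel norm_scaleR norm_triangle_ineq abs_numeral)
  with nu show ?thesis
    by (simp add: norm_star)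
qed

lemma norm_shift_square:
  fixes c :: "'c::unital_cstar_algebra"
  assumes c: "c\<^sup>\<star> = c" and T: "norm (c * c) < T"
  shows "norm (T *\<^sub>R 1 - c * c) \<le> T"
proof -
  have T0: "T > 0"
    using T norm_ge_zero[of "c * c"] by linarith
  define d where "d = (1 / sqrt T) *\<^sub>R c"
  have dd: "d * d = (1 / T) *\<^sub>R (c * c)"
    using T0 by (simp add: d_def)
  have "(norm c)\<^sup>2 < T"
    using T norm_selfadjoint_square[OF c] by simp
  then have "norm c < sqrt T"
    by (simp add: real_less_rsqrt)
  then have "norm d < 1"
    using T0 by (simp add: d_def)
  then have "norm (1 - 2 *\<^sub>R (d * d)) \<le> 1"
    using c by (intro norm_one_minus_square) (auto simp: d_def star_simps)
  then have "T * norm (1 - 2 *\<^sub>R (d * d)) \<le> T"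
    using T0 by simp
  also have "T * norm (1 - 2 *\<^sub>R (d * d)) = norm (T *\<^sub>R (1 - 2 *\<^sub>R (d * d)))"
    using T0 by simp
  also have "T *\<^sub>R (1 - 2 *\<^sub>R (d * d)) = T *\<^sub>R 1 - 2 *\<^sub>R (c * c)"
    using T0 by (simp add: dd algebra_simps)
  finally have *: "norm (T *\<^sub>R 1 - 2 *\<^sub>R (c * c)) \<le> T" .
  have "2 *\<^sub>R (T *\<^sub>R 1 - c * c) = (T *\<^sub>R 1 - 2 *\<^sub>R (c * c)) + T *\<^sub>R 1"
    by (simp add: algebra_simps scaleR_2 flip: scaleR_left_distrib)
  then have "2 * norm (T *\<^sub>R 1 - c * c) \<le> T + norm (T *\<^sub>R (1::'c))"
    using * by (metis norm_scaleR abs_numeral norm_triangle_le add_mono order_refl)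
  then show ?thesis
    using T0 by simp
qed

lemma pos_square: "c\<^sup>\<star> = c \<Longrightarrow> pos (c * c)"
  using norm_shift_square[of c "norm (c * c) + 1"]
  unfolding pos_def by (auto simp: star_simps intro!: exI[of _ "norm (c * c) + 1"])

text \<open>\<open>h + e\<close> is a multiple of \<open>1 - g\<close> with \<open>\<parallel>g\<parallel> < 1\<close>; without \<open>e\<close> only \<open>\<parallel>g\<parallel> \<le> 1\<close> is known.\<close>

lemma pos_sqrt_eps:
  fixes h :: "'c::unital_cstar_algebra"
  assumes "pos h" "e > 0"
  obtains c where "c\<^sup>\<star> = c" "c * c = h + e *\<^sub>R 1" "commutes_with h c" "pos c"
proof -
  from assms obtain t where t: "t \<ge> 0" "norm (t *\<^sub>R 1 - h) \<le> t" and h: "h\<^sup>\<star> = h"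
    by (auto simp: pos_def)
  define g where "g = (1 / (t + e)) *\<^sub>R (t *\<^sub>R 1 - h)"
  have "norm g < 1"
    using t assms(2) by (simp add: g_def)
  moreover have "g\<^sup>\<star> = g"
    by (simp add: g_def star_simps h)
  ultimately obtain s where s: "s\<^sup>\<star> = s" "s * s = 1 - g" "norm (1 - s) \<le> 1" "commutes_with g s"
    using sqrt_one_minus by blast
  have cg: "y * g = g * y" if "y * h = h * y" for y
    using that by (simp add: g_def algebra_simps)
  show ?thesis
  proof (rule that[of "sqrt (t + e) *\<^sub>R s"])
    have "(t + e) *\<^sub>R (1 - g) = h + e *\<^sub>R 1"
      using t assms(2) by (simp add: g_def scaleR_right_diff_distrib scaleR_left_distrib)
    then show "(sqrt (t + e) *\<^sub>R s) * (sqrt (t + e) *\<^sub>R s) = h + e *\<^sub>R 1"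
      using t assms(2) by (simp add: s)
    show "commutes_with h (sqrt (t + e) *\<^sub>R s)"
      using s(4) cg unfolding commutes_with_def by auto
    have "pos s"
      using s unfolding pos_def by (auto intro!: exI[of _ 1])
    then show "pos (sqrt (t + e) *\<^sub>R s)"
      using t assms(2) by (intro pos_scaleR) auto
  qed (simp add: star_simps s)
qed

lemma tendsto_eps: "(\<lambda>n. inverse (real (Suc n)) *\<^sub>R x) \<longlonglongrightarrow> (0::'a::real_normed_vector)"
  using tendsto_scaleR[OF LIMSEQ_inverse_real_of_nat tendsto_const[of x]] by simp

text \<open>In the definition of positivity one can take \<open>t = \<parallel>h\<parallel>\<close>, since \<open>h\<close> is a square up to a small multiple of \<open>1\<close>. This makes
  the positive elements a closed set.\<close>

lemma pos_norm_shift: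
  fixes h :: "'c::unital_cstar_algebra"
  assumes "pos h"
  shows "norm (norm h *\<^sub>R 1 - h) \<le> norm h"
proof -
  have *: "norm ((norm h + 3 * e) *\<^sub>R 1 - (h + e *\<^sub>R 1)) \<le> norm h + 3 * e" if e: "e > 0" for e
  proof -
    obtain c where c: "c\<^sup>\<star> = c" "c * c = h + e *\<^sub>R 1"
      using pos_sqrt_eps[OF assms e] by metis
    have "norm (c * c) < norm h + 3 * e"
      unfolding c(2) using e norm_triangle_ineq[of h "e *\<^sub>R 1"] by simp
    then show ?thesis
      using norm_shift_square[OF c(1)] c(2) by simp
  qed
  have "norm (norm h *\<^sub>R 1 - h) \<le> norm h + e" if e: "e > 0" for e
  proof -
    have "norm h *\<^sub>R 1 - h = (norm h + 3 * (e/5)) *\<^sub>R 1 - (h + (e/5) *\<^sub>R 1) - (2 * (e/5)) *\<^sub>R 1"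
      by (simp add: algebra_simps) (simp flip: scaleR_left_distrib)
    then have "norm (norm h *\<^sub>R 1 - h) \<le> norm ((norm h + 3 * (e/5)) *\<^sub>R 1 - (h + (e/5) *\<^sub>R 1)) + norm ((2 * (e/5)) *\<^sub>R (1::'c))"
      by (metis norm_triangle_ineq4)
    also have "\<dots> \<le> norm h + e"
      using *[of "e/5"] e by simp
    finally show ?thesis .
  qed
  then show ?thesis
    by (rule field_le_epsilon)
qed

lemma pos_iff: "pos h \<longleftrightarrow> h\<^sup>\<star> = h \<and> norm (norm h *\<^sub>R 1 - h) \<le> norm h"
  using pos_norm_shift[of h] norm_ge_zero[of h] unfolding pos_def by blast

lemma closed_pos: "closed {h::'c::unital_cstar_algebra. pos h}"
  unfolding pos_iff
  by (intro closed_Collect_conj closed_Collect_le closed_Collect_eq continuous_intros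
      linear_continuous_on[OF bounded_linear_star])

lemma pos_lim: "(\<And>n. pos (f n)) \<Longrightarrow> f \<longlonglongrightarrow> h \<Longrightarrow> pos h"
  using closed_sequentially[OF closed_pos, of f h] by auto

lemma pos_eps:
  assumes "\<And>e. e > 0 \<Longrightarrow> pos (h + e *\<^sub>R x)"
  shows "pos h"
proof (rule pos_lim)
  show "(\<lambda>n. h + inverse (real (Suc n)) *\<^sub>R x) \<longlonglongrightarrow> h"
    using tendsto_add[OF tendsto_const tendsto_eps] by simp
qed (use assms in simp)

lemma pos_mult_commuting:
  fixes a b :: "'c::unital_cstar_algebra"
  assumes a: "pos a" and b: "pos b" and ab: "a * b = b * a"
  shows "pos (a * b)"
proof -
  have *: "pos ((a + e *\<^sub>R 1) * (b + d *\<^sub>R 1))" if ed: "e > 0" "d > 0" for e d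
  proof -
    obtain x where x: "x\<^sup>\<star> = x" "x * x = a + e *\<^sub>R 1" "commutes_with a x"
      using pos_sqrt_eps[OF a ed(1)] by metis
    obtain y where y: "y\<^sup>\<star> = y" "y * y = b + d *\<^sub>R 1" "commutes_with b y"
      using pos_sqrt_eps[OF b ed(2)] by metis
    have "b * x = x * b"
      using x(3) ab by (simp add: commutes_with_def)
    then have xy: "x * y = y * x"
      using y(3) by (simp add: commutes_with_def)
    then have "x * x * (y * y) = (x * y) * (x * y)"
      by (metis mult.assoc)
    moreover have "pos ((x * y) * (x * y))"
      by (rule pos_square) (simp add: star_simps x y xy)
    ultimately show ?thesis
      by (simp add: x y)
  qed
  have "pos (a * (b + d *\<^sub>R 1))" if d: "d > 0" for d
  proof (rule pos_eps[of _ "b + d *\<^sub>R 1"])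
    show "pos (a * (b + d *\<^sub>R 1) + e *\<^sub>R (b + d *\<^sub>R 1))" if "e > 0" for e
      using *[OF that d] by (simp add: algebra_simps)
  qed
  then show ?thesis
    by (intro pos_eps[of "a * b" a]) (simp add: distrib_left)
qed

text \<open>Square roots \<open>c\<close>, \<open>d\<close> of \<open>h\<close> and \<open>k - h\<close> need not commute, which is why \<open>k\<close> is replaced by its
  norm; then \<open>u = c + i d\<close> has \<open>u\<^sup>* u = c\<^sup>2 + d\<^sup>2\<close> and dominates its real part.\<close>

lemma pos_norm_mono:
  fixes h k :: "'c::unital_cstar_algebra"
  assumes h: "pos h" and kh: "pos (k - h)"
  shows "norm h \<le> norm k"
proof -
  define T where "T = norm k"
  have k: "pos k"
    using pos_add[OF h kh] by simp
  have "pos (T *\<^sub>R 1 - k)"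
    using k by (intro pos_of_norm_le) (auto simp: T_def pos_selfadjoint)
  from pos_add[OF this kh] have Th: "pos (T *\<^sub>R 1 - h)"
    by simp
  have ii: "\<i> *\<^sub>C \<i> *\<^sub>C x = - x" for x :: 'c
    by (metis scaleC_scaleC i_squared complex_vector.scale_minus_left scaleC_one)
  have "norm h \<le> T + e" if e: "e > 0" for e
  proof -
    have e4: "e / 4 > 0"
      using e by simp
    obtain x where x: "x\<^sup>\<star> = x" "x * x = h + (e/4) *\<^sub>R 1" "commutes_with h x"
      using pos_sqrt_eps[OF h e4] by metis
    obtain y where y: "y\<^sup>\<star> = y" "y * y = T *\<^sub>R 1 - h + (e/4) *\<^sub>R 1" "commutes_with (T *\<^sub>R 1 - h) y"
      using pos_sqrt_eps[OF Th e4] by metis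
    have "h * x = x * h"
      using x(3) by (simp add: commutes_with_def)
    then have xy: "x * y = y * x"
      using y(3) by (simp add: commutes_with_def algebra_simps)
    define u where "u = x + \<i> *\<^sub>C y"
    have us: "u\<^sup>\<star> = x - \<i> *\<^sub>C y"
      by (simp add: u_def star_simps star_scaleC x y)
    have "u\<^sup>\<star> * u = x * x + y * y"
      using xy
      by (simp only: us) (simp add: u_def algebra_simps mult_scaleC_left mult_scaleC_right ii scaleC_add_right)
    also have "\<dots> = (T + e/2) *\<^sub>R 1"
      unfolding x y by (simp add: algebra_simps flip: scaleR_left_distrib)
    finally have "norm (u\<^sup>\<star> * u) = T + e/2"
      using e by (simp add: T_def)
    then have nu: "(norm u)\<^sup>2 = T + e/2"
      by (simp add: cstar_identity)
    have "2 *\<^sub>R x = u + u\<^sup>\<star>"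
      by (simp add: us) (simp add: u_def scaleR_2)
    then have "2 * norm x \<le> norm u + norm (u\<^sup>\<star>)"
      by (metis norm_scaleR norm_triangle_ineq abs_numeral)
    then have "norm x \<le> norm u"
      by (simp add: norm_star)
    then have "(norm x)\<^sup>2 \<le> (norm u)\<^sup>2"
      by (simp add: power_mono)
    then have "norm (x * x) \<le> T + e/2"
      using nu norm_selfadjoint_square[OF x(1)] by simp
    then have "norm (h + (e/4) *\<^sub>R 1) \<le> T + e/2"
      by (simp add: x)
    moreover have "norm h \<le> norm (h + (e/4) *\<^sub>R 1) + norm ((e/4) *\<^sub>R (1::'c))"
      by (rule order_trans[OF _ norm_triangle_ineq4]) simp
    ultimately show ?thesis
      using e by simp
  qed
  then show ?thesis
    unfolding T_def by (rule field_le_epsilon)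
qed

lemma pos_norm_le_interval:
  fixes k :: "'c::unital_cstar_algebra"
  assumes "pos (M *\<^sub>R 1 - k)" "pos (M *\<^sub>R 1 + k)" "M \<ge> 0"
  shows "norm k \<le> M"
proof -
  have "2 *\<^sub>R k = (M *\<^sub>R 1 + k) - (M *\<^sub>R 1 - k)"
    by (simp add: scaleR_2)
  also have "\<dots>\<^sup>\<star> = \<dots>"
    using pos_selfadjoint[OF assms(1)] pos_selfadjoint[OF assms(2)] by (simp only: star_diff[of "M *\<^sub>R 1 + k"])
  finally have sa: "k\<^sup>\<star> = k"
    by (simp add: star_simps)
  have "pos ((M *\<^sub>R 1 - k) * (M *\<^sub>R 1 + k))"
    using assms by (intro pos_mult_commuting) (auto simp: algebra_simps)
  also have "(M *\<^sub>R 1 - k) * (M *\<^sub>R 1 + k) = (M * M) *\<^sub>R 1 - k * k"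
    by (simp add: algebra_simps)
  finally have "norm (k * k) \<le> norm ((M * M) *\<^sub>R (1::'c))"
    using pos_square[OF sa] by (intro pos_norm_mono)
  then have "(norm k)\<^sup>2 \<le> M\<^sup>2"
    using assms by (simp add: norm_selfadjoint_square[OF sa] power2_eq_square)
  then show ?thesis
    using assms(3) power2_le_imp_le by blast
qed

section \<open>Continuous functional calculus\<close>

definition peval :: "real poly \<Rightarrow> 'c \<Rightarrow> 'c::unital_cstar_algebra" where
  "peval p x = fold_coeffs (\<lambda>a y. a *\<^sub>R 1 + x * y) p 0"

lemma peval_0 [simp]: "peval 0 x = 0"
  by (simp add: peval_def)

lemma peval_pCons [simp]: "peval (pCons a p) x = a *\<^sub>R 1 + x * peval p x"
  by (cases "p = 0 \<and> a = 0") (auto simp: peval_def)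

lemma peval_1 [simp]: "peval 1 x = 1"
  by (simp add: one_pCons)

lemma peval_add [simp]: "peval (p + q) x = peval p x + peval q x"
proof (induction p arbitrary: q)
  case (pCons a p)
  then show ?case
    by (cases q) (simp add: algebra_simps)
qed auto

lemma peval_smult [simp]: "peval (smult c p) x = c *\<^sub>R peval p x"
  by (induction p) (simp_all add: algebra_simps)

lemma peval_diff [simp]: "peval (p - q) x = peval p x - peval q x"
  using peval_add[of "p - q" q x] by simp

lemma peval_mult [simp]: "peval (p * q) x = peval p x * peval q x"
  by (induction p) (simp_all add: algebra_simps)

lemma peval_power [simp]: "peval (p ^ n) x = peval p x ^ n"
  by (induction n) simp_all

lemma peval_sum: "peval (sum f A) x = (\<Sum>i\<in>A. peval (f i) x)"
  by (induction A rule: infinite_finite_induct) simp_all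

lemma peval_pcompose: "peval (pcompose p q) x = peval p (peval q x)"
  by (induction p) (simp_all add: pcompose_pCons)

lemma peval_commute: "y * x = x * y \<Longrightarrow> y * peval p x = peval p x * y"
proof (induction p)
  case (pCons a p)
  then have "y * (x * peval p x) = x * peval p x * y"
    by (metis mult.assoc)
  then show ?case
    by (simp add: algebra_simps)
qed simp

lemma peval_star: "x\<^sup>\<star> = x \<Longrightarrow> (peval p x)\<^sup>\<star> = peval p x"
proof (induction p)
  case (pCons a p)
  then show ?case
    using peval_commute[of x x p] by (simp add: star_simps)
qed simp

lemma peval_monom: "peval (monom a n) x = a *\<^sub>R x ^ n"
  by (induction n) (simp_all add: monom_0 monom_Suc)

lemma peval_altdef_le:
  assumes "degree p \<le> d"
  shows "peval p x = (\<Sum>i\<le>d. coeff p i *\<^sub>R x ^ i)"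
  using arg_cong[OF poly_as_sum_of_monoms'[OF assms], of "\<lambda>q. peval q x"]
  by (simp add: peval_sum peval_monom)

lemma smult_sum_right: "smult c (sum f A) = (\<Sum>i\<in>A. smult c (f i))"
  by (induction A rule: infinite_finite_induct) (simp_all add: smult_add_right)

lemma pderiv_sum: "pderiv (sum f A) = (\<Sum>i\<in>A. pderiv (f i))"
  by (induction A rule: infinite_finite_induct) (simp_all add: pderiv_add)

text \<open>The Bernstein polynomials of the monomials, whose coefficients converge because of the
  recursion \<open>B\<^sub>n(t f) = t B\<^sub>n f + t (1 - t) (B\<^sub>n f)' / n\<close>.\<close>

definition bernstein_monom :: "nat \<Rightarrow> nat \<Rightarrow> real poly" where
  "bernstein_monom n m =
     (\<Sum>k\<le>n. smult ((real k / real n) ^ m * real (n choose k)) ([:0, 1:] ^ k * [:1, -1:] ^ (n - k)))"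

lemma bernstein_monom_0: "bernstein_monom n 0 = 1"
proof -
  have "bernstein_monom n 0 = (\<Sum>k\<le>n. of_nat (n choose k) * [:0, 1:] ^ k * [:1, -1:] ^ (n - k))"
    by (simp add: bernstein_monom_def of_nat_poly)
  also have "\<dots> = ([:0, 1:] + [:1, -1:]) ^ n"
    by (rule binomial_ring[symmetric])
  also have "[:0, 1:] + [:1, -1:] = (1 :: real poly)"
    by (simp add: one_pCons)
  finally show ?thesis
    by simp
qed

lemma bernstein_monom_Suc:
  assumes n: "n > 0"
  shows "bernstein_monom n (Suc m) = [:0, 1:] * bernstein_monom n m +
    smult (1 / real n) ([:0, 1:] * [:1, -1:] * pderiv (bernstein_monom n m))"
proof -
  define X Y :: "real poly" where "X = [:0, 1:]" and "Y = [:1, -1:]"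
  have dX: "pderiv X = 1" and dY: "pderiv Y = - 1" and Y: "Y = 1 - X"
    by (simp_all add: X_def Y_def pderiv_pCons one_pCons)
  have XdX: "X * pderiv (X ^ k) = smult (real k) (X ^ k)" for k
    by (cases k) (simp_all add: pderiv_power_Suc dX del: power_Suc, simp add: mult.commute)
  have YdY: "Y * pderiv (Y ^ k) = - smult (real k) (Y ^ k)" for k
    by (cases k) (simp_all add: pderiv_power_Suc dY del: power_Suc, simp add: mult.commute)
  have main: "X * Y * pderiv (X ^ k * Y ^ (n - k)) =
      smult (real k) (X ^ k * Y ^ (n - k)) - smult (real n) (X * (X ^ k * Y ^ (n - k)))" if "k \<le> n" for k
  proof -
    have "X * Y * pderiv (X ^ k * Y ^ (n - k)) =
      X * X ^ k * (Y * pderiv (Y ^ (n - k))) + Y * Y ^ (n - k) * (X * pderiv (X ^ k))"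
      by (simp add: pderiv_mult algebra_simps)
    also have "\<dots> = smult (real k) (Y * (X ^ k * Y ^ (n - k))) - smult (real (n - k)) (X * (X ^ k * Y ^ (n - k)))"
      by (simp add: XdX YdY mult_ac)
    also have "\<dots> = smult (real k) (X ^ k * Y ^ (n - k)) - smult (real k + real (n - k)) (X * (X ^ k * Y ^ (n - k)))"
      by (subst (1) Y) (simp add: algebra_simps smult_add_left smult_diff_right)
    finally show ?thesis
      using that by (simp add: of_nat_diff)
  qed
  have "smult (1 / real n) (X * Y * pderiv (bernstein_monom n m)) =
     (\<Sum>k\<le>n. smult (1 / real n) (smult ((real k / real n) ^ m * real (n choose k))
        (X * Y * pderiv (X ^ k * Y ^ (n - k)))))"
    by (simp add: bernstein_monom_def X_def[symmetric] Y_def[symmetric] pderiv_sum pderiv_smult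
        sum_distrib_left smult_sum_right mult_ac)
  also have "\<dots> = (\<Sum>k\<le>n. smult ((real k / real n) ^ Suc m * real (n choose k)) (X ^ k * Y ^ (n - k))
      - X * smult ((real k / real n) ^ m * real (n choose k)) (X ^ k * Y ^ (n - k)))"
    using n by (intro sum.cong refl, subst main) (auto simp: smult_diff_right mult_ac)
  also have "\<dots> = bernstein_monom n (Suc m) - X * bernstein_monom n m"
    by (simp add: bernstein_monom_def X_def[symmetric] Y_def[symmetric] sum_subtractf sum_distrib_left)
  finally show ?thesis
    by (simp add: X_def Y_def)
qed

lemma degree_bernstein_monom: "n > 0 \<Longrightarrow> degree (bernstein_monom n m) \<le> m"
proof (induction m)
  case (Suc m)
  have "degree ([:0, 1:] * bernstein_monom n m) \<le> Suc m"
    using Suc by (intro order_trans[OF degree_mult_le]) auto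
  moreover have "degree ([:0, 1:] * [:1, -1:] * pderiv (bernstein_monom n m)) \<le> Suc m"
  proof (cases "degree (bernstein_monom n m) = 0")
    case True
    then have "pderiv (bernstein_monom n m) = 0"
      by (simp add: pderiv_eq_0_iff)
    then show ?thesis by simp
  next
    case False
    have "degree ([:0, 1:] * [:1, -1:] * pderiv (bernstein_monom n m))
        \<le> degree ([:0, 1:] * [:1, -1::real:]) + degree (pderiv (bernstein_monom n m))"
      by (rule degree_mult_le)
    also have "\<dots> \<le> 2 + (degree (bernstein_monom n m) - 1)"
      by (simp add: degree_pderiv)
    finally show ?thesis
      using Suc False by linarith
  qed
  ultimately show ?case
    by (subst bernstein_monom_Suc[OF Suc.prems])
      (intro degree_add_le order_trans[OF degree_smult_le])
qed (simp add: bernstein_monom_0)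

lemma coeff_bernstein_monom_tendsto:
  "(\<lambda>n. coeff (bernstein_monom (Suc n) m) i) \<longlonglongrightarrow> (if i = m then 1 else 0)"
proof (induction m arbitrary: i)
  case 0
  then show ?case
    by (simp add: bernstein_monom_0)
next
  case (Suc m)
  have D: "(\<lambda>n. coeff (pderiv (bernstein_monom (Suc n) m)) j) \<longlonglongrightarrow> real (Suc j) * (if Suc j = m then 1 else 0)" for j
    unfolding coeff_pderiv by (intro tendsto_intros Suc)
  have XY: "[:0, 1:] * [:1, -1:] * q = pCons 0 q - pCons 0 (pCons 0 q)" for q :: "real poly"
    by simp
  have shift: "\<exists>L. (\<lambda>n. coeff (pCons 0 (P n)) i) \<longlonglongrightarrow> L"
    if "\<And>j. \<exists>L. (\<lambda>n. coeff (P n) j) \<longlonglongrightarrow> L" for P :: "nat \<Rightarrow> real poly" and i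
    using that by (cases i) (auto intro: tendsto_const)
  have D2: "\<exists>L. (\<lambda>n. coeff ([:0, 1:] * [:1, -1:] * pderiv (bernstein_monom (Suc n) m)) i) \<longlonglongrightarrow> L"
  proof -
    have 1: "\<exists>L. (\<lambda>n. coeff (pCons 0 (pderiv (bernstein_monom (Suc n) m))) j) \<longlonglongrightarrow> L" for j
      by (rule shift) (use D in blast)
    moreover have "\<exists>L. (\<lambda>n. coeff (pCons 0 (pCons 0 (pderiv (bernstein_monom (Suc n) m)))) j) \<longlonglongrightarrow> L" for j
      by (rule shift[OF 1])
    ultimately obtain K L where
      "(\<lambda>n. coeff (pCons 0 (pderiv (bernstein_monom (Suc n) m))) i) \<longlonglongrightarrow> K"
      "(\<lambda>n. coeff (pCons 0 (pCons 0 (pderiv (bernstein_monom (Suc n) m)))) i) \<longlonglongrightarrow> L"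
      by blast
    from tendsto_diff[OF this] show ?thesis
      unfolding XY coeff_diff by blast
  qed
  then obtain L where L: "(\<lambda>n. coeff ([:0, 1:] * [:1, -1:] * pderiv (bernstein_monom (Suc n) m)) i) \<longlonglongrightarrow> L"
    by blast
  have "(\<lambda>n. coeff (pCons 0 (bernstein_monom (Suc n) m)) i +
      inverse (real (Suc n)) * coeff ([:0, 1:] * [:1, -1:] * pderiv (bernstein_monom (Suc n) m)) i)
    \<longlonglongrightarrow> (if i = Suc m then 1 else 0) + 0 * L"
  proof (intro tendsto_add tendsto_mult L LIMSEQ_inverse_real_of_nat)
    show "(\<lambda>n. coeff (pCons 0 (bernstein_monom (Suc n) m)) i) \<longlonglongrightarrow> (if i = Suc m then 1 else 0)"
      using Suc[of "i - 1"] by (cases i) auto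
  qed
  moreover have "coeff (bernstein_monom (Suc n) (Suc m)) i = coeff (pCons 0 (bernstein_monom (Suc n) m)) i +
      inverse (real (Suc n)) * coeff ([:0, 1:] * [:1, -1:] * pderiv (bernstein_monom (Suc n) m)) i" for n
    by (simp only: bernstein_monom_Suc[OF zero_less_Suc] coeff_add coeff_smult)
      (simp add: inverse_eq_divide)
  ultimately show ?case
    by simp
qed

text \<open>The Bernstein polynomials of a monomial have bounded degree, so that convergence of their coefficients gives convergence
  in every algebra.\<close>

lemma peval_bernstein_monom_tendsto: "(\<lambda>n. peval (bernstein_monom (Suc n) m) x) \<longlonglongrightarrow> x ^ m"
proof -
  have eq: "x ^ m = (\<Sum>i\<le>m. (if i = m then 1 else 0::real) *\<^sub>R x ^ i)"
    by (simp add: if_distrib[of "\<lambda>c. c *\<^sub>R _"] sum.delta cong: if_cong)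
  show ?thesis
    by (subst eq) (auto simp: peval_altdef_le[OF degree_bernstein_monom]
        intro!: tendsto_sum tendsto_scaleR coeff_bernstein_monom_tendsto)
qed

lemma pos_power: "pos x \<Longrightarrow> pos (x ^ k)"
proof (induction k)
  case (Suc k)
  then show ?case
    by (simp add: pos_mult_commuting power_commutes)
qed simp

lemma pos_bernstein_basis:
  assumes "pos h" "pos (1 - h)"
  shows "pos (h ^ j * (1 - h) ^ k)"
proof (rule pos_mult_commuting)
  have "h * (1 - h) ^ k = (1 - h) ^ k * h"
    by (rule power_commuting_commutes[symmetric]) (simp add: algebra_simps)
  then show "h ^ j * (1 - h) ^ k = (1 - h) ^ k * h ^ j"
    by (rule power_commuting_commutes)
qed (use assms pos_power in auto)

text \<open>A polynomial that is nonnegative on \<open>[0,1]\<close> is a limit of positive combinations of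
  \<open>t\<^sup>j (1 - t)\<^sup>k\<close>, by Bernstein.\<close>

lemma pos_peval_unit:
  fixes h :: "'c::unital_cstar_algebra"
  assumes h: "pos h" "pos (1 - h)" and p: "\<And>t. 0 \<le> t \<Longrightarrow> t \<le> 1 \<Longrightarrow> poly p t \<ge> 0"
  shows "pos (peval p h)"
proof (rule pos_lim)
  define B where "B n = (\<Sum>i\<le>degree p. smult (coeff p i) (bernstein_monom n i))" for n
  show "(\<lambda>n. peval (B (Suc n)) h) \<longlonglongrightarrow> peval p h"
    unfolding B_def peval_sum peval_smult peval_altdef_le[OF order_refl, of p]
    by (intro tendsto_intros peval_bernstein_monom_tendsto)
  show "pos (peval (B (Suc n)) h)" for n
  proof -
    have "B (Suc n) = (\<Sum>i\<le>degree p. \<Sum>k\<le>Suc n. smult (coeff p i * (real k / real (Suc n)) ^ i * real (Suc n choose k))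
        ([:0, 1:] ^ k * [:1, -1:] ^ (Suc n - k)))"
      by (simp only: B_def bernstein_monom_def smult_sum_right smult_smult mult.assoc)
    also have "\<dots> = (\<Sum>k\<le>Suc n. smult (poly p (real k / real (Suc n)) * real (Suc n choose k))
        ([:0, 1:] ^ k * [:1, -1:] ^ (Suc n - k)))"
      by (subst sum.swap) (simp add: poly_altdef sum_distrib_right smult_sum)
    finally have "peval (B (Suc n)) h = (\<Sum>k\<le>Suc n. (poly p (real k / real (Suc n)) * real (Suc n choose k))
        *\<^sub>R (h ^ k * (1 - h) ^ (Suc n - k)))"
      by (simp only: peval_sum peval_smult peval_mult peval_power) simp
    also have "pos \<dots>"
      by (intro pos_sum pos_scaleR pos_bernstein_basis h mult_nonneg_nonneg p) auto
    finally show ?thesis .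
  qed
qed

lemma pos_peval:
  fixes h :: "'c::unital_cstar_algebra"
  assumes h: "pos (h - a *\<^sub>R 1)" "pos (b *\<^sub>R 1 - h)" and ab: "a < b"
    and p: "\<And>t. a \<le> t \<Longrightarrow> t \<le> b \<Longrightarrow> poly p t \<ge> 0"
  shows "pos (peval p h)"
proof -
  define k where "k = (1 / (b - a)) *\<^sub>R (h - a *\<^sub>R 1)"
  have 1: "1 - k = (1 / (b - a)) *\<^sub>R (b *\<^sub>R 1 - h)"
  proof -
    have "(1 / (b - a)) *\<^sub>R (b *\<^sub>R 1 - h) + k = (1 / (b - a)) *\<^sub>R ((b *\<^sub>R 1 - h) + (h - a *\<^sub>R 1))"
      by (simp only: k_def scaleR_add_right)
    also have "\<dots> = (1 / (b - a)) *\<^sub>R ((b - a) *\<^sub>R 1)"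
      by (simp add: algebra_simps)
    finally have "(1 / (b - a)) *\<^sub>R (b *\<^sub>R 1 - h) + k = 1"
      using ab by simp
    then show ?thesis
      by (metis add_diff_cancel_right')
  qed
  have "pos (peval (pcompose p [:a, b - a:]) k)"
  proof (rule pos_peval_unit)
    show "pos k" "pos (1 - k)"
      unfolding 1 using h ab by (auto simp: k_def intro!: pos_scaleR)
    show "poly (pcompose p [:a, b - a:]) t \<ge> 0" if "0 \<le> t" "t \<le> 1" for t
    proof -
      have "t * (b - a) \<le> b - a"
        using that ab by (intro mult_left_le_one_le) auto
      then have "a + t * (b - a) \<le> b"
        by linarith
      moreover have "a \<le> a + t * (b - a)"
        using that ab by simp
      ultimately show ?thesis
        using p by (simp add: poly_pcompose)
    qed
  qed
  moreover have "peval [:a, b - a:] k = h"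
    using ab by (simp add: k_def)
  ultimately show ?thesis
    by (simp add: peval_pcompose)
qed

lemma norm_peval_le_interval:
  fixes h :: "'c::unital_cstar_algebra"
  assumes h: "pos (h - a *\<^sub>R 1)" "pos (b *\<^sub>R 1 - h)" and ab: "a < b"
    and p: "\<And>t. a \<le> t \<Longrightarrow> t \<le> b \<Longrightarrow> \<bar>poly p t\<bar> \<le> M"
  shows "norm (peval p h) \<le> M"
proof (rule pos_norm_le_interval)
  have "pos (peval ([:M:] - p) h)"
    by (rule pos_peval[OF h ab]) (use p abs_le_D1 in fastforce)
  moreover have "pos (peval ([:M:] + p) h)"
  proof (rule pos_peval[OF h ab])
    fix t assume "a \<le> t" "t \<le> b"
    then show "poly ([:M:] + p) t \<ge> 0"
      using p[of t] by auto
  qed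
  ultimately show "pos (M *\<^sub>R 1 - peval p h)" "pos (M *\<^sub>R 1 + peval p h)"
    by simp_all
  show "M \<ge> 0"
    using p[of a] ab abs_ge_zero[of "poly p a"] by linarith
qed

lemma norm_peval_le:
  fixes P :: "'c::unital_cstar_algebra"
  assumes P: "pos P" and p: "\<And>t. 0 \<le> t \<Longrightarrow> t \<le> norm P \<Longrightarrow> \<bar>poly p t\<bar> \<le> M"
  shows "norm (peval p P) \<le> M"
proof (cases "norm P = 0")
  case True
  then have "peval p P = poly p 0 *\<^sub>R 1"
    by (cases p) auto
  then show ?thesis
    using p[of 0] by simp
next
  case False
  then have "0 < norm P" by simp
  moreover have "pos (norm P *\<^sub>R 1 - P)"
    using P by (intro pos_of_norm_le) (auto simp: pos_selfadjoint)
  ultimately show ?thesis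
    using norm_peval_le_interval[of P 0 "norm P" p M] P p by simp
qed

lemma poly_approx:
  fixes f :: "real \<Rightarrow> real"
  assumes "continuous_on {a..b} f" "e > 0"
  obtains p where "\<And>t. a \<le> t \<Longrightarrow> t \<le> b \<Longrightarrow> \<bar>f t - poly p t\<bar> < e"
proof -
  obtain g where g: "real_polynomial_function g" "\<And>x. x \<in> {a..b} \<Longrightarrow> \<bar>f x - g x\<bar> < e"
    using Stone_Weierstrass_real_polynomial_function[OF compact_Icc assms] by blast
  then obtain c n where "g = (\<lambda>x. \<Sum>i\<le>n::nat. c i * x ^ i)"
    by (auto simp: real_polynomial_function_iff_sum)
  then have "g t = poly (\<Sum>i\<le>n. monom (c i) i) t" for t
    by (simp add: poly_sum poly_monom)
  with g that show ?thesis
    by (metis atLeastAtMost_iff)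
qed

subsection \<open>Continuous functions of a positive element\<close>

lemma poly_fun_simps:
  fixes p q :: "'a::comm_ring_1 poly"
  shows "poly (p + q) = (\<lambda>x. poly p x + poly q x)" "poly (p - q) = (\<lambda>x. poly p x - poly q x)"
    "poly (p * q) = (\<lambda>x. poly p x * poly q x)"
  by auto

lemma peval_tendsto_0:
  fixes P :: "'c::unital_cstar_algebra"
  assumes P: "pos P" and p: "uniform_limit {0..norm P} (\<lambda>n. poly (p n)) (\<lambda>_. 0) sequentially"
  shows "(\<lambda>n. peval (p n) P) \<longlonglongrightarrow> 0"
proof (rule LIMSEQ_I)
  fix e :: real assume e: "e > 0"
  then have "\<forall>\<^sub>F n in sequentially. \<forall>t\<in>{0..norm P}. dist (poly (p n) t) 0 < e / 2"
    using p by (intro uniform_limitD) auto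
  then obtain N where N: "\<And>n t. n \<ge> N \<Longrightarrow> t \<in> {0..norm P} \<Longrightarrow> \<bar>poly (p n) t\<bar> < e / 2"
    unfolding eventually_sequentially dist_real_def by (metis diff_zero)
  have "norm (peval (p n) P - 0) < e" if "n \<ge> N" for n
  proof -
    have "norm (peval (p n) P) \<le> e / 2"
      using N[OF that] by (intro norm_peval_le[OF P]) (auto simp: less_imp_le)
    then show ?thesis
      using e by simp
  qed
  then show "\<exists>N. \<forall>n\<ge>N. norm (peval (p n) P - 0) < e"
    by blast
qed

lemma uniform_limit_poly_exists:
  fixes f :: "real \<Rightarrow> real"
  assumes "continuous_on {a..b} f"
  obtains p where "uniform_limit {a..b} (\<lambda>n. poly (p n)) f sequentially"
proof -
  have "\<exists>p. \<forall>t\<in>{a..b}. \<bar>f t - poly p t\<bar> < inverse (real (Suc n))" for n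
    using poly_approx[OF assms, of "inverse (real (Suc n))"]
    by (metis atLeastAtMost_iff inverse_positive_iff_positive of_nat_0_less_iff zero_less_Suc)
  then obtain p where p: "\<And>n t. t \<in> {a..b} \<Longrightarrow> \<bar>f t - poly (p n) t\<bar> < inverse (real (Suc n))"
    by metis
  have "uniform_limit {a..b} (\<lambda>n. poly (p n)) f sequentially"
  proof (rule uniform_limitI)
    fix e :: real assume "e > 0"
    then have "\<forall>\<^sub>F n in sequentially. inverse (real (Suc n)) < e"
      using order_tendstoD(2)[OF LIMSEQ_inverse_real_of_nat] by blast
    then show "\<forall>\<^sub>F n in sequentially. \<forall>t\<in>{a..b}. dist (poly (p n) t) (f t) < e"
      by eventually_elim (auto simp: dist_real_def abs_minus_commute intro: less_trans[OF p])
  qed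
  then show ?thesis
    by (rule that)
qed

lemma peval_convergent:
  fixes P :: "'c::unital_cstar_algebra"
  assumes P: "pos P" and p: "uniform_limit {0..norm P} (\<lambda>n. poly (p n)) f sequentially"
  shows "convergent (\<lambda>n. peval (p n) P)"
proof (rule Cauchy_convergent, rule CauchyI)
  fix e :: real assume e: "e > 0"
  then have "\<forall>\<^sub>F n in sequentially. \<forall>t\<in>{0..norm P}. dist (poly (p n) t) (f t) < e / 4"
    using p by (intro uniform_limitD) auto
  then obtain N where N: "\<And>n t. n \<ge> N \<Longrightarrow> t \<in> {0..norm P} \<Longrightarrow> \<bar>poly (p n) t - f t\<bar> < e / 4"
    unfolding eventually_sequentially dist_real_def by metis
  have "norm (peval (p m) P - peval (p n) P) < e" if "m \<ge> N" "n \<ge> N" for m n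
  proof -
    have "norm (peval (p m - p n) P) \<le> e / 2"
    proof (rule norm_peval_le[OF P])
      fix t assume t: "0 \<le> t" "t \<le> norm P"
      show "\<bar>poly (p m - p n) t\<bar> \<le> e / 2"
        using N[OF that(1), of t] N[OF that(2), of t] t unfolding poly_diff atLeastAtMost_iff
        by argo
    qed
    then show ?thesis
      using e by simp
  qed
  then show "\<exists>N. \<forall>m\<ge>N. \<forall>n\<ge>N. norm (peval (p m) P - peval (p n) P) < e"
    by blast
qed

definition fcalc :: "'c \<Rightarrow> (real \<Rightarrow> real) \<Rightarrow> 'c::unital_cstar_algebra" where
  "fcalc P f = (THE T. \<exists>p. uniform_limit {0..norm P} (\<lambda>n. poly (p n)) f sequentially
      \<and> (\<lambda>n. peval (p n) P) \<longlonglongrightarrow> T)"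

lemma fcalc_tendsto:
  fixes P :: "'c::unital_cstar_algebra"
  assumes P: "pos P" and p: "uniform_limit {0..norm P} (\<lambda>n. poly (p n)) f sequentially"
  shows "(\<lambda>n. peval (p n) P) \<longlonglongrightarrow> fcalc P f"
proof -
  obtain T where T: "(\<lambda>n. peval (p n) P) \<longlonglongrightarrow> T"
    using peval_convergent[OF assms] by (auto simp: convergent_def)
  have "fcalc P f = T"
    unfolding fcalc_def
  proof (rule the_equality)
    fix T' assume "\<exists>q. uniform_limit {0..norm P} (\<lambda>n. poly (q n)) f sequentially
      \<and> (\<lambda>n. peval (q n) P) \<longlonglongrightarrow> T'"
    then obtain q where q: "uniform_limit {0..norm P} (\<lambda>n. poly (q n)) f sequentially"
      "(\<lambda>n. peval (q n) P) \<longlonglongrightarrow> T'" by blast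
    have "uniform_limit {0..norm P} (\<lambda>n. poly (q n - p n)) (\<lambda>_. 0) sequentially"
      using uniform_limit_minus[OF q(1) p] by (simp add: poly_fun_simps)
    from peval_tendsto_0[OF P this] have "(\<lambda>n. peval (q n) P - peval (p n) P) \<longlonglongrightarrow> 0"
      by simp
    moreover have "(\<lambda>n. peval (q n) P - peval (p n) P) \<longlonglongrightarrow> T' - T"
      by (intro tendsto_diff q T)
    ultimately show "T' = T"
      using LIMSEQ_unique by fastforce
  qed (use p T in blast)
  with T show ?thesis
    by simp
qed

lemma fcalc_approx:
  fixes P :: "'c::unital_cstar_algebra"
  assumes P: "pos P" and f: "continuous_on {0..norm P} f"
  obtains p where "uniform_limit {0..norm P} (\<lambda>n. poly (p n)) f sequentially"
    "(\<lambda>n. peval (p n) P) \<longlonglongrightarrow> fcalc P f"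
  using uniform_limit_poly_exists[OF f] fcalc_tendsto[OF P] by metis

lemma fcalc_poly: "pos P \<Longrightarrow> fcalc P (poly p) = peval p P"
proof -
  assume P: "pos P"
  have "(\<lambda>_::nat. peval p P) \<longlonglongrightarrow> fcalc P (poly p)"
    using P by (rule fcalc_tendsto) (rule uniform_limit_const)
  then show ?thesis
    using LIMSEQ_unique tendsto_const by blast
qed

lemma fcalc_cong: "(\<And>t. 0 \<le> t \<Longrightarrow> t \<le> norm P \<Longrightarrow> f t = g t) \<Longrightarrow> fcalc P f = fcalc P g"
proof -
  assume *: "\<And>t. 0 \<le> t \<Longrightarrow> t \<le> norm P \<Longrightarrow> f t = g t"
  have "uniform_limit {0..norm P} h f sequentially \<longleftrightarrow> uniform_limit {0..norm P} h g sequentially" for h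
    by (rule uniform_limit_cong') (use * in auto)
  then show ?thesis
    by (simp add: fcalc_def)
qed

lemma fcalc_mult:
  fixes P :: "'c::unital_cstar_algebra"
  assumes P: "pos P" and f: "continuous_on {0..norm P} f" and g: "continuous_on {0..norm P} g"
  shows "fcalc P (\<lambda>t. f t * g t) = fcalc P f * fcalc P g"
proof -
  obtain p where p: "uniform_limit {0..norm P} (\<lambda>n. poly (p n)) f sequentially"
    "(\<lambda>n. peval (p n) P) \<longlonglongrightarrow> fcalc P f" using fcalc_approx[OF P f] .
  obtain q where q: "uniform_limit {0..norm P} (\<lambda>n. poly (q n)) g sequentially"
    "(\<lambda>n. peval (q n) P) \<longlonglongrightarrow> fcalc P g" using fcalc_approx[OF P g] .
  have "bounded (f ` {0..norm P})" "bounded (g ` {0..norm P})"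
    using f g by (auto intro!: compact_imp_bounded compact_continuous_image)
  from uniform_lim_mult[OF p(1) q(1) this]
  have "uniform_limit {0..norm P} (\<lambda>n. poly (p n * q n)) (\<lambda>t. f t * g t) sequentially"
    by (simp add: poly_fun_simps)
  from fcalc_tendsto[OF P this] have "(\<lambda>n. peval (p n) P * peval (q n) P) \<longlonglongrightarrow> fcalc P (\<lambda>t. f t * g t)"
    by simp
  with tendsto_mult[OF p(2) q(2)] show ?thesis
    using LIMSEQ_unique by blast
qed

lemma fcalc_commute:
  fixes P :: "'c::unital_cstar_algebra"
  assumes P: "pos P" and f: "continuous_on {0..norm P} f" and y: "y * P = P * y"
  shows "y * fcalc P f = fcalc P f * y"
proof -
  obtain p where p: "(\<lambda>n. peval (p n) P) \<longlonglongrightarrow> fcalc P f" using fcalc_approx[OF P f] .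
  have "(\<lambda>n. y * peval (p n) P) \<longlonglongrightarrow> y * fcalc P f" "(\<lambda>n. peval (p n) P * y) \<longlonglongrightarrow> fcalc P f * y"
    by (intro tendsto_intros p)+
  then show ?thesis
    using y LIMSEQ_unique by (simp add: peval_commute)
qed

lemma pos_fcalc:
  fixes P :: "'c::unital_cstar_algebra"
  assumes P: "pos P" and f: "continuous_on {0..norm P} f" and f0: "\<And>t. 0 \<le> t \<Longrightarrow> t \<le> norm P \<Longrightarrow> f t \<ge> 0"
  shows "pos (fcalc P f)"
proof -
  define g where "g t = sqrt (f t)" for t
  have g: "continuous_on {0..norm P} g"
    unfolding g_def by (intro continuous_intros f)
  obtain p where p: "(\<lambda>n. peval (p n) P) \<longlonglongrightarrow> fcalc P g" using fcalc_approx[OF P g] .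
  have "(\<lambda>n. (peval (p n) P)\<^sup>\<star>) \<longlonglongrightarrow> (fcalc P g)\<^sup>\<star>"
    by (rule bounded_linear.tendsto[OF bounded_linear_star p])
  then have "(fcalc P g)\<^sup>\<star> = fcalc P g"
    using p LIMSEQ_unique by (simp add: peval_star pos_selfadjoint[OF P])
  then have "pos (fcalc P g * fcalc P g)"
    by (rule pos_square)
  also have "fcalc P g * fcalc P g = fcalc P f"
    unfolding fcalc_mult[OF P g g, symmetric] by (rule fcalc_cong) (simp add: g_def f0)
  finally show ?thesis .
qed

lemma fcalc_add:
  fixes P :: "'c::unital_cstar_algebra"
  assumes P: "pos P" and f: "continuous_on {0..norm P} f" and g: "continuous_on {0..norm P} g"
  shows "fcalc P (\<lambda>t. f t + g t) = fcalc P f + fcalc P g"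
proof -
  obtain p where p: "uniform_limit {0..norm P} (\<lambda>n. poly (p n)) f sequentially"
    "(\<lambda>n. peval (p n) P) \<longlonglongrightarrow> fcalc P f" using fcalc_approx[OF P f] .
  obtain q where q: "uniform_limit {0..norm P} (\<lambda>n. poly (q n)) g sequentially"
    "(\<lambda>n. peval (q n) P) \<longlonglongrightarrow> fcalc P g" using fcalc_approx[OF P g] .
  from uniform_limit_add[OF p(1) q(1)]
  have "uniform_limit {0..norm P} (\<lambda>n. poly (p n + q n)) (\<lambda>t. f t + g t) sequentially"
    by (simp add: poly_fun_simps)
  from fcalc_tendsto[OF P this] have "(\<lambda>n. peval (p n) P + peval (q n) P) \<longlonglongrightarrow> fcalc P (\<lambda>t. f t + g t)"
    by simp
  with tendsto_add[OF p(2) q(2)] show ?thesis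
    using LIMSEQ_unique by blast
qed

subsection \<open>Positivity of \<open>y\<^sup>* y\<close>\<close>

lemma cartesian_squares:
  fixes x :: "'c::unital_cstar_algebra"
  shows "pos (x\<^sup>\<star> * x + x * x\<^sup>\<star>)"
proof -
  define a b where "a = x + x\<^sup>\<star>" and "b = \<i> *\<^sub>C (x - x\<^sup>\<star>)"
  have sa: "a\<^sup>\<star> = a" "b\<^sup>\<star> = b"
    by (simp_all add: a_def b_def star_simps star_scaleC complex_vector.scale_right_diff_distrib)
  have ii: "\<i> *\<^sub>C \<i> *\<^sub>C x = - x" for x :: 'c
    by (metis scaleC_scaleC i_squared complex_vector.scale_minus_left scaleC_one)
  have "b * b = - ((x - x\<^sup>\<star>) * (x - x\<^sup>\<star>))"
    by (simp only: b_def mult_scaleC_left mult_scaleC_right ii)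
  then have "a * a + b * b = 2 *\<^sub>R (x\<^sup>\<star> * x + x * x\<^sup>\<star>)"
    by (simp add: a_def algebra_simps scaleR_2)
  moreover have "pos (a * a + b * b)"
    using sa by (intro pos_add pos_square)
  ultimately have "pos (2 *\<^sub>R (x\<^sup>\<star> * x + x * x\<^sup>\<star>))"
    by metis
  from pos_scaleR[OF this, of "1/2"] show ?thesis
    by simp
qed

text \<open>Fukamiya's theorem. Let \<open>s\<close> be the square root of the negative part of \<open>h = y\<^sup>* y\<close>, so that \<open>h s = - s\<^sup>3\<close>. Then
  \<open>x = y s\<close> has \<open>x\<^sup>* x = - s\<^sup>4\<close>, and \<open>w = x s\<^sup>2\<close> has \<open>w\<^sup>* w = - s\<^sup>8\<close> and \<open>w w\<^sup>* = - (x x\<^sup>*)\<^sup>2\<close>. As \<open>w\<^sup>* w + w w\<^sup>*\<close> is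
  positive, \<open>s\<close> vanishes.\<close>

theorem pos_star_mult_self: "pos (y\<^sup>\<star> * y)" for y :: "'c::unital_cstar_algebra"
proof -
  define h N where "h = y\<^sup>\<star> * y" and "N = norm h"
  \<comment> \<open>The calculus is available for positive elements only, hence the shift by \<open>N\<close>.\<close>
  define P where "P = h + N *\<^sub>R 1"
  have h: "h\<^sup>\<star> = h"
    by (simp add: h_def star_simps)
  have P: "pos P"
    using pos_of_norm_le[of "- h" N] h by (simp add: P_def N_def star_simps add.commute)
  define \<sigma> where "\<sigma> t = sqrt (max 0 (N - t))" for t
  define s where "s = fcalc P \<sigma>"
  have cont: "continuous_on {0..norm P} \<sigma>" "continuous_on {0..norm P} (\<lambda>t. \<sigma> t * \<sigma> t)"
    "continuous_on {0..norm P} (\<lambda>t. t - N)" "continuous_on {0..norm P} (\<lambda>t. N - t)"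
    unfolding \<sigma>_def by (intro continuous_intros)+
  have "(\<lambda>t. t - N) = poly [:- N, 1:]" "(\<lambda>t. N - t) = poly [:N, - 1:]"
    by auto
  then have lin: "fcalc P (\<lambda>t. t - N) = h" "fcalc P (\<lambda>t. N - t) = - h"
    by (simp_all only: fcalc_poly[OF P]) (simp_all add: P_def)
  have s: "s\<^sup>\<star> = s"
    unfolding s_def by (intro pos_selfadjoint pos_fcalc[OF P cont(1)]) (simp add: \<sigma>_def)
  have "- h * s = fcalc P (\<lambda>t. (N - t) * \<sigma> t)"
    using fcalc_mult[OF P cont(4,1)] by (simp add: lin s_def)
  also have "\<dots> = fcalc P (\<lambda>t. \<sigma> t * \<sigma> t * \<sigma> t)"
    by (rule fcalc_cong) (auto simp: \<sigma>_def max_def)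
  also have "\<dots> = s * s * s"
    using fcalc_mult[OF P cont(2,1)] fcalc_mult[OF P cont(1,1)] by (simp add: s_def)
  finally have hs: "h * s = - (s * s * s)"
    using minus_equation_iff[of "h * s" "s * s * s"] by simp
  define x w where "x = y * s" and "w = x * (s * s)"
  have xx: "x\<^sup>\<star> * x = - (s * s * (s * s))"
  proof -
    have "x\<^sup>\<star> * x = s * (h * s)"
      by (simp add: x_def h_def star_simps s mult.assoc)
    then show ?thesis
      by (simp add: hs mult.assoc)
  qed
  have "w\<^sup>\<star> * w = s * s * (x\<^sup>\<star> * x) * (s * s)"
    by (simp add: w_def star_simps s mult.assoc)
  then have ww: "w\<^sup>\<star> * w = - (s ^ 8)"
    by (simp add: xx numeral_eq_Suc mult.assoc)
  have "w * w\<^sup>\<star> = x * (s * s * (s * s)) * x\<^sup>\<star>"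
    by (simp add: w_def star_simps s mult.assoc)
  also have "\<dots> = - (x * (x\<^sup>\<star> * x) * x\<^sup>\<star>)"
    by (simp add: xx)
  finally have ww': "w * w\<^sup>\<star> = - ((x * x\<^sup>\<star>) * (x * x\<^sup>\<star>))"
    by (simp add: mult.assoc)
  have "pos (w\<^sup>\<star> * w + w * w\<^sup>\<star> + (x * x\<^sup>\<star>) * (x * x\<^sup>\<star>))"
    by (intro pos_add cartesian_squares pos_square) (simp add: star_simps)
  then have "pos (0 - s ^ 8)"
    by (simp add: ww ww')
  moreover have "pos (s ^ 8)"
    using pos_square[of "s ^ 4"] by (simp add: star_power s flip: power_add)
  ultimately have "norm (s ^ (2 ^ 3)) \<le> 0"
    using pos_norm_mono[of "s ^ 8" 0] by simp
  then have "s = 0"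
    unfolding norm_selfadjoint_power[OF s] by simp
  have "h + s * s = fcalc P (\<lambda>t. (t - N) + \<sigma> t * \<sigma> t)"
    using fcalc_add[OF P cont(3,2)] fcalc_mult[OF P cont(1,1)] by (simp add: lin s_def)
  also have "pos \<dots>"
    by (intro pos_fcalc[OF P] continuous_intros cont) (simp add: \<sigma>_def max_def)
  finally show ?thesis
    using \<open>s = 0\<close> by (simp add: h_def)
qed

lemma pos_conj:
  fixes h y :: "'c::unital_cstar_algebra"
  assumes "pos h"
  shows "pos (y\<^sup>\<star> * h * y)"
proof (rule pos_eps[of _ "y\<^sup>\<star> * y"])
  fix e :: real assume "e > 0"
  then obtain c where c: "c\<^sup>\<star> = c" "c * c = h + e *\<^sub>R 1"
    using pos_sqrt_eps[OF assms] by metis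
  have "y\<^sup>\<star> * h * y + e *\<^sub>R (y\<^sup>\<star> * y) = y\<^sup>\<star> * (h + e *\<^sub>R 1) * y"
    by (simp add: algebra_simps)
  also have "\<dots> = (c * y)\<^sup>\<star> * (c * y)"
    by (simp add: c star_simps mult.assoc flip: c(2))
  finally show "pos (y\<^sup>\<star> * h * y + e *\<^sub>R (y\<^sup>\<star> * y))"
    by (simp add: pos_star_mult_self)
qed

subsection \<open>Fractional powers\<close>

text \<open>\<open>rp R s = R\<^bsup>s/2\<^esup>\<close>, so that \<open>rp R s = \<langle>D\<rangle>\<^bsup>-s\<^esup>\<close> for \<open>R = (1 + D\<^sup>2)\<^bsup>-1\<^esup>\<close>.\<close>

definition rp :: "'c \<Rightarrow> real \<Rightarrow> 'c::unital_cstar_algebra" where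
  "rp R s = fcalc R (\<lambda>t. if s = 0 then 1 else t powr (s / 2))"

lemma continuous_on_rp:
  assumes "s \<ge> 0"
  shows "continuous_on {0..N} (\<lambda>t::real. if s = 0 then 1 else t powr (s / 2))"
  using assms by (cases "s = 0") (simp_all add: continuous_on_powr')

lemma rp_0 [simp]: "pos R \<Longrightarrow> rp R 0 = 1"
  using fcalc_poly[of R 1] by (simp add: rp_def poly_1[abs_def])

lemma rp_2: "pos R \<Longrightarrow> rp R 2 = R"
proof -
  assume "pos R"
  then have "fcalc R (poly [:0, 1:]) = R"
    by (subst fcalc_poly) auto
  moreover have "rp R 2 = fcalc R (poly [:0, 1:])"
    unfolding rp_def by (rule fcalc_cong) auto
  ultimately show ?thesis
    by simp
qed

lemma rp_add: "pos R \<Longrightarrow> s \<ge> 0 \<Longrightarrow> t \<ge> 0 \<Longrightarrow> rp R s * rp R t = rp R (s + t)"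
  unfolding rp_def
  by (subst fcalc_mult[symmetric]) (auto simp: continuous_on_rp powr_add add_divide_distrib intro!: fcalc_cong)

lemma pos_rp: "pos R \<Longrightarrow> s \<ge> 0 \<Longrightarrow> pos (rp R s)"
  unfolding rp_def by (intro pos_fcalc continuous_on_rp) auto

lemma rp_star: "pos R \<Longrightarrow> s \<ge> 0 \<Longrightarrow> (rp R s)\<^sup>\<star> = rp R s"
  by (simp add: pos_rp pos_selfadjoint)

lemma rp_commute: "pos R \<Longrightarrow> s \<ge> 0 \<Longrightarrow> y * R = R * y \<Longrightarrow> y * rp R s = rp R s * y"
  unfolding rp_def by (intro fcalc_commute continuous_on_rp)

lemma norm_rp_1_le: "pos R \<Longrightarrow> norm R \<le> 1 \<Longrightarrow> norm (rp R 1) \<le> 1"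
  using norm_selfadjoint_square[of "rp R 1"] rp_star[of R 1] rp_add[of R 1 1] rp_2[of R]
  by (simp add: power_le_one_iff abs_square_le_1)

text \<open>\<open>t\<^sup>g \<le> N\<^bsup>2-2g\<^esup> t + N\<^bsup>-2g\<^esup>\<close> for \<open>0 \<le> g \<le> 1\<close>, applied to \<open>R\<close>.\<close>

lemma norm_rp_interpolate:
  fixes R T :: "'c::unital_cstar_algebra"
  assumes R: "pos R" and g: "0 \<le> g" "g \<le> 1" and N: "N > 0"
    and T: "norm T \<le> c" "norm (rp R 1 * T) \<le> c / N"
  shows "norm (rp R g * T) \<le> 2 * c * N powr (- g)"
proof -
  define A B where "A = N powr (2 - 2 * g)" and "B = N powr (- 2 * g)"
  have AB: "A \<ge> 0" "B \<ge> 0"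
    by (auto simp: A_def B_def)
  have c: "c \<ge> 0"
    using T(1) norm_ge_zero order_trans by blast
  define f where "f = (\<lambda>t::real. if 2 * g = 0 then 1 else t powr (2 * g / 2))"
  have f: "continuous_on {0..norm R} f"
    unfolding f_def by (rule continuous_on_rp) (use g in auto)
  have le: "f t \<le> A * t + B" if t: "t \<ge> 0" for t
  proof -
    have x: "x powr g \<le> x + 1" if "x \<ge> 0" for x :: real
    proof (cases "x \<le> 1")
      case True
      then show ?thesis
        using that g powr_le1[of g x] by linarith
    next
      case False
      then have "x powr g \<le> x powr 1"
        using g by (intro powr_mono) auto
      then show ?thesis
        using False by simp
    qed
    have "f t * N powr (2 * g) \<le> N powr 2 * t + 1"
    proof (cases "g = 0")
      case True
      then show ?thesis
        using N t by (simp add: f_def)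
    next
      case False
      have "f t * N powr (2 * g) = (N powr 2 * t) powr g"
        using False t N by (simp add: f_def powr_mult powr_powr mult.commute del: powr_numeral)
      also have "\<dots> \<le> N powr 2 * t + 1"
        using t by (intro x) simp
      finally show ?thesis .
    qed
    then have "f t * N powr (2 * g) * N powr (- 2 * g) \<le> (N powr 2 * t + 1) * N powr (- 2 * g)"
      by (intro mult_right_mono) auto
    then show ?thesis
      using N by (simp add: A_def B_def algebra_simps powr_diff powr_minus flip: powr_add)
        (simp add: field_simps flip: powr_add)
  qed
  have cont: "continuous_on {0..norm R} (\<lambda>t. (A * t + B) - f t)"
    by (intro continuous_intros f)
  have "pos (fcalc R (\<lambda>t. (A * t + B) - f t))"
    using le by (intro pos_fcalc[OF R cont]) simp
  also have "fcalc R (\<lambda>t. (A * t + B) - f t) = A *\<^sub>R R + B *\<^sub>R 1 - rp R (2 * g)"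
  proof -
    have "A *\<^sub>R R + B *\<^sub>R 1 = fcalc R (poly [:B, A:])"
      using R by (subst fcalc_poly) (auto simp: add.commute)
    also have "\<dots> = fcalc R (\<lambda>t. ((A * t + B) - f t) + f t)"
      by (rule fcalc_cong) (simp add: mult.commute)
    also have "\<dots> = fcalc R (\<lambda>t. (A * t + B) - f t) + rp R (2 * g)"
      unfolding rp_def f_def[symmetric] by (rule fcalc_add[OF R cont f])
    finally show ?thesis
      by simp
  qed
  finally have "pos (T\<^sup>\<star> * (A *\<^sub>R R + B *\<^sub>R 1 - rp R (2 * g)) * T)"
    by (rule pos_conj)
  then have p: "pos (A *\<^sub>R (T\<^sup>\<star> * R * T) + B *\<^sub>R (T\<^sup>\<star> * T) - T\<^sup>\<star> * rp R (2 * g) * T)"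
    by (simp add: algebra_simps)
  have sq: "(rp R s * T)\<^sup>\<star> * (rp R s * T) = T\<^sup>\<star> * rp R (2 * s) * T" if "s \<ge> 0" for s
  proof -
    have "(rp R s * T)\<^sup>\<star> * (rp R s * T) = T\<^sup>\<star> * (rp R s * rp R s) * T"
      using R that by (simp add: star_mult rp_star mult.assoc)
    then show ?thesis
      using R that by (simp add: rp_add)
  qed
  have "(norm (rp R g * T))\<^sup>2 = norm (T\<^sup>\<star> * rp R (2 * g) * T)"
    using sq[OF g(1)] cstar_identity[of "rp R g * T"] by simp
  also have "\<dots> \<le> norm (A *\<^sub>R (T\<^sup>\<star> * R * T) + B *\<^sub>R (T\<^sup>\<star> * T))"
    by (rule pos_norm_mono[OF _ p]) (use pos_conj[OF pos_rp[OF R]] g in simp)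
  also have "\<dots> \<le> A * norm (T\<^sup>\<star> * R * T) + B * norm (T\<^sup>\<star> * T)"
    using AB by (intro order_trans[OF norm_triangle_ineq]) simp
  also have "T\<^sup>\<star> * R * T = (rp R 1 * T)\<^sup>\<star> * (rp R 1 * T)"
    using sq[of 1] rp_2[OF R] by simp
  also have "A * norm ((rp R 1 * T)\<^sup>\<star> * (rp R 1 * T)) + B * norm (T\<^sup>\<star> * T) \<le> A * (c / N)\<^sup>2 + B * c\<^sup>2"
    unfolding cstar_identity using T AB by (intro add_mono mult_left_mono power_mono) auto
  also have "A * (c / N)\<^sup>2 = B * c\<^sup>2"
  proof -
    have "A = B * N\<^sup>2"
      using N powr_add[of N "- 2 * g" 2] by (simp add: A_def B_def algebra_simps)
    then show ?thesis
      using N by (simp add: power_divide)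
  qed
  also have "B * c\<^sup>2 + B * c\<^sup>2 \<le> (2 * c * N powr (- g))\<^sup>2"
  proof -
    have "B = (N powr (- g))\<^sup>2"
      by (simp add: B_def power2_eq_square flip: powr_add)
    then show ?thesis
      by (simp add: power_mult_distrib mult.commute)
  qed
  finally show ?thesis
    using c by (auto intro: power2_le_imp_le)
qed

section \<open>Decay rates\<close>

text \<open>The shift of the index avoids \<open>0 powr (- s) = 0\<close> at \<open>n = 0\<close>.\<close>

definition decays :: "real \<Rightarrow> (nat \<Rightarrow> 'c::real_normed_vector) \<Rightarrow> bool" where
  "decays s f \<longleftrightarrow> (\<exists>C\<ge>0. \<forall>n. norm (f n) \<le> C * real (Suc n) powr (- s))"

lemma decaysI: "C \<ge> 0 \<Longrightarrow> (\<And>n. norm (f n) \<le> C * real (Suc n) powr (- s)) \<Longrightarrow> decays s f"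
  by (auto simp: decays_def)

lemma decaysE:
  assumes "decays s f"
  obtains C where "C \<ge> 0" "\<And>n. norm (f n) \<le> C * real (Suc n) powr (- s)"
  using assms by (auto simp: decays_def)

lemma decays_const: "decays 0 (\<lambda>_. c)"
  by (rule decaysI[of "norm c"]) auto

lemma decays_mono: "decays t f \<Longrightarrow> s \<le> t \<Longrightarrow> decays s f"
proof (elim decaysE)
  fix C assume C: "C \<ge> 0" "\<And>n. norm (f n) \<le> C * real (Suc n) powr (- t)" and "s \<le> t"
  have "norm (f n) \<le> C * real (Suc n) powr (- s)" for n
    using \<open>s \<le> t\<close> by (intro order_trans[OF C(2)] mult_left_mono powr_mono C) auto
  with C(1) show "decays s f"
    by (rule decaysI)
qed

lemma decays_mult:
  fixes f g :: "nat \<Rightarrow> 'c::real_normed_algebra"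
  assumes "decays s f" "decays t g"
  shows "decays (s + t) (\<lambda>n. f n * g n)"
proof -
  obtain C where C: "C \<ge> 0" "\<And>n. norm (f n) \<le> C * real (Suc n) powr (- s)"
    using assms(1) by (rule decaysE) metis
  obtain D where D: "D \<ge> 0" "\<And>n. norm (g n) \<le> D * real (Suc n) powr (- t)"
    using assms(2) by (rule decaysE) metis
  have "norm (f n * g n) \<le> (C * D) * real (Suc n) powr (- (s + t))" for n
  proof -
    have "norm (f n * g n) \<le> (C * real (Suc n) powr (- s)) * (D * real (Suc n) powr (- t))"
      by (intro order_trans[OF norm_mult_ineq] mult_mono C D) (use C in auto)
    also have "real (Suc n) powr (- s) * real (Suc n) powr (- t) = real (Suc n) powr (- (s + t))"
      by (simp flip: powr_add)
    then have "(C * real (Suc n) powr (- s)) * (D * real (Suc n) powr (- t)) = (C * D) * real (Suc n) powr (- (s + t))"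
      by (metis mult.assoc mult.left_commute)
    finally show ?thesis .
  qed
  with C D show ?thesis
    by (intro decaysI[of "C * D"]) auto
qed

lemma decays_cmult: "decays s f \<Longrightarrow> decays s (\<lambda>n. c * f n)" for f :: "nat \<Rightarrow> 'c::real_normed_algebra"
  using decays_mult[OF decays_const, of s f c] by simp

lemma decays_multc: "decays s f \<Longrightarrow> decays s (\<lambda>n. f n * c)" for f :: "nat \<Rightarrow> 'c::real_normed_algebra"
  using decays_mult[OF _ decays_const, of s f c] by simp

lemma decays_scaleR: "decays s f \<Longrightarrow> decays s (\<lambda>n. c *\<^sub>R f n)"
proof (elim decaysE)
  fix C assume C: "C \<ge> 0" "\<And>n. norm (f n) \<le> C * real (Suc n) powr (- s)"
  have "norm (c *\<^sub>R f n) \<le> (\<bar>c\<bar> * C) * real (Suc n) powr (- s)" for n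
    using mult_left_mono[OF C(2)[of n], of "\<bar>c\<bar>"] by (simp add: mult.assoc)
  with C show "decays s (\<lambda>n. c *\<^sub>R f n)"
    by (intro decaysI[of "\<bar>c\<bar> * C"]) auto
qed

lemma decays_add: "decays s f \<Longrightarrow> decays s g \<Longrightarrow> decays s (\<lambda>n. f n + g n)"
proof (elim decaysE)
  fix C D assume C: "C \<ge> 0" "\<And>n. norm (f n) \<le> C * real (Suc n) powr (- s)"
    and D: "D \<ge> 0" "\<And>n. norm (g n) \<le> D * real (Suc n) powr (- s)"
  have "norm (f n + g n) \<le> (C + D) * real (Suc n) powr (- s)" for n
    using norm_triangle_mono[OF C(2)[of n] D(2)[of n]] by (simp add: algebra_simps)
  with C D show "decays s (\<lambda>n. f n + g n)"
    by (intro decaysI[of "C + D"]) auto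
qed

lemma decays_diff: "decays s f \<Longrightarrow> decays s g \<Longrightarrow> decays s (\<lambda>n. f n - g n)"
  using decays_add[of s f "\<lambda>n. (-1) *\<^sub>R g n"] decays_scaleR[of s g "-1"] by simp

lemma decays_star: "decays s f \<longleftrightarrow> decays s (\<lambda>n. (f n)\<^sup>\<star>)" for f :: "nat \<Rightarrow> 'c::cstar_algebra"
  by (simp add: decays_def norm_star)

lemma decays_summable:
  fixes f :: "nat \<Rightarrow> 'c::banach"
  assumes "decays s f" "s > 1"
  shows "summable f"
proof -
  obtain C where C: "\<And>n. norm (f n) \<le> C * real (Suc n) powr (- s)"
    using assms(1) by (rule decaysE) metis
  have "summable (\<lambda>n. real n powr (- s))"
    using assms(2) by (simp add: summable_real_powr_iff)
  then have "summable (\<lambda>n. C * real (Suc n) powr (- s))"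
    by (intro summable_mult) (subst summable_Suc_iff)
  then show ?thesis
    by (rule summable_comparison_test'[where N = 0]) (use C in auto)
qed

lemma decays_tendsto_0:
  assumes "decays s f" "s > 0"
  shows "f \<longlonglongrightarrow> 0"
proof -
  obtain C where C: "\<And>n. norm (f n) \<le> C * real (Suc n) powr (- s)"
    using assms(1) by (rule decaysE) metis
  have "filterlim (\<lambda>n. real (Suc n)) at_top sequentially"
    by (rule filterlim_compose[OF filterlim_real_sequentially filterlim_Suc])
  then have "(\<lambda>n. C * real (Suc n) powr (- s)) \<longlonglongrightarrow> C * 0"
    using assms(2) by (intro tendsto_mult tendsto_const tendsto_neg_powr) auto
  then have "(\<lambda>n. C * real (Suc n) powr (- s)) \<longlonglongrightarrow> 0"
    by simp
  then show ?thesis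
    by (rule Lim_null_comparison[OF always_eventually, rotated]) (use C in auto)
qed

text \<open>Multiplication by \<open>r\<^sup>g\<close> gains a rate \<open>g\<close> if multiplication by \<open>r\<close> gains a rate \<open>1\<close>.\<close>

lemma decays_interpolate:
  fixes R :: "'c::unital_cstar_algebra"
  assumes R: "pos R" and g: "0 \<le> g" "g \<le> 1"
    and T: "decays s T" "decays (s + 1) (\<lambda>n. rp R 1 * T n)"
  shows "decays (s + g) (\<lambda>n. rp R g * T n)"
proof -
  obtain C where C: "C \<ge> 0" "\<And>n. norm (T n) \<le> C * real (Suc n) powr (- s)"
    using T(1) by (rule decaysE) metis
  obtain D where D: "D \<ge> 0" "\<And>n. norm (rp R 1 * T n) \<le> D * real (Suc n) powr (- (s + 1))"
    using T(2) by (rule decaysE) metis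
  have "norm (rp R g * T n) \<le> (2 * max C D) * real (Suc n) powr (- (s + g))" for n
  proof -
    have 1: "norm (T n) \<le> max C D * real (Suc n) powr (- s)"
      by (intro order_trans[OF C(2)] mult_right_mono) auto
    have "norm (rp R 1 * T n) \<le> max C D * real (Suc n) powr (- (s + 1))"
      by (intro order_trans[OF D(2)] mult_right_mono) auto
    also have "\<dots> = max C D * real (Suc n) powr (- s) / real (Suc n)"
      by (simp add: powr_diff powr_minus field_simps)
    finally have 2: "norm (rp R 1 * T n) \<le> max C D * real (Suc n) powr (- s) / real (Suc n)" .
    have "norm (rp R g * T n) \<le> 2 * (max C D * real (Suc n) powr (- s)) * real (Suc n) powr (- g)"
      by (rule norm_rp_interpolate[OF R g _ 1 2]) simp
    also have "\<dots> = 2 * max C D * (real (Suc n) powr (- s) * real (Suc n) powr (- g))"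
      by (simp only: mult.assoc)
    also have "real (Suc n) powr (- s) * real (Suc n) powr (- g) = real (Suc n) powr (- (s + g))"
      by (simp flip: powr_add)
    finally show ?thesis .
  qed
  with C show ?thesis
    by (intro decaysI[of "2 * max C D"]) auto
qed

lemma decays_interpolate_right:
  fixes R :: "'c::unital_cstar_algebra"
  assumes R: "pos R" and g: "0 \<le> g" "g \<le> 1"
    and T: "decays s T" "decays (s + 1) (\<lambda>n. T n * rp R 1)"
  shows "decays (s + g) (\<lambda>n. T n * rp R g)"
proof -
  have "decays (s + g) (\<lambda>n. rp R g * (T n)\<^sup>\<star>)"
    using T unfolding decays_star[of _ T] decays_star[of _ "\<lambda>n. T n * _"]
    by (intro decays_interpolate[OF R g]) (simp_all add: star_mult rp_star R)
  then show ?thesis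
    using R g by (subst decays_star) (simp add: star_mult rp_star)
qed

text \<open>For \<open>0 \<le> t \<le> 1\<close>, the number \<open>(n + j choose j) t\<^sup>j (1 - t)\<^sup>n\<close> is a term of the binomial expansion of \<open>1 = (t + (1 - t))\<^bsup>n+j\<^esup>\<close>.\<close>

lemma norm_power_one_minus_le:
  fixes h :: "'c::unital_cstar_algebra"
  assumes h: "pos h" "norm h \<le> 1"
  shows "norm ((1 - h) ^ n) \<le> 1"
    and "norm (h * (1 - h) ^ n) \<le> 1 / real (Suc n)"
    and "norm (h * h * (1 - h) ^ n) \<le> 2 / (real (Suc n))\<^sup>2"
proof -
  have bin: "real (n + j choose j) * t ^ j * (1 - t) ^ n \<le> 1" if "0 \<le> t" "t \<le> 1" for t :: real and j
  proof -
    have "real (n + j choose j) * t ^ j * (1 - t) ^ (n + j - j) \<le> (\<Sum>k\<le>n + j. real (n + j choose k) * t ^ k * (1 - t) ^ (n + j - k))"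
      using that by (intro member_le_sum) auto
    also have "\<dots> = (t + (1 - t)) ^ (n + j)"
      by (subst binomial_ring) simp
    finally show ?thesis
      by simp
  qed
  have P: "norm (h ^ j * (1 - h) ^ n) \<le> 1 / real (n + j choose j)" for j
  proof -
    have "norm (peval ([:0, 1:] ^ j * [:1, -1:] ^ n) h) \<le> 1 / real (n + j choose j)"
    proof (rule norm_peval_le[OF h(1)])
      fix t assume "0 \<le> t" "t \<le> norm h"
      with h(2) have t: "0 \<le> t" "t \<le> 1" by auto
      then have "\<bar>poly ([:0, 1:] ^ j * [:1, -1:] ^ n) t\<bar> = t ^ j * (1 - t) ^ n"
        by (simp add: abs_mult)
      also have "\<dots> \<le> 1 / real (n + j choose j)"
        using bin[OF t, of j] zero_less_binomial[of j "n + j"] by (simp add: field_simps)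
      finally show "\<bar>poly ([:0, 1:] ^ j * [:1, -1:] ^ n) t\<bar> \<le> 1 / real (n + j choose j)" .
    qed
    then show ?thesis
      by (simp only: peval_mult peval_power) simp
  qed
  show "norm ((1 - h) ^ n) \<le> 1"
    using P[of 0] by simp
  show "norm (h * (1 - h) ^ n) \<le> 1 / real (Suc n)"
    using P[of 1] by simp
  have "2 * (n + 2 choose 2) = (n + 2) * (n + 1)"
    by (simp add: choose_two)
  then have "2 * real (n + 2 choose 2) = real (n + 2) * real (n + 1)"
    by (metis of_nat_mult of_nat_numeral)
  then have "(real (Suc n))\<^sup>2 \<le> 2 * real (n + 2 choose 2)"
    by (simp add: power2_eq_square)
  then have "1 / real (n + 2 choose 2) \<le> 2 / (real (Suc n))\<^sup>2"
    using zero_less_binomial[of 2 "n + 2"] by (simp add: divide_simps)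
  then show "norm (h * h * (1 - h) ^ n) \<le> 2 / (real (Suc n))\<^sup>2"
    using P[of 2] by (simp add: power2_eq_square)
qed

lemma decays_power_one_minus:
  fixes h :: "'c::unital_cstar_algebra"
  assumes "pos h" "norm h \<le> 1"
  shows "decays 0 (\<lambda>n. (1 - h) ^ n)"
    and "decays 1 (\<lambda>n. h * (1 - h) ^ n)"
    and "decays 2 (\<lambda>n. h * h * (1 - h) ^ n)"
proof -
  note * = norm_power_one_minus_le[OF assms]
  show "decays 0 (\<lambda>n. (1 - h) ^ n)"
    by (rule decaysI[of 1]) (use *(1) in auto)
  show "decays 1 (\<lambda>n. h * (1 - h) ^ n)"
    by (rule decaysI[of 1]) (use *(2) in \<open>auto simp: powr_minus divide_inverse\<close>)
  have "real (Suc n) powr (- 2) = 1 / (real (Suc n))\<^sup>2" for n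
    by (simp add: powr_minus divide_inverse)
  then show "decays 2 (\<lambda>n. h * h * (1 - h) ^ n)"
    by (intro decaysI[of 2]) (use *(3) in \<open>simp_all\<close>)
qed

section \<open>Bounded transforms, abstractly\<close>

text \<open>\<open>R\<close> and \<open>F\<close> stand for \<open>(1 + D\<^sup>2)\<^bsup>-1\<^esup>\<close> and \<open>D (1 + D\<^sup>2)\<^bsup>-1/2\<^esup>\<close>; the operator \<open>D\<close> itself does not appear.\<close>

locale bracket =
  fixes R F :: "'c::unital_cstar_algebra"
  assumes R_pos: "pos R" and R_norm: "norm R \<le> 1"
    and F_star: "F\<^sup>\<star> = F" and F_R: "F * R = R * F" and F_F: "F * F = 1 - R"
    and R_inj: "\<And>y. R * y = 0 \<Longrightarrow> y = 0"
begin

lemma rp_mult: "s \<ge> 0 \<Longrightarrow> t \<ge> 0 \<Longrightarrow> rp R s * rp R t = rp R (s + t)"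
  by (rule rp_add[OF R_pos])

lemma rp_mult_left: "s \<ge> 0 \<Longrightarrow> t \<ge> 0 \<Longrightarrow> rp R s * (rp R t * x) = rp R (s + t) * x"
  by (simp add: rp_mult flip: mult.assoc)

lemma F_rp: "s \<ge> 0 \<Longrightarrow> F * rp R s = rp R s * F"
  by (intro rp_commute[OF R_pos] F_R)

lemma F_rp_left: "s \<ge> 0 \<Longrightarrow> F * (rp R s * x) = rp R s * (F * x)"
  by (simp add: F_rp flip: mult.assoc)

lemma F_F_left: "F * (F * x) = x - rp R 2 * x"
  by (simp add: F_F rp_2[OF R_pos] left_diff_distrib flip: mult.assoc)

lemma F_F_rp: "F * F = 1 - rp R 2"
  by (simp add: F_F rp_2[OF R_pos])

lemmas normalize = rp_mult rp_mult_left F_rp F_rp_left F_F_left F_F_rp mult.assoc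
  left_diff_distrib right_diff_distrib distrib_left distrib_right

lemma rp_cancel_left:
  assumes s: "0 \<le> s" "s \<le> 2" and eq: "rp R s * x = rp R s * y"
  shows "x = y"
proof -
  have "rp R (2 - s) * (rp R s * (x - y)) = 0"
    using eq by (simp add: right_diff_distrib)
  then have "R * (x - y) = 0"
    using s by (simp add: rp_mult_left rp_2[OF R_pos])
  then show ?thesis
    using R_inj by fastforce
qed

lemma rp_cancel_right:
  assumes s: "0 \<le> s" "s \<le> 2" and eq: "x * rp R s = y * rp R s"
  shows "x = y"
proof -
  have "rp R s * x\<^sup>\<star> = rp R s * y\<^sup>\<star>"
    using arg_cong[OF eq, of star] s by (simp add: star_mult rp_star[OF R_pos])
  then have "x\<^sup>\<star> = y\<^sup>\<star>"
    using rp_cancel_left s by blast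
  then show ?thesis
    by (metis star_star)
qed

lemma rp_1: "pos (rp R 1)" "norm (rp R 1) \<le> 1"
  using pos_rp[OF R_pos] norm_rp_1_le[OF R_pos R_norm] by auto

lemma power_commute_rp: "s \<ge> 0 \<Longrightarrow> (1 - k *\<^sub>R rp R 1) ^ n * rp R s = rp R s * (1 - k *\<^sub>R rp R 1) ^ n"
  by (rule power_commuting_commutes)
    (simp add: left_diff_distrib right_diff_distrib rp_mult add.commute)

lemma decays_rp_power:
  assumes k: "0 < k" "k \<le> 1" and s: "0 \<le> s" "s \<le> 2"
  shows "decays s (\<lambda>n. rp R s * (1 - k *\<^sub>R rp R 1) ^ n)"
proof -
  define a where "a = 1 - k *\<^sub>R rp R 1"
  have h: "pos (k *\<^sub>R rp R 1)" "norm (k *\<^sub>R rp R 1) \<le> 1"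
    using rp_1 k by (auto intro: pos_scaleR mult_le_one)
  note * = decays_power_one_minus[OF h, folded a_def]
  have d0: "decays 0 (\<lambda>n. a ^ n)"
    by (rule *)
  have d1: "decays 1 (\<lambda>n. rp R 1 * a ^ n)"
    using decays_scaleR[OF *(2), of "1 / k"] k by simp
  have d2: "decays 2 (\<lambda>n. rp R 1 * (rp R 1 * a ^ n))"
    using decays_scaleR[OF *(3), of "1 / k\<^sup>2"] k by (simp add: power2_eq_square mult.assoc)
  show ?thesis
  proof (cases "s \<le> 1")
    case True
    then show ?thesis
      using decays_interpolate[OF R_pos, of s 0 "\<lambda>n. a ^ n"] d0 d1 s by (simp add: a_def)
  next
    case False
    then have s1: "0 \<le> s - 1" "s - 1 \<le> 1"
      using s by auto
    have "decays (1 + (s - 1)) (\<lambda>n. rp R (s - 1) * (rp R 1 * a ^ n))"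
      by (rule decays_interpolate[OF R_pos s1 d1]) (simp add: d2)
    moreover have "rp R (s - 1) * (rp R 1 * x) = rp R s * x" for x
      using False by (subst rp_mult_left) auto
    ultimately show ?thesis
      by (simp only: a_def) simp
  qed
qed

lemma decays_power_rp:
  assumes "0 < k" "k \<le> 1" "0 \<le> s" "s \<le> 2"
  shows "decays s (\<lambda>n. (1 - k *\<^sub>R rp R 1) ^ n * rp R s)"
  using decays_rp_power[OF assms] assms by (simp add: power_commute_rp)

lemmas decays_rp_power_1 = decays_rp_power[where k = 1, simplified]
lemmas decays_power_rp_1 = decays_power_rp[where k = 1, simplified]

text \<open>The Sylvester-type equation \<open>x - a x b = N\<close> with \<open>a = 1 - k r\<close> is solved by \<open>\<Sum> a\<^sup>n N b\<^sup>n\<close>: the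
  remainder \<open>a\<^sup>n x b\<^sup>n\<close> vanishes after multiplication by the injective element \<open>r\<close>.\<close>

lemma sylvester_sums:
  assumes k: "0 < k" "k \<le> 1" and b: "decays 0 (\<lambda>n. b ^ n)"
    and M: "summable (\<lambda>n. (1 - k *\<^sub>R rp R 1) ^ n * (x - (1 - k *\<^sub>R rp R 1) * x * b) * b ^ n)"
  shows "(\<lambda>n. (1 - k *\<^sub>R rp R 1) ^ n * (x - (1 - k *\<^sub>R rp R 1) * x * b) * b ^ n) sums x"
proof -
  define a where "a = 1 - k *\<^sub>R rp R 1"
  define S where "S = suminf (\<lambda>n. a ^ n * (x - a * x * b) * b ^ n)"
  have sums: "(\<lambda>n. a ^ n * (x - a * x * b) * b ^ n) sums S"
    using M by (simp add: S_def a_def summable_sums)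
  have partial: "(\<Sum>i<n. a ^ i * (x - a * x * b) * b ^ i) = x - a ^ n * x * b ^ n" for n
  proof (induction n)
    case (Suc n)
    have "a ^ Suc n * x * b ^ Suc n = a ^ n * (a * x * b) * b ^ n"
      by (metis mult.assoc power_Suc power_Suc2)
    then have "a ^ n * (x - a * x * b) * b ^ n = a ^ n * x * b ^ n - a ^ Suc n * x * b ^ Suc n"
      by (simp only: right_diff_distrib left_diff_distrib mult.assoc)
    then show ?case
      by (simp only: Suc sum.lessThan_Suc) simp
  qed simp
  have "decays (1 + 0) (\<lambda>n. (rp R 1 * a ^ n) * (x * b ^ n))"
    unfolding a_def by (intro decays_mult decays_rp_power decays_cmult b k) auto
  then have "(\<lambda>n. rp R 1 * (a ^ n * x * b ^ n)) \<longlonglongrightarrow> 0"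
    using decays_tendsto_0 by (fastforce simp: mult.assoc)
  moreover have "(\<lambda>n. rp R 1 * (x - (\<Sum>i<n. a ^ i * (x - a * x * b) * b ^ i))) \<longlonglongrightarrow> rp R 1 * (x - S)"
    by (intro tendsto_intros sums[unfolded sums_def])
  ultimately have "rp R 1 * (x - S) = rp R 1 * 0"
    unfolding partial using LIMSEQ_unique by fastforce
  then have "x - S = 0"
    by (rule rp_cancel_left[rotated 2]) auto
  with sums show ?thesis
    by (simp add: a_def)
qed

end

text \<open>For \<open>D\<^sub>2 p = q D\<^sub>1 + X\<close> on the domain of \<open>D\<^sub>1\<close>, where the operators \<open>X \<langle>D\<^sub>1\<rangle>\<^bsup>-\<alpha>\<^esup>\<close> and \<open>\<langle>D\<^sub>2\<rangle>\<^bsup>-\<alpha>\<^esup> X\<close> are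
  bounded with \<open>\<alpha> = 1 - 2 g\<close>: this is the equation multiplied by \<open>\<langle>D\<^sub>2\<rangle>\<^bsup>-1\<^esup>\<close> and \<open>\<langle>D\<^sub>1\<rangle>\<^bsup>-1\<^esup>\<close>.\<close>

definition intertwines ::
  "real \<Rightarrow> 'c::unital_cstar_algebra \<Rightarrow> 'c \<Rightarrow> 'c \<Rightarrow> 'c \<Rightarrow> 'c \<Rightarrow> 'c \<Rightarrow> bool" where
  "intertwines g R2 F2 R1 F1 p q \<longleftrightarrow>
    (\<exists>K. F2 * p * rp R1 1 - rp R2 1 * q * F1 = rp R2 1 * K * rp R1 (2 * g)) \<and>
    (\<exists>L. F2 * p * rp R1 1 - rp R2 1 * q * F1 = rp R2 (2 * g) * L * rp R1 1)"

locale bracket_pair = one: bracket R1 F1 + two: bracket R2 F2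
  for R1 F1 R2 F2 :: "'c::unital_cstar_algebra" +
  fixes g :: real
  assumes g: "0 < g" "2 * g \<le> 1"
begin

lemma intertwines_adjoint:
  assumes "intertwines g R2 F2 R1 F1 p q"
  shows "intertwines g R1 F1 R2 F2 (q\<^sup>\<star>) (p\<^sup>\<star>)"
proof -
  define N where "N = F2 * p * rp R1 1 - rp R2 1 * q * F1"
  obtain K L where K: "N = rp R2 1 * K * rp R1 (2 * g)" and L: "N = rp R2 (2 * g) * L * rp R1 1"
    using assms unfolding intertwines_def N_def by blast
  have "F1 * q\<^sup>\<star> * rp R2 1 - rp R1 1 * p\<^sup>\<star> * F2 = - N\<^sup>\<star>"
    using g by (simp add: N_def star_simps rp_star one.R_pos two.R_pos one.F_star two.F_star mult.assoc)
  moreover have "- N\<^sup>\<star> = rp R1 (2 * g) * (- K\<^sup>\<star>) * rp R2 1"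
    unfolding K using g by (simp add: star_simps rp_star one.R_pos two.R_pos mult.assoc)
  moreover have "- N\<^sup>\<star> = rp R1 1 * (- L\<^sup>\<star>) * rp R2 (2 * g)"
    unfolding L using g by (simp add: star_simps rp_star one.R_pos two.R_pos mult.assoc)
  ultimately show ?thesis
    unfolding intertwines_def by metis
qed

text \<open>\<open>p\<close> maps the domain of \<open>D\<^sub>1\<close> into the domain of \<open>D\<^sub>2\<close>.\<close>

lemma intertwines_domain:
  assumes K: "F2 * p * rp R1 1 - rp R2 1 * q * F1 = rp R2 1 * K * rp R1 (2 * g)"
  obtains Y where "p * rp R1 1 = rp R2 1 * Y" "F2 * Y = q * F1 + K * rp R1 (2 * g)"
proof
  define M where "M = q * F1 + K * rp R1 (2 * g)"
  define Y where "Y = rp R2 1 * (p * rp R1 1) + F2 * M"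
  have rM: "rp R2 1 * M = F2 * p * rp R1 1"
    using K by (simp add: M_def algebra_simps)
  have "p * rp R1 1 = rp R2 2 * (p * rp R1 1) + F2 * (F2 * (p * rp R1 1))"
    by (simp add: two.F_F_left)
  also have "F2 * (F2 * (p * rp R1 1)) = rp R2 1 * (F2 * M)"
    using rM by (simp add: mult.assoc two.F_rp_left[symmetric])
  finally show pY: "p * rp R1 1 = rp R2 1 * Y"
    by (simp add: Y_def distrib_left two.rp_mult_left)
  have "rp R2 1 * (F2 * Y) = F2 * (p * rp R1 1)"
    by (simp add: pY two.F_rp_left)
  also have "\<dots> = rp R2 1 * M"
    by (simp add: rM mult.assoc)
  finally show "F2 * Y = q * F1 + K * rp R1 (2 * g)"
    unfolding M_def by (rule two.rp_cancel_left[rotated 2]) auto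
qed

lemma intertwines_preserves:
  assumes "intertwines g R2 F2 R1 F1 p q"
  shows "\<exists>Y. p * rp R1 1 = rp R2 1 * Y" and "\<exists>Y. rp R2 1 * q = Y * rp R1 1"
proof -
  show "\<exists>Y. p * rp R1 1 = rp R2 1 * Y"
    using assms intertwines_domain unfolding intertwines_def by metis
  interpret swap: bracket_pair R2 F2 R1 F1 g
    by unfold_locales (rule g)+
  have "intertwines g R1 F1 R2 F2 (q\<^sup>\<star>) (p\<^sup>\<star>)"
    by (rule intertwines_adjoint[OF assms])
  then obtain Y where "q\<^sup>\<star> * rp R2 1 = rp R1 1 * Y"
    using swap.intertwines_domain unfolding intertwines_def by metis
  from arg_cong[OF this, of star] have "rp R2 1 * q = Y\<^sup>\<star> * rp R1 1"
    by (simp add: star_simps rp_star one.R_pos two.R_pos)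
  then show "\<exists>Y. rp R2 1 * q = Y * rp R1 1"
    by blast
qed

text \<open>A substitute for complex interpolation, with an arbitrarily small loss in the exponent:
  \<open>1 = \<Sum> a\<^sup>2\<^sup>n (1 - a\<^sup>2)\<close> with \<open>a = 1 - r\<^sub>2\<close> and \<open>1 - a\<^sup>2 = r\<^sub>2 (2 - r\<^sub>2)\<close>.\<close>

lemma interpolate_domain:
  assumes TY: "rp R1 1 * T = Y * rp R2 1" and ab: "0 \<le> \<alpha>" "\<alpha> < \<beta>" "\<beta> \<le> 1"
  shows "\<exists>S. rp R1 \<beta> * T = S * rp R2 \<alpha>"
proof -
  define a where "a = 1 - rp R2 1"
  have a_comm: "a ^ n * rp R2 s = rp R2 s * a ^ n" if "s \<ge> 0" for n s
    using two.power_commute_rp[of s 1 n] that by (simp add: a_def)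
  define M where "M n = (rp R1 \<beta> * (T * a ^ n)) * (a ^ n * rp R2 (1 - \<alpha>)) * (2 - rp R2 1)" for n
  have "decays (0 + \<beta>) (\<lambda>n. rp R1 \<beta> * (T * a ^ n))"
  proof (rule decays_interpolate[OF one.R_pos])
    show "decays 0 (\<lambda>n. T * a ^ n)"
      using two.decays_rp_power_1[where s = 0] two.R_pos by (intro decays_cmult) (simp add: a_def)
    have "decays 1 (\<lambda>n. Y * (rp R2 1 * a ^ n))"
      by (rule decays_cmult) (use two.decays_rp_power_1[where s = 1] in \<open>simp add: a_def\<close>)
    then show "decays (0 + 1) (\<lambda>n. rp R1 1 * (T * a ^ n))"
      by (simp add: TY flip: mult.assoc)
  qed (use ab in auto)
  moreover have "decays (1 - \<alpha>) (\<lambda>n. a ^ n * rp R2 (1 - \<alpha>))"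
    using ab two.decays_power_rp_1[where s = "1 - \<alpha>"] by (simp add: a_def)
  ultimately have "decays (0 + \<beta> + (1 - \<alpha>)) M"
    unfolding M_def by (intro decays_multc) (rule decays_mult)
  then have "summable M"
    using ab by (intro decays_summable) auto
  then obtain S where "M sums S"
    by (auto simp: summable_def)
  then have "(\<lambda>n. (\<Sum>i<n. M i) * rp R2 \<alpha> * rp R2 1) \<longlonglongrightarrow> S * rp R2 \<alpha> * rp R2 1"
    unfolding sums_def by (intro tendsto_intros)
  moreover have M_rp: "M n * rp R2 \<alpha> = rp R1 \<beta> * T * (a ^ (2 * n) - a ^ (2 * Suc n))" for n
  proof -
    have 1: "rp R2 (1 - \<alpha>) * (2 - rp R2 1) * rp R2 \<alpha> = 1 - a * a"
      using ab by (simp add: a_def algebra_simps two.rp_mult mult_2 mult_2_right)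
    have 2: "a ^ n * (a ^ n * (1 - a * a)) = a ^ (2 * n) - a ^ (2 * Suc n)"
    proof -
      have "a ^ n * (a ^ n * (a * a)) = a ^ n * a ^ n * a ^ 2"
        by (simp only: power2_eq_square mult.assoc)
      also have "\<dots> = a ^ (2 * Suc n)"
        unfolding power_add[symmetric] by (rule arg_cong[where f = "power a"]) simp
      finally show ?thesis
        by (simp add: right_diff_distrib mult_2 power_add)
    qed
    show ?thesis
      unfolding M_def mult.assoc by (simp only: 1[unfolded mult.assoc] 2)
  qed
  have "(\<Sum>i<n. M i) * rp R2 \<alpha> = rp R1 \<beta> * T * (1 - a ^ (2 * n))" for n
    by (induction n) (simp_all add: distrib_right M_rp right_diff_distrib)
  moreover have "(\<lambda>n. rp R1 \<beta> * T * (1 - a ^ (2 * n)) * rp R2 1) \<longlonglongrightarrow> rp R1 \<beta> * T * rp R2 1 - 0"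
  proof -
    have "decays (0 + 1) (\<lambda>n. (rp R1 \<beta> * T * a ^ n) * (rp R2 1 * a ^ n))"
      by (rule decays_mult[OF decays_cmult])
        (use two.decays_rp_power_1[where s = 0] two.decays_rp_power_1[where s = 1] two.R_pos
          in \<open>simp_all add: a_def\<close>)
    then have "(\<lambda>n. (rp R1 \<beta> * T * a ^ n) * (rp R2 1 * a ^ n)) \<longlonglongrightarrow> 0"
      by (rule decays_tendsto_0) simp
    moreover have "rp R1 \<beta> * T * (1 - a ^ (2 * n)) * rp R2 1 =
        rp R1 \<beta> * T * rp R2 1 - (rp R1 \<beta> * T * a ^ n) * (rp R2 1 * a ^ n)" for n
    proof -
      have "a ^ (2 * n) * rp R2 1 = a ^ n * (rp R2 1 * a ^ n)"
        by (simp add: mult_2 power_add mult.assoc a_comm)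
      then show ?thesis
        by (simp only: right_diff_distrib left_diff_distrib mult.assoc mult_1_right)
    qed
    ultimately show ?thesis
      by (simp only:) (intro tendsto_intros)
  qed
  ultimately have "S * rp R2 \<alpha> * rp R2 1 = rp R1 \<beta> * T * rp R2 1"
    using LIMSEQ_unique by fastforce
  then have "S * rp R2 \<alpha> = rp R1 \<beta> * T"
    using two.rp_cancel_right[of 1] by simp
  then show ?thesis
    by metis
qed

end

subsection \<open>Commutators with elements of the Lipschitz algebra\<close>

context bracket
begin

text \<open>With \<open>r = \<langle>D\<rangle>\<^bsup>-1\<^esup>\<close> and \<open>x = [r, b]\<close>, the commutator \<open>r x + x r = [R, b]\<close> is expressed by \<open>[D, b]\<close> and bounded
  operators, and \<open>x - (1 - r) x (1 - r) = r x + x r - r x r\<close> is solved for \<open>x\<close> by a series.\<close>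

lemma commutator_rp:
  assumes g: "0 < g" "2 * g \<le> 1" and b: "intertwines g R F R F b b"
  shows "\<exists>Y. rp R 1 * b - b * rp R 1 = rp R g * Y * rp R 1" (is ?A)
    and "\<exists>Y. F * b - b * F = rp R g * Y" (is ?B)
proof -
  interpret self: bracket_pair R F R F g
    by unfold_locales (rule g)+
  define r a where "r = rp R 1" and "a = 1 - r"
  define N where "N = F * b * r - r * b * F"
  obtain K L where K: "N = r * K * rp R (2 * g)" and L: "N = rp R (2 * g) * L * r"
    using b unfolding intertwines_def N_def r_def by blast
  obtain Y1 where Y1: "r * b = Y1 * r"
    using self.intertwines_preserves(2)[OF b] unfolding r_def by blast
  define x Y0 where "x = r * b - b * r" and "Y0 = Y1 - b"
  have x: "x = Y0 * r"
    by (simp add: x_def Y0_def Y1 left_diff_distrib)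
  have rx: "r * x + x * r = - (F * N * r + r * N * F)"
    by (simp add: x_def N_def r_def normalize)
  define Ny where "Ny = - (rp R (1 - g) * (F * K) * rp R (2 * g)) - rp R (1 + g) * (L * F) - rp R (1 - g) * Y0 * r"
  have Fr: "F * r = r * F"
    by (simp add: r_def F_rp)
  have r_split: "r = rp R g * rp R (1 - g)" "r * rp R (2 * g) = rp R g * rp R (1 + g)"
    using g by (simp_all add: r_def rp_mult add.commute)
  have FNr: "F * N * r = rp R g * (rp R (1 - g) * (F * K) * rp R (2 * g)) * r"
  proof -
    have "F * N * r = (F * r) * K * rp R (2 * g) * r"
      by (simp add: K mult.assoc)
    also have "F * r = rp R g * rp R (1 - g) * F"
      by (simp add: Fr flip: r_split(1))
    finally show ?thesis
      by (simp add: mult.assoc)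
  qed
  have rNF: "r * N * F = rp R g * (rp R (1 + g) * (L * F)) * r"
  proof -
    have "r * N * F = (r * rp R (2 * g)) * L * (r * F)"
      by (simp add: L mult.assoc)
    also have "\<dots> = rp R g * rp R (1 + g) * L * (F * r)"
      by (simp add: r_split(2) Fr)
    finally show ?thesis
      by (simp add: mult.assoc)
  qed
  have rxr: "r * x * r = rp R g * (rp R (1 - g) * Y0 * r) * r"
  proof -
    have "r * x * r = r * (Y0 * r) * r"
      by (simp add: x)
    also have "\<dots> = (rp R g * rp R (1 - g)) * (Y0 * r) * r"
      by (simp flip: r_split(1))
    finally show ?thesis
      by (simp add: mult.assoc)
  qed
  have "x - a * x * a = (r * x + x * r) - r * x * r"
    by (simp add: a_def algebra_simps)
  also have "\<dots> = rp R g * Ny * r"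
    unfolding rx FNr rNF rxr by (simp add: Ny_def algebra_simps)
  finally have xa: "x - a * x * a = rp R g * Ny * r" .
  have d: "decays s (\<lambda>n. a ^ n * rp R s)" "decays s (\<lambda>n. rp R s * a ^ n)" if "0 \<le> s" "s \<le> 2" for s
    using decays_power_rp_1[OF that] decays_rp_power_1[OF that] by (simp_all add: a_def r_def)
  have d0: "decays 0 (\<lambda>n. a ^ n)"
    using d(1)[of 0] R_pos by simp
  define y where "y n = a ^ n * Ny * a ^ n" for n
  have "decays (1 + g) (\<lambda>n. (a ^ n * rp R (1 - g)) * (F * K) * (rp R (2 * g) * a ^ n))"
    using decays_mult[OF decays_multc[OF d(1)[of "1 - g"], of "F * K"] d(2)[of "2 * g"]] g by (simp add: add.commute)
  moreover have "decays (1 + g) (\<lambda>n. (a ^ n * rp R (1 + g)) * (L * F) * a ^ n)"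
    using decays_mult[OF decays_multc[OF d(1)[of "1 + g"], of "L * F"] d0] g by simp
  moreover have "decays (1 + g) (\<lambda>n. (a ^ n * rp R (1 - g)) * Y0 * (r * a ^ n))"
  proof (rule decays_mono)
    show "decays (1 - g + 1) (\<lambda>n. (a ^ n * rp R (1 - g)) * Y0 * (r * a ^ n))"
      using d(2)[of 1] g by (intro decays_mult decays_multc d(1)) (auto simp: r_def)
  qed (use g in auto)
  ultimately have "decays (1 + g) (\<lambda>n. (-1) *\<^sub>R ((a ^ n * rp R (1 - g)) * (F * K) * (rp R (2 * g) * a ^ n))
      - (a ^ n * rp R (1 + g)) * (L * F) * a ^ n - (a ^ n * rp R (1 - g)) * Y0 * (r * a ^ n))"
    by (intro decays_diff decays_scaleR)
  then have "decays (1 + g) y"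
    by (rule back_subst[of "decays (1 + g)"]) (rule ext, simp add: y_def Ny_def algebra_simps)
  then have ysum: "y sums suminf y"
    using g by (intro summable_sums decays_summable) auto
  have ar: "a ^ n * rp R s = rp R s * a ^ n" if "s \<ge> 0" for n s
    using power_commute_rp[OF that, of 1] by (simp add: a_def r_def)
  have "(\<lambda>n. a ^ n * (x - a * x * a) * a ^ n) sums (rp R g * suminf y * r)"
  proof -
    have "a ^ n * (x - a * x * a) * a ^ n = rp R g * y n * r" for n
    proof -
      have "a ^ n * (x - a * x * a) * a ^ n = (a ^ n * rp R g) * Ny * (r * a ^ n)"
        by (simp only: xa) (simp add: mult.assoc)
      also have "\<dots> = (rp R g * a ^ n) * Ny * (a ^ n * r)"
        using g by (simp add: ar r_def)
      finally show ?thesis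
        by (simp add: y_def mult.assoc)
    qed
    then show ?thesis
      using ysum by (simp add: sums_mult sums_mult2)
  qed
  moreover from this have "(\<lambda>n. a ^ n * (x - a * x * a) * a ^ n) sums x"
    using sylvester_sums[of 1 a x] d0 by (auto simp: a_def r_def summable_def)
  ultimately have xy: "x = rp R g * suminf y * r"
    by (rule sums_unique2[symmetric])
  then show ?A
    unfolding x_def r_def by blast
  have "(F * b - b * F) * r = N + x * F"
    by (simp add: N_def x_def algebra_simps r_def F_rp)
  also have "\<dots> = rp R g * (rp R g * L + suminf y * F) * r"
  proof -
    have "x * F = rp R g * (suminf y * F) * r"
      unfolding xy by (simp add: Fr mult.assoc)
    moreover have "N = rp R g * (rp R g * L) * r"
      using g rp_mult[of g g] by (simp add: L flip: mult.assoc)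
    ultimately show ?thesis
      by (simp add: distrib_left distrib_right)
  qed
  finally have "F * b - b * F = rp R g * (rp R g * L + suminf y * F)"
    unfolding r_def by (rule rp_cancel_right[rotated 2]) auto
  then show ?B
    by blast
qed

lemma commutator_rp_right:
  assumes g: "0 < g" "2 * g \<le> 1" and b: "intertwines g R F R F b b"
  shows "\<exists>Y. F * b - b * F = Y * rp R g"
proof -
  interpret self: bracket_pair R F R F g
    by unfold_locales (rule g)+
  obtain Y where "F * b\<^sup>\<star> - b\<^sup>\<star> * F = rp R g * Y"
    using commutator_rp(2)[OF g self.intertwines_adjoint[OF b]] by blast
  from arg_cong[OF this, of star] have "F * b - b * F = (- Y\<^sup>\<star>) * rp R g"
    using g by (simp add: star_simps rp_star R_pos F_star algebra_simps)
  then show ?thesis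
    by blast
qed

end

section \<open>The multiplicative perturbation theorem\<close>

locale closed_right_ideal =
  fixes I :: "'c::unital_cstar_algebra set"
  assumes closed: "closed I" and zero: "0 \<in> I" and add: "\<And>x y. x \<in> I \<Longrightarrow> y \<in> I \<Longrightarrow> x + y \<in> I"
    and mult: "\<And>x y. x \<in> I \<Longrightarrow> x * y \<in> I"
begin

lemma scaleR: "x \<in> I \<Longrightarrow> t *\<^sub>R x \<in> I"
  using mult[of x "t *\<^sub>R 1"] by simp

lemma diff: "x \<in> I \<Longrightarrow> y \<in> I \<Longrightarrow> x - y \<in> I"
  using add[of x "(-1) *\<^sub>R y"] scaleR[of y "-1"] by simp

lemma sum: "(\<And>i. i \<in> A \<Longrightarrow> f i \<in> I) \<Longrightarrow> sum f A \<in> I"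
  by (induction A rule: infinite_finite_induct) (auto intro: zero add)

lemma lim: "(\<And>n. f n \<in> I) \<Longrightarrow> f \<longlonglongrightarrow> x \<Longrightarrow> x \<in> I"
  using closed closed_sequentially by blast

end

context bracket
begin

text \<open>\<open>r\<^sup>s\<close> is the limit of \<open>(1 - (1 - r)\<^sup>n) r\<^sup>s\<close>, and \<open>1 - (1 - r)\<^sup>n\<close> is a multiple of \<open>r\<close>.\<close>

lemma right_ideal_rp:
  assumes I: "closed_right_ideal I" and y: "y * rp R 1 \<in> I" and s: "0 < s" "s \<le> 1"
  shows "y * rp R s \<in> I"
proof (rule closed_right_ideal.lim[OF I])
  define a where "a = 1 - rp R 1"
  have geom: "1 - a ^ n = rp R 1 * (\<Sum>i<n. a ^ i)" for n
    by (induction n) (simp_all add: a_def algebra_simps)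
  show "y * (1 - a ^ n) * rp R s \<in> I" for n
    unfolding geom using closed_right_ideal.mult[OF I y] by (simp add: mult.assoc)
  have "(\<lambda>n. a ^ n * rp R s) \<longlonglongrightarrow> 0"
    using decays_tendsto_0[OF decays_power_rp_1[of s]] s by (simp add: a_def)
  then have "(\<lambda>n. y * (rp R s - a ^ n * rp R s)) \<longlonglongrightarrow> y * (rp R s - 0)"
    by (intro tendsto_intros)
  then show "(\<lambda>n. y * (1 - a ^ n) * rp R s) \<longlonglongrightarrow> y * rp R s"
    by (simp add: algebra_simps)
qed

end

context bracket_pair
begin

text \<open>Up to operators of lower order, \<open>p\<^sup>* D\<^sub>2 p\<close> is \<open>p\<^sup>* q D\<^sub>1\<close> by the intertwining relation and \<open>D\<^sub>1 q\<^sup>* p\<close> by its adjoint, while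
  \<open>D\<^sub>1 q\<^sup>* p\<close> and \<open>q\<^sup>* p D\<^sub>1\<close> agree. Hence \<open>(q\<^sup>* p - p\<^sup>* q) D\<^sub>1\<close> is of order \<open>1 - g\<close>. The loss of \<open>g\<close> comes from the
  interpolation.\<close>

lemma defect_commutator:
  assumes pq: "intertwines g R2 F2 R1 F1 p q"
    and p: "intertwines g R1 F1 R1 F1 p p" and q: "intertwines g R1 F1 R1 F1 q q"
  shows "\<exists>Y. q\<^sup>\<star> * p - p\<^sup>\<star> * q = rp R1 g * Y"
proof -
  interpret self: bracket_pair R1 F1 R1 F1 g
    by unfold_locales (rule g)+
  note star1 = rp_star[OF one.R_pos] and star2 = rp_star[OF two.R_pos]
  obtain K L where K: "F2 * p * rp R1 1 - rp R2 1 * q * F1 = rp R2 1 * K * rp R1 (2 * g)"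
    and L: "F2 * p * rp R1 1 - rp R2 1 * q * F1 = rp R2 (2 * g) * L * rp R1 1"
    using pq unfolding intertwines_def by blast
  define M' where "M' = K * rp R1 (2 * g)"
  have M': "rp R2 (1 - 2 * g) * M' = L * rp R1 1"
  proof -
    have "rp R2 (2 * g) * (rp R2 (1 - 2 * g) * M') = rp R2 (2 * g) * (L * rp R1 1)"
      using g K L by (simp add: M'_def two.rp_mult_left mult.assoc)
    then show ?thesis
      using g two.rp_cancel_left[of "2 * g"] by simp
  qed
  obtain Y where Y: "p * rp R1 1 = rp R2 1 * Y" "F2 * Y = q * F1 + M'"
    using intertwines_domain[OF K] unfolding M'_def .
  have pY: "rp R1 1 * p\<^sup>\<star> = Y\<^sup>\<star> * rp R2 1"
    using arg_cong[OF Y(1), of star] by (simp add: star_mult star1 star2)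
  have "rp R1 1 * p\<^sup>\<star> * (F2 * Y) = Y\<^sup>\<star> * (rp R2 1 * (F2 * Y))"
    by (simp only: pY mult.assoc)
  also have "\<dots> = (F2 * Y)\<^sup>\<star> * (p * rp R1 1)"
    by (simp add: Y(1) star_mult two.F_star two.F_rp_left mult.assoc)
  finally have two_sides: "rp R1 1 * p\<^sup>\<star> * (q * F1 + M') = (q * F1 + M')\<^sup>\<star> * (p * rp R1 1)"
    by (simp only: Y(2))
  obtain S where "rp R1 (1 - g) * p\<^sup>\<star> = S * rp R2 (1 - 2 * g)"
    using interpolate_domain[OF pY, of "1 - 2 * g" "1 - g"] g by auto
  from arg_cong[OF this, of star] have S: "p * rp R1 (1 - g) = rp R2 (1 - 2 * g) * S\<^sup>\<star>"
    using g by (simp add: star_simps star1 star2)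
  have p_split: "p * rp R1 1 = p * rp R1 (1 - g) * rp R1 g"
    using g by (simp add: one.rp_mult mult.assoc)
  have M'p: "M'\<^sup>\<star> * (p * rp R1 1) = rp R1 1 * (L\<^sup>\<star> * S\<^sup>\<star> * rp R1 g)"
  proof -
    have "M'\<^sup>\<star> * (p * rp R1 1) = (rp R2 (1 - 2 * g) * M')\<^sup>\<star> * S\<^sup>\<star> * rp R1 g"
      using g by (simp add: p_split S star_mult star2 mult.assoc)
    then show ?thesis
      by (simp add: M' star_mult star1 mult.assoc)
  qed
  obtain Kp where Kp: "F1 * p * rp R1 1 - rp R1 1 * p * F1 = rp R1 1 * Kp * rp R1 (2 * g)"
    using p unfolding intertwines_def by blast
  obtain Yp where Yp: "p * rp R1 1 = rp R1 1 * Yp" "F1 * Yp = p * F1 + Kp * rp R1 (2 * g)"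
    using self.intertwines_domain[OF Kp] .
  obtain Kq where Kq: "F1 * q\<^sup>\<star> * rp R1 1 - rp R1 1 * q\<^sup>\<star> * F1 = rp R1 1 * Kq * rp R1 (2 * g)"
    using self.intertwines_adjoint[OF q] unfolding intertwines_def by blast
  have pYp: "rp R1 1 * p\<^sup>\<star> = Yp\<^sup>\<star> * rp R1 1"
    using arg_cong[OF Yp(1), of star] by (simp add: star_mult star1)
  obtain S' where "rp R1 (1 - g) * p\<^sup>\<star> = S' * rp R1 (1 - 2 * g)"
    using self.interpolate_domain[OF pYp, of "1 - 2 * g" "1 - g"] g by auto
  from arg_cong[OF this, of star] have S': "p * rp R1 (1 - g) = rp R1 (1 - 2 * g) * S'\<^sup>\<star>"
    using g by (simp add: star_simps star1)
  have rYp: "rp R1 (2 * g) * Yp = S'\<^sup>\<star> * rp R1 g"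
  proof -
    have "rp R1 (1 - 2 * g) * (rp R1 (2 * g) * Yp) = p * rp R1 1"
      using g by (simp add: Yp(1) one.rp_mult_left)
    also have "\<dots> = rp R1 (1 - 2 * g) * (S'\<^sup>\<star> * rp R1 g)"
      by (simp add: p_split S' mult.assoc)
    finally show ?thesis
      using g one.rp_cancel_left[of "1 - 2 * g"] by simp
  qed
  have Fqp: "F1 * q\<^sup>\<star> * (p * rp R1 1) = rp R1 1 * (q\<^sup>\<star> * p * F1 + q\<^sup>\<star> * Kp * rp R1 (2 * g) + Kq * S'\<^sup>\<star> * rp R1 g)"
  proof -
    have "F1 * q\<^sup>\<star> * (p * rp R1 1) = (F1 * q\<^sup>\<star> * rp R1 1) * Yp"
      by (simp add: Yp(1) mult.assoc)
    also have "F1 * q\<^sup>\<star> * rp R1 1 = rp R1 1 * q\<^sup>\<star> * F1 + rp R1 1 * Kq * rp R1 (2 * g)"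
      using Kq by (simp add: algebra_simps)
    also have "\<dots> * Yp = rp R1 1 * (q\<^sup>\<star> * (F1 * Yp) + Kq * (rp R1 (2 * g) * Yp))"
      by (simp add: distrib_left distrib_right mult.assoc)
    finally show ?thesis
      by (simp add: Yp(2) rYp distrib_left mult.assoc add.assoc)
  qed
  define z where "z = q\<^sup>\<star> * p - p\<^sup>\<star> * q"
  define V where "V = p\<^sup>\<star> * K * rp R1 g - q\<^sup>\<star> * Kp * rp R1 g - Kq * S'\<^sup>\<star> - L\<^sup>\<star> * S\<^sup>\<star>"
  have split2g: "rp R1 (2 * g) = rp R1 g * rp R1 g"
    using g by (simp add: one.rp_mult)
  have "rp R1 1 * (z * F1) = rp R1 1 * (V * rp R1 g)"
  proof -
    have "(q * F1 + M')\<^sup>\<star> * (p * rp R1 1) = F1 * q\<^sup>\<star> * (p * rp R1 1) + M'\<^sup>\<star> * (p * rp R1 1)"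
      by (simp add: star_simps one.F_star distrib_right mult.assoc)
    with two_sides have "rp R1 1 * p\<^sup>\<star> * (q * F1 + M') = rp R1 1 * (q\<^sup>\<star> * p * F1 + q\<^sup>\<star> * Kp * rp R1 (2 * g) + Kq * S'\<^sup>\<star> * rp R1 g)
        + rp R1 1 * (L\<^sup>\<star> * S\<^sup>\<star> * rp R1 g)"
      by (simp only: Fqp M'p)
    then show ?thesis
      unfolding z_def V_def M'_def split2g by (simp add: algebra_simps)
  qed
  then have zF: "z * F1 = V * rp R1 g"
    by (rule one.rp_cancel_left[rotated 2]) auto
  have "z = z * F1 * F1 + z * rp R1 2"
    by (simp add: mult.assoc one.F_F_rp right_diff_distrib)
  also have "z * rp R1 2 = z * rp R1 (2 - g) * rp R1 g"
    using g by (simp add: one.rp_mult mult.assoc)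
  also have "z * F1 * F1 = V * F1 * rp R1 g"
    using g by (simp add: zF one.F_rp mult.assoc)
  finally have z1: "z = (V * F1 + z * rp R1 (2 - g)) * rp R1 g"
    by (simp add: distrib_right)
  have "z = - z\<^sup>\<star>"
    by (simp add: z_def star_simps)
  also have "\<dots> = rp R1 g * (- (V * F1 + z * rp R1 (2 - g))\<^sup>\<star>)"
    using g by (subst z1) (simp add: star_mult star1)
  finally show ?thesis
    unfolding z_def by blast
qed

text \<open>\<open>r\<^sub>1 v v\<^sup>*\<close> is similar to the positive element \<open>v\<^sup>* r\<^sub>1 v\<close>, though not self-adjoint itself.\<close>

lemma decays_conjugated_power:
  assumes v: "v * vi = 1" "vi * v = 1"
  obtains k where "0 < k" "k \<le> 1"
    "decays 0 (\<lambda>n. (1 - k *\<^sub>R (rp R1 1 * (v * v\<^sup>\<star>))) ^ n)"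
    "decays 1 (\<lambda>n. rp R1 1 * (v * v\<^sup>\<star>) * (1 - k *\<^sub>R (rp R1 1 * (v * v\<^sup>\<star>))) ^ n)"
proof -
  have vs: "v\<^sup>\<star> * vi\<^sup>\<star> = 1" "vi\<^sup>\<star> * v\<^sup>\<star> = 1"
    using v by (simp_all flip: star_mult)
  define \<rho> where "\<rho> = v\<^sup>\<star> * rp R1 1 * v"
  have \<rho>: "pos \<rho>"
    unfolding \<rho>_def by (intro pos_conj one.rp_1)
  define k where "k = 1 / (1 + norm \<rho>)"
  have "0 < 1 + norm \<rho>"
    by (simp add: add_pos_nonneg)
  then have k: "0 < k" "k \<le> 1" and k\<rho>: "pos (k *\<^sub>R \<rho>)" "norm (k *\<^sub>R \<rho>) \<le> 1"
    using \<rho> by (auto simp: k_def intro!: pos_scaleR)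
  define b where "b = 1 - k *\<^sub>R (rp R1 1 * (v * v\<^sup>\<star>))"
  have "b * vi\<^sup>\<star> = vi\<^sup>\<star> * (1 - k *\<^sub>R \<rho>)"
    by (simp add: b_def \<rho>_def left_diff_distrib right_diff_distrib mult.assoc vs)
      (simp add: vs flip: mult.assoc)
  then have "b ^ n * vi\<^sup>\<star> = vi\<^sup>\<star> * (1 - k *\<^sub>R \<rho>) ^ n" for n
    by (induction n) (simp_all add: mult.assoc, metis mult.assoc)
  then have bn: "b ^ n = vi\<^sup>\<star> * (1 - k *\<^sub>R \<rho>) ^ n * v\<^sup>\<star>" for n
    by (metis mult.assoc mult_1_right vs(2))
  have rbn: "rp R1 1 * (v * v\<^sup>\<star>) * b ^ n = (1 / k) *\<^sub>R (vi\<^sup>\<star> * (k *\<^sub>R \<rho> * (1 - k *\<^sub>R \<rho>) ^ n) * v\<^sup>\<star>)" for n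
  proof -
    have "rp R1 1 * (v * v\<^sup>\<star>) * b ^ n = rp R1 1 * v * (v\<^sup>\<star> * vi\<^sup>\<star>) * (1 - k *\<^sub>R \<rho>) ^ n * v\<^sup>\<star>"
      by (simp add: bn mult.assoc)
    also have "\<dots> = (vi\<^sup>\<star> * v\<^sup>\<star>) * rp R1 1 * v * (1 - k *\<^sub>R \<rho>) ^ n * v\<^sup>\<star>"
      by (simp add: vs)
    also have "\<dots> = vi\<^sup>\<star> * (\<rho> * (1 - k *\<^sub>R \<rho>) ^ n) * v\<^sup>\<star>"
      by (simp add: \<rho>_def mult.assoc)
    finally show ?thesis
      using k by simp
  qed
  show ?thesis
  proof (rule that[OF k])
    show "decays 0 (\<lambda>n. (1 - k *\<^sub>R (rp R1 1 * (v * v\<^sup>\<star>))) ^ n)"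
      unfolding b_def[symmetric] bn by (intro decays_multc decays_cmult decays_power_one_minus k\<rho>)
    show "decays 1 (\<lambda>n. rp R1 1 * (v * v\<^sup>\<star>) * (1 - k *\<^sub>R (rp R1 1 * (v * v\<^sup>\<star>))) ^ n)"
      unfolding b_def[symmetric] rbn
      by (rule decays_scaleR, rule decays_multc, rule decays_cmult, rule decays_power_one_minus)
        (rule k\<rho>)+
  qed
qed

text \<open>With \<open>E\<^sub>1 = F\<^sub>2 p - p F\<^sub>1\<close>, \<open>E\<^sub>2 = F\<^sub>2 q - q F\<^sub>1\<close> and \<open>w = vi\<^sup>* vi\<close>, the intertwining relation reads \<open>E\<^sub>1 r\<^sub>1 + r\<^sub>2 E\<^sub>2 = r\<^sub>2 W r\<^sub>1\<^bsup>2g\<^esup>\<close>. Since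
  \<open>q = p w\<close>, the difference \<open>E\<^sub>2 - E\<^sub>1 w\<close> involves commutators with \<open>F\<^sub>1\<close> only, so that both terms on the left can be expressed by
  \<open>x = E\<^sub>1 q\<^sup>* p\<close>; for the first, \<open>r\<^sub>1\<close> is moved past \<open>q\<^sup>* p\<close>. The result is a Sylvester equation for \<open>x\<close>. Its right-hand side
  begins with \<open>r\<^sub>2\<close> or with \<open>E\<^sub>1 r\<^sub>1\<^sup>g\<close>, where \<open>E\<^sub>1 r\<^sub>1 = r\<^sub>2 (\<dots>)\<close> by the same relation; this gives both the convergence of the
  series and the membership of its terms in \<open>I\<close> after multiplication by \<open>c\<close>.\<close>

lemma perturbation_in_ideal:
  assumes pq: "intertwines g R2 F2 R1 F1 p q"
    and p: "intertwines g R1 F1 R1 F1 p p" and q: "intertwines g R1 F1 R1 F1 q q"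
    and v: "v * vi = 1" "vi * v = 1" and q_def: "q = p * (vi\<^sup>\<star> * vi)"
    and I: "closed_right_ideal I" and c1: "c * rp R1 1 \<in> I" and c2: "c * rp R2 1 \<in> I"
  shows "c * (F2 - F1) * p * q\<^sup>\<star> * p \<in> I"
proof -
  interpret I: closed_right_ideal I
    by (rule I)
  interpret self: bracket_pair R1 F1 R1 F1 g
    by unfold_locales (rule g)+
  have vs: "v\<^sup>\<star> * vi\<^sup>\<star> = 1" "vi\<^sup>\<star> * v\<^sup>\<star> = 1"
    using v by (simp_all flip: star_mult)
  obtain k where k: "0 < k" "k \<le> 1"
    and b0': "decays 0 (\<lambda>n. (1 - k *\<^sub>R (rp R1 1 * (v * v\<^sup>\<star>))) ^ n)"
    and b1': "decays 1 (\<lambda>n. rp R1 1 * (v * v\<^sup>\<star>) * (1 - k *\<^sub>R (rp R1 1 * (v * v\<^sup>\<star>))) ^ n)"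
    using decays_conjugated_power[OF v] .
  define r1 r2 where "r1 = rp R1 1" and "r2 = rp R2 1"
  define w wi where "w = vi\<^sup>\<star> * vi" and "wi = v * v\<^sup>\<star>"
  define a b where "a = 1 - k *\<^sub>R r2" and "b = 1 - k *\<^sub>R (r1 * wi)"
  have b0: "decays 0 (\<lambda>n. b ^ n)" and b1: "decays 1 (\<lambda>n. r1 * wi * b ^ n)"
    using b0' b1' by (simp_all add: b_def r1_def wi_def)
  have wwi: "w * wi = 1" "wi * w = 1"
  proof -
    have "w * wi = vi\<^sup>\<star> * (vi * v) * v\<^sup>\<star>" "wi * w = v * (v\<^sup>\<star> * vi\<^sup>\<star>) * vi"
      by (simp_all add: w_def wi_def mult.assoc)
    then show "w * wi = 1" "wi * w = 1"
      by (simp_all add: v vs)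
  qed
  have w_sa: "w\<^sup>\<star> = w"
    by (simp add: w_def star_simps)
  have qw: "q = p * w"
    by (simp add: q_def w_def)
  have pw: "p = q * wi"
    by (simp add: qw mult.assoc wwi)
  have qs: "q\<^sup>\<star> = w * p\<^sup>\<star>"
    by (simp add: qw star_mult w_sa)
  obtain K where K: "F2 * p * r1 - r2 * q * F1 = r2 * K * rp R1 (2 * g)"
    using pq unfolding intertwines_def r1_def r2_def by blast
  define E1 E2 where "E1 = F2 * p - p * F1" and "E2 = F2 * q - q * F1"
  define Z where "Z = E2 - E1 * w"
  define W where "W = K - F2 * K * F1 - r2 * p * F1 * rp R1 (1 - 2 * g) + F2 * q * rp R1 (2 - 2 * g)"
  have E1r: "E1 * r1 = r2 * (W * rp R1 (2 * g) - E2)"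
  proof -
    define N where "N = F2 * p * r1 - r2 * q * F1"
    have "E1 * r1 + r2 * E2 = N - (F2 * N * F1 + r2 * (r2 * p * F1 * r1) - r2 * (F2 * q * (r1 * r1)))"
      by (simp add: E1_def E2_def N_def r1_def r2_def one.normalize two.F_rp_left two.F_F_left two.rp_mult_left)
    also have "r1 * r1 = rp R1 (2 - 2 * g) * rp R1 (2 * g)"
      using g by (simp add: r1_def one.rp_mult)
    also have "r2 * p * F1 * r1 = r2 * p * F1 * rp R1 (1 - 2 * g) * rp R1 (2 * g)"
      using g by (simp add: r1_def one.rp_mult mult.assoc)
    also have "F2 * N * F1 = r2 * (F2 * K * F1 * rp R1 (2 * g))"
      unfolding N_def K using g by (simp add: r2_def two.F_rp_left one.F_rp mult.assoc)
    also have "N = r2 * (K * rp R1 (2 * g))"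
      unfolding N_def K by (simp add: mult.assoc)
    finally have "E1 * r1 + r2 * E2 = r2 * (W * rp R1 (2 * g))"
      by (simp add: W_def algebra_simps)
    then show ?thesis
      by (simp add: algebra_simps)
  qed
  have Z_eq: "Z = (F1 * q - q * F1) - (F1 * p - p * F1) * w"
    by (simp add: Z_def E1_def E2_def qw algebra_simps)
  obtain Yz where Yz: "q\<^sup>\<star> * p - p\<^sup>\<star> * q = rp R1 g * Yz"
    using defect_commutator[OF pq p q] by blast
  obtain Y3 where Y3: "F1 * q - q * F1 = Y3 * rp R1 g"
    using one.commutator_rp_right[OF g q] by blast
  obtain Y4 where Y4: "F1 * p - p * F1 = Y4 * rp R1 g"
    using one.commutator_rp_right[OF g p] by blast
  obtain Y5 where Y5: "r1 * p\<^sup>\<star> - p\<^sup>\<star> * r1 = rp R1 g * Y5 * r1"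
    using one.commutator_rp(1)[OF g self.intertwines_adjoint[OF p]] unfolding r1_def by blast
  obtain Y6 where Y6: "r1 * q - q * r1 = rp R1 g * Y6 * r1"
    using one.commutator_rp(1)[OF g q] unfolding r1_def by blast
  obtain Y7 where Y7: "F1 * p - p * F1 = rp R1 g * Y7"
    using one.commutator_rp(2)[OF g p] by blast
  obtain Ya where Ya: "r1 * p\<^sup>\<star> = Ya * r1"
    using self.intertwines_preserves(2)[OF self.intertwines_adjoint[OF p]] unfolding r1_def by blast
  obtain Yb where Yb: "r1 * q = Yb * r1"
    using self.intertwines_preserves(2)[OF q] unfolding r1_def by blast
  obtain Yc where Yc: "r1 * q\<^sup>\<star> = Yc * r1"
    using self.intertwines_preserves(2)[OF self.intertwines_adjoint[OF q]] unfolding r1_def by blast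
  obtain Yd where Yd: "p\<^sup>\<star> * r1 = r1 * Yd"
    using self.intertwines_preserves(1)[OF self.intertwines_adjoint[OF p]] unfolding r1_def by blast
  define x where "x = E1 * q\<^sup>\<star> * p"
  define X where "X = rp R1 g * Yz * r1 - (rp R1 g * Y5 * Yb * r1 + p\<^sup>\<star> * rp R1 g * Y6 * r1)"
  have commX: "q\<^sup>\<star> * p * r1 - r1 * p\<^sup>\<star> * q = X"
  proof -
    have "q\<^sup>\<star> * p * r1 - r1 * p\<^sup>\<star> * q = (q\<^sup>\<star> * p - p\<^sup>\<star> * q) * r1
        - ((r1 * p\<^sup>\<star> - p\<^sup>\<star> * r1) * q + p\<^sup>\<star> * (r1 * q - q * r1))"
      by (simp add: algebra_simps)
    also have "\<dots> = X"
      by (simp only: Yz Y5 Y6) (simp add: X_def Yb mult.assoc)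
    finally show ?thesis .
  qed
  have sylv: "x * (r1 * wi) + r2 * x = r2 * (W * rp R1 (2 * g) * (p\<^sup>\<star> * p) - Z * (p\<^sup>\<star> * p)) + E1 * X * wi"
  proof -
    have 1: "r2 * x = r2 * E2 * (p\<^sup>\<star> * p) - r2 * Z * (p\<^sup>\<star> * p)"
      by (simp add: x_def Z_def qs algebra_simps)
    have 2: "r2 * E2 = r2 * W * rp R1 (2 * g) - E1 * r1"
      using E1r by (simp add: algebra_simps)
    have 3: "x * (r1 * wi) = E1 * X * wi + E1 * r1 * (p\<^sup>\<star> * p)"
    proof -
      have "x * (r1 * wi) = E1 * (q\<^sup>\<star> * p * r1) * wi"
        by (simp add: x_def mult.assoc)
      also have "q\<^sup>\<star> * p * r1 = X + r1 * p\<^sup>\<star> * q"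
        by (simp flip: commX)
      finally show ?thesis
        by (simp add: pw[symmetric] distrib_left distrib_right mult.assoc)
    qed
    show ?thesis
      unfolding 1 2 3 by (simp add: algebra_simps)
  qed
  \<comment> \<open>The terms of the series, grouped into factors whose decay is known; each of them is \<open>O(n\<^bsup>-1-g\<^esup>)\<close>.\<close>
  define T1 T2 T3 T4 T5 where
    "T1 n = (a ^ n * r2) * W * (rp R1 (2 * g) * (p\<^sup>\<star> * p * b ^ n))" and
    "T2 n = (a ^ n * r2) * (Y3 * (rp R1 g * (p\<^sup>\<star> * p * b ^ n)) - Y4 * (rp R1 g * (q\<^sup>\<star> * p * b ^ n)))" and
    "T3 n = (a ^ n * E1 * rp R1 g) * (Yz - Y5 * Yb) * (r1 * wi * b ^ n)" and
    "T4 n = (a ^ n * (E1 * p\<^sup>\<star>) * rp R1 g) * Y6 * (r1 * wi * b ^ n)" and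
    "T5 n = (a ^ n * r2) * x * (r1 * wi * b ^ n)" for n
  have term_eq: "a ^ n * (x - a * x * b) * b ^ n = k *\<^sub>R (T1 n - T2 n + T3 n - T4 n - k *\<^sub>R T5 n)" for n
  proof -
    have Zh: "Z * (p\<^sup>\<star> * p) = Y3 * (rp R1 g * (p\<^sup>\<star> * p)) - Y4 * (rp R1 g * (q\<^sup>\<star> * p))"
      unfolding Z_eq Y3 Y4 by (simp add: qs left_diff_distrib mult.assoc)
    have "x - a * x * b = k *\<^sub>R (x * (r1 * wi) + r2 * x - k *\<^sub>R (r2 * x * (r1 * wi)))"
      by (simp add: a_def b_def algebra_simps)
    also have "\<dots> = k *\<^sub>R (r2 * (W * rp R1 (2 * g) * (p\<^sup>\<star> * p)
        - (Y3 * (rp R1 g * (p\<^sup>\<star> * p)) - Y4 * (rp R1 g * (q\<^sup>\<star> * p)))) + E1 * X * wi - k *\<^sub>R (r2 * x * (r1 * wi)))"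
      by (simp only: sylv Zh)
    finally show ?thesis
      by (simp only:) (simp add: T1_def T2_def T3_def T4_def T5_def X_def algebra_simps)
  qed
  have ar2: "decays 1 (\<lambda>n. a ^ n * r2)"
    unfolding a_def r2_def by (rule two.decays_power_rp) (use k in auto)
  have a0: "decays 0 (\<lambda>n. a ^ n)"
    using two.decays_power_rp[of k 0] k two.R_pos by (simp add: a_def r2_def)
  have h1: "decays 1 (\<lambda>n. r1 * (p\<^sup>\<star> * p * b ^ n))"
  proof -
    have "r1 * (p\<^sup>\<star> * p * b ^ n) = (Ya * Yb) * (r1 * wi * b ^ n)" for n
    proof -
      have "r1 * (p\<^sup>\<star> * p * b ^ n) = (r1 * p\<^sup>\<star>) * q * (wi * b ^ n)"
        by (subst (2) pw) (simp add: mult.assoc)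
      also have "\<dots> = Ya * (r1 * q) * (wi * b ^ n)"
        by (simp add: Ya mult.assoc)
      finally show ?thesis
        by (simp add: Yb mult.assoc)
    qed
    then show ?thesis
      using decays_cmult[OF b1, of "Ya * Yb"] by simp
  qed
  have h2: "decays 1 (\<lambda>n. r1 * (q\<^sup>\<star> * p * b ^ n))"
  proof -
    have "r1 * (q\<^sup>\<star> * p * b ^ n) = (Yc * Yb) * (r1 * wi * b ^ n)" for n
    proof -
      have "r1 * (q\<^sup>\<star> * p * b ^ n) = (r1 * q\<^sup>\<star>) * q * (wi * b ^ n)"
        by (subst pw) (simp add: mult.assoc)
      also have "\<dots> = Yc * (r1 * q) * (wi * b ^ n)"
        by (simp add: Yc mult.assoc)
      finally show ?thesis
        by (simp add: Yb mult.assoc)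
    qed
    then show ?thesis
      using decays_cmult[OF b1, of "Yc * Yb"] by simp
  qed
  have interp: "decays s (\<lambda>n. rp R1 s * (y * b ^ n))" if "decays 1 (\<lambda>n. r1 * (y * b ^ n))" "0 \<le> s" "s \<le> 1" for s y
    using decays_interpolate[OF one.R_pos that(2,3) decays_cmult[OF b0, of y]] that(1) by (simp add: r1_def)
  have aE1r: "a ^ n * E1 * r1 = (a ^ n * r2) * (W * rp R1 (2 * g) - E2)" for n
    by (simp add: E1r mult.assoc)
  have aE1pr: "a ^ n * (E1 * p\<^sup>\<star>) * r1 = (a ^ n * r2) * ((W * rp R1 (2 * g) - E2) * Yd)" for n
    using aE1r[of n] by (simp add: mult.assoc Yd) (simp flip: mult.assoc)
  have interp': "decays g (\<lambda>n. a ^ n * y * rp R1 g)" if "decays 1 (\<lambda>n. a ^ n * y * r1)" for y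
    using decays_interpolate_right[OF one.R_pos _ _ decays_multc[OF a0, of y], of g] that g by (simp add: r1_def)
  have dE1: "decays g (\<lambda>n. a ^ n * E1 * rp R1 g)"
    by (rule interp') (simp only: aE1r decays_multc[OF ar2])
  have dE1p: "decays g (\<lambda>n. a ^ n * (E1 * p\<^sup>\<star>) * rp R1 g)"
    by (rule interp') (simp only: aE1pr decays_multc[OF ar2])
  have "decays (1 + 2 * g) T1"
    unfolding T1_def using g by (intro decays_mult decays_multc ar2 interp h1) auto
  then have d1: "decays (1 + g) T1"
    by (rule decays_mono) (use g in auto)
  have d2: "decays (1 + g) T2"
    unfolding T2_def
    by (rule decays_mult[OF ar2], rule decays_diff; rule decays_cmult, rule interp) (use g h1 h2 in auto)
  have d3: "decays (1 + g) T3"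
    unfolding T3_def add.commute[of 1] by (rule decays_mult[OF decays_multc[OF dE1] b1])
  have d4: "decays (1 + g) T4"
    unfolding T4_def add.commute[of 1] by (rule decays_mult[OF decays_multc[OF dE1p] b1])
  have "decays (1 + 1) T5"
    unfolding T5_def by (rule decays_mult[OF decays_multc[OF ar2] b1])
  then have d5: "decays (1 + g) T5"
    by (rule decays_mono) (use g in auto)
  have "decays (1 + g) (\<lambda>n. a ^ n * (x - a * x * b) * b ^ n)"
    unfolding term_eq by (intro decays_scaleR decays_diff decays_add d1 d2 d3 d4 d5)
  then have "summable (\<lambda>n. a ^ n * (x - a * x * b) * b ^ n)"
    using g by (intro decays_summable) auto
  then have sums: "(\<lambda>n. a ^ n * (x - a * x * b) * b ^ n) sums x"
    using two.sylvester_sums[OF k b0] by (simp add: a_def r2_def)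
  have ca: "c * a ^ n * r2 \<in> I" for n
    using I.mult[OF c2, of "a ^ n"] two.power_commute_rp[of 1 k n] by (simp add: a_def r2_def mult.assoc)
  have cE: "c * a ^ n * E1 * rp R1 g \<in> I" for n
  proof (rule one.right_ideal_rp[OF I])
    show "c * a ^ n * E1 * rp R1 1 \<in> I"
      using I.mult[OF ca[of n], of "W * rp R1 (2 * g) - E2"] by (simp add: E1r[unfolded r1_def] mult.assoc)
  qed (use g in auto)
  have cEp: "c * a ^ n * (E1 * p\<^sup>\<star>) * rp R1 g \<in> I" for n
  proof (rule one.right_ideal_rp[OF I])
    show "c * a ^ n * (E1 * p\<^sup>\<star>) * rp R1 1 \<in> I"
      using I.mult[OF ca[of n], of "(W * rp R1 (2 * g) - E2) * Yd"] aE1pr[of n] by (simp add: r1_def mult.assoc)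
  qed (use g in auto)
  have "c * (a ^ n * (x - a * x * b) * b ^ n) \<in> I" for n
  proof -
    have "c * T1 n \<in> I" "c * T2 n \<in> I" "c * T5 n \<in> I"
      using I.mult[OF ca[of n]] by (simp_all add: T1_def T2_def T5_def mult.assoc)
    moreover have "c * T3 n \<in> I"
      using I.mult[OF cE[of n]] by (simp add: T3_def mult.assoc)
    moreover have "c * T4 n \<in> I"
      using I.mult[OF cEp[of n]] by (simp add: T4_def mult.assoc)
    ultimately have "k *\<^sub>R (c * T1 n - c * T2 n + c * T3 n - c * T4 n - k *\<^sub>R (c * T5 n)) \<in> I"
      by (intro I.scaleR I.diff I.add)
    then show ?thesis
      by (simp only: term_eq) (simp add: right_diff_distrib distrib_left)
  qed
  then have "(\<Sum>i<n. c * (a ^ i * (x - a * x * b) * b ^ i)) \<in> I" for n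
    by (rule I.sum)
  then have "c * x \<in> I"
    using sums_mult[OF sums, of c] unfolding sums_def by (rule I.lim)
  moreover have "c * (F1 * p - p * F1) * (q\<^sup>\<star> * p) \<in> I"
  proof -
    have "c * rp R1 g \<in> I"
      by (rule one.right_ideal_rp[OF I c1]) (use g in auto)
    then have "c * rp R1 g * (Y7 * (q\<^sup>\<star> * p)) \<in> I"
      by (rule I.mult)
    then show ?thesis
      by (simp add: Y7 mult.assoc)
  qed
  ultimately have "c * x - c * (F1 * p - p * F1) * (q\<^sup>\<star> * p) \<in> I"
    by (rule I.diff)
  also have "c * x - c * (F1 * p - p * F1) * (q\<^sup>\<star> * p) = c * (F2 - F1) * p * q\<^sup>\<star> * p"
    by (simp add: x_def E1_def algebra_simps)
  finally show ?thesis .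
qed

end

section \<open>The unitization of a C*-algebra\<close>

text \<open>The norm is that of \<open>B \<oplus> \<complex>\<close> acting by multipliers on \<open>B\<close> and on \<open>\<complex>\<close>. The second summand keeps
  the unit apart from \<open>B\<close> when \<open>B\<close> is unital, or zero.\<close>

datatype 'b unitz = Unitz (bpart: 'b) (cpart: complex)

lemma unitz_eq_iff: "x = y \<longleftrightarrow> bpart x = bpart y \<and> cpart x = cpart y"
  by (cases x; cases y) auto

definition mulop :: "'b::cstar_algebra unitz \<Rightarrow> 'b \<Rightarrow> 'b" where
  "mulop x y = bpart x * y + cpart x *\<^sub>C y"

lemma bounded_linear_mulop: "bounded_linear (mulop x)"
  unfolding mulop_def
  by (intro bounded_linear_add bounded_linear_mult_right bounded_linear_scaleC)

lemma norm_mulop: "norm (mulop x y) \<le> onorm (mulop x) * norm y"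
  by (rule onorm[OF bounded_linear_mulop])

lemma onorm_mulop_le: "(\<And>y. norm (mulop x y) \<le> K * norm y) \<Longrightarrow> 0 \<le> K \<Longrightarrow> onorm (mulop x) \<le> K"
  by (rule onorm_bound)

lemma onorm_mulop_nonneg: "0 \<le> onorm (mulop x)"
  by (rule onorm_pos_le[OF bounded_linear_mulop])

instantiation unitz :: (cstar_algebra) "{complex_vector, real_normed_algebra_1}"
begin

definition "0 = Unitz 0 0"
definition "1 = Unitz 0 1"
definition "x + y = Unitz (bpart x + bpart y) (cpart x + cpart y)"
definition "x - y = Unitz (bpart x - bpart y) (cpart x - cpart y)"
definition "- x = Unitz (- bpart x) (- cpart x)"
definition "x * y = Unitz (bpart x * bpart y + cpart x *\<^sub>C bpart y + cpart y *\<^sub>C bpart x) (cpart x * cpart y)"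
definition "c *\<^sub>C x = Unitz (c *\<^sub>C bpart x) (c * cpart x)"
definition "r *\<^sub>R x = Unitz (r *\<^sub>R bpart x) (r *\<^sub>R cpart x)"
definition "norm x = max (cmod (cpart x)) (onorm (mulop x))"
definition dist_unitz :: "'a unitz \<Rightarrow> 'a unitz \<Rightarrow> real" where "dist_unitz x y = norm (x - y)"
definition sgn_unitz :: "'a unitz \<Rightarrow> 'a unitz" where "sgn_unitz x = inverse (norm x) *\<^sub>R x"
definition uniformity_unitz :: "('a unitz \<times> 'a unitz) filter" where
  "uniformity_unitz = (INF e\<in>{0 <..}. principal {(x, y). dist x y < e})"
definition open_unitz :: "'a unitz set \<Rightarrow> bool" where
  "open_unitz U = (\<forall>x\<in>U. \<forall>\<^sub>F (x', y) in uniformity. x' = x \<longrightarrow> y \<in> U)"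

lemmas unitz_defs = zero_unitz_def one_unitz_def plus_unitz_def minus_unitz_def uminus_unitz_def
  times_unitz_def scaleC_unitz_def scaleR_unitz_def

lemma mulop_simps:
  "mulop (x + y) z = mulop x z + mulop y z" "mulop (x * y) z = mulop x (mulop y z)"
  "mulop (c *\<^sub>C x) z = c *\<^sub>C mulop x z" "mulop 0 z = 0" "mulop 1 z = z"
  by (simp_all add: mulop_def unitz_defs algebra_simps scaleC_add_left scaleC_add_right scaleC_scaleC
      mult_scaleC_left mult_scaleC_right star_simps star_scaleC scaleC_one)

lemma onorm_mulop_mult: "onorm (mulop (x * y)) \<le> onorm (mulop x) * onorm (mulop y)"
proof (rule onorm_mulop_le)
  fix z
  have "norm (mulop x (mulop y z)) \<le> onorm (mulop x) * (onorm (mulop y) * norm z)"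
    by (intro order_trans[OF norm_mulop] mult_left_mono norm_mulop onorm_mulop_nonneg)
  then show "norm (mulop (x * y) z) \<le> onorm (mulop x) * onorm (mulop y) * norm z"
    by (simp add: mulop_simps mult.assoc)
qed (simp add: onorm_mulop_nonneg)

lemma norm_bpart_le: "norm (bpart x) \<le> 2 * norm x" for x :: "'a unitz"
proof (cases "bpart x = 0")
  case False
  have "bpart x * (bpart x)\<^sup>\<star> = mulop x ((bpart x)\<^sup>\<star>) - cpart x *\<^sub>C (bpart x)\<^sup>\<star>"
    by (simp add: mulop_def)
  moreover have "norm (bpart x) * norm (bpart x) = norm (bpart x * (bpart x)\<^sup>\<star>)"
    using cstar_identity[of "(bpart x)\<^sup>\<star>"] by (simp add: star_star norm_star power2_eq_square)
  ultimately have "norm (bpart x) * norm (bpart x) \<le> norm (mulop x ((bpart x)\<^sup>\<star>)) + norm (cpart x *\<^sub>C (bpart x)\<^sup>\<star>)"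
    by (simp add: norm_triangle_ineq4)
  also have "\<dots> \<le> norm x * norm (bpart x) + norm x * norm (bpart x)"
    using norm_mulop[of x "(bpart x)\<^sup>\<star>"]
    by (intro add_mono order_trans[OF norm_mulop])
      (auto simp: norm_star norm_scaleC norm_unitz_def intro!: mult_right_mono)
  also have "\<dots> = (2 * norm x) * norm (bpart x)"
    by simp
  finally show ?thesis
    using False by (simp only: mult_le_cancel_right) simp
next
  case True
  have "0 \<le> norm x"
    by (auto simp: norm_unitz_def intro: max.coboundedI1)
  with True show ?thesis
    by simp
qed

lemma norm_unitz_le: "norm x \<le> norm (bpart x) + cmod (cpart x)" for x :: "'a unitz"
proof -
  have "norm (mulop x y) \<le> (norm (bpart x) + cmod (cpart x)) * norm y" for y
    unfolding mulop_def distrib_right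
    by (intro order_trans[OF norm_triangle_ineq] add_mono norm_mult_ineq) (simp add: norm_scaleC)
  then have "onorm (mulop x) \<le> norm (bpart x) + cmod (cpart x)"
    by (rule onorm_mulop_le) simp
  then show ?thesis
    by (simp add: norm_unitz_def)
qed

lemma norm_scaleC_unitz: "norm (c *\<^sub>C x) = cmod c * norm x" for x :: "'a unitz"
proof -
  have on_C: "onorm (mulop (c *\<^sub>C x)) = cmod c * onorm (mulop x)" for c and x :: "'a unitz"
  proof (rule antisym)
    show le: "onorm (mulop (c *\<^sub>C x)) \<le> cmod c * onorm (mulop x)" for c and x :: "'a unitz"
      by (rule onorm_mulop_le)
        (auto simp: mulop_simps norm_scaleC mult.assoc onorm_mulop_nonneg intro!: mult_left_mono norm_mulop)
    show "cmod c * onorm (mulop x) \<le> onorm (mulop (c *\<^sub>C x))"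
    proof (cases "c = 0")
      case False
      have "inverse c *\<^sub>C (c *\<^sub>C x) = x"
        using False by (simp add: scaleC_unitz_def unitz_eq_iff)
      then have "onorm (mulop x) \<le> inverse (cmod c) * onorm (mulop (c *\<^sub>C x))"
        using le[of "inverse c" "c *\<^sub>C x"] by (simp only: norm_inverse)
      then show ?thesis
        using False by (simp add: field_simps)
    qed (simp add: onorm_mulop_nonneg)
  qed
  show ?thesis
    by (simp add: norm_unitz_def on_C max_mult_distrib_left norm_mult) (simp add: scaleC_unitz_def norm_mult max_def)
qed

instance
proof
  fix x y z :: "'a unitz" and r s :: real and c d :: complex
  show "x + y + z = x + (y + z)" "x + y = y + x" "0 + x = x" "- x + x = 0" "x - y = x + - y"
    "x * y * z = x * (y * z)" "(x + y) * z = x * z + y * z" "x * (y + z) = x * y + x * z"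
    "1 * x = x" "x * 1 = x" "(0::'a unitz) \<noteq> 1"
    "r *\<^sub>R (x + y) = r *\<^sub>R x + r *\<^sub>R y" "(r + s) *\<^sub>R x = r *\<^sub>R x + s *\<^sub>R x"
    "r *\<^sub>R s *\<^sub>R x = (r * s) *\<^sub>R x" "1 *\<^sub>R x = x"
    "c *\<^sub>C (x + y) = c *\<^sub>C x + c *\<^sub>C y" "(c + d) *\<^sub>C x = c *\<^sub>C x + d *\<^sub>C x"
    "c *\<^sub>C d *\<^sub>C x = (c * d) *\<^sub>C x" "1 *\<^sub>C x = x"
    "r *\<^sub>R x * y = r *\<^sub>R (x * y)" "x * r *\<^sub>R y = r *\<^sub>R (x * y)"
    by (simp_all add: unitz_defs unitz_eq_iff algebra_simps scaleC_add_left scaleC_add_right scaleC_scaleC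
      mult_scaleC_left mult_scaleC_right star_simps star_scaleC scaleC_one scaleR_scaleC scaleR_conv_of_real)
  show "dist x y = norm (x - y)" "sgn x = inverse (norm x) *\<^sub>R x"
    by (fact dist_unitz_def sgn_unitz_def)+
  show "uniformity = (INF e\<in>{0<..}. principal {(x, y :: 'a unitz). dist x y < e})"
    by (fact uniformity_unitz_def)
  show "open U = (\<forall>x\<in>U. \<forall>\<^sub>F (x', y) in uniformity. x' = x \<longrightarrow> y \<in> U)" for U :: "'a unitz set"
    by (fact open_unitz_def)
  show "norm x = 0 \<longleftrightarrow> x = 0"
  proof
    assume "norm x = 0"
    moreover have "cmod (cpart x) \<le> norm x"
      by (simp add: norm_unitz_def)
    ultimately show "x = 0"
      using norm_bpart_le[of x] by (simp add: unitz_defs unitz_eq_iff)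
  next
    assume "x = 0"
    moreover have "0 \<le> norm x"
      by (auto simp: norm_unitz_def intro: max.coboundedI1)
    ultimately show "norm x = 0"
      using norm_unitz_le[of x] by (simp add: unitz_defs)
  qed
  have on_add: "onorm (mulop (x + y)) \<le> onorm (mulop x) + onorm (mulop y)"
    by (rule onorm_mulop_le)
      (auto simp: mulop_simps distrib_right onorm_mulop_nonneg
        intro!: order_trans[OF norm_triangle_ineq] add_mono norm_mulop)
  have c_add: "cmod (cpart (x + y)) \<le> cmod (cpart x) + cmod (cpart y)"
    by (simp add: plus_unitz_def norm_triangle_ineq)
  show "norm (x + y) \<le> norm x + norm y"
    unfolding norm_unitz_def using on_add c_add by linarith
  have "r *\<^sub>R x = complex_of_real r *\<^sub>C x"
    by (simp add: unitz_defs unitz_eq_iff scaleR_scaleC scaleR_conv_of_real)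
  with norm_scaleC_unitz[of "complex_of_real r" x] show "norm (r *\<^sub>R x) = \<bar>r\<bar> * norm x"
    by simp
  have nmult: "norm (x * y) \<le> norm x * norm y" for x y :: "'a unitz"
  proof -
    have "onorm (mulop (x * y)) \<le> norm x * norm y"
      by (rule order_trans[OF onorm_mulop_mult mult_mono])
        (auto simp: norm_unitz_def onorm_mulop_nonneg intro: max.coboundedI1)
    moreover have "cmod (cpart (x * y)) \<le> norm x * norm y"
      by (simp add: times_unitz_def norm_mult) (auto simp: norm_unitz_def intro!: mult_mono max.coboundedI1)
    ultimately show ?thesis
      by (simp add: norm_unitz_def[of "x * y"])
  qed
  then show "norm (x * y) \<le> norm x * norm y" .
  show "norm (1::'a unitz) = 1"
  proof -
    have "onorm (mulop (1::'a unitz)) \<le> 1"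
      by (rule onorm_mulop_le) (simp_all add: mulop_simps)
    then show ?thesis
      by (simp add: norm_unitz_def) (simp add: one_unitz_def)
  qed
qed

end

instance unitz :: (cstar_algebra) banach
proof
  fix X :: "nat \<Rightarrow> 'a unitz" assume "Cauchy X"
  then have X: "\<And>e. e > 0 \<Longrightarrow> \<exists>N. \<forall>m\<ge>N. \<forall>n\<ge>N. norm (X m - X n) < e"
    by (simp add: Cauchy_def dist_norm)
  have "Cauchy (\<lambda>n. bpart (X n))"
  proof (rule CauchyI)
    fix e :: real assume "e > 0"
    then obtain N where N: "\<And>m n. m \<ge> N \<Longrightarrow> n \<ge> N \<Longrightarrow> norm (X m - X n) < e / 2"
      using X[of "e / 2"] by (meson half_gt_zero)
    have "norm (bpart (X m) - bpart (X n)) < e" if "m \<ge> N" "n \<ge> N" for m n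
      using norm_bpart_le[of "X m - X n"] N[OF that] by (simp add: minus_unitz_def)
    then show "\<exists>N. \<forall>m\<ge>N. \<forall>n\<ge>N. norm (bpart (X m) - bpart (X n)) < e"
      by blast
  qed
  then obtain b where b: "(\<lambda>n. bpart (X n)) \<longlonglongrightarrow> b"
    using Cauchy_convergent convergent_def by blast
  have "Cauchy (\<lambda>n. cpart (X n))"
  proof (rule CauchyI)
    fix e :: real assume "e > 0"
    then obtain N where N: "\<And>m n. m \<ge> N \<Longrightarrow> n \<ge> N \<Longrightarrow> norm (X m - X n) < e"
      using X[of e] by meson
    have "cmod (cpart (X m) - cpart (X n)) < e" if "m \<ge> N" "n \<ge> N" for m n
      using N[OF that] by (simp add: norm_unitz_def) (simp add: minus_unitz_def)
    then show "\<exists>N. \<forall>m\<ge>N. \<forall>n\<ge>N. cmod (cpart (X m) - cpart (X n)) < e"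
      by blast
  qed
  then obtain c where c: "(\<lambda>n. cpart (X n)) \<longlonglongrightarrow> c"
    using Cauchy_convergent convergent_def by blast
  have "X \<longlonglongrightarrow> Unitz b c"
    unfolding lim_sequentially dist_norm
  proof (intro allI impI)
    fix e :: real assume "e > 0"
    have "(\<lambda>n. norm (bpart (X n) - b) + cmod (cpart (X n) - c)) \<longlonglongrightarrow> 0 + 0"
      using b c by (intro tendsto_add) (simp_all add: LIM_zero_iff tendsto_norm_zero)
    from LIMSEQ_D[OF this \<open>e > 0\<close>] obtain N where
      N: "\<And>n. n \<ge> N \<Longrightarrow> norm (bpart (X n) - b) + cmod (cpart (X n) - c) < e"
      by auto
    have "norm (X n - Unitz b c) < e" if "n \<ge> N" for n
      using norm_unitz_le[of "X n - Unitz b c"] N[OF that] by (simp add: minus_unitz_def)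
    then show "\<exists>N. \<forall>n\<ge>N. norm (X n - Unitz b c) < e"
      by blast
  qed
  then show "convergent X"
    by (auto simp: convergent_def)
qed

instantiation unitz :: (cstar_algebra) cstar_algebra
begin

definition "x\<^sup>\<star> = Unitz ((bpart x)\<^sup>\<star>) (cnj (cpart x))"

lemma mulop_star: "(mulop x u)\<^sup>\<star> * z = u\<^sup>\<star> * mulop (x\<^sup>\<star>) z"
  by (simp add: mulop_def star_unitz_def algebra_simps mult_scaleC_left mult_scaleC_right star_simps star_scaleC)

text \<open>The C*-identity for multipliers: \<open>\<parallel>x y\<parallel>\<^sup>2 = \<parallel>y\<^sup>* (x\<^sup>* x) y\<parallel>\<close>.\<close>

lemma onorm_mulop_square: "(onorm (mulop x))\<^sup>2 \<le> onorm (mulop (x\<^sup>\<star> * x))"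
proof -
  have "onorm (mulop x) \<le> sqrt (onorm (mulop (x\<^sup>\<star> * x)))"
  proof (rule onorm_mulop_le)
    fix y
    have "(norm (mulop x y))\<^sup>2 = norm ((mulop x y)\<^sup>\<star> * mulop x y)"
      by (simp add: cstar_identity)
    also have "\<dots> = norm (y\<^sup>\<star> * mulop (x\<^sup>\<star> * x) y)"
      by (simp add: mulop_simps mulop_star)
    also have "\<dots> \<le> norm y * (onorm (mulop (x\<^sup>\<star> * x)) * norm y)"
      by (intro order_trans[OF norm_mult_ineq] mult_mono norm_mulop) (auto simp: norm_star)
    also have "\<dots> = (sqrt (onorm (mulop (x\<^sup>\<star> * x))) * norm y)\<^sup>2"
      by (simp add: power_mult_distrib onorm_mulop_nonneg power2_eq_square)
    finally show "norm (mulop x y) \<le> sqrt (onorm (mulop (x\<^sup>\<star> * x))) * norm y"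
      by (rule power2_le_imp_le) (simp add: onorm_mulop_nonneg)
  qed (simp add: onorm_mulop_nonneg)
  then have "(onorm (mulop x))\<^sup>2 \<le> (sqrt (onorm (mulop (x\<^sup>\<star> * x))))\<^sup>2"
    by (intro power_mono onorm_mulop_nonneg)
  then show ?thesis
    by (simp add: onorm_mulop_nonneg)
qed

lemma star_star_unitz: "(x\<^sup>\<star>)\<^sup>\<star> = x" for x :: "'a unitz"
  by (simp add: star_unitz_def unitz_eq_iff star_star)

lemma onorm_mulop_star: "onorm (mulop (x\<^sup>\<star>)) = onorm (mulop x)" for x :: "'a unitz"
proof -
  have le: "onorm (mulop x) \<le> onorm (mulop (x\<^sup>\<star>))" for x :: "'a unitz"
  proof (cases "onorm (mulop x) = 0")
    case False
    have "onorm (mulop x) * onorm (mulop x) \<le> onorm (mulop (x\<^sup>\<star>)) * onorm (mulop x)"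
      using order_trans[OF onorm_mulop_square onorm_mulop_mult] by (simp add: power2_eq_square)
    then show ?thesis
      using False onorm_mulop_nonneg[of x] by simp
  qed (simp add: onorm_mulop_nonneg)
  from le[of x] le[of "x\<^sup>\<star>"] show ?thesis
    by (simp add: star_star_unitz)
qed

instance
proof
  fix x y z :: "'a unitz" and r s :: real and c d :: complex
  show
    "r *\<^sub>R x = complex_of_real r *\<^sub>C x"
    "c *\<^sub>C x * y = c *\<^sub>C (x * y)" "x * c *\<^sub>C y = c *\<^sub>C (x * y)"
    "(x\<^sup>\<star>)\<^sup>\<star> = x" "(x + y)\<^sup>\<star> = x\<^sup>\<star> + y\<^sup>\<star>" "(c *\<^sub>C x)\<^sup>\<star> = cnj c *\<^sub>C x\<^sup>\<star>" "(x * y)\<^sup>\<star> = y\<^sup>\<star> * x\<^sup>\<star>"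
    by (simp_all add: star_unitz_def unitz_defs unitz_eq_iff algebra_simps scaleC_add_left scaleC_add_right scaleC_scaleC
      mult_scaleC_left mult_scaleC_right star_simps star_scaleC scaleC_one scaleR_scaleC scaleR_conv_of_real)
  show "norm (c *\<^sub>C x) = cmod c * norm x"
    by (rule norm_scaleC_unitz)
  show "norm (x\<^sup>\<star> * x) = (norm x)\<^sup>2"
  proof (rule antisym)
    have "norm (x\<^sup>\<star>) = norm x"
      by (simp add: norm_unitz_def onorm_mulop_star) (simp add: star_unitz_def)
    then show "norm (x\<^sup>\<star> * x) \<le> (norm x)\<^sup>2"
      using norm_mult_ineq[of "x\<^sup>\<star>" x] by (simp add: power2_eq_square)
    have "(cmod (cpart x))\<^sup>2 \<le> norm (x\<^sup>\<star> * x)"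
      by (simp add: norm_unitz_def) (simp add: unitz_defs star_unitz_def norm_mult power2_eq_square)
    moreover have "(onorm (mulop x))\<^sup>2 \<le> norm (x\<^sup>\<star> * x)"
      using onorm_mulop_square[of x] by (simp add: norm_unitz_def[of "x\<^sup>\<star> * x"])
    ultimately show "(norm x)\<^sup>2 \<le> norm (x\<^sup>\<star> * x)"
      by (simp add: norm_unitz_def[of x] max_def)
  qed
qed

end

instance unitz :: (cstar_algebra) unital_cstar_algebra ..

definition inc :: "'b \<Rightarrow> 'b unitz" where
  "inc b = Unitz b 0"

lemma inc_simps:
  fixes x y :: "'b::cstar_algebra"
  shows "inc x + inc y = inc (x + y)" "inc x - inc y = inc (x - y)" "inc x * inc y = inc (x * y)"
    "(inc x)\<^sup>\<star> = inc (x\<^sup>\<star>)" "c *\<^sub>C inc x = inc (c *\<^sub>C x)" "r *\<^sub>R inc x = inc (r *\<^sub>R x)" "inc 0 = (0::'b unitz)"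
    "- inc x = inc (- x)"
  by (simp_all add: inc_def unitz_defs star_unitz_def)

lemma inc_inject [simp]: "inc x = inc y \<longleftrightarrow> x = y"
  by (simp add: inc_def)

lemma norm_inc [simp]: "norm (inc x) = norm x" for x :: "'b::cstar_algebra"
proof (rule antisym)
  show "norm (inc x) \<le> norm x"
    using norm_unitz_le[of "inc x"] by (simp add: inc_def)
  show "norm x \<le> norm (inc x)"
  proof (cases "x = 0")
    case False
    have "norm x * norm x = norm (mulop (inc x) (x\<^sup>\<star>))"
      using cstar_identity[of "x\<^sup>\<star>"] by (simp add: mulop_def inc_def star_star norm_star power2_eq_square)
    also have "\<dots> \<le> norm (inc x) * norm x"
      using norm_mulop[of "inc x" "x\<^sup>\<star>"]
      by (rule order_trans) (auto simp: norm_star norm_unitz_def intro!: mult_right_mono)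
    finally show ?thesis
      using False by simp
  qed simp
qed

text \<open>Positivity of \<open>inc b\<close>, expressed by the multiplication operators on \<open>B\<close>.\<close>

lemma norm_scaleR_minus_inc:
  fixes b :: "'b::cstar_algebra"
  assumes "0 \<le> t" "\<And>x. norm (t *\<^sub>R x - b * x) \<le> t * norm x"
  shows "norm (t *\<^sub>R 1 - inc b) \<le> t"
proof -
  have "onorm (mulop (t *\<^sub>R 1 - inc b)) \<le> t"
  proof (rule onorm_mulop_le)
    fix x
    have "mulop (t *\<^sub>R 1 - inc b) x = t *\<^sub>R x - b * x"
      by (simp add: mulop_def inc_def unitz_defs scaleR_scaleC scaleR_conv_of_real)
    then show "norm (mulop (t *\<^sub>R 1 - inc b) x) \<le> t * norm x"
      using assms by simp
  qed (rule assms(1))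
  then show ?thesis
    using assms(1) by (simp add: norm_unitz_def) (simp add: inc_def unitz_defs)
qed

lemma norm_scaleR_minus_mult_le:
  fixes b :: "'b::cstar_algebra"
  assumes "pos (inc b)" "norm b \<le> t"
  shows "norm (t *\<^sub>R x - b * x) \<le> t * norm x"
proof -
  have "norm (t *\<^sub>R 1 - inc b) \<le> t"
    using norm_shift_mono[of "norm b" "inc b" 0 t] pos_norm_shift[OF assms(1)] assms(2) by simp
  then have "norm ((t *\<^sub>R 1 - inc b) * inc x) \<le> t * norm x"
    by (intro order_trans[OF norm_mult_ineq]) (simp add: mult_right_mono)
  also have "(t *\<^sub>R 1 - inc b) * inc x = inc (t *\<^sub>R x - b * x)"
    by (simp add: left_diff_distrib inc_simps)
  finally show ?thesis
    by simp
qed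

text \<open>A square root of an element of \<open>B\<close> lies in \<open>B\<close> because its image in \<open>\<complex>\<close> squares to zero.\<close>

lemma cstar_positive_iff_pos: "cstar_positive b \<longleftrightarrow> pos (inc b)" for b :: "'b::cstar_algebra"
proof
  assume "cstar_positive b"
  then obtain y where "b = y\<^sup>\<star> * y"
    by (auto simp: cstar_positive_def)
  then show "pos (inc b)"
    using pos_star_mult_self[of "inc y"] by (simp add: inc_simps)
next
  assume p: "pos (inc b)"
  define s where "s = rp (inc b) 1"
  have ss: "s\<^sup>\<star> * s = inc b"
    using rp_add[OF p, of 1 1] rp_2[OF p] rp_star[OF p, of 1] by (simp add: s_def)
  then have "cpart (s\<^sup>\<star> * s) = 0"
    by (simp add: inc_def)
  then have "cpart s = 0"
    by (simp add: unitz_defs star_unitz_def)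
  then have "s = inc (bpart s)"
    by (simp add: inc_def unitz_eq_iff)
  then have "inc b = inc ((bpart s)\<^sup>\<star> * bpart s)"
    using ss by (metis inc_simps(3,4))
  then show "cstar_positive b"
    by (auto simp: cstar_positive_def)
qed

lemma cstar_positive_norm_mono: "cstar_positive x \<Longrightarrow> cstar_positive (y - x) \<Longrightarrow> norm x \<le> norm y"
  using pos_norm_mono[of "inc x" "inc y"] by (simp add: cstar_positive_iff_pos inc_simps)

lemma cstar_positive_star: "cstar_positive x \<Longrightarrow> x\<^sup>\<star> = x"
  by (auto simp: cstar_positive_def star_simps)

text \<open>Pointwise square roots are not obviously continuous; instead, positivity is read off from norms, which can be computed
  pointwise.\<close>

lemma cstar_positive_bcontfun:
  fixes f :: "'t::metric_space \<Rightarrow>\<^sub>C 'b::cstar_algebra"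
  assumes f: "\<And>t. cstar_positive (apply_bcontfun f t)"
  shows "cstar_positive f"
proof -
  have "f\<^sup>\<star> = f"
    using f by (intro bcontfun_eqI) (simp add: cstar_positive_star)
  moreover have "norm (norm f *\<^sub>R 1 - inc f) \<le> norm f"
  proof (rule norm_scaleR_minus_inc)
    fix h :: "'t \<Rightarrow>\<^sub>C 'b"
    show "norm (norm f *\<^sub>R h - f * h) \<le> norm f * norm h"
    proof (rule norm_bound)
      fix t
      have "norm (norm f *\<^sub>R apply_bcontfun h t - apply_bcontfun f t * apply_bcontfun h t)
          \<le> norm f * norm (apply_bcontfun h t)"
        using f[of t] norm_bounded[of f t] by (intro norm_scaleR_minus_mult_le) (auto simp: cstar_positive_iff_pos)
      also have "\<dots> \<le> norm f * norm h"
        by (intro mult_left_mono norm_bounded) auto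
      finally show "norm (apply_bcontfun (norm f *\<^sub>R h - f * h) t) \<le> norm f * norm h"
        by simp
    qed
  qed simp
  ultimately have "pos (inc f)"
    unfolding pos_def by (auto simp: inc_simps intro!: exI[of _ "norm f"])
  then show ?thesis
    by (simp add: cstar_positive_iff_pos)
qed

section \<open>Hilbert modules\<close>

context hilbert_module
begin

lemma zero_mem [simp, intro]: "0 \<in> hcarrier E"
  using subspace by (rule complex_vector.subspace_0)

lemma add_mem [simp, intro]: "x \<in> hcarrier E \<Longrightarrow> y \<in> hcarrier E \<Longrightarrow> x + y \<in> hcarrier E"
  using subspace by (rule complex_vector.subspace_add)

lemma diff_mem [simp, intro]: "x \<in> hcarrier E \<Longrightarrow> y \<in> hcarrier E \<Longrightarrow> x - y \<in> hcarrier E"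
  using subspace by (rule complex_vector.subspace_diff)

lemma scaleC_mem [simp, intro]: "x \<in> hcarrier E \<Longrightarrow> c *\<^sub>C x \<in> hcarrier E"
  using subspace by (rule complex_vector.subspace_scale)

lemma uminus_mem [simp, intro]: "x \<in> hcarrier E \<Longrightarrow> - x \<in> hcarrier E"
  using subspace by (rule complex_vector.subspace_neg)

declare act_closed [simp, intro]

lemma ip_add_left:
  assumes "x \<in> hcarrier E" "y \<in> hcarrier E" "z \<in> hcarrier E"
  shows "hip E (x + y) z = hip E x z + hip E y z"
proof -
  have "hip E (x + y) z = (hip E z (x + y))\<^sup>\<star>"
    using assms by (intro ip_star) auto
  also have "\<dots> = (hip E z x)\<^sup>\<star> + (hip E z y)\<^sup>\<star>"
    using assms by (simp add: ip_add star_add)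
  finally show ?thesis
    using assms ip_star[of z x] ip_star[of z y] by simp
qed

lemma ip_scaleC_left:
  assumes "x \<in> hcarrier E" "y \<in> hcarrier E"
  shows "hip E (c *\<^sub>C x) y = cnj c *\<^sub>C hip E x y"
proof -
  have "hip E (c *\<^sub>C x) y = (hip E y (c *\<^sub>C x))\<^sup>\<star>"
    using assms by (intro ip_star) auto
  then show ?thesis
    using assms ip_star[of y x] by (simp add: ip_scaleC star_scaleC)
qed

lemma ip_act_left:
  assumes "x \<in> hcarrier E" "y \<in> hcarrier E"
  shows "hip E (hact E x b) y = b\<^sup>\<star> * hip E x y"
proof -
  have "hip E (hact E x b) y = (hip E y (hact E x b))\<^sup>\<star>"
    using assms by (intro ip_star) auto
  then show ?thesis
    using assms ip_star[of y x] by (simp add: ip_act star_mult)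
qed

lemma ip_diff: "x \<in> hcarrier E \<Longrightarrow> y \<in> hcarrier E \<Longrightarrow> z \<in> hcarrier E \<Longrightarrow> hip E x (y - z) = hip E x y - hip E x z"
  using ip_add[of x "y - z" z] by simp

lemma ip_diff_left: "x \<in> hcarrier E \<Longrightarrow> y \<in> hcarrier E \<Longrightarrow> z \<in> hcarrier E \<Longrightarrow> hip E (x - y) z = hip E x z - hip E y z"
  using ip_add_left[of "x - y" y z] by simp

lemma ip_zero [simp]: "x \<in> hcarrier E \<Longrightarrow> hip E x 0 = 0" "x \<in> hcarrier E \<Longrightarrow> hip E 0 x = 0"
  using ip_diff[of x x x] ip_diff_left[of x x x] by auto

lemma hnorm_nonneg [simp]: "0 \<le> hnorm E x"
  by (simp add: hnorm_def)

lemma hnorm_square: "(hnorm E x)\<^sup>2 = norm (hip E x x)"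
  by (simp add: hnorm_def)

lemma hnorm_zero [simp]: "hnorm E 0 = 0"
  by (simp add: hnorm_def)

lemma hnorm_eq_0: "x \<in> hcarrier E \<Longrightarrow> hnorm E x = 0 \<longleftrightarrow> x = 0"
  using ip_definite[of x] by (auto simp: hnorm_def)

text \<open>With \<open>a = \<langle>x, y\<rangle>\<close> and \<open>k = \<parallel>\<langle>x, x\<rangle>\<parallel>\<close>, expand \<open>\<langle>u, u\<rangle>\<close> for \<open>u = x a - k y\<close> and use
  \<open>a\<^sup>* \<langle>x, x\<rangle> a \<le> k a\<^sup>* a\<close>.\<close>

lemma Cauchy_Schwarz:
  assumes x: "x \<in> hcarrier E" and y: "y \<in> hcarrier E"
  shows "norm (hip E x y) \<le> hnorm E x * hnorm E y"
proof (cases "hip E x x = 0")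
  case True
  then have "x = 0"
    using x ip_definite by blast
  then show ?thesis
    using y by simp
next
  case False
  define k where "k = norm (hip E x x)"
  have k: "k > 0"
    using False by (simp add: k_def)
  define a where "a = hip E x y"
  define u where "u = hact E x a - complex_of_real k *\<^sub>C y"
  have ya: "hip E y x = a\<^sup>\<star>"
    using x y ip_star[of x y] by (simp add: a_def)
  have kC: "complex_of_real k *\<^sub>C b = k *\<^sub>R b" for b :: 'b
    by (simp add: scaleR_scaleC)
  have uu: "hip E u u = a\<^sup>\<star> * hip E x x * a - (2 * k) *\<^sub>R (a\<^sup>\<star> * a) + k\<^sup>2 *\<^sub>R hip E y y"
    using x y unfolding u_def
    by (simp add: ip_diff ip_diff_left ip_act ip_act_left ip_scaleC ip_scaleC_left ya a_def[symmetric] kC mult.assoc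
        power2_eq_square algebra_simps) (simp flip: scaleR_left_distrib)
  have "pos ((inc a)\<^sup>\<star> * (k *\<^sub>R 1 - inc (hip E x x)) * inc a)"
    using x y cstar_positive_star[OF ip_positive[OF x]]
    by (intro pos_conj pos_of_norm_le) (auto simp: k_def inc_simps)
  then have "pos (inc (k *\<^sub>R (a\<^sup>\<star> * a) - a\<^sup>\<star> * hip E x x * a))"
    by (simp add: algebra_simps inc_simps)
  moreover have "pos (inc (hip E u u))"
    using x y by (intro iffD1[OF cstar_positive_iff_pos] ip_positive) (auto simp: u_def)
  ultimately have "pos (inc (k *\<^sub>R (a\<^sup>\<star> * a) - a\<^sup>\<star> * hip E x x * a) + inc (hip E u u))"
    by (rule pos_add)
  also have "inc (k *\<^sub>R (a\<^sup>\<star> * a) - a\<^sup>\<star> * hip E x x * a) + inc (hip E u u)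
      = inc (k\<^sup>2 *\<^sub>R hip E y y - k *\<^sub>R (a\<^sup>\<star> * a))"
    unfolding uu inc_simps by (simp add: algebra_simps scaleR_2)
      (simp flip: scaleR_left_distrib)
  finally have "cstar_positive (k\<^sup>2 *\<^sub>R hip E y y - k *\<^sub>R (a\<^sup>\<star> * a))"
    by (simp add: cstar_positive_iff_pos)
  moreover have "cstar_positive (k *\<^sub>R (a\<^sup>\<star> * a))"
    unfolding cstar_positive_iff_pos using k pos_scaleR[OF pos_star_mult_self[of "inc a"], of k]
    by (simp add: inc_simps)
  ultimately have "norm (k *\<^sub>R (a\<^sup>\<star> * a)) \<le> norm (k\<^sup>2 *\<^sub>R hip E y y)"
    by (intro cstar_positive_norm_mono)
  then have "k * (norm a)\<^sup>2 \<le> k * (k * norm (hip E y y))"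
    using k by (simp add: cstar_identity power2_eq_square mult.assoc)
  then have "(norm a)\<^sup>2 \<le> (hnorm E x * hnorm E y)\<^sup>2"
    using k by (simp add: power_mult_distrib hnorm_square k_def)
  then show ?thesis
    unfolding a_def by (rule power2_le_imp_le) simp
qed

lemma hnorm_triangle:
  assumes x: "x \<in> hcarrier E" and y: "y \<in> hcarrier E"
  shows "hnorm E (x + y) \<le> hnorm E x + hnorm E y"
proof (rule power2_le_imp_le)
  have "hip E (x + y) (x + y) = (hip E x x + hip E x y) + (hip E y x + hip E y y)"
    using x y by (simp add: ip_add ip_add_left)
  then have "(hnorm E (x + y))\<^sup>2 \<le> (norm (hip E x x) + norm (hip E x y)) + (norm (hip E y x) + norm (hip E y y))"
    unfolding hnorm_square by (metis norm_triangle_mono norm_triangle_ineq)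
  also have "\<dots> \<le> ((hnorm E x)\<^sup>2 + hnorm E x * hnorm E y) + (hnorm E y * hnorm E x + (hnorm E y)\<^sup>2)"
    unfolding hnorm_square by (intro add_mono order_refl Cauchy_Schwarz x y)
  finally show "(hnorm E (x + y))\<^sup>2 \<le> (hnorm E x + hnorm E y)\<^sup>2"
    by (simp add: power2_eq_square algebra_simps)
qed simp

lemma hnorm_scaleC: "x \<in> hcarrier E \<Longrightarrow> hnorm E (c *\<^sub>C x) = cmod c * hnorm E x"
proof -
  assume "x \<in> hcarrier E"
  then have "(hnorm E (c *\<^sub>C x))\<^sup>2 = (cmod c * hnorm E x)\<^sup>2"
    by (simp add: hnorm_square ip_scaleC ip_scaleC_left norm_scaleC power_mult_distrib norm_mult)
      (simp add: power2_eq_square)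
  then show ?thesis
    by simp
qed

lemma hnorm_minus: "x \<in> hcarrier E \<Longrightarrow> hnorm E (- x) = hnorm E x"
  using hnorm_scaleC[of x "-1"] by (simp add: scaleC_one)

lemma hnorm_minus_commute: "x \<in> hcarrier E \<Longrightarrow> y \<in> hcarrier E \<Longrightarrow> hnorm E (x - y) = hnorm E (y - x)"
  using hnorm_minus[of "x - y"] by simp

lemma hnorm_diff_triangle:
  "x \<in> hcarrier E \<Longrightarrow> y \<in> hcarrier E \<Longrightarrow> z \<in> hcarrier E \<Longrightarrow> hnorm E (x - z) \<le> hnorm E (x - y) + hnorm E (y - z)"
  using hnorm_triangle[of "x - y" "y - z"] by simp

lemma hnorm_triangle4: "x \<in> hcarrier E \<Longrightarrow> y \<in> hcarrier E \<Longrightarrow> hnorm E (x - y) \<le> hnorm E x + hnorm E y"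
  using hnorm_triangle[of x "- y"] by (simp add: hnorm_minus)

lemma hnorm_act_le:
  assumes "x \<in> hcarrier E"
  shows "hnorm E (hact E x b) \<le> hnorm E x * norm b"
proof (rule power2_le_imp_le)
  have "(hnorm E (hact E x b))\<^sup>2 = norm (b\<^sup>\<star> * hip E x x * b)"
    using assms by (simp add: hnorm_square ip_act ip_act_left mult.assoc)
  also have "\<dots> \<le> norm (b\<^sup>\<star>) * norm (hip E x x) * norm b"
    by (meson norm_mult_ineq mult_right_mono norm_ge_zero order_trans)
  also have "\<dots> = (hnorm E x * norm b)\<^sup>2"
    by (simp add: norm_star power_mult_distrib hnorm_square) (simp add: power2_eq_square)
  finally show "(hnorm E (hact E x b))\<^sup>2 \<le> (hnorm E x * norm b)\<^sup>2" .
qed simp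

lemma eq_if_ip_eq:
  assumes "x \<in> hcarrier E" "y \<in> hcarrier E" "\<And>z. z \<in> hcarrier E \<Longrightarrow> hip E z x = hip E z y"
  shows "x = y"
proof -
  have "hip E (x - y) (x - y) = 0"
    using assms by (simp add: ip_diff)
  then show ?thesis
    using ip_definite[of "x - y"] assms by simp
qed

lemma hnorm_le_if_ip_le:
  assumes x: "x \<in> hcarrier E" and le: "norm (hip E x x) \<le> c * hnorm E x" and c: "c \<ge> 0"
  shows "hnorm E x \<le> c"
proof (cases "hnorm E x = 0")
  case False
  then show ?thesis
    using le hnorm_nonneg[of x] unfolding hnorm_square[symmetric]
    by (simp add: power2_eq_square)
qed (use c in simp)

lemma ip_tendsto:
  assumes "\<And>n. X n \<in> hcarrier E" "x \<in> hcarrier E" "y \<in> hcarrier E" "(\<lambda>n. hnorm E (X n - x)) \<longlonglongrightarrow> 0"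
  shows "(\<lambda>n. hip E (X n) y) \<longlonglongrightarrow> hip E x y" and "(\<lambda>n. hip E y (X n)) \<longlonglongrightarrow> hip E y x"
proof -
  have "(\<lambda>n. hnorm E (X n - x) * hnorm E y) \<longlonglongrightarrow> 0 * hnorm E y" "(\<lambda>n. hnorm E y * hnorm E (X n - x)) \<longlonglongrightarrow> hnorm E y * 0"
    by (intro tendsto_intros assms)+
  then have 0: "(\<lambda>n. hnorm E (X n - x) * hnorm E y) \<longlonglongrightarrow> 0" "(\<lambda>n. hnorm E y * hnorm E (X n - x)) \<longlonglongrightarrow> 0"
    by simp_all
  have "(\<lambda>n. hip E (X n) y - hip E x y) \<longlonglongrightarrow> 0"
    by (rule Lim_null_comparison[OF always_eventually 0(1)])
      (use assms Cauchy_Schwarz[of "X _ - x" y] in \<open>auto simp: ip_diff_left\<close>)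
  then show "(\<lambda>n. hip E (X n) y) \<longlonglongrightarrow> hip E x y"
    by (rule LIM_zero_cancel)
  have "(\<lambda>n. hip E y (X n) - hip E y x) \<longlonglongrightarrow> 0"
    by (rule Lim_null_comparison[OF always_eventually 0(2)])
      (use assms Cauchy_Schwarz[of y "X _ - x"] in \<open>auto simp: ip_diff\<close>)
  then show "(\<lambda>n. hip E y (X n)) \<longlonglongrightarrow> hip E y x"
    by (rule LIM_zero_cancel)
qed

end

subsection \<open>Adjointable maps\<close>

locale hilbert_pair = dom: hilbert_module E + cod: hilbert_module E'
  for E :: "('e::complex_vector, 'b::cstar_algebra, 'y) hmod_scheme"
    and E' :: "('f::complex_vector, 'b, 'z) hmod_scheme"
begin

lemma adjointable_mem: "T \<in> adjointable E E' \<Longrightarrow> x \<in> hcarrier E \<Longrightarrow> T x \<in> hcarrier E'"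
  by (auto simp: adjointable_def op_maps_def)

lemma adjointable_off: "T \<in> adjointable E E' \<Longrightarrow> x \<notin> hcarrier E \<Longrightarrow> T x = 0"
  by (auto simp: adjointable_def op_maps_def)

lemma adj_unique:
  assumes "S \<in> op_maps E' E" "S' \<in> op_maps E' E" "is_adjoint E E' T S" "is_adjoint E E' T S'"
  shows "S = S'"
proof
  fix y show "S y = S' y"
  proof (cases "y \<in> hcarrier E'")
    case True
    with assms show ?thesis
      by (intro dom.eq_if_ip_eq) (auto simp: op_maps_def is_adjoint_def)
  qed (use assms in \<open>auto simp: op_maps_def\<close>)
qed

lemma adj_props:
  assumes "T \<in> adjointable E E'"
  shows "adj E E' T \<in> op_maps E' E" "is_adjoint E E' T (adj E E' T)"
proof -
  obtain S where S: "S \<in> op_maps E' E" "is_adjoint E E' T S"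
    using assms by (auto simp: adjointable_def)
  then have "adj E E' T = S"
    unfolding adj_def using adj_unique by blast
  with S show "adj E E' T \<in> op_maps E' E" "is_adjoint E E' T (adj E E' T)"
    by simp_all
qed

lemma adj_eqI: "T \<in> adjointable E E' \<Longrightarrow> S \<in> op_maps E' E \<Longrightarrow> is_adjoint E E' T S \<Longrightarrow> adj E E' T = S"
  using adj_props adj_unique by blast

lemma ip_adj: "T \<in> adjointable E E' \<Longrightarrow> x \<in> hcarrier E \<Longrightarrow> y \<in> hcarrier E' \<Longrightarrow> hip E' (T x) y = hip E x (adj E E' T y)"
  using adj_props[of T] by (auto simp: is_adjoint_def)

lemma is_adjoint_sym: "T \<in> op_maps E E' \<Longrightarrow> S \<in> op_maps E' E \<Longrightarrow> is_adjoint E E' T S \<Longrightarrow> is_adjoint E' E S T"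
  unfolding is_adjoint_def op_maps_def
  by safe (metis cod.ip_star dom.ip_star)

lemma adjointableI: "T \<in> op_maps E E' \<Longrightarrow> S \<in> op_maps E' E \<Longrightarrow> is_adjoint E E' T S \<Longrightarrow> T \<in> adjointable E E'"
  by (auto simp: adjointable_def)

lemma adj_adjointable: "T \<in> adjointable E E' \<Longrightarrow> adj E E' T \<in> adjointable E' E"
  using adj_props[of T] is_adjoint_sym[of T "adj E E' T"] by (auto simp: adjointable_def)

lemma adj_mem: "T \<in> adjointable E E' \<Longrightarrow> y \<in> hcarrier E' \<Longrightarrow> adj E E' T y \<in> hcarrier E"
  using adj_props[of T] by (auto simp: op_maps_def)

lemma adjointable_add: "T \<in> adjointable E E' \<Longrightarrow> x \<in> hcarrier E \<Longrightarrow> y \<in> hcarrier E \<Longrightarrow> T (x + y) = T x + T y"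
proof (rule cod.eq_if_ip_eq)
  assume *: "T \<in> adjointable E E'" "x \<in> hcarrier E" "y \<in> hcarrier E"
  fix z assume z: "z \<in> hcarrier E'"
  have "hip E' (T (x + y)) z = hip E' (T x + T y) z"
    using * z by (simp add: ip_adj dom.ip_add_left cod.ip_add_left adj_mem adjointable_mem)
  then show "hip E' z (T (x + y)) = hip E' z (T x + T y)"
    using * z cod.ip_star[of "T (x + y)" z] cod.ip_star[of "T x + T y" z] by (simp add: adjointable_mem)
qed (auto simp: adjointable_mem)

lemma adjointable_scaleC: "T \<in> adjointable E E' \<Longrightarrow> x \<in> hcarrier E \<Longrightarrow> T (c *\<^sub>C x) = c *\<^sub>C T x"
proof (rule cod.eq_if_ip_eq)
  assume *: "T \<in> adjointable E E'" "x \<in> hcarrier E"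
  fix z assume z: "z \<in> hcarrier E'"
  have "hip E' (T (c *\<^sub>C x)) z = hip E' (c *\<^sub>C T x) z"
    using * z by (simp add: ip_adj dom.ip_scaleC_left cod.ip_scaleC_left adj_mem adjointable_mem)
  then show "hip E' z (T (c *\<^sub>C x)) = hip E' z (c *\<^sub>C T x)"
    using * z cod.ip_star[of "T (c *\<^sub>C x)" z] cod.ip_star[of "c *\<^sub>C T x" z] by (simp add: adjointable_mem)
qed (auto simp: adjointable_mem)

lemma adjointable_act: "T \<in> adjointable E E' \<Longrightarrow> x \<in> hcarrier E \<Longrightarrow> T (hact E x b) = hact E' (T x) b"
proof (rule cod.eq_if_ip_eq)
  assume *: "T \<in> adjointable E E'" "x \<in> hcarrier E"
  fix z assume z: "z \<in> hcarrier E'"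
  have "hip E' (T (hact E x b)) z = hip E' (hact E' (T x) b) z"
    using * z by (simp add: ip_adj dom.ip_act_left cod.ip_act_left adj_mem adjointable_mem)
  then show "hip E' z (T (hact E x b)) = hip E' z (hact E' (T x) b)"
    using * z cod.ip_star[of "T (hact E x b)" z] cod.ip_star[of "hact E' (T x) b" z] by (simp add: adjointable_mem)
qed (auto simp: adjointable_mem)

lemma adjointable_zero: "T \<in> adjointable E E' \<Longrightarrow> T 0 = 0"
  using adjointable_scaleC[of T 0 0] by (simp add: complex_vector.scale_zero_left)

lemma adjointable_uminus: "T \<in> adjointable E E' \<Longrightarrow> x \<in> hcarrier E \<Longrightarrow> T (- x) = - T x"
  using adjointable_scaleC[of T x "-1"] by (simp add: scaleC_one)

lemma adjointable_diff: "T \<in> adjointable E E' \<Longrightarrow> x \<in> hcarrier E \<Longrightarrow> y \<in> hcarrier E \<Longrightarrow> T (x - y) = T x - T y"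
  using adjointable_add[of T x "- y"] by (simp add: adjointable_uminus)

lemma adjointable_ext:
  assumes "T \<in> adjointable E E'" "S \<in> adjointable E E'" "\<And>x. x \<in> hcarrier E \<Longrightarrow> T x = S x"
  shows "T = S"
proof
  show "T x = S x" for x
    using assms(3) adjointable_off[OF assms(1)] adjointable_off[OF assms(2)] by (cases "x \<in> hcarrier E") auto
qed

text \<open>Uniform boundedness of the functionals \<open>y \<mapsto> \<langle>T y\<^sub>n, y\<rangle> = \<langle>y\<^sub>n, T\<^sup>* y\<rangle>\<close> with \<open>\<parallel>y\<^sub>n\<parallel> \<le> 1\<close>, by Sokal's argument: if
  \<open>\<parallel>T y\<^sub>n\<parallel> > 4\<^sup>n\<close>, one of \<open>x \<plusminus> 3\<^sup>-\<^sup>n T y\<^sub>n / \<parallel>T y\<^sub>n\<parallel>\<close> makes the \<open>n\<close>-th functional large whatever \<open>x\<close> is,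
  and the later steps are too small to spoil this.\<close>

lemma adjointable_bounded:
  assumes T: "T \<in> adjointable E E'"
  shows "\<exists>K\<ge>0. \<forall>x\<in>hcarrier E. hnorm E' (T x) \<le> K * hnorm E x"
proof (rule ccontr)
  assume unbdd: "\<not> ?thesis"
  have "\<exists>y. y \<in> hcarrier E \<and> hnorm E y \<le> 1 \<and> hnorm E' (T y) > 4 ^ n" for n
  proof -
    obtain x where x: "x \<in> hcarrier E" "hnorm E' (T x) > 4 ^ n * hnorm E x"
      using unbdd by (metis linorder_not_less zero_le_numeral zero_le_power)
    have nz: "hnorm E x \<noteq> 0"
    proof
      assume "hnorm E x = 0"
      then have "x = 0"
        using x dom.hnorm_eq_0 by blast
      with x(2) T show False
        by (simp add: adjointable_zero)
    qed
    then have "hnorm E x > 0"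
      using dom.hnorm_nonneg[of x] by linarith
    with x T show ?thesis
      by (intro exI[of _ "complex_of_real (1 / hnorm E x) *\<^sub>C x"])
        (simp add: adjointable_scaleC dom.hnorm_scaleC cod.hnorm_scaleC adjointable_mem norm_divide field_simps)
  qed
  then obtain y where y: "\<And>n. y n \<in> hcarrier E" "\<And>n. hnorm E (y n) \<le> 1" "\<And>n. hnorm E' (T (y n)) > 4 ^ n"
    by metis
  define t where "t n = hnorm E' (T (y n))" for n
  have t: "t n > 4 ^ n" "t n > 0" for n
    using y(3)[of n] less_trans[OF zero_less_power y(3), of n] by (auto simp: t_def)
  define d where "d n = complex_of_real ((1/3) ^ n / t n) *\<^sub>C T (y n)" for n
  have d: "d n \<in> hcarrier E'" for n
    using T y by (simp add: d_def adjointable_mem)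
  have nd: "hnorm E' (d n) = (1/3) ^ n" for n
    using T y t(2)[of n] by (simp add: d_def cod.hnorm_scaleC adjointable_mem norm_divide norm_power flip: t_def)
  define \<phi> where "\<phi> n z = hip E' (T (y n)) z" for n z
  have \<phi>d: "norm (\<phi> n (d n)) = (1/3) ^ n * t n" for n
  proof -
    have "norm (\<phi> n (d n)) = (1/3) ^ n / t n * (t n)\<^sup>2"
      unfolding \<phi>_def d_def using T y t(2)[of n]
      by (simp add: cod.ip_scaleC adjointable_mem norm_scaleC norm_divide norm_power t_def cod.hnorm_square)
    then show ?thesis
      using t(2)[of n] by (simp add: power2_eq_square)
  qed
  define X where "X = rec_nat 0 (\<lambda>n x. if norm (\<phi> n (x + d n)) \<ge> norm (\<phi> n (d n)) then x + d n else x - d n)"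
  have X0: "X 0 = 0" and XSuc: "X (Suc n) = (if norm (\<phi> n (X n + d n)) \<ge> norm (\<phi> n (d n)) then X n + d n else X n - d n)" for n
    by (simp_all add: X_def)
  have X: "X n \<in> hcarrier E'" for n
    by (induction n) (simp_all add: X0 XSuc d)
  have step: "hnorm E' (X (Suc n) - X n) = (1/3) ^ n" for n
    using nd[of n] d[of n] by (simp add: XSuc cod.hnorm_minus)
  have big: "norm (\<phi> n (X (Suc n))) \<ge> (1/3) ^ n * t n" for n
  proof (cases "norm (\<phi> n (X n + d n)) \<ge> norm (\<phi> n (d n))")
    case True
    then show ?thesis
      by (simp add: XSuc \<phi>d)
  next
    case False
    have Ty: "T (y n) \<in> hcarrier E'"
      using T y by (simp add: adjointable_mem)
    have "2 *\<^sub>R \<phi> n (d n) = \<phi> n (X n + d n) - \<phi> n (X n - d n)"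
      using X[of n] d[of n] Ty by (simp add: \<phi>_def cod.ip_add cod.ip_diff scaleR_2)
    then have "2 * norm (\<phi> n (d n)) \<le> norm (\<phi> n (X n + d n)) + norm (\<phi> n (X n - d n))"
      by (metis norm_scaleR norm_triangle_ineq4 abs_numeral)
    with False show ?thesis
      by (simp add: XSuc \<phi>d)
  qed
  have tail: "hnorm E' (X (n + k) - X n) \<le> (3/2) * ((1/3) ^ n - (1/3) ^ (n + k))" for n k
  proof (induction k)
    case (Suc k)
    have "hnorm E' (X (n + Suc k) - X n) \<le> hnorm E' (X (Suc (n + k)) - X (n + k)) + hnorm E' (X (n + k) - X n)"
      using cod.hnorm_diff_triangle[of "X (n + Suc k)" "X (n + k)" "X n"] X by simp
    also have "\<dots> \<le> (1/3) ^ (n + k) + (3/2) * ((1/3) ^ n - (1/3) ^ (n + k))"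
      using Suc by (simp add: step)
    finally show ?case
      by (simp add: algebra_simps)
  qed simp
  have tail': "hnorm E' (X m - X n) \<le> (3/2) * (1/3) ^ n" if "m \<ge> n" for m n
    using tail[of n "m - n"] that by (simp add: algebra_simps) (smt (verit) divide_pos_pos zero_less_power)
  have "\<forall>e>0. \<exists>N. \<forall>m\<ge>N. \<forall>n\<ge>N. hnorm E' (X m - X n) < e"
  proof (intro allI impI)
    fix e :: real assume "e > 0"
    have "(\<lambda>n. (3/2) * (1/3::real) ^ n) \<longlonglongrightarrow> (3/2) * 0"
      by (intro tendsto_intros LIMSEQ_power_zero) auto
    from LIMSEQ_D[OF this \<open>e > 0\<close>] obtain N where N: "\<And>n. n \<ge> N \<Longrightarrow> (3/2) * (1/3::real) ^ n < e"
      by auto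
    have "hnorm E' (X m - X n) < e" if "m \<ge> N" "n \<ge> N" for m n
    proof (cases "m \<ge> n")
      case True
      then show ?thesis
        using tail' N that by (meson le_less_trans)
    next
      case False
      then show ?thesis
        using tail'[of m n] N[of m] that X cod.hnorm_minus_commute[of "X m" "X n"] by (simp add: le_less_trans)
    qed
    then show "\<exists>N. \<forall>m\<ge>N. \<forall>n\<ge>N. hnorm E' (X m - X n) < e"
      by blast
  qed
  then obtain x where x: "x \<in> hcarrier E'" "(\<lambda>n. hnorm E' (X n - x)) \<longlonglongrightarrow> 0"
    using cod.complete[of X] X by blast
  have close: "hnorm E' (X (Suc n) - x) \<le> (1/2) * (1/3) ^ n" for n
  proof (rule LIMSEQ_le_const)
    have "(\<lambda>m. (1/2) * (1/3) ^ n + hnorm E' (X m - x)) \<longlonglongrightarrow> (1/2) * (1/3) ^ n + 0"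
      by (intro tendsto_intros x)
    then show "(\<lambda>m. (1/2) * (1/3) ^ n + hnorm E' (X m - x)) \<longlonglongrightarrow> (1/2) * (1/3) ^ n"
      by simp
    have "hnorm E' (X (Suc n) - x) \<le> (1/2) * (1/3) ^ n + hnorm E' (X m - x)" if "m \<ge> Suc n" for m
    proof -
      have "hnorm E' (X (Suc n) - x) \<le> hnorm E' (X (Suc n) - X m) + hnorm E' (X m - x)"
        using X x by (intro cod.hnorm_diff_triangle) auto
      also have "hnorm E' (X (Suc n) - X m) \<le> (1/2) * (1/3) ^ n"
        using tail'[OF that] X cod.hnorm_minus_commute[of "X (Suc n)" "X m"] by simp
      finally show ?thesis by simp
    qed
    then show "\<exists>N. \<forall>m\<ge>N. hnorm E' (X (Suc n) - x) \<le> (1/2) * (1/3) ^ n + hnorm E' (X m - x)"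
      by blast
  qed
  define S where "S = adj E E' T"
  have lower: "(1/2) * (4/3) ^ n \<le> hnorm E (S x)" for n
  proof -
    have Ty: "T (y n) \<in> hcarrier E'"
      using T y by (simp add: adjointable_mem)
    have 1: "norm (\<phi> n (X (Suc n) - x)) \<le> t n * ((1/2) * (1/3) ^ n)"
    proof -
      have "norm (\<phi> n (X (Suc n) - x)) \<le> t n * hnorm E' (X (Suc n) - x)"
        using cod.Cauchy_Schwarz[OF Ty, of "X (Suc n) - x"] X x by (simp add: \<phi>_def t_def)
      also have "\<dots> \<le> t n * ((1/2) * (1/3) ^ n)"
        using close[of n] t(2)[of n] by (intro mult_left_mono) auto
      finally show ?thesis .
    qed
    have 2: "\<phi> n (X (Suc n)) = \<phi> n x + \<phi> n (X (Suc n) - x)"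
      using X x Ty by (simp add: \<phi>_def cod.ip_diff)
    have "(1/3) ^ n * t n \<le> norm (\<phi> n x) + t n * ((1/2) * (1/3) ^ n)"
      using 1 big[of n, unfolded 2] norm_triangle_ineq[of "\<phi> n x" "\<phi> n (X (Suc n) - x)"] by linarith
    then have "(1/2) * ((1/3) ^ n * t n) \<le> norm (\<phi> n x)"
      by (simp add: algebra_simps)
    also have "\<phi> n x = hip E (y n) (S x)"
      unfolding \<phi>_def S_def using T y x by (simp add: ip_adj)
    also have "norm \<dots> \<le> hnorm E (y n) * hnorm E (S x)"
      using T y x by (intro dom.Cauchy_Schwarz) (auto simp: S_def adj_mem)
    also have "\<dots> \<le> 1 * hnorm E (S x)"
      by (intro mult_right_mono y) simp
    finally have "(1/2) * ((1/3) ^ n * t n) \<le> hnorm E (S x)"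
      by simp
    moreover have "(4/3) ^ n \<le> (1/3) ^ n * t n"
      using mult_left_mono[OF less_imp_le[OF t(1)[of n]], of "(1/3) ^ n"] by (simp flip: power_mult_distrib)
    ultimately show ?thesis
      by linarith
  qed
  obtain n where "2 * hnorm E (S x) < (4/3) ^ n"
    using real_arch_pow[of "4/3" "2 * hnorm E (S x)"] by auto
  with lower[of n] show False
    by simp
qed

end

lemma adj_adj:
  assumes "hilbert_module E" "hilbert_module E'" "T \<in> adjointable E E'"
  shows "adj E' E (adj E E' T) = T"
proof -
  interpret EE: hilbert_pair E E' using assms by (simp add: hilbert_pair_def)
  interpret EE': hilbert_pair E' E using assms by (simp add: hilbert_pair_def)
  show ?thesis
  proof (rule EE'.adj_eqI)
    show "adj E E' T \<in> adjointable E' E" "T \<in> op_maps E E'"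
      using assms EE.adj_adjointable by (auto simp: adjointable_def)
    then show "is_adjoint E' E (adj E E' T) T"
      using EE.is_adjoint_sym EE.adj_props assms by blast
  qed
qed

lemma adjointable_comp:
  assumes "hilbert_module E" "hilbert_module E'" "hilbert_module E''"
    and T: "T \<in> adjointable E E'" and S: "S \<in> adjointable E' E''"
  shows "S \<circ> T \<in> adjointable E E''" "adj E E'' (S \<circ> T) = adj E E' T \<circ> adj E' E'' S"
proof -
  interpret A: hilbert_pair E E' using assms by (simp add: hilbert_pair_def)
  interpret B: hilbert_pair E' E'' using assms by (simp add: hilbert_pair_def)
  interpret C: hilbert_pair E E'' using assms by (simp add: hilbert_pair_def)
  interpret A': hilbert_pair E' E using assms by (simp add: hilbert_pair_def)
  note m = A.adjointable_mem[OF T] B.adjointable_mem[OF S] A.adj_mem[OF T] B.adj_mem[OF S]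
  have 1: "S \<circ> T \<in> op_maps E E''"
    using m A.adjointable_off[OF T] B.adjointable_zero[OF S] by (auto simp: op_maps_def)
  have 2: "adj E E' T \<circ> adj E' E'' S \<in> op_maps E'' E"
    using m A'.adjointable_zero[OF A.adj_adjointable[OF T]] B.adj_props(1)[OF S] by (auto simp: op_maps_def)
  have 3: "is_adjoint E E'' (S \<circ> T) (adj E E' T \<circ> adj E' E'' S)"
    using m by (auto simp: is_adjoint_def A.ip_adj[OF T] B.ip_adj[OF S])
  show "S \<circ> T \<in> adjointable E E''"
    by (rule C.adjointableI[OF 1 2 3])
  then show "adj E E'' (S \<circ> T) = adj E E' T \<circ> adj E' E'' S"
    using 2 3 by (intro C.adj_eqI)
qed

context hilbert_module
begin

sublocale self: hilbert_pair E E
  by (simp add: hilbert_pair_def hilbert_module_axioms)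

lemmas End_mem = self.adjointable_mem and End_off = self.adjointable_off
  and End_add_apply = self.adjointable_add and End_diff_apply = self.adjointable_diff
  and End_scaleC_apply = self.adjointable_scaleC and End_zero_apply = self.adjointable_zero
  and End_adj = self.adj_adjointable and End_ext = self.adjointable_ext

lemma End_mem_all: "T \<in> End_ops E \<Longrightarrow> T x \<in> hcarrier E"
  using End_mem End_off zero_mem by metis

lemma End_adj_adj: "T \<in> End_ops E \<Longrightarrow> adj E E (adj E E T) = T"
  by (rule adj_adj) (auto intro: hilbert_module_axioms)

lemma End_comp: "S \<in> End_ops E \<Longrightarrow> T \<in> End_ops E \<Longrightarrow> S \<circ> T \<in> End_ops E"
  "S \<in> End_ops E \<Longrightarrow> T \<in> End_ops E \<Longrightarrow> adj E E (S \<circ> T) = adj E E T \<circ> adj E E S"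
  using adjointable_comp[OF hilbert_module_axioms hilbert_module_axioms hilbert_module_axioms] by blast+

lemma ip_adj_left: "T \<in> End_ops E \<Longrightarrow> x \<in> hcarrier E \<Longrightarrow> y \<in> hcarrier E \<Longrightarrow> hip E (adj E E T x) y = hip E x (T y)"
  using self.ip_adj[OF End_adj, of T x y] by (simp add: End_adj_adj)

lemma End_plus:
  assumes "S \<in> End_ops E" "T \<in> End_ops E"
  shows "S + T \<in> End_ops E" "adj E E (S + T) = adj E E S + adj E E T"
proof -
  have 1: "S + T \<in> op_maps E E" "adj E E S + adj E E T \<in> op_maps E E"
    using assms End_adj by (auto simp: op_maps_def End_mem End_off)
  have 2: "is_adjoint E E (S + T) (adj E E S + adj E E T)"
    using assms by (auto simp: is_adjoint_def ip_add ip_add_left End_mem End_adj self.ip_adj)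
  show "S + T \<in> End_ops E"
    using 1 2 by (intro self.adjointableI)
  then show "adj E E (S + T) = adj E E S + adj E E T"
    using 1 2 by (intro self.adj_eqI)
qed

lemma End_scale:
  assumes "T \<in> End_ops E"
  shows "c *\<^sub>C T \<in> End_ops E" "adj E E (c *\<^sub>C T) = cnj c *\<^sub>C adj E E T"
proof -
  have 1: "c *\<^sub>C T \<in> op_maps E E" "cnj c *\<^sub>C adj E E T \<in> op_maps E E"
    using assms End_adj by (auto simp: op_maps_def End_mem End_off scaleC_fun_def)
  have 2: "is_adjoint E E (c *\<^sub>C T) (cnj c *\<^sub>C adj E E T)"
    using assms by (auto simp: is_adjoint_def ip_scaleC ip_scaleC_left End_mem End_adj self.ip_adj scaleC_fun_def)
  show "c *\<^sub>C T \<in> End_ops E"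
    using 1 2 by (intro self.adjointableI)
  then show "adj E E (c *\<^sub>C T) = cnj c *\<^sub>C adj E E T"
    using 1 2 by (intro self.adj_eqI)
qed

lemma End_uminus: "T \<in> End_ops E \<Longrightarrow> - T \<in> End_ops E" "T \<in> End_ops E \<Longrightarrow> adj E E (- T) = - adj E E T"
  using End_scale[of T "-1"] by (simp_all add: scaleC_one)

lemma End_minus:
  assumes "S \<in> End_ops E" "T \<in> End_ops E"
  shows "S - T \<in> End_ops E" "adj E E (S - T) = adj E E S - adj E E T"
  using End_plus[of S "- T"] assms by (simp_all add: End_uminus)

lemma End_0: "0 \<in> End_ops E" "adj E E 0 = 0"
proof -
  have "0 \<in> op_maps E E" "is_adjoint E E 0 0"
    by (auto simp: op_maps_def is_adjoint_def)
  then show "0 \<in> End_ops E" "adj E E 0 = 0"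
    using self.adjointableI self.adj_eqI by blast+
qed

lemma End_id: "id_op E \<in> End_ops E" "adj E E (id_op E) = id_op E"
proof -
  have "id_op E \<in> op_maps E E" "is_adjoint E E (id_op E) (id_op E)"
    by (auto simp: op_maps_def is_adjoint_def id_op_def)
  then show "id_op E \<in> End_ops E" "adj E E (id_op E) = id_op E"
    using self.adjointableI self.adj_eqI by blast+
qed

lemma id_op_apply: "x \<in> hcarrier E \<Longrightarrow> id_op E x = x"
  by (simp add: id_op_def)

lemma id_op_comp: "T \<in> End_ops E \<Longrightarrow> id_op E \<circ> T = T" "T \<in> End_ops E \<Longrightarrow> T \<circ> id_op E = T"
  by (auto simp: fun_eq_iff id_op_def End_mem_all End_off End_zero_apply)

lemma End_comp_plus:
  assumes "S \<in> End_ops E" "T \<in> End_ops E" "U \<in> End_ops E"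
  shows "S \<circ> (T + U) = (S \<circ> T) + (S \<circ> U)" "S \<circ> (T - U) = (S \<circ> T) - (S \<circ> U)" "S \<circ> (c *\<^sub>C T) = c *\<^sub>C (S \<circ> T)"
  using assms by (auto simp: fun_eq_iff End_add_apply End_diff_apply End_scaleC_apply End_mem_all scaleC_fun_def)

subsection \<open>The operator norm\<close>

lemma op_norm_bdd: "T \<in> End_ops E \<Longrightarrow> bdd_above ((\<lambda>x. hnorm E (T x)) ` {x \<in> hcarrier E. hnorm E x \<le> 1})"
proof -
  assume "T \<in> End_ops E"
  then obtain K where "K \<ge> 0" "\<And>x. x \<in> hcarrier E \<Longrightarrow> hnorm E (T x) \<le> K * hnorm E x"
    using self.adjointable_bounded by blast
  then have "hnorm E (T x) \<le> K" if "x \<in> hcarrier E" "hnorm E x \<le> 1" for x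
    using that by (meson mult_left_le order_trans)
  then show ?thesis
    by (auto simp: bdd_above_def)
qed

lemma op_norm_nonneg: "T \<in> End_ops E \<Longrightarrow> 0 \<le> op_norm E T"
proof -
  assume T: "T \<in> End_ops E"
  have "hnorm E (T 0) \<le> op_norm E T"
    unfolding op_norm_def by (rule cSUP_upper[OF _ op_norm_bdd[OF T]]) simp
  then show ?thesis
    by (rule order_trans[OF hnorm_nonneg])
qed

lemma op_norm_bound:
  assumes T: "T \<in> End_ops E" and x: "x \<in> hcarrier E"
  shows "hnorm E (T x) \<le> op_norm E T * hnorm E x"
proof (cases "x = 0")
  case False
  define y where "y = complex_of_real (1 / hnorm E x) *\<^sub>C x"
  have n: "hnorm E x > 0"
    using False x hnorm_eq_0[OF x] hnorm_nonneg[of x] by linarith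
  have y: "y \<in> hcarrier E" "hnorm E y \<le> 1"
    using x n by (auto simp: y_def hnorm_scaleC norm_divide)
  have "hnorm E (T y) \<le> op_norm E T"
    unfolding op_norm_def using y by (intro cSUP_upper op_norm_bdd T) auto
  moreover have "hnorm E (T y) = hnorm E (T x) / hnorm E x"
    using T x n by (simp add: y_def End_scaleC_apply hnorm_scaleC End_mem norm_divide)
  ultimately show ?thesis
    using n by (simp add: divide_le_eq)
qed (simp add: End_zero_apply T)

lemma op_norm_le:
  assumes "K \<ge> 0" "\<And>x. x \<in> hcarrier E \<Longrightarrow> hnorm E (T x) \<le> K * hnorm E x"
  shows "op_norm E T \<le> K"
  unfolding op_norm_def
proof (rule cSUP_least)
  show "{x \<in> hcarrier E. hnorm E x \<le> 1} \<noteq> {}"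
    using zero_mem by fastforce
  show "hnorm E (T x) \<le> K" if "x \<in> {x \<in> hcarrier E. hnorm E x \<le> 1}" for x
    using that assms mult_left_le[of "hnorm E x" K] by (fastforce intro: order_trans)
qed

lemma op_norm_plus: "S \<in> End_ops E \<Longrightarrow> T \<in> End_ops E \<Longrightarrow> op_norm E (S + T) \<le> op_norm E S + op_norm E T"
proof (rule op_norm_le)
  assume *: "S \<in> End_ops E" "T \<in> End_ops E"
  fix x assume x: "x \<in> hcarrier E"
  have "hnorm E (S x + T x) \<le> hnorm E (S x) + hnorm E (T x)"
    using * x by (intro hnorm_triangle) (simp_all add: End_mem)
  then show "hnorm E ((S + T) x) \<le> (op_norm E S + op_norm E T) * hnorm E x"
    using op_norm_bound[OF *(1) x] op_norm_bound[OF *(2) x] by (simp add: distrib_right)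
qed (simp add: op_norm_nonneg)

lemma op_norm_scale: "T \<in> End_ops E \<Longrightarrow> op_norm E (c *\<^sub>C T) = cmod c * op_norm E T"
proof -
  have le: "op_norm E (c *\<^sub>C T) \<le> cmod c * op_norm E T" if T: "T \<in> End_ops E" for c T
  proof (rule op_norm_le)
    show "hnorm E ((c *\<^sub>C T) x) \<le> cmod c * op_norm E T * hnorm E x" if "x \<in> hcarrier E" for x
      using mult_left_mono[OF op_norm_bound[OF T that], of "cmod c"] T that
      by (simp add: hnorm_scaleC End_mem scaleC_fun_def mult.assoc)
  qed (simp add: op_norm_nonneg T)
  assume T: "T \<in> End_ops E"
  show ?thesis
  proof (cases "c = 0")
    case True
    then show ?thesis
      using le[OF T, of 0] op_norm_nonneg[OF End_scale(1)[OF T, of 0]] by simp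
  next
    case False
    then have "op_norm E T \<le> inverse (cmod c) * op_norm E (c *\<^sub>C T)"
      using le[OF End_scale(1)[OF T], of "inverse c" c] by (simp add: norm_inverse scaleC_scaleC scaleC_one)
    then show ?thesis
      using le[OF T, of c] False by (intro antisym) (simp_all add: field_simps)
  qed
qed

lemma op_norm_comp: "S \<in> End_ops E \<Longrightarrow> T \<in> End_ops E \<Longrightarrow> op_norm E (S \<circ> T) \<le> op_norm E S * op_norm E T"
proof (rule op_norm_le)
  assume *: "S \<in> End_ops E" "T \<in> End_ops E"
  fix x assume x: "x \<in> hcarrier E"
  have "hnorm E (S (T x)) \<le> op_norm E S * hnorm E (T x)"
    using * x by (intro op_norm_bound) (simp_all add: End_mem)
  also have "\<dots> \<le> op_norm E S * (op_norm E T * hnorm E x)"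
    using * x by (intro mult_left_mono op_norm_bound op_norm_nonneg)
  finally show "hnorm E ((S \<circ> T) x) \<le> op_norm E S * op_norm E T * hnorm E x"
    by (simp add: mult.assoc)
qed (simp add: op_norm_nonneg)

lemma op_norm_eq_0: "T \<in> End_ops E \<Longrightarrow> op_norm E T = 0 \<Longrightarrow> T = 0"
proof (rule End_ext)
  assume *: "T \<in> End_ops E" "op_norm E T = 0"
  fix x assume x: "x \<in> hcarrier E"
  have "hnorm E (T x) = 0"
    using op_norm_bound[OF *(1) x] *(2) hnorm_nonneg[of "T x"] by simp
  then show "T x = 0 x"
    using hnorm_eq_0 End_mem[OF *(1) x] by simp
qed (simp_all add: End_0)

text \<open>\<open>\<parallel>T x\<parallel>\<^sup>2 = \<parallel>\<langle>x, T\<^sup>* T x\<rangle>\<parallel>\<close>\<close>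

lemma op_norm_square: "T \<in> End_ops E \<Longrightarrow> (op_norm E T)\<^sup>2 \<le> op_norm E (adj E E T \<circ> T)"
proof -
  assume T: "T \<in> End_ops E"
  note TT = End_comp(1)[OF End_adj[OF T] T]
  have "op_norm E T \<le> sqrt (op_norm E (adj E E T \<circ> T))"
  proof (rule op_norm_le)
    fix x assume x: "x \<in> hcarrier E"
    have "(hnorm E (T x))\<^sup>2 = norm (hip E x ((adj E E T \<circ> T) x))"
      using T x by (simp add: hnorm_square self.ip_adj End_mem)
    also have "\<dots> \<le> hnorm E x * hnorm E ((adj E E T \<circ> T) x)"
      by (rule Cauchy_Schwarz[OF x End_mem[OF TT x]])
    also have "\<dots> \<le> hnorm E x * (op_norm E (adj E E T \<circ> T) * hnorm E x)"
      by (intro mult_left_mono op_norm_bound TT x) simp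
    also have "\<dots> = (sqrt (op_norm E (adj E E T \<circ> T)) * hnorm E x)\<^sup>2"
      using op_norm_nonneg[OF TT] by (simp add: power_mult_distrib power2_eq_square)
    finally show "hnorm E (T x) \<le> sqrt (op_norm E (adj E E T \<circ> T)) * hnorm E x"
      by (rule power2_le_imp_le) (simp add: op_norm_nonneg TT)
  qed (simp add: op_norm_nonneg TT)
  then have "(op_norm E T)\<^sup>2 \<le> (sqrt (op_norm E (adj E E T \<circ> T)))\<^sup>2"
    by (intro power_mono op_norm_nonneg T)
  then show ?thesis
    by (simp add: op_norm_nonneg TT)
qed

lemma op_norm_adj: "T \<in> End_ops E \<Longrightarrow> op_norm E (adj E E T) = op_norm E T"
proof -
  have le: "op_norm E T \<le> op_norm E (adj E E T)" if T: "T \<in> End_ops E" for T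
  proof (cases "op_norm E T = 0")
    case False
    have "op_norm E T * op_norm E T \<le> op_norm E (adj E E T) * op_norm E T"
      using order_trans[OF op_norm_square[OF T] op_norm_comp[OF End_adj[OF T] T]] by (simp add: power2_eq_square)
    then show ?thesis
      using False op_norm_nonneg[OF T] by simp
  qed (use op_norm_nonneg[OF End_adj[OF T]] in simp)
  assume T: "T \<in> End_ops E"
  show ?thesis
    using le[OF T] le[OF End_adj[OF T]] T by (simp add: End_adj_adj)
qed

lemma op_norm_diff_commute: "S \<in> End_ops E \<Longrightarrow> T \<in> End_ops E \<Longrightarrow> op_norm E (S - T) = op_norm E (T - S)"
  using op_norm_scale[of "S - T" "-1"] by (simp add: End_minus scaleC_one)

text \<open>The pointwise limits of \<open>X\<^sub>n\<close> and of \<open>X\<^sub>n\<^sup>*\<close> are adjoint to each other. The bounds on \<open>X\<^sub>m - X\<^sub>n\<close> are kept in the limit, as the same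
  estimate has to serve all modules at the same time in the algebra below.\<close>

lemma End_complete:
  fixes X :: "nat \<Rightarrow> 'e \<Rightarrow> 'e"
  assumes X: "\<And>n. X n \<in> End_ops E"
    and C: "\<And>e. e > 0 \<Longrightarrow> \<exists>N. \<forall>m\<ge>N. \<forall>n\<ge>N. op_norm E (X m - X n) \<le> e"
  shows "\<exists>T\<in>End_ops E. \<forall>e N. (\<forall>m\<ge>N. \<forall>n\<ge>N. op_norm E (X m - X n) \<le> e) \<longrightarrow> (\<forall>n\<ge>N. op_norm E (X n - T) \<le> e)"
proof -
  have ptw: "\<exists>y\<in>hcarrier E. (\<lambda>n. hnorm E (Y n x - y)) \<longlonglongrightarrow> 0"
    if Y: "\<And>n. Y n \<in> End_ops E" and C: "\<And>e. e > 0 \<Longrightarrow> \<exists>N. \<forall>m\<ge>N. \<forall>n\<ge>N. op_norm E (Y m - Y n) \<le> e"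
      and x: "x \<in> hcarrier E" for Y x
  proof (rule complete)
    show "Y n x \<in> hcarrier E" for n
      using Y x by (rule End_mem)
    show "\<forall>e>0. \<exists>N. \<forall>m\<ge>N. \<forall>n\<ge>N. hnorm E (Y m x - Y n x) < e"
    proof (intro allI impI)
      fix e :: real assume e: "e > 0"
      define d where "d = e / (hnorm E x + 1)"
      have p: "hnorm E x + 1 > 0"
        using hnorm_nonneg[of x] by linarith
      then have "d > 0"
        using e by (simp add: d_def)
      then obtain N where N: "\<And>m n. m \<ge> N \<Longrightarrow> n \<ge> N \<Longrightarrow> op_norm E (Y m - Y n) \<le> d"
        using C by meson
      have "hnorm E (Y m x - Y n x) < e" if "m \<ge> N" "n \<ge> N" for m n
      proof -
        have "hnorm E (Y m x - Y n x) \<le> op_norm E (Y m - Y n) * hnorm E x"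
          using op_norm_bound[OF End_minus(1)[OF Y Y] x] by simp
        also have "\<dots> \<le> d * hnorm E x"
          by (intro mult_right_mono N that) simp
        also have "\<dots> < d * (hnorm E x + 1)"
          using \<open>d > 0\<close> by simp
        also have "\<dots> = e"
          using p by (simp add: d_def)
        finally show ?thesis .
      qed
      then show "\<exists>N. \<forall>m\<ge>N. \<forall>n\<ge>N. hnorm E (Y m x - Y n x) < e"
        by blast
    qed
  qed
  define L where "L Y = (\<lambda>x. if x \<in> hcarrier E then SOME y. y \<in> hcarrier E \<and> (\<lambda>n. hnorm E (Y n x - y)) \<longlonglongrightarrow> 0 else 0)"
    for Y :: "nat \<Rightarrow> 'e \<Rightarrow> 'e"
  have L: "L Y x \<in> hcarrier E" "(\<lambda>n. hnorm E (Y n x - L Y x)) \<longlonglongrightarrow> 0"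
    if "\<And>n. Y n \<in> End_ops E" "\<And>e. e > 0 \<Longrightarrow> \<exists>N. \<forall>m\<ge>N. \<forall>n\<ge>N. op_norm E (Y m - Y n) \<le> e" "x \<in> hcarrier E" for Y x
    using someI_ex[OF ptw[OF that, unfolded Bex_def]] that(3) by (simp_all add: L_def)
  define X' where "X' n = adj E E (X n)" for n
  have X': "X' n \<in> End_ops E" for n
    unfolding X'_def by (rule End_adj[OF X])
  have "op_norm E (X' m - X' n) = op_norm E (X m - X n)" for m n
    using op_norm_adj[OF End_minus(1)[OF X X]] X by (simp add: X'_def End_minus)
  then have C': "\<exists>N. \<forall>m\<ge>N. \<forall>n\<ge>N. op_norm E (X' m - X' n) \<le> e" if "e > 0" for e
    using C[OF that] by simp
  have om: "L X \<in> op_maps E E" "L X' \<in> op_maps E E"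
    using L(1)[OF X C] L(1)[OF X' C'] by (auto simp: op_maps_def) (auto simp: L_def)
  have "is_adjoint E E (L X) (L X')"
    unfolding is_adjoint_def
  proof (intro ballI)
    fix x y assume xy: "x \<in> hcarrier E" "y \<in> hcarrier E"
    have "(\<lambda>n. hip E (X n x) y) \<longlonglongrightarrow> hip E (L X x) y"
      using X xy L[OF X C xy(1)] by (intro ip_tendsto(1)) (simp_all add: End_mem)
    moreover have "(\<lambda>n. hip E x (X' n y)) \<longlonglongrightarrow> hip E x (L X' y)"
      using X' xy L[OF X' C' xy(2)] by (intro ip_tendsto(2)) (simp_all add: End_mem)
    moreover have "hip E (X n x) y = hip E x (X' n y)" for n
      unfolding X'_def using X xy by (rule self.ip_adj)
    ultimately show "hip E (L X x) y = hip E x (L X' y)"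
      using LIMSEQ_unique by simp
  qed
  with om have T: "L X \<in> End_ops E"
    by (intro self.adjointableI)
  have "\<forall>e N. (\<forall>m\<ge>N. \<forall>n\<ge>N. op_norm E (X m - X n) \<le> e) \<longrightarrow> (\<forall>n\<ge>N. op_norm E (X n - L X) \<le> e)"
  proof (intro allI impI)
    fix e N n assume N: "\<forall>m\<ge>N. \<forall>n\<ge>N. op_norm E (X m - X n) \<le> e" and n: "n \<ge> N"
    show "op_norm E (X n - L X) \<le> e"
    proof (rule op_norm_le)
      show "0 \<le> e"
        using N n op_norm_nonneg[OF End_minus(1)[OF X X]] by (meson order_trans)
      fix x assume x: "x \<in> hcarrier E"
      have "(\<lambda>m. e * hnorm E x + hnorm E (X m x - L X x)) \<longlonglongrightarrow> e * hnorm E x + 0"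
        by (intro tendsto_intros L[OF X C x])
      moreover have "hnorm E (X n x - L X x) \<le> e * hnorm E x + hnorm E (X m x - L X x)" if "m \<ge> N" for m
      proof -
        have "hnorm E (X n x - L X x) \<le> hnorm E (X n x - X m x) + hnorm E (X m x - L X x)"
          by (rule hnorm_diff_triangle[OF End_mem[OF X x] End_mem[OF X x] L(1)[OF X C x]])
        also have "hnorm E (X n x - X m x) \<le> op_norm E (X n - X m) * hnorm E x"
          using op_norm_bound[OF End_minus(1)[OF X X] x] by simp
        also have "\<dots> \<le> e * hnorm E x"
          using N n that by (intro mult_right_mono) auto
        finally show ?thesis
          by simp
      qed
      ultimately have "hnorm E (X n x - L X x) \<le> e * hnorm E x + 0"
        by (intro LIMSEQ_le_const) auto
      then show "hnorm E ((X n - L X) x) \<le> e * hnorm E x"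
        by simp
    qed
  qed
  with T show ?thesis
    by blast
qed

end

section \<open>A C*-algebra containing the operators on all Hilbert modules\<close>

lemma hilbert_module_trivial:
  "hilbert_module \<lparr>hcarrier = {0 :: 'e::complex_vector}, hip = \<lambda>_ _. 0 :: 'b::cstar_algebra, hact = \<lambda>_ _. 0\<rparr>"
  by unfold_locales
    (auto simp: complex_vector.subspace_def hnorm_def cstar_positive_def intro: exI[of _ 0])

text \<open>Adjointable operators on a single Hilbert module do not form a type. Bounded families of such
  operators, indexed by all Hilbert modules over \<open>B\<close> inside a given ambient space, do; and the operators on one
  module are the families that vanish elsewhere.\<close>

typedef (overloaded) ('e, 'b) opalg =
  "{T :: ('e::complex_vector, 'b::cstar_algebra) hmod \<Rightarrow> 'e \<Rightarrow> 'e.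
     (\<forall>E. hilbert_module E \<longrightarrow> T E \<in> End_ops E) \<and> (\<forall>E. \<not> hilbert_module E \<longrightarrow> T E = 0) \<and>
     (\<exists>K. \<forall>E. hilbert_module E \<longrightarrow> op_norm E (T E) \<le> K)}"
  morphisms component Abs_opalg
proof (rule exI[of _ "\<lambda>_. 0"], safe)
  show "\<exists>K. \<forall>E::('e, 'b) hmod. hilbert_module E \<longrightarrow> op_norm E (0 :: 'e \<Rightarrow> 'e) \<le> K"
  proof (intro exI allI impI)
    show "op_norm E (0 :: 'e \<Rightarrow> 'e) \<le> 0" if "hilbert_module E" for E :: "('e, 'b) hmod"
      using that by (intro hilbert_module.op_norm_le) (auto simp: hilbert_module.hnorm_zero)
  qed
qed (rule hilbert_module.End_0)

setup_lifting type_definition_opalg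

lemma component_End: "hilbert_module E \<Longrightarrow> component T E \<in> End_ops E"
  by transfer blast

lemma component_bounded: "\<exists>K. \<forall>E. hilbert_module E \<longrightarrow> op_norm E (component T E) \<le> K"
  by transfer blast

lemma opalg_eqI:
  assumes "\<And>E x. hilbert_module E \<Longrightarrow> x \<in> hcarrier E \<Longrightarrow> component S E x = component T E x"
  shows "S = T"
proof -
  have "component S E = component T E" for E
  proof (cases "hilbert_module E")
    case True
    then show ?thesis
      using assms by (intro hilbert_module.End_ext[OF True component_End[OF True] component_End[OF True]]) auto
  next
    case False
    then show ?thesis
      using component[of S] component[of T] by auto
  qed
  then show ?thesis
    using component_inject by blast
qed

instantiation opalg :: (complex_vector, cstar_algebra) "{complex_vector, real_normed_algebra}"
begin

lift_definition zero_opalg :: "('a, 'b) opalg" is "\<lambda>_. 0"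
  using hilbert_module.End_0 by (auto intro!: exI[of _ 0] hilbert_module.op_norm_le simp: hilbert_module.hnorm_zero)

lift_definition plus_opalg :: "('a, 'b) opalg \<Rightarrow> ('a, 'b) opalg \<Rightarrow> ('a, 'b) opalg" is "\<lambda>S T E. S E + T E"
proof (intro conjI allI impI)
  fix S T :: "('a, 'b) hmod \<Rightarrow> 'a \<Rightarrow> 'a"
  assume S: "(\<forall>E. hilbert_module E \<longrightarrow> S E \<in> End_ops E) \<and> (\<forall>E. \<not> hilbert_module E \<longrightarrow> S E = 0) \<and> (\<exists>K. \<forall>E. hilbert_module E \<longrightarrow> op_norm E (S E) \<le> K)"
    and T: "(\<forall>E. hilbert_module E \<longrightarrow> T E \<in> End_ops E) \<and> (\<forall>E. \<not> hilbert_module E \<longrightarrow> T E = 0) \<and> (\<exists>K. \<forall>E. hilbert_module E \<longrightarrow> op_norm E (T E) \<le> K)"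
  then obtain K L where "\<And>E. hilbert_module E \<Longrightarrow> op_norm E (S E) \<le> K" "\<And>E. hilbert_module E \<Longrightarrow> op_norm E (T E) \<le> L"
    by blast
  then have "op_norm E (S E + T E) \<le> K + L" if "hilbert_module E" for E
    using that S T hilbert_module.op_norm_plus[OF that, of "S E" "T E"]
    by (meson add_mono order_trans)
  then show "\<exists>K. \<forall>E. hilbert_module E \<longrightarrow> op_norm E (S E + T E) \<le> K"
    by blast
  show "S E + T E \<in> End_ops E" if "hilbert_module E" for E
    using S T that by (auto intro: hilbert_module.End_plus)
  show "S E + T E = 0" if "\<not> hilbert_module E" for E
    using S T that by auto
qed

lift_definition scaleC_opalg :: "complex \<Rightarrow> ('a, 'b) opalg \<Rightarrow> ('a, 'b) opalg" is "\<lambda>c T E. c *\<^sub>C T E"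
proof (intro conjI allI impI)
  fix c and T :: "('a, 'b) hmod \<Rightarrow> 'a \<Rightarrow> 'a"
  assume T: "(\<forall>E. hilbert_module E \<longrightarrow> T E \<in> End_ops E) \<and> (\<forall>E. \<not> hilbert_module E \<longrightarrow> T E = 0) \<and> (\<exists>K. \<forall>E. hilbert_module E \<longrightarrow> op_norm E (T E) \<le> K)"
  then obtain L where "\<And>E. hilbert_module E \<Longrightarrow> op_norm E (T E) \<le> L"
    by blast
  then have "op_norm E (c *\<^sub>C T E) \<le> cmod c * L" if "hilbert_module E" for E
    using that T by (simp add: hilbert_module.op_norm_scale mult_left_mono)
  then show "\<exists>K. \<forall>E. hilbert_module E \<longrightarrow> op_norm E (c *\<^sub>C T E) \<le> K"
    by blast
  show "c *\<^sub>C T E \<in> End_ops E" if "hilbert_module E" for E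
    using T that by (auto intro: hilbert_module.End_scale)
  show "c *\<^sub>C T E = 0" if "\<not> hilbert_module E" for E
    using T that by auto
qed

lift_definition times_opalg :: "('a, 'b) opalg \<Rightarrow> ('a, 'b) opalg \<Rightarrow> ('a, 'b) opalg" is "\<lambda>S T E. S E \<circ> T E"
proof (intro conjI allI impI)
  fix S T :: "('a, 'b) hmod \<Rightarrow> 'a \<Rightarrow> 'a"
  assume S: "(\<forall>E. hilbert_module E \<longrightarrow> S E \<in> End_ops E) \<and> (\<forall>E. \<not> hilbert_module E \<longrightarrow> S E = 0) \<and> (\<exists>K. \<forall>E. hilbert_module E \<longrightarrow> op_norm E (S E) \<le> K)"
    and T: "(\<forall>E. hilbert_module E \<longrightarrow> T E \<in> End_ops E) \<and> (\<forall>E. \<not> hilbert_module E \<longrightarrow> T E = 0) \<and> (\<exists>K. \<forall>E. hilbert_module E \<longrightarrow> op_norm E (T E) \<le> K)"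
  then obtain K L where KL: "\<And>E. hilbert_module E \<Longrightarrow> op_norm E (S E) \<le> K" "\<And>E. hilbert_module E \<Longrightarrow> op_norm E (T E) \<le> L"
    by blast
  have "op_norm E (S E \<circ> T E) \<le> K * L" if E: "hilbert_module E" for E
  proof -
    interpret hilbert_module E by (rule E)
    have ST: "S E \<in> End_ops E" "T E \<in> End_ops E"
      using S T E by auto
    have "op_norm E (S E) * op_norm E (T E) \<le> K * L"
      using KL[OF E] op_norm_nonneg[OF ST(1)] op_norm_nonneg[OF ST(2)] by (intro mult_mono) auto
    then show ?thesis
      using op_norm_comp[OF ST] by simp
  qed
  then show "\<exists>K. \<forall>E. hilbert_module E \<longrightarrow> op_norm E (S E \<circ> T E) \<le> K"
    by blast
  show "S E \<circ> T E \<in> End_ops E" if "hilbert_module E" for E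
    using S T that by (auto intro: hilbert_module.End_comp)
  show "S E \<circ> T E = 0" if "\<not> hilbert_module E" for E
    using S T that by (auto simp: fun_eq_iff)
qed

definition uminus_opalg :: "('a, 'b) opalg \<Rightarrow> ('a, 'b) opalg" where "uminus_opalg T = (-1) *\<^sub>C T"
definition minus_opalg :: "('a, 'b) opalg \<Rightarrow> ('a, 'b) opalg \<Rightarrow> ('a, 'b) opalg" where "minus_opalg S T = S + (-1) *\<^sub>C T"
definition scaleR_opalg :: "real \<Rightarrow> ('a, 'b) opalg \<Rightarrow> ('a, 'b) opalg" where "scaleR_opalg r T = complex_of_real r *\<^sub>C T"
definition norm_opalg :: "('a, 'b) opalg \<Rightarrow> real" where
  "norm_opalg T = (SUP E\<in>{E. hilbert_module E}. op_norm E (component T E))"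
definition dist_opalg :: "('a, 'b) opalg \<Rightarrow> ('a, 'b) opalg \<Rightarrow> real" where "dist_opalg x y = norm (x - y)"
definition sgn_opalg :: "('a, 'b) opalg \<Rightarrow> ('a, 'b) opalg" where "sgn_opalg x = inverse (norm x) *\<^sub>R x"
definition uniformity_opalg :: "(('a, 'b) opalg \<times> ('a, 'b) opalg) filter" where
  "uniformity_opalg = (INF e\<in>{0 <..}. principal {(x, y). dist x y < e})"
definition open_opalg :: "('a, 'b) opalg set \<Rightarrow> bool" where
  "open_opalg U = (\<forall>x\<in>U. \<forall>\<^sub>F (x', y) in uniformity. x' = x \<longrightarrow> y \<in> U)"

lemma component_simps:
  "component 0 E = 0" "component (S + T) E = component S E + component T E"
  "component (c *\<^sub>C T) E = c *\<^sub>C component T E" "component (S * T) E = component S E \<circ> component T E"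
  "component (- T) E = - component T E" "component (S - T) E = component S E - component T E"
  "component (r *\<^sub>R T) E = complex_of_real r *\<^sub>C component T E"
proof -
  have neg: "(-1) *\<^sub>C f = - f" for f :: "'a \<Rightarrow> 'a"
    using complex_vector.scale_minus_left[of 1 f] by (simp add: scaleC_one)
  show "component (- T) E = - component T E" "component (S - T) E = component S E - component T E"
    by (simp_all add: uminus_opalg_def minus_opalg_def scaleC_opalg.rep_eq plus_opalg.rep_eq neg)
qed (simp_all add: zero_opalg.rep_eq plus_opalg.rep_eq scaleC_opalg.rep_eq times_opalg.rep_eq scaleR_opalg_def)

lemma op_norm_component_le: "hilbert_module E \<Longrightarrow> op_norm E (component T E) \<le> norm T"
  unfolding norm_opalg_def using component_bounded[of T]
  by (intro cSUP_upper) (auto simp: bdd_above_def)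

lemma norm_opalg_le: "(\<And>E. hilbert_module E \<Longrightarrow> op_norm E (component T E) \<le> K) \<Longrightarrow> norm T \<le> K"
  unfolding norm_opalg_def using hilbert_module_trivial by (intro cSUP_least) auto

lemma norm_opalg_nonneg: "0 \<le> norm (T :: ('a, 'b) opalg)"
  using op_norm_component_le[OF hilbert_module_trivial, of T]
    hilbert_module.op_norm_nonneg[OF hilbert_module_trivial component_End[OF hilbert_module_trivial], of T]
  by linarith

lemma norm_scaleC_opalg: "norm (c *\<^sub>C T) = cmod c * norm T" for T :: "('a, 'b) opalg"
proof -
  have le: "norm (c *\<^sub>C T) \<le> cmod c * norm T" for c and T :: "('a, 'b) opalg"
    by (rule norm_opalg_le)
      (auto simp: component_simps hilbert_module.op_norm_scale component_End intro!: mult_left_mono op_norm_component_le)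
  show ?thesis
  proof (cases "c = 0")
    case True
    then show ?thesis
      using le[of 0 T] norm_opalg_nonneg[of "0 *\<^sub>C T"] by simp
  next
    case False
    have "inverse c *\<^sub>C c *\<^sub>C T = T"
      by (rule opalg_eqI) (use False in \<open>simp add: component_simps scaleC_scaleC scaleC_one\<close>)
    then have "norm T \<le> inverse (cmod c) * norm (c *\<^sub>C T)"
      using le[of "inverse c" "c *\<^sub>C T"] by (simp only: norm_inverse)
    then show ?thesis
      using le[of c T] False by (intro antisym) (simp_all add: field_simps)
  qed
qed

instance
proof
  fix x y z :: "('a, 'b) opalg" and r s :: real and c d :: complex
  show "x + y + z = x + (y + z)" "x + y = y + x" "0 + x = x" "- x + x = 0" "x - y = x + - y"
    "r *\<^sub>R (x + y) = r *\<^sub>R x + r *\<^sub>R y" "(r + s) *\<^sub>R x = r *\<^sub>R x + s *\<^sub>R x"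
    "r *\<^sub>R s *\<^sub>R x = (r * s) *\<^sub>R x" "1 *\<^sub>R x = x"
    "c *\<^sub>C (x + y) = c *\<^sub>C x + c *\<^sub>C y" "(c + d) *\<^sub>C x = c *\<^sub>C x + d *\<^sub>C x"
    "c *\<^sub>C d *\<^sub>C x = (c * d) *\<^sub>C x" "1 *\<^sub>C x = x"
    by (rule opalg_eqI; simp add: component_simps scaleC_fun_def algebra_simps scaleC_add_left scaleC_add_right scaleC_scaleC scaleC_one)+
  have lin: "component T E (u + v) = component T E u + component T E v" "component T E (c *\<^sub>C u) = c *\<^sub>C component T E u"
    if "hilbert_module E" "u \<in> hcarrier E" "v \<in> hcarrier E" for E u v c and T :: "('a, 'b) opalg"
    using that component_End[OF that(1), of T]
    by (auto simp: hilbert_module.End_add_apply hilbert_module.End_scaleC_apply)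
  have mem: "component T E u \<in> hcarrier E" if "hilbert_module E" for E u and T :: "('a, 'b) opalg"
    using that component_End[OF that(1), of T] by (rule hilbert_module.End_mem_all)
  show "x * y * z = x * (y * z)" "(x + y) * z = x * z + y * z" "x * (y + z) = x * y + x * z"
    "r *\<^sub>R x * y = r *\<^sub>R (x * y)" "x * r *\<^sub>R y = r *\<^sub>R (x * y)"
    by (rule opalg_eqI; simp add: component_simps scaleC_fun_def lin mem)+
  show "dist x y = norm (x - y)" "sgn x = inverse (norm x) *\<^sub>R x"
    by (fact dist_opalg_def sgn_opalg_def)+
  show "uniformity = (INF e\<in>{0<..}. principal {(x, y :: ('a, 'b) opalg). dist x y < e})"
    by (fact uniformity_opalg_def)
  show "open U = (\<forall>x\<in>U. \<forall>\<^sub>F (x', y) in uniformity. x' = x \<longrightarrow> y \<in> U)" for U :: "('a, 'b) opalg set"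
    by (fact open_opalg_def)
  show "norm x = 0 \<longleftrightarrow> x = 0"
  proof
    assume n: "norm x = 0"
    show "x = 0"
    proof (rule opalg_eqI)
      fix E :: "('a, 'b) hmod" and u assume E: "hilbert_module E"
      have "op_norm E (component x E) = 0"
        using op_norm_component_le[OF E, of x] n hilbert_module.op_norm_nonneg[OF E component_End[OF E], of x] by simp
      then have "component x E = 0"
        using hilbert_module.op_norm_eq_0[OF E component_End[OF E]] by blast
      then show "component x E u = component 0 E u"
        by (simp add: component_simps)
    qed
  next
    assume "x = 0"
    then have "x = 0 *\<^sub>C x"
      by (intro opalg_eqI) (simp add: component_simps scaleC_fun_def)
    then show "norm x = 0"
      using norm_scaleC_opalg[of 0 x] by simp
  qed
  show "norm (x + y) \<le> norm x + norm y"
  proof (rule norm_opalg_le)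
    fix E :: "('a, 'b) hmod" assume E: "hilbert_module E"
    then show "op_norm E (component (x + y) E) \<le> norm x + norm y"
      using hilbert_module.op_norm_plus[OF E component_End[OF E] component_End[OF E], of x y]
        op_norm_component_le[OF E, of x] op_norm_component_le[OF E, of y] by (simp add: component_simps)
  qed
  show "norm (r *\<^sub>R x) = \<bar>r\<bar> * norm x"
    by (simp add: scaleR_opalg_def norm_scaleC_opalg)
  show "norm (x * y) \<le> norm x * norm y"
  proof (rule norm_opalg_le)
    fix E :: "('a, 'b) hmod" assume E: "hilbert_module E"
    have "op_norm E (component x E) * op_norm E (component y E) \<le> norm x * norm y"
      using E by (intro mult_mono op_norm_component_le norm_opalg_nonneg hilbert_module.op_norm_nonneg component_End)
    then show "op_norm E (component (x * y) E) \<le> norm x * norm y"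
      using hilbert_module.op_norm_comp[OF E component_End[OF E] component_End[OF E], of x y]
      by (simp add: component_simps)
  qed
qed

end

instance opalg :: (complex_vector, cstar_algebra) banach
proof
  fix X :: "nat \<Rightarrow> ('a, 'b) opalg" assume "Cauchy X"
  then have X: "\<exists>N. \<forall>m\<ge>N. \<forall>n\<ge>N. norm (X m - X n) \<le> e" if "e > 0" for e
    using that unfolding Cauchy_def dist_norm by (meson less_imp_le)
  have comp_le: "op_norm E (component (X m) E - component (X n) E) \<le> norm (X m - X n)" if "hilbert_module E" for E m n
    using op_norm_component_le[OF that, of "X m - X n"] by (simp add: component_simps)
  have "\<exists>T\<in>End_ops E. \<forall>e N. (\<forall>m\<ge>N. \<forall>n\<ge>N. op_norm E (component (X m) E - component (X n) E) \<le> e)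
      \<longrightarrow> (\<forall>n\<ge>N. op_norm E (component (X n) E - T) \<le> e)" if E: "hilbert_module E" for E
    by (rule hilbert_module.End_complete[OF E component_End[OF E]])
      (use X comp_le[OF E] in \<open>meson order_trans\<close>)
  then obtain T where T: "\<And>E. hilbert_module E \<Longrightarrow> T E \<in> End_ops E"
    and lim: "\<And>E e N n. hilbert_module E \<Longrightarrow> (\<forall>m\<ge>N. \<forall>n\<ge>N. op_norm E (component (X m) E - component (X n) E) \<le> e)
      \<Longrightarrow> n \<ge> N \<Longrightarrow> op_norm E (component (X n) E - T E) \<le> e"
    by metis
  define T' where "T' E = (if hilbert_module E then T E else 0)" for E
  have lim': "op_norm E (component (X n) E - T' E) \<le> e"
    if "hilbert_module E" "\<forall>m\<ge>N. \<forall>n\<ge>N. norm (X m - X n) \<le> e" "n \<ge> N" for E e N n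
    using lim[OF that(1) _ that(3)] that(1,2) comp_le[OF that(1)] by (simp add: T'_def) (meson order_trans)
  have "T' \<in> {T. (\<forall>E. hilbert_module E \<longrightarrow> T E \<in> End_ops E) \<and> (\<forall>E. \<not> hilbert_module E \<longrightarrow> T E = 0) \<and>
     (\<exists>K. \<forall>E. hilbert_module E \<longrightarrow> op_norm E (T E) \<le> K)}"
  proof -
    obtain N where N: "\<forall>m\<ge>N. \<forall>n\<ge>N. norm (X m - X n) \<le> 1"
      using X[of 1] by auto
    have "op_norm E (T' E) \<le> 1 + norm (X N)" if E: "hilbert_module E" for E
    proof -
      interpret hilbert_module E by (rule E)
      have TE: "T' E \<in> End_ops E"
        using T E by (simp add: T'_def)
      note XE = component_End[OF E, of "X N"]
      have "op_norm E (T' E) = op_norm E ((T' E - component (X N) E) + component (X N) E)"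
        by simp
      also have "\<dots> \<le> op_norm E (T' E - component (X N) E) + op_norm E (component (X N) E)"
        by (rule op_norm_plus[OF End_minus(1)[OF TE XE] XE])
      also have "\<dots> \<le> 1 + norm (X N)"
        using lim'[OF E N order_refl] op_norm_diff_commute[OF TE XE] op_norm_component_le[OF E, of "X N"] by simp
      finally show ?thesis .
    qed
    then show ?thesis
      using T by (auto simp: T'_def)
  qed
  then have cT: "component (Abs_opalg T') = T'"
    by (rule Abs_opalg_inverse)
  have "X \<longlonglongrightarrow> Abs_opalg T'"
  proof (rule LIMSEQ_I)
    fix e :: real assume e: "e > 0"
    then obtain N where N: "\<forall>m\<ge>N. \<forall>n\<ge>N. norm (X m - X n) \<le> e / 2"
      using X[of "e / 2"] by auto
    have "norm (X n - Abs_opalg T') \<le> e / 2" if "n \<ge> N" for n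
      using lim'[OF _ N that] by (intro norm_opalg_le) (simp add: component_simps cT)
    then show "\<exists>N. \<forall>n\<ge>N. norm (X n - Abs_opalg T') < e"
      using e by (intro exI[of _ N]) fastforce
  qed
  then show "convergent X"
    by (auto simp: convergent_def)
qed

instantiation opalg :: (complex_vector, cstar_algebra) cstar_algebra
begin

lift_definition star_opalg :: "('a, 'b) opalg \<Rightarrow> ('a, 'b) opalg" is
  "\<lambda>T E. if hilbert_module E then adj E E (T E) else 0"
  using hilbert_module.End_adj hilbert_module.op_norm_adj by fastforce

instance
proof
  fix x y :: "('a, 'b) opalg" and r :: real and c :: complex
  have mem: "component T E u \<in> hcarrier E" if "hilbert_module E" for E u and T :: "('a, 'b) opalg"
    using that component_End[OF that(1), of T] by (rule hilbert_module.End_mem_all)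
  have lin: "component T E (c *\<^sub>C u) = c *\<^sub>C component T E u"
    if "hilbert_module E" "u \<in> hcarrier E" for E u c and T :: "('a, 'b) opalg"
    using that component_End[OF that(1), of T] by (simp add: hilbert_module.End_scaleC_apply)
  show "r *\<^sub>R x = complex_of_real r *\<^sub>C x"
    by (fact scaleR_opalg_def)
  show "c *\<^sub>C x * y = c *\<^sub>C (x * y)" "x * c *\<^sub>C y = c *\<^sub>C (x * y)"
    by (rule opalg_eqI; simp add: component_simps scaleC_fun_def lin mem)+
  show "norm (c *\<^sub>C x) = cmod c * norm x"
    by (fact norm_scaleC_opalg)
  note st = component_simps star_opalg.rep_eq hilbert_module.End_adj_adj hilbert_module.End_plus
      hilbert_module.End_scale hilbert_module.End_comp component_End
  show "(x\<^sup>\<star>)\<^sup>\<star> = x" "(x + y)\<^sup>\<star> = x\<^sup>\<star> + y\<^sup>\<star>" "(c *\<^sub>C x)\<^sup>\<star> = cnj c *\<^sub>C x\<^sup>\<star>" "(x * y)\<^sup>\<star> = y\<^sup>\<star> * x\<^sup>\<star>"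
    by (rule opalg_eqI; simp add: st)+
  have comp: "component (x\<^sup>\<star> * x) E = adj E E (component x E) \<circ> component x E" if "hilbert_module E" for E
    using that by (simp add: st)
  show "norm (x\<^sup>\<star> * x) = (norm x)\<^sup>2"
  proof (rule antisym)
    show "norm (x\<^sup>\<star> * x) \<le> (norm x)\<^sup>2"
    proof (rule norm_opalg_le)
      fix E :: "('a, 'b) hmod" assume E: "hilbert_module E"
      interpret hilbert_module E by (rule E)
      note xE = component_End[OF E, of x]
      have "op_norm E (component (x\<^sup>\<star> * x) E) \<le> op_norm E (component x E) * op_norm E (component x E)"
        using op_norm_comp[OF End_adj[OF xE] xE] xE by (simp add: comp E op_norm_adj)
      also have "\<dots> \<le> (norm x)\<^sup>2"
        unfolding power2_eq_square by (intro mult_mono op_norm_component_le E op_norm_nonneg xE) auto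
      finally show "op_norm E (component (x\<^sup>\<star> * x) E) \<le> (norm x)\<^sup>2" .
    qed
    have "norm x \<le> sqrt (norm (x\<^sup>\<star> * x))"
    proof (rule norm_opalg_le)
      fix E :: "('a, 'b) hmod" assume E: "hilbert_module E"
      have "(op_norm E (component x E))\<^sup>2 \<le> norm (x\<^sup>\<star> * x)"
        using hilbert_module.op_norm_square[OF E component_End[OF E], of x] op_norm_component_le[OF E, of "x\<^sup>\<star> * x"]
        by (simp add: comp E)
      then show "op_norm E (component x E) \<le> sqrt (norm (x\<^sup>\<star> * x))"
        by (rule real_le_rsqrt)
    qed
    then have "(norm x)\<^sup>2 \<le> (sqrt (norm (x\<^sup>\<star> * x)))\<^sup>2"
      by (intro power_mono) auto
    then show "(norm x)\<^sup>2 \<le> norm (x\<^sup>\<star> * x)"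
      by simp
  qed
qed

end

section \<open>Compact operators\<close>

context hilbert_module
begin

lemma rank_one_End:
  assumes "x \<in> hcarrier E" "y \<in> hcarrier E"
  shows "rank_one E x y \<in> End_ops E" "adj E E (rank_one E x y) = rank_one E y x"
proof -
  have om: "rank_one E x y \<in> op_maps E E" "rank_one E y x \<in> op_maps E E"
    using assms by (auto simp: op_maps_def rank_one_def)
  have "is_adjoint E E (rank_one E x y) (rank_one E y x)"
    unfolding is_adjoint_def rank_one_def using assms
    by (auto simp: ip_act ip_act_left ip_star[of y, symmetric] mult.assoc)
  with om show "rank_one E x y \<in> End_ops E" "adj E E (rank_one E x y) = rank_one E y x"
    using self.adjointableI self.adj_eqI by blast+
qed

definition "rank_ones = {rank_one E x y | x y. x \<in> hcarrier E \<and> y \<in> hcarrier E}"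

lemma finite_rank_induct:
  assumes T: "T \<in> complex_vector.span rank_ones" and zero: "P 0"
    and step: "\<And>x y T. x \<in> hcarrier E \<Longrightarrow> y \<in> hcarrier E \<Longrightarrow> T \<in> complex_vector.span rank_ones \<Longrightarrow> P T
      \<Longrightarrow> P (rank_one E x y + T)"
  shows "P T"
proof -
  have "T \<in> complex_vector.span rank_ones \<and> P T"
  proof (rule complex_vector.span_induct_alt[OF T, of "\<lambda>T. T \<in> complex_vector.span rank_ones \<and> P T"])
    show "0 \<in> complex_vector.span rank_ones \<and> P 0"
      using zero complex_vector.span_zero by blast
  next
    fix c T S assume "T \<in> rank_ones" and S: "S \<in> complex_vector.span rank_ones \<and> P S"
    then obtain x y where T: "T = rank_one E x y" and xy: "x \<in> hcarrier E" "y \<in> hcarrier E"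
      by (auto simp: rank_ones_def)
    have "c *\<^sub>C T = rank_one E (c *\<^sub>C x) y"
      using xy by (auto simp: T rank_one_def scaleC_fun_def fun_eq_iff act_scaleC_left complex_vector.scale_zero_right)
    moreover have "rank_one E (c *\<^sub>C x) y \<in> complex_vector.span rank_ones"
      using xy by (intro complex_vector.span_base) (auto simp: rank_ones_def)
    ultimately show "c *\<^sub>C T + S \<in> complex_vector.span rank_ones \<and> P (c *\<^sub>C T + S)"
      using step[of "c *\<^sub>C x" y S] S xy complex_vector.span_add by auto
  qed
  then show ?thesis ..
qed

lemma finite_rank_End:
  assumes "T \<in> complex_vector.span rank_ones"
  shows "T \<in> End_ops E"
proof (rule finite_rank_induct[OF assms])
  show "0 \<in> End_ops E"
    by (rule End_0)
  show "rank_one E x y + T \<in> End_ops E"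
    if "x \<in> hcarrier E" "y \<in> hcarrier E" "T \<in> End_ops E" for x y T
    using that by (intro End_plus rank_one_End)
qed

lemma compact_iff:
  "T \<in> compact_ops E \<longleftrightarrow> T \<in> End_ops E \<and> (\<forall>e>0. \<exists>R\<in>complex_vector.span rank_ones. op_norm E (T - R) < e)"
  by (simp add: compact_ops_def closed_span_def op_closure_def rank_ones_def)

lemma compact_End: "T \<in> compact_ops E \<Longrightarrow> T \<in> End_ops E"
  by (simp add: compact_iff)

lemma op_norm_0: "op_norm E 0 = 0"
  using op_norm_le[of 0 0] op_norm_nonneg[OF End_0(1)] by simp

lemma finite_rank_compact: "T \<in> complex_vector.span rank_ones \<Longrightarrow> T \<in> compact_ops E"
  unfolding compact_iff using finite_rank_End by (auto intro!: bexI[of _ T] simp: op_norm_0)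

lemma compact_zero: "0 \<in> compact_ops E"
  by (rule finite_rank_compact) (rule complex_vector.span_zero)

lemma compact_limit:
  assumes T: "T \<in> End_ops E" and lim: "\<And>e. e > 0 \<Longrightarrow> \<exists>K\<in>compact_ops E. op_norm E (T - K) < e"
  shows "T \<in> compact_ops E"
  unfolding compact_iff
proof (intro conjI allI impI T)
  fix e :: real assume "e > 0"
  then obtain K where K: "K \<in> compact_ops E" "op_norm E (T - K) < e / 2"
    using lim[of "e / 2"] by auto
  then obtain R where R: "R \<in> complex_vector.span rank_ones" "op_norm E (K - R) < e / 2"
    using \<open>e > 0\<close> unfolding compact_iff by (meson half_gt_zero)
  have "op_norm E (T - R) = op_norm E ((T - K) + (K - R))"
    by simp
  also have "\<dots> \<le> op_norm E (T - K) + op_norm E (K - R)"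
    using T K(1) R(1) by (intro op_norm_plus End_minus) (simp_all add: compact_End finite_rank_End)
  finally show "\<exists>R\<in>complex_vector.span rank_ones. op_norm E (T - R) < e"
    using K R by (intro bexI[OF _ R(1)]) simp
qed

lemma compact_plus:
  assumes "S \<in> compact_ops E" "T \<in> compact_ops E"
  shows "S + T \<in> compact_ops E"
  unfolding compact_iff
proof (intro conjI allI impI)
  show "S + T \<in> End_ops E"
    using assms by (simp add: End_plus compact_End)
  fix e :: real assume "e > 0"
  then obtain R Q where R: "R \<in> complex_vector.span rank_ones" "op_norm E (S - R) < e / 2"
    and Q: "Q \<in> complex_vector.span rank_ones" "op_norm E (T - Q) < e / 2"
    using assms unfolding compact_iff by (meson half_gt_zero)
  have "op_norm E ((S + T) - (R + Q)) = op_norm E ((S - R) + (T - Q))"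
    by (simp add: algebra_simps)
  also have "\<dots> \<le> op_norm E (S - R) + op_norm E (T - Q)"
    using assms R(1) Q(1) by (intro op_norm_plus End_minus) (simp_all add: compact_End finite_rank_End)
  finally show "\<exists>R\<in>complex_vector.span rank_ones. op_norm E (S + T - R) < e"
    using R Q by (intro bexI[of _ "R + Q"] complex_vector.span_add) auto
qed

lemma rank_one_compact: "x \<in> hcarrier E \<Longrightarrow> y \<in> hcarrier E \<Longrightarrow> rank_one E x y \<in> compact_ops E"
  by (intro finite_rank_compact complex_vector.span_base) (auto simp: rank_ones_def)

end

lemma compact_image:
  fixes E :: "('e::complex_vector, 'b::cstar_algebra, 'y) hmod_scheme"
    and E' :: "('f::complex_vector, 'c::cstar_algebra, 'z) hmod_scheme"
  assumes E: "hilbert_module E" "hilbert_module E'" and K: "K \<in> compact_ops E"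
    and End: "\<And>T. T \<in> End_ops E \<Longrightarrow> \<phi> T \<in> End_ops E'"
    and plus: "\<And>S T. S \<in> End_ops E \<Longrightarrow> T \<in> End_ops E \<Longrightarrow> \<phi> (S + T) = \<phi> S + \<phi> T"
    and bound: "\<And>T. T \<in> End_ops E \<Longrightarrow> op_norm E' (\<phi> T) \<le> C * op_norm E T"
    and rank_one: "\<And>x y. x \<in> hcarrier E \<Longrightarrow> y \<in> hcarrier E \<Longrightarrow> \<phi> (rank_one E x y) \<in> compact_ops E'"
  shows "\<phi> K \<in> compact_ops E'"
proof -
  interpret dom: hilbert_module E + cod: hilbert_module E'
    by (rule E)+
  show ?thesis
  proof (rule cod.compact_limit)
    note KE = dom.compact_End[OF K]
    show "\<phi> K \<in> End_ops E'"
      by (rule End[OF KE])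
    have finite: "\<phi> S \<in> compact_ops E'" if S: "S \<in> complex_vector.span dom.rank_ones" for S
    proof (rule dom.finite_rank_induct[OF S, of "\<lambda>S. \<phi> S \<in> compact_ops E'"])
      have "\<phi> 0 = 0"
        using plus[OF dom.End_0(1) dom.End_0(1)] by simp
      then show "\<phi> 0 \<in> compact_ops E'"
        by (simp only: cod.compact_zero)
      show "\<phi> (rank_one E x y + S) \<in> compact_ops E'"
        if "x \<in> hcarrier E" "y \<in> hcarrier E" "S \<in> complex_vector.span dom.rank_ones" "\<phi> S \<in> compact_ops E'" for x y S
        using cod.compact_plus[OF rank_one[OF that(1,2)] that(4)]
        by (simp only: plus[OF dom.rank_one_End(1)[OF that(1,2)] dom.finite_rank_End[OF that(3)]])
    qed
    fix e :: real assume e: "e > 0"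
    define c where "c = max C 0 + 1"
    have c: "c > 0" "C \<le> c"
      by (auto simp: c_def)
    obtain S where S: "S \<in> complex_vector.span dom.rank_ones" "op_norm E (K - S) < e / c"
      using K e c unfolding dom.compact_iff by (meson divide_pos_pos)
    note SE = dom.finite_rank_End[OF S(1)]
    note KS = dom.End_minus(1)[OF KE SE]
    have "op_norm E' (\<phi> K - \<phi> S) = op_norm E' (\<phi> (K - S))"
      using plus[OF KS SE] by simp
    also have "\<dots> \<le> c * op_norm E (K - S)"
      using bound[OF KS] c(2) dom.op_norm_nonneg[OF KS] by (meson mult_right_mono order_trans)
    also have "\<dots> < e"
      using S(2) c(1) by (simp add: field_simps)
    finally show "\<exists>L\<in>compact_ops E'. op_norm E' (\<phi> K - L) < e"
      using finite[OF S(1)] by blast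
  qed
qed

context hilbert_module
begin

lemma compact_comp_right:
  assumes T: "T \<in> compact_ops E" and S: "S \<in> End_ops E"
  shows "T \<circ> S \<in> compact_ops E"
proof (rule compact_image[OF hilbert_module_axioms hilbert_module_axioms T, of "\<lambda>T. T \<circ> S" "op_norm E S"])
  show "T \<circ> S \<in> End_ops E" "op_norm E (T \<circ> S) \<le> op_norm E S * op_norm E T" if "T \<in> End_ops E" for T
    using End_comp(1)[OF that S] op_norm_comp[OF that S] by (simp_all add: mult.commute)
  show "(T + T') \<circ> S = (T \<circ> S) + (T' \<circ> S)" for T T' :: "'e \<Rightarrow> 'e"
    by (auto simp: fun_eq_iff)
  fix x y assume xy: "x \<in> hcarrier E" "y \<in> hcarrier E"
  note Sy = End_mem[OF End_adj[OF S] xy(2)]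
  have "rank_one E x y \<circ> S = rank_one E x (adj E E S y)"
    by (rule End_ext[OF End_comp(1)[OF rank_one_End(1)[OF xy] S] rank_one_End(1)[OF xy(1) Sy]])
      (use S xy in \<open>simp add: rank_one_def End_mem ip_adj_left\<close>)
  then show "rank_one E x y \<circ> S \<in> compact_ops E"
    using rank_one_compact[OF xy(1) Sy] by (simp only:)
qed

lemma compact_adj:
  assumes T: "T \<in> compact_ops E"
  shows "adj E E T \<in> compact_ops E"
proof (rule compact_image[OF hilbert_module_axioms hilbert_module_axioms T, of _ 1])
  show "adj E E (S + T) = adj E E S + adj E E T" if "S \<in> End_ops E" "T \<in> End_ops E" for S T
    by (rule End_plus(2)[OF that])
qed (simp_all add: End_adj op_norm_adj rank_one_End rank_one_compact)

end

section \<open>Embedding the operators on one module\<close>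

text \<open>\<open>\<epsilon>\<close> identifies the operators on \<open>E\<close> with a corner of \<open>'c\<close>, whose unit is \<open>\<epsilon> 1\<close>.\<close>

locale corner_embedding = hilbert_module E
  for E :: "('e::complex_vector, 'b::cstar_algebra, 'z) hmod_scheme" +
  fixes \<epsilon> :: "('e \<Rightarrow> 'e) \<Rightarrow> 'c::unital_cstar_algebra"
  assumes plus: "S \<in> End_ops E \<Longrightarrow> T \<in> End_ops E \<Longrightarrow> \<epsilon> (S + T) = \<epsilon> S + \<epsilon> T"
    and scale: "T \<in> End_ops E \<Longrightarrow> \<epsilon> (c *\<^sub>C T) = c *\<^sub>C \<epsilon> T"
    and comp: "S \<in> End_ops E \<Longrightarrow> T \<in> End_ops E \<Longrightarrow> \<epsilon> (S \<circ> T) = \<epsilon> S * \<epsilon> T"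
    and adjoint: "T \<in> End_ops E \<Longrightarrow> \<epsilon> (adj E E T) = (\<epsilon> T)\<^sup>\<star>"
    and norm: "T \<in> End_ops E \<Longrightarrow> norm (\<epsilon> T) = op_norm E T"
    and corner: "\<exists>T\<in>End_ops E. \<epsilon> (id_op E) * y * \<epsilon> (id_op E) = \<epsilon> T"
begin

lemma minus: "S \<in> End_ops E \<Longrightarrow> T \<in> End_ops E \<Longrightarrow> \<epsilon> (S - T) = \<epsilon> S - \<epsilon> T"
  using plus[of "S - T" T] by (simp add: End_minus)

lemma zero: "\<epsilon> 0 = 0"
  using plus[of 0 0] by (simp add: End_0)

lemma inject: "S \<in> End_ops E \<Longrightarrow> T \<in> End_ops E \<Longrightarrow> \<epsilon> S = \<epsilon> T \<longleftrightarrow> S = T"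
  using norm[of "S - T"] op_norm_eq_0[of "S - T"] by (auto simp: End_minus minus)

definition "unit = \<epsilon> (id_op E)"

lemma unit_mult [simp]: "T \<in> End_ops E \<Longrightarrow> unit * \<epsilon> T = \<epsilon> T" "T \<in> End_ops E \<Longrightarrow> \<epsilon> T * unit = \<epsilon> T"
  by (simp_all add: unit_def id_op_comp End_id flip: comp)

lemma unit_props: "unit * unit = unit" "unit\<^sup>\<star> = unit"
  using unit_mult(1)[OF End_id(1)] adjoint[OF End_id(1)] by (simp_all add: unit_def End_id(2))

end

text \<open>The type of the algebra only admits modules without further record fields.\<close>

definition emb :: "('e, 'b, 'z) hmod_scheme \<Rightarrow> ('e \<Rightarrow> 'e) \<Rightarrow> ('e::complex_vector, 'b::cstar_algebra) opalg unitz" where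
  "emb E T = inc (Abs_opalg (\<lambda>E'. if E' = hmod.truncate E then T else 0))"

lemma truncate_simps:
  "hcarrier (hmod.truncate E) = hcarrier E" "hip (hmod.truncate E) = hip E" "hact (hmod.truncate E) = hact E"
  by (simp_all add: hmod.truncate_def)

lemma hilbert_module_truncate: "hilbert_module (hmod.truncate E) \<longleftrightarrow> hilbert_module E"
  by (simp add: hilbert_module_def truncate_simps hnorm_def)

lemma End_truncate: "End_ops (hmod.truncate E) = End_ops E" "adj (hmod.truncate E) (hmod.truncate E) = adj E E"
  by (auto simp: adjointable_def adj_def op_maps_def is_adjoint_def truncate_simps fun_eq_iff)

lemma op_norm_truncate: "op_norm (hmod.truncate E) T = op_norm E T"
  by (simp add: op_norm_def hnorm_def truncate_simps)

context hilbert_module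
begin

lemma component_emb:
  assumes T: "T \<in> End_ops E"
  shows "component (bpart (emb E T)) E' = (if E' = hmod.truncate E then T else 0)" "cpart (emb E T) = 0"
proof -
  have "(\<lambda>E'. if E' = hmod.truncate E then T else 0) \<in> {T :: ('e, 'b) hmod \<Rightarrow> 'e \<Rightarrow> 'e.
     (\<forall>E. hilbert_module E \<longrightarrow> T E \<in> End_ops E) \<and> (\<forall>E. \<not> hilbert_module E \<longrightarrow> T E = 0) \<and>
     (\<exists>K. \<forall>E. hilbert_module E \<longrightarrow> op_norm E (T E) \<le> K)}"
    using T op_norm_nonneg[OF T]
    by (auto simp: End_truncate hilbert_module.End_0 hilbert_module_truncate hilbert_module_axioms
        op_norm_truncate hilbert_module.op_norm_0 intro!: exI[of _ "op_norm E T"])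
  from Abs_opalg_inverse[OF this]
  show "component (bpart (emb E T)) E' = (if E' = hmod.truncate E then T else 0)" "cpart (emb E T) = 0"
    by (simp_all add: emb_def inc_def)
qed

lemma emb_eqI:
  assumes "T \<in> End_ops E" "\<And>E'. component (bpart x) E' = (if E' = hmod.truncate E then T else 0)" "cpart x = 0"
  shows "emb E T = x"
  using assms by (auto simp: unitz_eq_iff component_emb fun_eq_iff intro!: component_inject[THEN iffD1])

text \<open>The operator on \<open>E\<close> through which an element of the unitized algebra acts.\<close>

definition act_at :: "('e, 'b) opalg unitz \<Rightarrow> 'e \<Rightarrow> 'e" where
  "act_at y = component (bpart y) (hmod.truncate E) + cpart y *\<^sub>C id_op E"

lemma act_at_End: "act_at y \<in> End_ops E"
  unfolding act_at_def using component_End[of "hmod.truncate E"]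
  by (intro End_plus End_scale End_id) (simp add: hilbert_module_truncate hilbert_module_axioms End_truncate)

lemma emb_mult:
  assumes T: "T \<in> End_ops E"
  shows "emb E T * y = emb E (T \<circ> act_at y)" "y * emb E T = emb E (act_at y \<circ> T)"
proof -
  define A where "A = component (bpart y) (hmod.truncate E)"
  have A: "A \<in> End_ops E"
    using component_End[of "hmod.truncate E" "bpart y"]
    by (simp add: A_def hilbert_module_truncate hilbert_module_axioms End_truncate)
  have 1: "T \<circ> act_at y = (T \<circ> A) + cpart y *\<^sub>C T"
    unfolding act_at_def A_def[symmetric] using T A
    by (simp add: End_comp_plus End_scale End_id id_op_comp)
  have 2: "act_at y \<circ> T = (A \<circ> T) + cpart y *\<^sub>C T"
    unfolding act_at_def A_def[symmetric] using T
    by (auto simp: fun_eq_iff id_op_def End_mem_all scaleC_fun_def)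
  have off: "component (bpart y) E' 0 = 0" for E'
    using component_End[of E' "bpart y"] component[of "bpart y"]
    by (cases "hilbert_module E'") (auto simp: hilbert_module.End_zero_apply)
  have comp0: "component (bpart y) E' \<circ> 0 = 0" for E'
    by (auto simp: fun_eq_iff off)
  have Oc: "0 \<circ> f = 0" for f :: "'e \<Rightarrow> 'e"
    by (auto simp: fun_eq_iff)
  show "emb E T * y = emb E (T \<circ> act_at y)"
  proof (rule emb_eqI[symmetric, OF End_comp(1)[OF T act_at_End]])
    show "component (bpart (emb E T * y)) E' = (if E' = hmod.truncate E then T \<circ> act_at y else 0)" for E'
      using T by (simp add: times_unitz_def component_simps component_emb 1 Oc) (simp add: A_def)
  qed (simp add: times_unitz_def component_emb T)
  show "y * emb E T = emb E (act_at y \<circ> T)"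
  proof (rule emb_eqI[symmetric, OF End_comp(1)[OF act_at_End T]])
    show "component (bpart (y * emb E T)) E' = (if E' = hmod.truncate E then act_at y \<circ> T else 0)" for E'
      using T by (simp add: times_unitz_def component_simps component_emb 2 comp0) (simp add: A_def)
  qed (simp add: times_unitz_def component_emb T)
qed

lemma act_at_emb: "T \<in> End_ops E \<Longrightarrow> act_at (emb E T) = T"
  by (simp add: act_at_def component_emb)

lemma norm_emb: "T \<in> End_ops E \<Longrightarrow> norm (emb E T) = op_norm E T"
proof -
  assume T: "T \<in> End_ops E"
  define t where "t = bpart (emb E T)"
  have t: "emb E T = inc t"
    using component_emb(2)[OF T] by (simp add: t_def inc_def unitz_eq_iff)
  have c: "component t E' = (if E' = hmod.truncate E then T else 0)" for E'
    unfolding t_def by (rule component_emb(1)[OF T])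
  have "norm t = op_norm E T"
  proof (rule antisym)
    show "norm t \<le> op_norm E T"
      by (rule norm_opalg_le) (simp add: c op_norm_truncate hilbert_module.op_norm_0 op_norm_nonneg T)
    show "op_norm E T \<le> norm t"
      using op_norm_component_le[of "hmod.truncate E" t]
      by (simp add: c op_norm_truncate hilbert_module_truncate hilbert_module_axioms)
  qed
  then show ?thesis
    by (simp add: t)
qed

lemma corner_embedding_emb: "corner_embedding E (emb E)"
proof
  fix S T and c
  assume S: "S \<in> End_ops E"
  show "emb E (c *\<^sub>C S) = c *\<^sub>C emb E S"
    by (rule emb_eqI) (use S in \<open>auto simp: scaleC_unitz_def component_simps component_emb End_scale\<close>)
  show "norm (emb E S) = op_norm E S"
    by (rule norm_emb[OF S])
  show "emb E (adj E E S) = (emb E S)\<^sup>\<star>"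
    by (rule emb_eqI)
      (use S in \<open>auto simp: star_unitz_def star_opalg.rep_eq component_emb End_adj End_truncate
        hilbert_module_truncate hilbert_module_axioms hilbert_module.End_0\<close>)
  assume T: "T \<in> End_ops E"
  show "emb E (S + T) = emb E S + emb E T"
    by (rule emb_eqI) (use S T in \<open>auto simp: plus_unitz_def component_simps component_emb End_plus\<close>)
  show "emb E (S \<circ> T) = emb E S * emb E T"
    using S T by (simp add: emb_mult act_at_emb)
next
  fix y
  show "\<exists>T\<in>End_ops E. emb E (id_op E) * y * emb E (id_op E) = emb E T"
    using emb_mult End_id act_at_End End_comp by metis
qed

text \<open>A limit of elements of the corner lies in the corner.\<close>

lemma compact_right_ideal: "closed_right_ideal (emb E ` compact_ops E)"
proof -
  interpret emb: corner_embedding E "emb E"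
    by (rule corner_embedding_emb)
  show ?thesis
  proof
    show "0 \<in> emb E ` compact_ops E"
      using compact_zero emb.zero by force
    show "x + y \<in> emb E ` compact_ops E" if xy: "x \<in> emb E ` compact_ops E" "y \<in> emb E ` compact_ops E" for x y
    proof -
      obtain S T where "x = emb E S" "y = emb E T" "S \<in> compact_ops E" "T \<in> compact_ops E"
        using xy by auto
      then show ?thesis
        using compact_plus[of S T] compact_End emb.plus[of S T] by (auto intro!: image_eqI[of _ _ "S + T"])
    qed
    show "x * y \<in> emb E ` compact_ops E" if x: "x \<in> emb E ` compact_ops E" for x y
    proof -
      obtain S where "x = emb E S" "S \<in> compact_ops E"
        using x by auto
      then show ?thesis
        using compact_comp_right[OF _ act_at_End, of S y] compact_End emb_mult(1)[of S y]
        by (auto intro!: image_eqI[of _ _ "S \<circ> act_at y"])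
    qed
    show "closed (emb E ` compact_ops E)"
      unfolding closed_sequential_limits
    proof (intro allI impI, elim conjE)
      fix X :: "nat \<Rightarrow> ('e, 'b) opalg unitz" and l
      assume X: "\<forall>n. X n \<in> emb E ` compact_ops E" and lim: "X \<longlonglongrightarrow> l"
      have "emb.unit * (X n * emb.unit) = X n" for n
      proof -
        obtain K where "K \<in> compact_ops E" "X n = emb E K"
          using X by blast
        then show ?thesis
          by (simp add: compact_End)
      qed
      moreover have "(\<lambda>n. emb.unit * (X n * emb.unit)) \<longlonglongrightarrow> emb.unit * (l * emb.unit)"
        by (intro tendsto_intros lim)
      ultimately have "emb.unit * l * emb.unit = l"
        using lim LIMSEQ_unique by (simp add: mult.assoc)
      then obtain T where T: "T \<in> End_ops E" "l = emb E T"
        using emb.corner[of l] by (auto simp: emb.unit_def)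
      have "T \<in> compact_ops E"
      proof (rule compact_limit[OF T(1)])
        fix e :: real assume "e > 0"
        then obtain N where "norm (X N - l) < e"
          using LIMSEQ_D[OF lim] by blast
        moreover obtain K where K: "K \<in> compact_ops E" "X N = emb E K"
          using X by blast
        ultimately show "\<exists>K\<in>compact_ops E. op_norm E (T - K) < e"
          using emb.norm[OF End_minus(1)[OF T(1) compact_End[OF K(1)]]] emb.minus[OF T(1) compact_End[OF K(1)]] T(2)
          by (intro bexI[OF _ K(1)]) (simp add: norm_minus_commute)
      qed
      then show "l \<in> emb E ` compact_ops E"
        using T(2) by blast
    qed
  qed
qed

end

section \<open>Self-adjoint regular operators\<close>

context hilbert_module
begin

lemma hdense_sequence:
  assumes "hdense E W" "x \<in> hcarrier E"
  obtains w where "\<And>n::nat. w n \<in> W" "\<And>n. w n \<in> hcarrier E" "(\<lambda>n. hnorm E (w n - x)) \<longlonglongrightarrow> 0"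
proof -
  have "\<exists>w. w \<in> W \<and> hnorm E (x - w) < inverse (real (Suc n))" for n
  proof -
    have "0 < inverse (real (Suc n))"
      by simp
    with assms show ?thesis
      unfolding hdense_def by blast
  qed
  then obtain w where w: "\<And>n. w n \<in> W" "\<And>n. hnorm E (x - w n) < inverse (real (Suc n))"
    by metis
  have wE: "w n \<in> hcarrier E" for n
    using w(1) assms(1) by (auto simp: hdense_def)
  have "(\<lambda>n. hnorm E (w n - x)) \<longlonglongrightarrow> 0"
  proof (rule Lim_null_comparison[OF always_eventually LIMSEQ_inverse_real_of_nat], rule allI)
    show "norm (hnorm E (w n - x)) \<le> inverse (real (Suc n))" for n
      using w(2)[of n] hnorm_minus_commute[OF assms(2) wE, of n] by simp
  qed
  with w(1) wE that show ?thesis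
    by blast
qed

lemma hdense_ip_eq:
  assumes W: "hdense E W" and z: "z \<in> hcarrier E" "z' \<in> hcarrier E"
    and eq: "\<And>x. x \<in> W \<Longrightarrow> hip E x z = hip E x z'"
  shows "z = z'"
proof (rule eq_if_ip_eq[OF z])
  fix x assume x: "x \<in> hcarrier E"
  obtain w where w: "\<And>n. w n \<in> W" "\<And>n. w n \<in> hcarrier E" "(\<lambda>n. hnorm E (w n - x)) \<longlonglongrightarrow> 0"
    using hdense_sequence[OF W x] by blast
  show "hip E x z = hip E x z'"
    using LIMSEQ_unique[OF ip_tendsto(1)[OF w(2) x z(1) w(3)]] ip_tendsto(1)[OF w(2) x z(2) w(3)] eq[OF w(1)]
    by simp
qed

lemma Cauchy_if_dominated:
  assumes X: "\<And>n. X n \<in> hcarrier E" and Y: "\<And>n. Y n \<in> hcarrier E"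
    and dom: "\<And>m n. hnorm E (X m - X n) \<le> hnorm E (Y m - Y n)"
    and y: "y \<in> hcarrier E" "(\<lambda>n. hnorm E (Y n - y)) \<longlonglongrightarrow> 0"
  obtains x where "x \<in> hcarrier E" "(\<lambda>n. hnorm E (X n - x)) \<longlonglongrightarrow> 0"
proof -
  have "\<forall>e>0. \<exists>N. \<forall>m\<ge>N. \<forall>n\<ge>N. hnorm E (X m - X n) < e"
  proof (intro allI impI)
    fix e :: real assume "e > 0"
    then obtain N where N: "\<And>n. n \<ge> N \<Longrightarrow> hnorm E (Y n - y) < e / 2"
      using LIMSEQ_D[OF y(2), of "e / 2"] by auto
    have "hnorm E (X m - X n) < e" if "m \<ge> N" "n \<ge> N" for m n
      using dom[of m n] N[OF that(1)] N[OF that(2)] hnorm_diff_triangle[OF Y y(1) Y, of m n]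
        hnorm_minus_commute[OF y(1) Y, of n] by linarith
    then show "\<exists>N. \<forall>m\<ge>N. \<forall>n\<ge>N. hnorm E (X m - X n) < e"
      by blast
  qed
  then show ?thesis
    using complete[of X] X that by blast
qed

end

locale selfadjoint_regular = hilbert_module E
  for E :: "('e::complex_vector, 'b::cstar_algebra, 'z) hmod_scheme" +
  fixes D :: "('e, 'e) unbounded_op"
  assumes regular: "regular E D" and self_adjoint: "self_adjoint E D"
begin

lemma dom_dense: "hdense E (udom D)"
  using regular unfolding regular_def by blast

lemma dom_mem [simp]: "x \<in> udom D \<Longrightarrow> x \<in> hcarrier E"
  using dom_dense by (auto simp: hdense_def)

lemma D_mem [simp]: "x \<in> udom D \<Longrightarrow> uapp D x \<in> hcarrier E"
  using regular unfolding regular_def by blast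

lemma dom_subspace: "complex_vector.subspace (udom D)"
  using regular unfolding regular_def by blast

lemma dom_add: "x \<in> udom D \<Longrightarrow> y \<in> udom D \<Longrightarrow> x + y \<in> udom D"
  and dom_diff: "x \<in> udom D \<Longrightarrow> y \<in> udom D \<Longrightarrow> x - y \<in> udom D"
  and dom_scaleC: "x \<in> udom D \<Longrightarrow> c *\<^sub>C x \<in> udom D"
  and dom_zero: "0 \<in> udom D"
  using complex_vector.subspace_add[OF dom_subspace] complex_vector.subspace_diff[OF dom_subspace]
    complex_vector.subspace_scale[OF dom_subspace] complex_vector.subspace_0[OF dom_subspace] by blast+

lemma D_add: "x \<in> udom D \<Longrightarrow> y \<in> udom D \<Longrightarrow> uapp D (x + y) = uapp D x + uapp D y"
  using regular unfolding regular_def by blast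

lemma D_scaleC: "x \<in> udom D \<Longrightarrow> uapp D (c *\<^sub>C x) = c *\<^sub>C uapp D x"
  using regular unfolding regular_def by blast

lemma D_diff: "x \<in> udom D \<Longrightarrow> y \<in> udom D \<Longrightarrow> uapp D (x - y) = uapp D x - uapp D y"
  using D_add[of "x - y" y] dom_diff[of x y] by simp

lemma D_closed:
  assumes "\<And>n. X n \<in> udom D" "x \<in> hcarrier E" "y \<in> hcarrier E"
    "(\<lambda>n. hnorm E (X n - x)) \<longlonglongrightarrow> 0" "(\<lambda>n. hnorm E (uapp D (X n) - y)) \<longlonglongrightarrow> 0"
  shows "x \<in> udom D" "uapp D x = y"
proof -
  have "\<forall>X x y. (\<forall>n::nat. X n \<in> udom D) \<and> x \<in> hcarrier E \<and> y \<in> hcarrier E \<and>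
        (\<lambda>n. hnorm E (X n - x)) \<longlonglongrightarrow> 0 \<and> (\<lambda>n. hnorm E (uapp D (X n) - y)) \<longlonglongrightarrow> 0
        \<longrightarrow> x \<in> udom D \<and> uapp D x = y"
    using regular unfolding regular_def by blast
  then show "x \<in> udom D" "uapp D x = y"
    using assms by blast+
qed

lemma uadj_eq:
  assumes "y \<in> hcarrier E" "z \<in> hcarrier E" "\<And>x. x \<in> udom D \<Longrightarrow> hip E (uapp D x) y = hip E x z"
  shows "y \<in> udom (uadj E D)" "uapp (uadj E D) y = z"
proof -
  show "y \<in> udom (uadj E D)"
    using assms by (auto simp: uadj_def Let_def)
  have "(THE z. z \<in> hcarrier E \<and> (\<forall>x\<in>udom D. hip E (uapp D x) y = hip E x z)) = z"
  proof (rule the_equality)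
    show "z \<in> hcarrier E \<and> (\<forall>x\<in>udom D. hip E (uapp D x) y = hip E x z)"
      using assms by blast
    show "z' = z" if z': "z' \<in> hcarrier E \<and> (\<forall>x\<in>udom D. hip E (uapp D x) y = hip E x z')" for z'
      using assms z' by (intro hdense_ip_eq[OF dom_dense]) auto
  qed
  then show "uapp (uadj E D) y = z"
    by (simp add: uadj_def Let_def)
qed

lemma dom_uadj: "udom (uadj E D) = udom D" and uapp_uadj: "x \<in> udom D \<Longrightarrow> uapp (uadj E D) x = uapp D x"
  using self_adjoint by (simp_all add: self_adjoint_def)

text \<open>\<open>D\<^sup>* \<subseteq> D\<close>\<close>

lemma D_maximal:
  assumes "y \<in> hcarrier E" "z \<in> hcarrier E" "\<And>x. x \<in> udom D \<Longrightarrow> hip E (uapp D x) y = hip E x z"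
  shows "y \<in> udom D" "uapp D y = z"
  using uadj_eq[OF assms] dom_uadj uapp_uadj by auto

lemma D_symmetric:
  assumes "x \<in> udom D" "y \<in> udom D"
  shows "hip E (uapp D x) y = hip E x (uapp D y)"
proof -
  have "y \<in> udom (uadj E D)"
    using assms dom_uadj by simp
  then obtain z where z: "y \<in> hcarrier E" "z \<in> hcarrier E" "\<And>x. x \<in> udom D \<Longrightarrow> hip E (uapp D x) y = hip E x z"
    by (auto simp: uadj_def Let_def)
  then have "uapp D y = z"
    by (rule D_maximal)
  with z assms show ?thesis
    by simp
qed

subsection \<open>The resolvent \<open>(1 + D\<^sup>2)\<^bsup>-1\<^esup>\<close>\<close>

text \<open>\<open>\<langle>x, (1 + D\<^sup>2) x\<rangle> = \<langle>x, x\<rangle> + \<langle>D x, D x\<rangle>\<close>\<close>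

lemma energy_estimate:
  assumes x: "x \<in> udom D" "uapp D x \<in> udom D"
  shows "hnorm E x \<le> hnorm E (x + uapp D (uapp D x))" "hnorm E (uapp D x) \<le> hnorm E (x + uapp D (uapp D x))"
proof -
  define y where "y = x + uapp D (uapp D x)"
  have xy: "hip E x y = hip E x x + hip E (uapp D x) (uapp D x)"
    using x by (simp add: y_def ip_add D_symmetric)
  have pos: "cstar_positive (hip E x x)" "cstar_positive (hip E (uapp D x) (uapp D x))"
    using x by (simp_all add: ip_positive)
  have CS: "norm (hip E x y) \<le> hnorm E x * hnorm E y"
    using x by (intro Cauchy_Schwarz) (simp_all add: y_def)
  have "norm (hip E x x) \<le> norm (hip E x y)"
    using pos by (intro cstar_positive_norm_mono) (simp_all add: xy)
  then have "norm (hip E x x) \<le> hnorm E y * hnorm E x"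
    using CS by (simp add: mult.commute)
  then show 1: "hnorm E x \<le> hnorm E (x + uapp D (uapp D x))"
    using x unfolding y_def[symmetric] by (intro hnorm_le_if_ip_le) simp_all
  have "norm (hip E (uapp D x) (uapp D x)) \<le> norm (hip E x y)"
    using pos by (intro cstar_positive_norm_mono) (simp_all add: xy)
  also have "\<dots> \<le> hnorm E y * hnorm E y"
    using 1 by (intro order_trans[OF CS] mult_right_mono) (simp_all add: y_def)
  finally have "(hnorm E (uapp D x))\<^sup>2 \<le> (hnorm E y)\<^sup>2"
    unfolding hnorm_square[symmetric] power2_eq_square[symmetric] by simp
  then show "hnorm E (uapp D x) \<le> hnorm E (x + uapp D (uapp D x))"
    unfolding y_def[symmetric] by (rule power2_le_imp_le) simp
qed

text \<open>By the energy estimate, the graph norm of \<open>D\<close> is controlled by \<open>\<parallel>(1 + D\<^sup>2) x\<parallel>\<close>, so that the range of \<open>1 + D\<^sup>2\<close> is closed;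
  it is dense by regularity.\<close>

lemma resolvent_exists:
  assumes y: "y \<in> hcarrier E"
  shows "\<exists>!x. x \<in> udom D \<and> uapp D x \<in> udom D \<and> x + uapp D (uapp D x) = y"
proof -
  let ?S = "one_plus (uadj E D \<circ>\<^sub>u D)"
  have "uapp ?S ` udom ?S = (\<lambda>x. x + uapp D (uapp D x)) ` {x \<in> udom D. uapp D x \<in> udom D}"
    by (intro image_cong) (auto simp: one_plus_def ucomp_def dom_uadj uapp_uadj)
  moreover have "hdense E (uapp ?S ` udom ?S)"
    using regular unfolding regular_def by blast
  ultimately have "hdense E ((\<lambda>x. x + uapp D (uapp D x)) ` {x \<in> udom D. uapp D x \<in> udom D})"
    by simp
  from hdense_sequence[OF this y] obtain w where w: "\<And>n. w n \<in> (\<lambda>x. x + uapp D (uapp D x)) ` {x \<in> udom D. uapp D x \<in> udom D}"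
    "\<And>n. w n \<in> hcarrier E" "(\<lambda>n. hnorm E (w n - y)) \<longlonglongrightarrow> 0"
    by blast
  have "\<forall>n. \<exists>x. x \<in> udom D \<and> uapp D x \<in> udom D \<and> w n = x + uapp D (uapp D x)"
    using w(1) by blast
  then obtain X where X: "\<And>n. X n \<in> udom D" "\<And>n. uapp D (X n) \<in> udom D" "\<And>n. w n = X n + uapp D (uapp D (X n))"
    by metis
  have diff: "w m - w n = (X m - X n) + uapp D (uapp D (X m - X n))" for m n
    using X by (simp add: D_diff dom_diff algebra_simps)
  have dXn: "X m - X n \<in> udom D" "uapp D (X m - X n) \<in> udom D" for m n
    using X by (simp_all add: D_diff dom_diff)
  have "hnorm E (X m - X n) \<le> hnorm E (w m - w n)" "hnorm E (uapp D (X m) - uapp D (X n)) \<le> hnorm E (w m - w n)" for m n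
    using energy_estimate[OF dXn, of m n] X(1) unfolding diff[symmetric] by (simp_all add: D_diff)
  note le = this
  obtain x where x: "x \<in> hcarrier E" "(\<lambda>n. hnorm E (X n - x)) \<longlonglongrightarrow> 0"
    by (rule Cauchy_if_dominated[OF dom_mem[OF X(1)] w(2) le(1) y w(3)])
  obtain z where z: "z \<in> hcarrier E" "(\<lambda>n. hnorm E (uapp D (X n) - z)) \<longlonglongrightarrow> 0"
    by (rule Cauchy_if_dominated[OF D_mem[OF X(1)] w(2) le(2) y w(3)])
  have xD: "x \<in> udom D" "uapp D x = z"
    using D_closed[OF X(1) x(1) z(1) x(2) z(2)] by simp_all
  have "(\<lambda>n. hnorm E (w n - y) + hnorm E (X n - x)) \<longlonglongrightarrow> 0 + 0"
    by (intro tendsto_add w x)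
  moreover have "norm (hnorm E (uapp D (uapp D (X n)) - (y - x))) \<le> hnorm E (w n - y) + hnorm E (X n - x)" for n
  proof -
    have eq: "uapp D (uapp D (X n)) - (y - x) = (w n - y) - (X n - x)"
      using X(3)[of n] by (simp add: algebra_simps)
    show ?thesis
      unfolding eq using hnorm_triangle4[of "w n - y" "X n - x"] w(2) y X(1) x(1) by simp
  qed
  ultimately have lim: "(\<lambda>n. hnorm E (uapp D (uapp D (X n)) - (y - x))) \<longlonglongrightarrow> 0"
    using Lim_null_comparison[OF always_eventually, of "\<lambda>n. hnorm E (uapp D (uapp D (X n)) - (y - x))"
        "\<lambda>n. hnorm E (w n - y) + hnorm E (X n - x)"] by simp
  have zD: "z \<in> udom D" "uapp D z = y - x"
    using D_closed[OF X(2) z(1) diff_mem[OF y x(1)] z(2) lim] by simp_all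
  show ?thesis
  proof (rule ex1I[of _ x])
    show "x \<in> udom D \<and> uapp D x \<in> udom D \<and> x + uapp D (uapp D x) = y"
      using xD zD by simp
    fix x' assume x': "x' \<in> udom D \<and> uapp D x' \<in> udom D \<and> x' + uapp D (uapp D x') = y"
    have "hnorm E (x' - x) \<le> hnorm E ((x' - x) + uapp D (uapp D (x' - x)))"
      using x' xD zD by (intro energy_estimate) (simp_all add: D_diff dom_diff)
    also have "(x' - x) + uapp D (uapp D (x' - x)) = 0"
      using x' xD zD by (simp add: D_diff dom_diff algebra_simps)
    finally have "hnorm E (x' - x) = 0"
      using hnorm_nonneg[of "x' - x"] by simp
    then show "x' = x"
      using x' xD hnorm_eq_0[of "x' - x"] by simp
  qed
qed

definition "R = resolvent_sq E D"

lemma R_props: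
  assumes y: "y \<in> hcarrier E"
  shows "R y \<in> udom D" "uapp D (R y) \<in> udom D" "R y + uapp D (uapp D (R y)) = y"
proof -
  have "R y = (THE x. x \<in> udom D \<and> uapp D x \<in> udom D \<and> x + uapp D (uapp D x) = y)"
    using y by (simp add: R_def uinverse_def one_plus_def ucomp_def conj_assoc)
  then have "R y \<in> udom D \<and> uapp D (R y) \<in> udom D \<and> R y + uapp D (uapp D (R y)) = y"
    using theI'[OF resolvent_exists[OF y]] by simp
  then show "R y \<in> udom D" "uapp D (R y) \<in> udom D" "R y + uapp D (uapp D (R y)) = y"
    by simp_all
qed

lemma R_eqI: "x \<in> udom D \<Longrightarrow> uapp D x \<in> udom D \<Longrightarrow> R (x + uapp D (uapp D x)) = x"
  using resolvent_exists[of "x + uapp D (uapp D x)"] R_props[of "x + uapp D (uapp D x)"] by auto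

lemma R_off: "y \<notin> hcarrier E \<Longrightarrow> R y = 0"
  by (simp add: R_def uinverse_def)

text \<open>\<open>S = D (1 + D\<^sup>2)\<^bsup>-1\<^esup>\<close>\<close>

definition S :: "'e \<Rightarrow> 'e" where
  "S = (\<lambda>y. if y \<in> hcarrier E then uapp D (R y) else 0)"

lemma ip_R:
  assumes "y \<in> hcarrier E" "z \<in> hcarrier E"
  shows "hip E (R y) z = hip E (R y) (R z) + hip E (uapp D (R y)) (uapp D (R z))"
proof -
  have "hip E (R y) z = hip E (R y) (R z + uapp D (uapp D (R z)))"
    using R_props(3)[OF assms(2)] by simp
  also have "\<dots> = hip E (R y) (R z) + hip E (R y) (uapp D (uapp D (R z)))"
    using R_props assms by (intro ip_add) auto
  finally show ?thesis
    using R_props assms by (simp add: D_symmetric)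
qed

lemma R_End: "R \<in> End_ops E" "adj E E R = R"
proof -
  have om: "R \<in> op_maps E E"
    using R_props R_off by (auto simp: op_maps_def)
  have "is_adjoint E E R R"
    unfolding is_adjoint_def
  proof (intro ballI)
    fix y z assume yz: "y \<in> hcarrier E" "z \<in> hcarrier E"
    have m: "R y \<in> hcarrier E" "R z \<in> hcarrier E" "uapp D (R y) \<in> hcarrier E" "uapp D (R z) \<in> hcarrier E"
      using R_props yz by auto
    have "hip E y (R z) = (hip E (R z) y)\<^sup>\<star>"
      using m yz by (intro ip_star)
    also have "\<dots> = hip E (R y) (R z) + hip E (uapp D (R y)) (uapp D (R z))"
      using ip_R[OF yz(2,1)] m by (simp add: star_add flip: ip_star)
    finally show "hip E (R y) z = hip E y (R z)"
      using ip_R[OF yz] by simp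
  qed
  with om show "R \<in> End_ops E" "adj E E R = R"
    using self.adjointableI self.adj_eqI by blast+
qed

lemma S_End: "S \<in> End_ops E" "adj E E S = S"
proof -
  have om: "S \<in> op_maps E E"
    using R_props by (auto simp: op_maps_def S_def)
  have "is_adjoint E E S S"
    unfolding is_adjoint_def
  proof (intro ballI)
    fix y z assume yz: "y \<in> hcarrier E" "z \<in> hcarrier E"
    note Ry = R_props[OF yz(1)] and Rz = R_props[OF yz(2)]
    have "hip E (S y) z = hip E (uapp D (R y)) (R z + uapp D (uapp D (R z)))"
      using yz Rz(3) by (simp add: S_def)
    also have "\<dots> = hip E (uapp D (R y)) (R z) + hip E (uapp D (R y)) (uapp D (uapp D (R z)))"
      using Ry Rz by (intro ip_add) auto
    also have "\<dots> = hip E (R y) (uapp D (R z)) + hip E (uapp D (uapp D (R y))) (uapp D (R z))"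
      using Ry Rz by (simp add: D_symmetric)
    also have "\<dots> = hip E (R y + uapp D (uapp D (R y))) (uapp D (R z))"
      using Ry Rz by (intro ip_add_left[symmetric]) auto
    finally show "hip E (S y) z = hip E y (S z)"
      using yz Ry(3) by (simp add: S_def)
  qed
  with om show "S \<in> End_ops E" "adj E E S = S"
    using self.adjointableI self.adj_eqI by blast+
qed

lemma R_S_apply:
  assumes y: "y \<in> hcarrier E"
  shows "R (S y) = S (R y)" "S (S y) = R y - R (R y)"
proof -
  define u where "u = R (R y)"
  note Ry = R_props[OF y]
  have u: "u \<in> udom D" "uapp D u \<in> udom D" "u + uapp D (uapp D u) = R y"
    using R_props[of "R y"] Ry by (auto simp: u_def)
  have DDu: "uapp D (uapp D u) = R y - u"
    using u(3) by (simp add: algebra_simps)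
  then have DDu_dom: "uapp D (uapp D u) \<in> udom D"
    using Ry(1) u(1) by (simp add: dom_diff)
  have "uapp D u + uapp D (uapp D (uapp D u)) = uapp D (R y)"
    using u DDu_dom by (metis D_add)
  then have RDR: "R (uapp D (R y)) = uapp D u"
    using R_eqI[OF u(2) DDu_dom] by simp
  show "R (S y) = S (R y)"
    using y Ry by (simp add: S_def RDR u_def)
  show "S (S y) = R y - R (R y)"
    using y Ry by (simp add: S_def RDR DDu) (simp add: u_def)
qed

lemma R_S: "R \<circ> S = S \<circ> R" "S \<circ> S = R - (R \<circ> R)"
  by (rule End_ext; use R_End S_End in \<open>simp add: End_comp End_minus R_S_apply\<close>)+

lemma R_inj: "y \<in> hcarrier E \<Longrightarrow> R y = 0 \<Longrightarrow> y = 0"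
  using R_props[of y] D_scaleC[of 0 0] dom_zero by (simp add: complex_vector.scale_zero_left)

lemma op_norm_R: "op_norm E R \<le> 1"
proof (rule op_norm_le)
  show "hnorm E (R x) \<le> 1 * hnorm E x" if "x \<in> hcarrier E" for x
    using energy_estimate(1)[OF R_props(1,2)[OF that]] R_props(3)[OF that] by simp
qed simp

text \<open>\<open>y = R (1 + D\<^sup>2) y\<close>, rewritten so as to make sense on the whole domain of \<open>D\<close>.\<close>

lemma dom_eq_R_S:
  assumes y: "y \<in> udom D"
  shows "y = R y + S (uapp D y)"
proof (rule eq_if_ip_eq)
  fix z assume z: "z \<in> hcarrier E"
  note Rz = R_props[OF z]
  have "hip E z (S (uapp D y)) = hip E (S z) (uapp D y)"
    using y z S_End self.ip_adj[OF S_End(1), of z "uapp D y"] by simp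
  also have "\<dots> = hip E (uapp D (uapp D (R z))) y"
    using y z Rz by (simp add: S_def D_symmetric)
  also have "uapp D (uapp D (R z)) = z - R z"
    using Rz(3) by (simp add: algebra_simps)
  finally have "hip E z (S (uapp D y)) = hip E z y - hip E (R z) y"
    using y z Rz by (simp add: ip_diff_left)
  also have "hip E (R z) y = hip E z (R y)"
    using y z self.ip_adj[OF R_End(1), of z y] R_End(2) by simp
  finally show "hip E z y = hip E z (R y + S (uapp D y))"
    using y z by (simp add: ip_add End_mem[OF R_End(1)] End_mem[OF S_End(1)])
qed (use y in \<open>simp_all add: End_mem[OF R_End(1)] End_mem[OF S_End(1)]\<close>)

end

section \<open>Functional calculus and the bounded transform\<close>

context corner_embedding
begin

text \<open>The extension of \<open>\<epsilon>\<close> by the identity on the complement of the corner, which is unital and keeps \<open>R\<close> injective.\<close>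

definition "lift T = \<epsilon> T + (1 - unit)"

lemma unit_mult_assoc: "T \<in> End_ops E \<Longrightarrow> unit * (\<epsilon> T * y) = \<epsilon> T * y" "T \<in> End_ops E \<Longrightarrow> \<epsilon> T * (unit * y) = \<epsilon> T * y"
  "unit * (unit * y) = unit * y"
  by (simp_all add: unit_props flip: mult.assoc)

lemma lift_mult: "S \<in> End_ops E \<Longrightarrow> T \<in> End_ops E \<Longrightarrow> lift S * lift T = lift (S \<circ> T)"
  by (simp add: lift_def comp algebra_simps unit_props)

lemma lift_star: "T \<in> End_ops E \<Longrightarrow> (lift T)\<^sup>\<star> = lift (adj E E T)"
  by (simp add: lift_def adjoint star_simps unit_props)

lemma lift_id: "lift (id_op E) = 1"
  by (simp add: lift_def unit_def)

lemma lift_mult_emb: "S \<in> End_ops E \<Longrightarrow> T \<in> End_ops E \<Longrightarrow> lift S * \<epsilon> T = \<epsilon> (S \<circ> T)"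
  "S \<in> End_ops E \<Longrightarrow> T \<in> End_ops E \<Longrightarrow> \<epsilon> S * lift T = \<epsilon> (S \<circ> T)"
  by (simp_all add: lift_def comp algebra_simps)

lemma lift_inject: "S \<in> End_ops E \<Longrightarrow> T \<in> End_ops E \<Longrightarrow> lift S = lift T \<longleftrightarrow> S = T"
  by (simp add: lift_def inject)

lemma pos_one_minus_unit: "pos (1 - unit)"
proof -
  have "pos ((1 - unit) * (1 - unit))"
    by (rule pos_square) (simp add: star_simps unit_props)
  then show ?thesis
    by (simp add: algebra_simps unit_props)
qed

lemma pos_lift: "pos (\<epsilon> T) \<Longrightarrow> pos (lift T)"
  unfolding lift_def by (intro pos_add pos_one_minus_unit)

lemma End_power: "P \<in> End_ops E \<Longrightarrow> (P ^^ i) \<circ> id_op E \<in> End_ops E"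
proof (induction i)
  case (Suc i)
  have eq: "(P ^^ Suc i) \<circ> id_op E = P \<circ> ((P ^^ i) \<circ> id_op E)"
    by (simp add: comp_assoc)
  show ?case
    unfolding eq by (rule End_comp(1)[OF Suc.prems Suc.IH[OF Suc.prems]])
qed (simp add: End_id)

lemma emb_power: "P \<in> End_ops E \<Longrightarrow> \<epsilon> ((P ^^ i) \<circ> id_op E) = unit * \<epsilon> P ^ i"
proof (induction i)
  case (Suc i)
  have eq: "(P ^^ Suc i) \<circ> id_op E = P \<circ> ((P ^^ i) \<circ> id_op E)"
    by (simp add: comp_assoc)
  show ?case
    unfolding eq comp[OF Suc.prems End_power[OF Suc.prems]] Suc.IH[OF Suc.prems]
    by (simp add: unit_mult_assoc Suc.prems)
qed (simp add: unit_def)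

lemma lift_power: "P \<in> End_ops E \<Longrightarrow> lift P ^ i = unit * \<epsilon> P ^ i + (1 - unit)"
proof (induction i)
  case (Suc i)
  show ?case
    unfolding power_Suc Suc.IH[OF Suc.prems] using Suc.prems
    by (simp add: lift_def distrib_left distrib_right left_diff_distrib right_diff_distrib unit_mult_assoc unit_props)
qed simp

lemma emb_sum:
  assumes "\<And>i. i \<in> A \<Longrightarrow> f i \<in> End_ops E"
  shows "sum f A \<in> End_ops E" "\<epsilon> (sum f A) = (\<Sum>i\<in>A. \<epsilon> (f i))"
proof -
  have "sum f A \<in> End_ops E \<and> \<epsilon> (sum f A) = (\<Sum>i\<in>A. \<epsilon> (f i))"
    using assms
  proof (induction A rule: infinite_finite_induct)
    case (insert x A)
    have IH: "f x \<in> End_ops E" "sum f A \<in> End_ops E" "\<epsilon> (sum f A) = (\<Sum>i\<in>A. \<epsilon> (f i))"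
      using insert by blast+
    show ?case
      unfolding sum.insert[OF insert.hyps(1,2)] plus[OF IH(1,2)] IH(3) using End_plus(1)[OF IH(1,2)] by blast
  next
    case (infinite A)
    show ?case
      unfolding sum.infinite[OF infinite.hyps] zero using End_0(1) by blast
  next
    case empty
    show ?case
      unfolding sum.empty zero using End_0(1) by blast
  qed
  then show "sum f A \<in> End_ops E" "\<epsilon> (sum f A) = (\<Sum>i\<in>A. \<epsilon> (f i))"
    by blast+
qed

lemma emb_op_poly:
  assumes P: "P \<in> End_ops E"
  shows "op_poly E p P \<in> End_ops E" "\<epsilon> (op_poly E p P) = unit * peval p (\<epsilon> P)"
proof -
  note PE = End_power[OF P]
  have summand: "complex_of_real (coeff p i) *\<^sub>C ((P ^^ i) \<circ> id_op E) \<in> End_ops E" for i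
    by (rule End_scale(1)[OF PE])
  show "op_poly E p P \<in> End_ops E"
    unfolding op_poly_def by (rule emb_sum(1)[OF summand])
  have "\<epsilon> (op_poly E p P) = (\<Sum>i\<le>degree p. \<epsilon> (complex_of_real (coeff p i) *\<^sub>C ((P ^^ i) \<circ> id_op E)))"
    unfolding op_poly_def by (rule emb_sum(2)[OF summand])
  also have "\<dots> = (\<Sum>i\<le>degree p. coeff p i *\<^sub>R (unit * \<epsilon> P ^ i))"
    using scale[OF PE] emb_power[OF P] by (simp add: scaleR_scaleC)
  finally show "\<epsilon> (op_poly E p P) = unit * peval p (\<epsilon> P)"
    by (simp add: peval_altdef_le[OF order_refl] sum_distrib_left)
qed

lemma peval_lift:
  assumes P: "P \<in> End_ops E"
  shows "peval p (lift P) = unit * peval p (\<epsilon> P) + poly p 1 *\<^sub>R (1 - unit)"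
proof -
  have "peval p (lift P) = (\<Sum>i\<le>degree p. coeff p i *\<^sub>R (unit * \<epsilon> P ^ i) + coeff p i *\<^sub>R (1 - unit))"
    by (simp add: peval_altdef_le[OF order_refl] lift_power[OF P] scaleR_add_right)
  then show ?thesis
    by (simp add: peval_altdef_le[OF order_refl] sum_distrib_left sum.distrib poly_altdef scaleR_sum_left)
qed

text \<open>\<open>\<epsilon>\<close> maps the approximating polynomials in \<open>P\<close> to those in \<open>\<epsilon> P\<close>, cut down to the corner, which determine their limit.\<close>

lemma fun_calc_emb:
  assumes P: "P \<in> End_ops E" "pos (\<epsilon> P)" and f: "continuous_on {0..op_norm E P} f"
  shows "fun_calc E f P \<in> End_ops E" "\<epsilon> (fun_calc E f P) = unit * fcalc (\<epsilon> P) f"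
proof -
  note nP = norm[OF P(1)]
  have com: "unit * fcalc (\<epsilon> P) f = fcalc (\<epsilon> P) f * unit"
    by (rule fcalc_commute) (use P f in \<open>simp_all add: nP\<close>)
  obtain T where T: "T \<in> End_ops E" "unit * fcalc (\<epsilon> P) f * unit = \<epsilon> T"
    using corner[of "fcalc (\<epsilon> P) f"] by (auto simp: unit_def)
  have eT: "\<epsilon> T = unit * fcalc (\<epsilon> P) f"
    using T(2) by (simp add: com mult.assoc unit_props)
  let ?Q = "\<lambda>T. T \<in> End_ops E \<and> (\<exists>p :: nat \<Rightarrow> real poly.
    uniform_limit {0..op_norm E P} (\<lambda>n x. poly (p n) x) f sequentially \<and>
    (\<lambda>n. op_norm E (T - op_poly E (p n) P)) \<longlonglongrightarrow> 0)"
  have lim: "(\<lambda>n. unit * peval (p n) (\<epsilon> P)) \<longlonglongrightarrow> unit * fcalc (\<epsilon> P) f"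
    if "uniform_limit {0..op_norm E P} (\<lambda>n x. poly (p n) x) f sequentially" for p
    using fcalc_tendsto[OF P(2), of p f] that by (intro tendsto_mult tendsto_const) (simp add: nP)
  have op_norm_diff: "op_norm E (T' - op_poly E q P) = norm (unit * peval q (\<epsilon> P) - \<epsilon> T')"
    if "T' \<in> End_ops E" for T' q
    using norm[of "T' - op_poly E q P"] that emb_op_poly[OF P(1), of q]
    by (simp add: End_minus minus norm_minus_commute)
  have "fun_calc E f P = T"
    unfolding fun_calc_def
  proof (rule the_equality)
    obtain p where p: "uniform_limit {0..op_norm E P} (\<lambda>n x. poly (p n) x) f sequentially"
      using uniform_limit_poly_exists[OF f] by blast
    have "(\<lambda>n. op_norm E (T - op_poly E (p n) P)) \<longlonglongrightarrow> 0"
      unfolding op_norm_diff[OF T(1)] using tendsto_norm_zero[OF LIM_zero[OF lim[OF p]]] by (simp add: eT)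
    with T(1) p show "?Q T"
      by blast
  next
    fix T' assume "?Q T'"
    then obtain p where T': "T' \<in> End_ops E" and p: "uniform_limit {0..op_norm E P} (\<lambda>n x. poly (p n) x) f sequentially"
      and p0: "(\<lambda>n. op_norm E (T' - op_poly E (p n) P)) \<longlonglongrightarrow> 0"
      by blast
    from p0 have "(\<lambda>n. unit * peval (p n) (\<epsilon> P)) \<longlonglongrightarrow> \<epsilon> T'"
      unfolding op_norm_diff[OF T'] by (rule LIM_zero_cancel[OF tendsto_norm_zero_cancel])
    then have "\<epsilon> T' = unit * fcalc (\<epsilon> P) f"
      using lim[OF p] by (rule LIMSEQ_unique)
    then show "T' = T"
      using eT inject[OF T' T(1)] by simp
  qed
  then show "fun_calc E f P \<in> End_ops E" "\<epsilon> (fun_calc E f P) = unit * fcalc (\<epsilon> P) f"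
    using T(1) eT by simp_all
qed

lemma fcalc_lift:
  assumes P: "P \<in> End_ops E" "pos (\<epsilon> P)" "op_norm E P \<le> 1" "norm (lift P) \<le> 1" and f: "continuous_on {0..1} f" "f 1 = 1"
  shows "fcalc (lift P) f = lift (fun_calc E f P)"
proof -
  obtain p where p: "uniform_limit {0..1} (\<lambda>n x. poly (p n) x) f sequentially"
    using uniform_limit_poly_exists[OF f(1)] by blast
  have "(\<lambda>n. peval (p n) (lift P)) \<longlonglongrightarrow> fcalc (lift P) f"
    using P by (intro fcalc_tendsto pos_lift uniform_limit_on_subset[OF p]) auto
  moreover have "(\<lambda>n. unit * peval (p n) (\<epsilon> P) + poly (p n) 1 *\<^sub>R (1 - unit)) \<longlonglongrightarrow> unit * fcalc (\<epsilon> P) f + f 1 *\<^sub>R (1 - unit)"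
    using P by (intro tendsto_intros fcalc_tendsto uniform_limit_on_subset[OF p] tendsto_uniform_limitI[OF p])
      (auto simp: norm)
  ultimately have "fcalc (lift P) f = unit * fcalc (\<epsilon> P) f + f 1 *\<^sub>R (1 - unit)"
    by (auto simp: peval_lift[OF P(1)] intro: LIMSEQ_unique)
  moreover have "\<epsilon> (fun_calc E f P) = unit * fcalc (\<epsilon> P) f"
    using P f by (intro fun_calc_emb continuous_on_subset[OF f(1)]) auto
  ultimately show ?thesis
    by (simp add: lift_def f(2))
qed

end

locale embedded_regular = selfadjoint_regular E D + corner_embedding E \<epsilon>
  for E :: "('e::complex_vector, 'b::cstar_algebra, 'z) hmod_scheme" and D
    and \<epsilon> :: "('e \<Rightarrow> 'e) \<Rightarrow> 'c::unital_cstar_algebra"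
begin

lemma emb_S_S: "\<epsilon> S * \<epsilon> S = \<epsilon> R - \<epsilon> R * \<epsilon> R"
  using comp[OF S_End(1) S_End(1)] comp[OF R_End(1) R_End(1)] minus[OF R_End(1) End_comp(1)[OF R_End(1) R_End(1)]]
  by (simp add: R_S)

lemma emb_selfadjoint: "(\<epsilon> R)\<^sup>\<star> = \<epsilon> R" "(\<epsilon> S)\<^sup>\<star> = \<epsilon> S"
  using adjoint[OF R_End(1)] adjoint[OF S_End(1)] by (simp_all add: R_End S_End)

lemma pos_emb_R: "pos (\<epsilon> R)"
proof -
  have "pos (\<epsilon> R * \<epsilon> R + \<epsilon> S * \<epsilon> S)"
    by (intro pos_add pos_square emb_selfadjoint)
  then show ?thesis
    by (simp add: emb_S_S)
qed

lemma norm_lift_R: "norm (lift R) \<le> 1"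
proof -
  have "pos ((unit - \<epsilon> R) * (unit - \<epsilon> R) + \<epsilon> S * \<epsilon> S)"
    by (intro pos_add pos_square) (simp_all add: star_simps emb_selfadjoint unit_props)
  also have "(unit - \<epsilon> R) * (unit - \<epsilon> R) + \<epsilon> S * \<epsilon> S = 1 - lift R"
    by (simp add: emb_S_S algebra_simps R_End unit_props lift_def)
  finally show ?thesis
    using pos_norm_mono[OF pos_lift[OF pos_emb_R], of 1] by simp
qed

text \<open>It suffices to show that \<open>z = y y\<^sup>*\<close> vanishes, which lies in the corner and so is given by an operator on \<open>E\<close>.\<close>

lemma lift_R_inj:
  assumes "lift R * y = 0"
  shows "y = 0"
proof -
  define z where "z = y * y\<^sup>\<star>"
  have z: "z\<^sup>\<star> = z" "\<epsilon> R * z + (1 - unit) * z = 0"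
    using arg_cong[OF assms, of "\<lambda>x. x * y\<^sup>\<star>"] by (simp_all add: z_def star_simps lift_def distrib_right mult.assoc)
  have "unit * (\<epsilon> R * z + (1 - unit) * z) = \<epsilon> R * z"
    by (simp add: distrib_left left_diff_distrib right_diff_distrib unit_mult_assoc R_End)
  then have Rz: "\<epsilon> R * z = 0" and uz: "unit * z = z"
    using z(2) by (simp_all add: left_diff_distrib)
  have "z * unit = z"
    using arg_cong[OF uz, of star] by (simp add: star_simps z(1) unit_props)
  with uz obtain T where T: "T \<in> End_ops E" "z = \<epsilon> T"
    using corner[of z] by (auto simp: unit_def)
  have "\<epsilon> (R \<circ> T) = \<epsilon> 0"
    using Rz T by (simp add: comp R_End zero)
  then have "R \<circ> T = 0"
    using inject[OF End_comp(1)[OF R_End(1) T(1)] End_0(1)] by simp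
  have "T x = 0" for x
    using R_inj[OF End_mem_all[OF T(1), of x]] fun_cong[OF \<open>R \<circ> T = 0\<close>, of x] by simp
  then have "z = 0"
    using T(2) zero by (metis (full_types) ext zero_fun_apply)
  then have "norm ((y\<^sup>\<star>)\<^sup>\<star> * y\<^sup>\<star>) = 0"
    by (simp add: z_def star_star)
  then show ?thesis
    by (simp add: cstar_identity norm_star)
qed

lemma rp_lift:
  assumes "s \<ge> 0"
  shows "bracket_power E D s \<in> End_ops E" "rp (lift R) s = lift (bracket_power E D s)"
  unfolding bracket_power_def rp_def R_def[symmetric]
  using assms continuous_on_rp[OF assms]
  by (auto intro!: fun_calc_emb(1) fcalc_lift simp: R_End pos_emb_R op_norm_R norm_lift_R)

definition "r = bracket_power E D 1"

lemma r_End: "r \<in> End_ops E" "adj E E r = r" "lift r = rp (lift R) 1"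
proof -
  show "r \<in> End_ops E" "lift r = rp (lift R) 1"
    using rp_lift[of 1] by (simp_all add: r_def)
  then show "adj E E r = r"
    using rp_star[OF pos_lift[OF pos_emb_R], of 1] lift_star[of r] lift_inject[of "adj E E r" r] End_adj[of r] by simp
qed

lemma r_r: "r \<circ> r = R"
proof -
  have "lift (r \<circ> r) = lift R"
    using rp_add[OF pos_lift[OF pos_emb_R], of 1 1] rp_2[OF pos_lift[OF pos_emb_R]] r_End
    by (simp flip: lift_mult)
  then show ?thesis
    by (simp add: lift_inject End_comp R_End r_End)
qed

lemma r_commute: 
  assumes "T \<in> End_ops E" "T \<circ> R = R \<circ> T"
  shows "T \<circ> r = r \<circ> T"
proof -
  have "lift T * lift r = lift r * lift T"
    unfolding r_End(3)
    by (rule rp_commute[OF pos_lift[OF pos_emb_R]]) (use assms in \<open>simp_all add: lift_mult R_End\<close>)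
  then show ?thesis
    by (simp add: assms(1) r_End(1) lift_mult lift_inject End_comp)
qed

text \<open>The domain of \<open>D\<^sup>2\<close> is dense: \<open>y \<in> dom D\<close> equals \<open>R y + S w\<close> with \<open>w = D y\<close>, and \<open>S w = R D w\<close> if
  \<open>w \<in> dom D\<close>.\<close>

lemma S_dom:
  assumes w: "w \<in> udom D"
  shows "S w = R (uapp D w)"
proof (rule eq_if_ip_eq)
  fix z assume z: "z \<in> hcarrier E"
  have "hip E z (R (uapp D w)) = hip E (R z) (uapp D w)"
    using self.ip_adj[OF R_End(1) z, of "uapp D w"] w by (simp add: R_End)
  also have "\<dots> = hip E (S z) w"
    using D_symmetric[OF R_props(1)[OF z] w] z by (simp add: S_def)
  also have "\<dots> = hip E z (S w)"
    using self.ip_adj[OF S_End(1) z, of w] w by (simp add: S_End)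
  finally show "hip E z (S w) = hip E z (R (uapp D w))" ..
qed (simp_all add: End_mem_all[OF R_End(1)] End_mem_all[OF S_End(1)])

lemma R_range_dense:
  assumes x: "x \<in> hcarrier E" and e: "e > 0"
  shows "\<exists>z\<in>hcarrier E. hnorm E (x - R z) < e"
proof -
  obtain y where y: "y \<in> udom D" "hnorm E (x - y) < e / 2"
    using dom_dense x e unfolding hdense_def by (metis half_gt_zero)
  define K where "K = op_norm E S + 1"
  have K: "K > 0"
    using op_norm_nonneg[OF S_End(1)] by (simp add: K_def)
  obtain w where w: "w \<in> udom D" "hnorm E (uapp D y - w) < e / 2 / K"
    using dom_dense D_mem[OF y(1)] e K unfolding hdense_def by (metis half_gt_zero divide_pos_pos)
  define z where "z = y + uapp D w"
  have z: "z \<in> hcarrier E"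
    using y w by (simp add: z_def)
  have "R z = R y + R (uapp D w)"
    using y w by (simp add: z_def End_add_apply[OF R_End(1)])
  then have "y - R z = S (uapp D y) - S w"
    using dom_eq_R_S[OF y(1)] S_dom[OF w(1)] by (metis add_diff_cancel_left add_diff_cancel_left')
  also have "\<dots> = S (uapp D y - w)"
    using y w by (simp add: End_diff_apply[OF S_End(1)])
  finally have "hnorm E (y - R z) \<le> op_norm E S * hnorm E (uapp D y - w)"
    using op_norm_bound[OF S_End(1), of "uapp D y - w"] y w by simp
  also have "\<dots> \<le> K * hnorm E (uapp D y - w)"
    by (intro mult_right_mono) (simp_all add: K_def)
  also have "\<dots> < e / 2"
    using w(2) K by (simp add: field_simps)
  finally have "hnorm E (x - R z) < e"
    using hnorm_diff_triangle[of x y "R z"] x y z End_mem_all[OF R_End(1)] by fastforce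
  with z show ?thesis
    by blast
qed

abbreviation "F \<equiv> bounded_transform E D"

text \<open>The operator \<open>D r\<close> is everywhere defined: \<open>D\<close> is closed, \<open>x\<close> is the limit of some \<open>r z\<^sub>n\<close>, and \<open>D (r (r z\<^sub>n)) = S z\<^sub>n\<close> converges because
  \<open>\<parallel>S z\<parallel> \<le> \<parallel>r z\<parallel>\<close>.\<close>

lemma F_limit:
  assumes x: "x \<in> hcarrier E"
  obtains z where "\<And>n. z n \<in> hcarrier E" "(\<lambda>n. hnorm E (r (z n) - x)) \<longlonglongrightarrow> 0"
    "(\<lambda>n. hnorm E (S (z n) - F x)) \<longlonglongrightarrow> 0" "r x \<in> udom D" "F x \<in> hcarrier E"
proof -
  have "hdense E (r ` hcarrier E)"
    unfolding hdense_def
  proof (intro conjI ballI allI impI)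
    show "r ` hcarrier E \<subseteq> hcarrier E"
      using End_mem_all[OF r_End(1)] by auto
    fix x :: 'e and e :: real assume "x \<in> hcarrier E" "e > 0"
    then obtain z where "z \<in> hcarrier E" "hnorm E (x - R z) < e"
      using R_range_dense by blast
    then show "\<exists>w\<in>r ` hcarrier E. hnorm E (x - w) < e"
      using fun_cong[OF r_r, of z] End_mem_all[OF r_End(1)] by (intro bexI[of _ "r (r z)"]) (simp_all add: image_eqI[of _ r "r z"])
  qed
  from hdense_sequence[OF this x] obtain w where w: "\<And>n::nat. w n \<in> r ` hcarrier E"
    "\<And>n. w n \<in> hcarrier E" "(\<lambda>n. hnorm E (w n - x)) \<longlonglongrightarrow> 0"
    by blast
  have "\<forall>n. \<exists>z. z \<in> hcarrier E \<and> w n = r z"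
    using w(1) by blast
  then obtain z where z: "\<And>n. z n \<in> hcarrier E" "\<And>n. w n = r (z n)"
    by metis
  have SE: "S (z n) \<in> hcarrier E" and rE: "r (z n) \<in> hcarrier E" for n
    by (simp_all add: End_mem_all[OF S_End(1)] End_mem_all[OF r_End(1)])
  have S_le_r: "hnorm E (S y) \<le> hnorm E (r y)" if y: "y \<in> hcarrier E" for y
  proof -
    have "hip E (r y) (r y) = hip E y (R y)"
      using self.ip_adj[OF r_End(1) y, of "r y"] y fun_cong[OF r_r, of y] by (simp add: r_End End_mem_all[OF r_End(1)])
    moreover have "hip E (S y) (S y) = hip E y (R y) - hip E y (R (R y))"
      using self.ip_adj[OF S_End(1) y, of "S y"] y R_S_apply(2)[OF y]
      by (simp add: S_End End_mem_all[OF S_End(1)] End_mem_all[OF R_End(1)] ip_diff)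
    moreover have "hip E (R y) (R y) = hip E y (R (R y))"
      using self.ip_adj[OF R_End(1) y, of "R y"] y by (simp add: R_End End_mem_all[OF R_End(1)])
    ultimately have "hip E (r y) (r y) = hip E (S y) (S y) + hip E (R y) (R y)"
      by simp
    then have "norm (hip E (S y) (S y)) \<le> norm (hip E (r y) (r y))"
      using ip_positive[OF End_mem_all[OF S_End(1)]] ip_positive[OF End_mem_all[OF R_End(1)]]
      by (intro cstar_positive_norm_mono) simp_all
    then show ?thesis
      by (simp add: hnorm_def)
  qed
  have le: "hnorm E (S (z m) - S (z n)) \<le> hnorm E (w m - w n)" for m n
    using S_le_r[of "z m - z n"] z
    by (simp add: End_diff_apply[OF S_End(1)] End_diff_apply[OF r_End(1)])
  obtain v where v: "v \<in> hcarrier E" "(\<lambda>n. hnorm E (S (z n) - v)) \<longlonglongrightarrow> 0"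
    by (rule Cauchy_if_dominated[OF SE w(2) le x w(3)])
  have Rz: "R (z n) \<in> udom D" "uapp D (R (z n)) = S (z n)" for n
    using R_props[OF z(1)] z(1) by (simp_all add: S_def)
  have lim_r: "(\<lambda>n. hnorm E (r (w n) - r x)) \<longlonglongrightarrow> 0"
  proof (rule Lim_null_comparison[OF always_eventually])
    show "\<forall>n. norm (hnorm E (r (w n) - r x)) \<le> op_norm E r * hnorm E (w n - x)"
      using op_norm_bound[OF r_End(1)] w(2) x by (auto simp flip: End_diff_apply[OF r_End(1)])
    show "(\<lambda>n. op_norm E r * hnorm E (w n - x)) \<longlonglongrightarrow> 0"
      using tendsto_mult_left[OF w(3), of "op_norm E r"] by simp
  qed
  have "r (w n) = R (z n)" for n
    using fun_cong[OF r_r, of "z n"] z by simp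
  then have lim_R: "(\<lambda>n. hnorm E (R (z n) - r x)) \<longlonglongrightarrow> 0"
    using lim_r by simp
  have limD: "(\<lambda>n. hnorm E (uapp D (R (z n)) - v)) \<longlonglongrightarrow> 0"
    using v(2) by (simp add: Rz)
  have rx: "r x \<in> udom D" "uapp D (r x) = v"
    using D_closed[OF Rz(1) End_mem_all[OF r_End(1)] v(1) lim_R limD] by simp_all
  then have "F x = v"
    using x by (simp add: bounded_transform_def r_def)
  then show ?thesis
    using that[of z] z v rx w(3) by simp
qed

lemma F_apply: "x \<in> hcarrier E \<Longrightarrow> r x \<in> udom D" "x \<in> hcarrier E \<Longrightarrow> F x = uapp D (r x)"
  using F_limit[of x] by (auto simp: bounded_transform_def r_def)

lemma F_r: "F \<circ> r = S"
proof
  fix x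
  show "(F \<circ> r) x = S x"
  proof (cases "x \<in> hcarrier E")
    case True
    then show ?thesis
      using F_apply(2)[of "r x"] End_mem_all[OF r_End(1)] fun_cong[OF r_r, of x] by (simp add: S_def)
  next
    case False
    then show ?thesis
      using End_off[OF r_End(1)] End_off[OF S_End(1)] F_apply(2)[of 0] End_zero_apply[OF r_End(1)] D_scaleC[OF dom_zero, of 0]
      by simp
  qed
qed

lemma F_End: "F \<in> End_ops E" "adj E E F = F"
proof -
  have om: "F \<in> op_maps E E"
  proof -
    have "F x \<in> hcarrier E" if "x \<in> hcarrier E" for x
      using F_apply[OF that] by simp
    then show ?thesis
      by (auto simp: op_maps_def bounded_transform_def)
  qed
  then have FE: "F x \<in> hcarrier E" if "x \<in> hcarrier E" for x
    using that by (auto simp: op_maps_def)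
  note rE = End_mem_all[OF r_End(1)] and SE = End_mem_all[OF S_End(1)]
  have "S \<circ> r = r \<circ> S"
    using r_commute[OF S_End(1)] R_S(1) by simp
  from fun_cong[OF this] have Sr: "S (r w) = r (S w)" for w
    by simp
  have S_r: "hip E (S z) (r w) = hip E (r z) (S w)" if "z \<in> hcarrier E" "w \<in> hcarrier E" for z w
    using self.ip_adj[OF S_End(1) that(1) rE, of w] self.ip_adj[OF r_End(1) that(1) SE, of w]
      by (simp add: S_End r_End Sr)
  have F_r': "hip E (F x) (r w) = hip E x (S w)" if x: "x \<in> hcarrier E" and w: "w \<in> hcarrier E" for x w
  proof -
    obtain z where z: "\<And>n. z n \<in> hcarrier E" "(\<lambda>n. hnorm E (r (z n) - x)) \<longlonglongrightarrow> 0"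
      "(\<lambda>n. hnorm E (S (z n) - F x)) \<longlonglongrightarrow> 0"
      using F_limit[OF x] by blast
    have "(\<lambda>n. hip E (S (z n)) (r w)) \<longlonglongrightarrow> hip E (F x) (r w)"
      by (rule ip_tendsto(1)[OF SE FE[OF x] rE z(3)])
    moreover have "(\<lambda>n. hip E (S (z n)) (r w)) \<longlonglongrightarrow> hip E x (S w)"
      using ip_tendsto(1)[OF rE x SE z(2), of w] by (simp add: S_r z(1) w)
    ultimately show ?thesis
      by (rule LIMSEQ_unique)
  qed
  have "is_adjoint E E F F"
    unfolding is_adjoint_def
  proof (intro ballI)
    fix x y assume x: "x \<in> hcarrier E" and y: "y \<in> hcarrier E"
    obtain z where z: "\<And>n. z n \<in> hcarrier E" "(\<lambda>n. hnorm E (r (z n) - y)) \<longlonglongrightarrow> 0"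
      "(\<lambda>n. hnorm E (S (z n) - F y)) \<longlonglongrightarrow> 0"
      using F_limit[OF y] by blast
    have "(\<lambda>n. hip E (F x) (r (z n))) \<longlonglongrightarrow> hip E (F x) y"
      by (rule ip_tendsto(2)[OF rE y FE[OF x] z(2)])
    moreover have "(\<lambda>n. hip E (F x) (r (z n))) \<longlonglongrightarrow> hip E x (F y)"
      using ip_tendsto(2)[OF SE FE[OF y] x z(3)] by (simp add: F_r' x z(1))
    ultimately show "hip E (F x) y = hip E x (F y)"
      by (rule LIMSEQ_unique)
  qed
  with om show "F \<in> End_ops E" "adj E E F = F"
    using self.adjointableI self.adj_eqI by blast+
qed

lemma r_F: "r \<circ> F = S"
  using End_comp(2)[OF F_End(1) r_End(1)] by (simp add: F_r F_End r_End S_End)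

text \<open>\<open>(1 + D\<^sup>2)\<^bsup>-1/2\<^esup> D \<subseteq> F\<close>\<close>

lemma r_D:
  assumes y: "y \<in> udom D"
  shows "r (uapp D y) = F y"
proof (rule eq_if_ip_eq)
  fix z assume z: "z \<in> hcarrier E"
  have "hip E z (r (uapp D y)) = hip E (r z) (uapp D y)"
    using self.ip_adj[OF r_End(1) z, of "uapp D y"] y by (simp add: r_End)
  also have "\<dots> = hip E (F z) y"
    using D_symmetric[OF F_apply(1)[OF z] y] F_apply(2)[OF z] by simp
  also have "\<dots> = hip E z (F y)"
    using self.ip_adj[OF F_End(1) z, of y] y by (simp add: F_End)
  finally show "hip E z (r (uapp D y)) = hip E z (F y)" .
qed (simp_all add: End_mem_all[OF r_End(1)] End_mem_all[OF F_End(1)])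

lemma F_R: "F \<circ> R = R \<circ> F"
proof -
  have "F \<circ> R = S \<circ> r" "R \<circ> F = r \<circ> S"
    using F_r r_F by (metis r_r comp_assoc)+
  then show ?thesis
    using r_commute[OF S_End(1)] R_S(1) by simp
qed

text \<open>\<open>R F\<^sup>2 = S\<^sup>2 = R (1 - R)\<close>, and \<open>R\<close> is injective.\<close>

lemma F_F: "F \<circ> F = id_op E - R"
proof -
  note FF = End_comp(1)[OF F_End(1) F_End(1)] and iR = End_minus[OF End_id(1) R_End(1)]
  have "R \<circ> (F \<circ> F) = S \<circ> S"
    using F_R F_r r_F r_r by (metis comp_assoc)
  also have "\<dots> = R \<circ> (id_op E - R)"
    using End_comp_plus(2)[OF R_End(1) End_id(1) R_End(1)] by (simp add: R_S id_op_comp R_End)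
  finally have eq: "R \<circ> ((F \<circ> F) - (id_op E - R)) = 0"
    using End_comp_plus(2)[OF R_End(1) FF iR(1)] by simp
  have "((F \<circ> F) - (id_op E - R)) x = 0" for x
  proof (rule R_inj)
    show "((F \<circ> F) - (id_op E - R)) x \<in> hcarrier E"
      by (rule End_mem_all[OF End_minus(1)[OF FF iR(1)]])
    show "R (((F \<circ> F) - (id_op E - R)) x) = 0"
      using fun_cong[OF eq, of x] by (simp only: comp_apply zero_fun_apply)
  qed
  then have "(F \<circ> F) - (id_op E - R) = 0"
    by (intro ext) (simp only: zero_fun_apply)
  then show ?thesis
    by (simp only: right_minus_eq)
qed

lemma bracket_lift: "bracket (lift R) (\<epsilon> F)"
proof
  show "pos (lift R)" "norm (lift R) \<le> 1"
    using pos_lift pos_emb_R norm_lift_R by blast+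
  show "(\<epsilon> F)\<^sup>\<star> = \<epsilon> F"
    using adjoint[OF F_End(1)] by (simp add: F_End)
  show "\<epsilon> F * lift R = lift R * \<epsilon> F"
    by (simp add: lift_mult_emb F_End R_End F_R)
  show "\<epsilon> F * \<epsilon> F = 1 - lift R"
    using comp[OF F_End(1) F_End(1)] minus[OF End_id(1) R_End(1)] by (simp add: F_F lift_def unit_def)
  show "y = 0" if "lift R * y = 0" for y
    using lift_R_inj that .
qed

end

section \<open>From commutator estimates for \<open>D\<close> to the bounded transforms\<close>

locale unitary_operator = hilbert_pair E E'
  for E :: "('e::complex_vector, 'b::cstar_algebra, 'y) hmod_scheme"
    and E' :: "('f::complex_vector, 'b, 'z) hmod_scheme" +
  fixes U :: "'e \<Rightarrow> 'f"
  assumes unitary: "unitary E E' U"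
begin

abbreviation "Uadj \<equiv> adj E E' U"

lemma U_adjointable: "U \<in> adjointable E E'" "Uadj \<in> adjointable E' E" "adj E' E Uadj = U"
  using unitary adj_adj[OF dom.hilbert_module_axioms cod.hilbert_module_axioms, of U] adj_adjointable[of U]
  by (auto simp: unitary_def)

lemma U_mem [simp]: "x \<in> hcarrier E \<Longrightarrow> U x \<in> hcarrier E'" "y \<in> hcarrier E' \<Longrightarrow> Uadj y \<in> hcarrier E"
  using U_adjointable adjointable_mem adj_mem by blast+

lemma U_comp: "Uadj \<circ> U = id_op E" "U \<circ> Uadj = id_op E'"
  using unitary by (auto simp: unitary_def)

lemma U_inverse [simp]: "x \<in> hcarrier E \<Longrightarrow> Uadj (U x) = x" "y \<in> hcarrier E' \<Longrightarrow> U (Uadj y) = y"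
  using fun_cong[OF U_comp(1), of x] fun_cong[OF U_comp(2), of y]
  by (simp_all add: dom.id_op_apply cod.id_op_apply)

lemma ip_U: "x \<in> hcarrier E \<Longrightarrow> y \<in> hcarrier E \<Longrightarrow> hip E' (U x) (U y) = hip E x y"
  using ip_adj[OF U_adjointable(1), of x "U y"] by simp

lemma hnorm_U: "x \<in> hcarrier E \<Longrightarrow> hnorm E' (U x) = hnorm E x"
  by (simp add: hnorm_def ip_U)

lemma hnorm_Uadj: "y \<in> hcarrier E' \<Longrightarrow> hnorm E (Uadj y) = hnorm E' y"
  using hnorm_U[of "Uadj y"] by simp

lemma U_image: "U ` hcarrier E = hcarrier E'"
  using U_inverse(2) U_mem by (metis image_eqI image_subsetI subsetI subset_antisym)

lemma adjointable_comp_U: "T \<in> End_ops E' \<Longrightarrow> T \<circ> U \<in> adjointable E E'"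
  by (rule adjointable_comp(1)[OF dom.hilbert_module_axioms cod.hilbert_module_axioms cod.hilbert_module_axioms U_adjointable(1)])

lemma adjointable_Uadj_comp: "T \<in> adjointable E E' \<Longrightarrow> Uadj \<circ> T \<in> End_ops E"
  by (rule adjointable_comp(1)[OF dom.hilbert_module_axioms cod.hilbert_module_axioms dom.hilbert_module_axioms _ U_adjointable(2)])

definition "conjugate T = Uadj \<circ> T \<circ> U"

lemma conjugate_apply: "conjugate T x = Uadj (T (U x))"
  by (simp add: conjugate_def)

lemma conjugate_End:
  assumes "T \<in> End_ops E'"
  shows "conjugate T \<in> End_ops E" "adj E E (conjugate T) = conjugate (adj E' E' T)"
proof -
  note TU = adjointable_comp_U[OF assms]
  show "conjugate T \<in> End_ops E"
    using adjointable_Uadj_comp[OF TU] by (simp add: conjugate_def comp_assoc)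
  show "adj E E (conjugate T) = conjugate (adj E' E' T)"
    using adjointable_comp(2)[OF dom.hilbert_module_axioms cod.hilbert_module_axioms dom.hilbert_module_axioms TU U_adjointable(2)]
      adjointable_comp(2)[OF dom.hilbert_module_axioms cod.hilbert_module_axioms cod.hilbert_module_axioms U_adjointable(1) assms]
    by (simp add: conjugate_def comp_assoc U_adjointable(3))
qed

lemma conjugate_id: "conjugate (id_op E') = id_op E"
  by (rule dom.End_ext) (simp_all add: conjugate_End cod.End_id dom.End_id conjugate_apply cod.id_op_apply dom.id_op_apply)

lemma conjugate_comp: "S \<in> End_ops E' \<Longrightarrow> T \<in> End_ops E' \<Longrightarrow> conjugate (S \<circ> T) = conjugate S \<circ> conjugate T"
  by (rule dom.End_ext)
    (simp_all add: conjugate_End cod.End_comp(1) dom.End_comp(1) conjugate_apply cod.End_mem)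

lemma conjugate_plus:
  assumes "S \<in> End_ops E'" "T \<in> End_ops E'"
  shows "conjugate (S + T) = conjugate S + conjugate T"
proof (rule dom.End_ext[OF conjugate_End(1)[OF cod.End_plus(1)[OF assms]] dom.End_plus(1)[OF conjugate_End(1)[OF assms(1)] conjugate_End(1)[OF assms(2)]]])
  interpret V: hilbert_pair E' E ..
  show "conjugate (S + T) x = (conjugate S + conjugate T) x" if "x \<in> hcarrier E" for x
    using assms that by (simp add: conjugate_apply V.adjointable_add[OF U_adjointable(2)] cod.End_mem)
qed

lemma conjugate_scale:
  assumes "T \<in> End_ops E'"
  shows "conjugate (c *\<^sub>C T) = c *\<^sub>C conjugate T"
proof (rule dom.End_ext[OF conjugate_End(1)[OF cod.End_scale(1)[OF assms]] dom.End_scale(1)[OF conjugate_End(1)[OF assms]]])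
  interpret V: hilbert_pair E' E ..
  show "conjugate (c *\<^sub>C T) x = (c *\<^sub>C conjugate T) x" if "x \<in> hcarrier E" for x
    using assms that by (simp add: conjugate_apply scaleC_fun_def V.adjointable_scaleC[OF U_adjointable(2)] cod.End_mem)
qed

lemma op_norm_conjugate:
  assumes T: "T \<in> End_ops E'"
  shows "op_norm E (conjugate T) = op_norm E' T"
proof (rule antisym)
  show "op_norm E (conjugate T) \<le> op_norm E' T"
  proof (rule dom.op_norm_le)
    show "hnorm E (conjugate T x) \<le> op_norm E' T * hnorm E x" if "x \<in> hcarrier E" for x
      using cod.op_norm_bound[OF T, of "U x"] that by (simp add: conjugate_apply hnorm_U hnorm_Uadj cod.End_mem T)
  qed (simp add: cod.op_norm_nonneg T)
  show "op_norm E' T \<le> op_norm E (conjugate T)"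
  proof (rule cod.op_norm_le)
    show "hnorm E' (T y) \<le> op_norm E (conjugate T) * hnorm E' y" if "y \<in> hcarrier E'" for y
      using dom.op_norm_bound[OF conjugate_End(1)[OF T], of "Uadj y"] that
      by (simp add: conjugate_apply hnorm_Uadj cod.End_mem T)
  qed (simp add: dom.op_norm_nonneg conjugate_End T)
qed

lemma conjugate_surj:
  assumes T: "T \<in> End_ops E"
  shows "\<exists>S\<in>End_ops E'. conjugate S = T"
proof
  have UT: "U \<circ> T \<in> adjointable E E'"
    using adjointable_comp(1)[OF dom.hilbert_module_axioms dom.hilbert_module_axioms cod.hilbert_module_axioms T U_adjointable(1)] .
  show S: "(U \<circ> T) \<circ> Uadj \<in> End_ops E'"
    by (rule adjointable_comp(1)[OF cod.hilbert_module_axioms dom.hilbert_module_axioms cod.hilbert_module_axioms U_adjointable(2) UT])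
  show "conjugate ((U \<circ> T) \<circ> Uadj) = T"
    by (rule dom.End_ext[OF conjugate_End(1)[OF S] T]) (simp add: conjugate_apply dom.End_mem T)
qed

text \<open>The operators on \<open>E'\<close> are placed into the corner belonging to \<open>E\<close>, so that operators on both modules can be compared.\<close>

lemma corner_embedding_conjugate:
  assumes "corner_embedding E \<epsilon>"
  shows "corner_embedding E' (\<lambda>T. \<epsilon> (conjugate T))"
proof -
  interpret corner_embedding E \<epsilon> by fact
  show ?thesis
  proof
    fix S T c y
    assume S: "S \<in> End_ops E'"
    show "\<epsilon> (conjugate (c *\<^sub>C S)) = c *\<^sub>C \<epsilon> (conjugate S)" "norm (\<epsilon> (conjugate S)) = op_norm E' S"
      "\<epsilon> (conjugate (adj E' E' S)) = (\<epsilon> (conjugate S))\<^sup>\<star>"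
      using conjugate_scale[OF S] op_norm_conjugate[OF S] conjugate_End(1)[OF S] scale norm
        adjoint[OF conjugate_End(1)[OF S]] conjugate_End(2)[OF S] by auto
    assume T: "T \<in> End_ops E'"
    show "\<epsilon> (conjugate (S + T)) = \<epsilon> (conjugate S) + \<epsilon> (conjugate T)" "\<epsilon> (conjugate (S \<circ> T)) = \<epsilon> (conjugate S) * \<epsilon> (conjugate T)"
      using conjugate_plus[OF S T] conjugate_comp[OF S T] plus[OF conjugate_End(1)[OF S] conjugate_End(1)[OF T]]
        comp[OF conjugate_End(1)[OF S] conjugate_End(1)[OF T]] by auto
  next
    fix y
    show "\<exists>T\<in>End_ops E'. \<epsilon> (conjugate (id_op E')) * y * \<epsilon> (conjugate (id_op E')) = \<epsilon> (conjugate T)"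
      using corner[of y] conjugate_surj unfolding conjugate_id by metis
  qed
qed

end

locale conjugate_regular = unitary_operator E1 E2 U +
  one: embedded_regular E1 D1 \<epsilon> + two: selfadjoint_regular E2 D2
  for E1 :: "('e::complex_vector, 'b::cstar_algebra, 'z) hmod_scheme" and D1
    and E2 :: "('f::complex_vector, 'b, 'y) hmod_scheme" and D2 and U
    and \<epsilon> :: "('e \<Rightarrow> 'e) \<Rightarrow> 'c::unital_cstar_algebra"
begin

sublocale img: embedded_regular E2 D2 "\<lambda>T. \<epsilon> (conjugate T)"
  unfolding embedded_regular_def
  using corner_embedding_conjugate[OF one.corner_embedding_axioms] two.selfadjoint_regular_axioms by blast

lemma img_lift: "img.lift T = one.lift (conjugate T)"
  by (simp add: img.lift_def one.lift_def img.unit_def one.unit_def conjugate_id)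

text \<open>For \<open>G = U\<^sup>* F\<^sub>2 U p r\<^sub>1 - U\<^sup>* r\<^sub>2 U q F\<^sub>1\<close> and any \<open>x\<close>, the vector \<open>y = r\<^sub>1 x\<close> is in the domain of \<open>D\<^sub>1\<close>, and
  \<open>G x = U\<^sup>* r\<^sub>2 (D\<^sub>2 U p y - U q D\<^sub>1 y)\<close>. Either \<open>r\<^sub>1\<close> or \<open>r\<^sub>2\<close> is then split into the powers \<open>\<alpha>\<close> and \<open>1 - \<alpha> = 2 g\<close>.\<close>

lemma intertwinesI:
  assumes g: "\<alpha> = 1 - 2 * g" "0 \<le> \<alpha>" "0 < g"
    and p: "p \<in> End_ops E1" and q: "q \<in> End_ops E1"
    and dom: "\<And>x. x \<in> udom D1 \<Longrightarrow> U (p x) \<in> udom D2"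
    and K: "K \<in> End_ops E1"
      "\<And>x. x \<in> hcarrier E1 \<Longrightarrow> bracket_power E1 D1 \<alpha> x \<in> udom D1 \<Longrightarrow>
        K x = Uadj (uapp D2 (U (p (bracket_power E1 D1 \<alpha> x)))) - q (uapp D1 (bracket_power E1 D1 \<alpha> x))"
    and L: "L \<in> adjointable E1 E2"
      "\<And>x. x \<in> udom D1 \<Longrightarrow> L x = bracket_power E2 D2 \<alpha> (uapp D2 (U (p x)) - U (q (uapp D1 x)))"
  shows "intertwines g (img.lift two.R) (\<epsilon> (conjugate img.F)) (one.lift one.R) (\<epsilon> one.F) (\<epsilon> p) (\<epsilon> q)"
proof -
  define b1 b2 where "b1 = bracket_power E1 D1" and "b2 = bracket_power E2 D2"
  have \<alpha>: "0 \<le> 2 * g" "\<alpha> + 2 * g = 1"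
    using g by auto
  note b1 = one.rp_lift[OF g(2), folded b1_def] one.rp_lift[OF \<alpha>(1), folded b1_def]
  note b2 = img.rp_lift[OF g(2), folded b2_def] img.rp_lift[OF \<alpha>(1), folded b2_def]
  note posR = one.pos_lift[OF one.pos_emb_R] img.pos_lift[OF img.pos_emb_R]
  have split1: "b1 \<alpha> \<circ> b1 (2 * g) = one.r"
    using rp_add[OF posR(1) g(2) \<alpha>(1)] unfolding \<alpha>(2) b1 one.r_End(3)[symmetric] one.lift_mult[OF b1(1,3)]
    using one.lift_inject[OF dom.End_comp(1)[OF b1(1,3)] one.r_End(1)] by blast
  have split2: "b2 (2 * g) \<circ> b2 \<alpha> = img.r"
    using rp_add[OF posR(2) \<alpha>(1) g(2)] unfolding add.commute[of "2 * g"] \<alpha>(2) b2 img.r_End(3)[symmetric] img.lift_mult[OF b2(3,1)]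
    using img.lift_inject[OF cod.End_comp(1)[OF b2(3,1)] img.r_End(1)] by blast
  define G where "G = (conjugate img.F \<circ> p \<circ> one.r) - (conjugate img.r \<circ> q \<circ> one.F)"
  have End: "conjugate img.F \<in> End_ops E1" "conjugate img.r \<in> End_ops E1" "conjugate (b2 (2 * g)) \<in> End_ops E1"
    "conjugate img.F \<circ> p \<in> End_ops E1" "conjugate img.r \<circ> q \<in> End_ops E1"
    "conjugate img.F \<circ> p \<circ> one.r \<in> End_ops E1" "conjugate img.r \<circ> q \<circ> one.F \<in> End_ops E1"
    by (simp_all add: conjugate_End img.F_End img.r_End b2 dom.End_comp p q one.r_End one.F_End)
  have GE: "G \<in> End_ops E1"
    unfolding G_def by (rule dom.End_minus(1)[OF End(6,7)])
  have G_apply: "G x = Uadj (img.r (uapp D2 (U (p (one.r x))) - U (q (uapp D1 (one.r x)))))" if x: "x \<in> hcarrier E1" for x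
  proof -
    have rx: "one.r x \<in> udom D1" "one.F x = uapp D1 (one.r x)"
      using one.F_apply[OF x] by auto
    interpret V: hilbert_pair E2 E1 ..
    have m: "uapp D2 (U (p (one.r x))) \<in> hcarrier E2" "U (q (uapp D1 (one.r x))) \<in> hcarrier E2"
      using dom[OF rx(1)] rx(1) by (auto simp: dom.End_mem q)
    then show ?thesis
      using img.r_D[OF dom[OF rx(1)]] rx(1)
      by (simp add: G_def conjugate_apply rx(2) cod.End_diff_apply[OF img.r_End(1)] V.adjointable_diff[OF U_adjointable(2)]
          cod.End_mem[OF img.r_End(1)] cod.End_mem[OF img.F_End(1)] dom.End_mem[OF p])
  qed
  have rp1: "rp (one.lift one.R) 1 = one.lift one.r" and rp2: "rp (img.lift two.R) 1 = one.lift (conjugate img.r)"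
    and rp2g: "rp (img.lift two.R) (2 * g) = one.lift (conjugate (b2 (2 * g)))"
    using one.r_End(3) img.r_End(3) b2(4) by (simp_all add: img_lift)
  have "\<epsilon> (conjugate img.F) * \<epsilon> p * rp (one.lift one.R) 1 = \<epsilon> (conjugate img.F \<circ> p \<circ> one.r)"
    unfolding rp1 by (simp only: one.comp[OF End(1) p, symmetric] one.lift_mult_emb(2)[OF End(4) one.r_End(1)])
  moreover have "rp (img.lift two.R) 1 * \<epsilon> q * \<epsilon> one.F = \<epsilon> (conjugate img.r \<circ> q \<circ> one.F)"
    unfolding rp2 by (simp only: one.lift_mult_emb(1)[OF End(2) q] one.comp[OF End(5) one.F_End(1), symmetric])
  ultimately have eG: "\<epsilon> (conjugate img.F) * \<epsilon> p * rp (one.lift one.R) 1 - rp (img.lift two.R) 1 * \<epsilon> q * \<epsilon> one.F = \<epsilon> G"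
    unfolding G_def one.minus[OF End(6,7)] by simp
  have GK: "G = conjugate img.r \<circ> K \<circ> b1 (2 * g)"
  proof (rule dom.End_ext[OF GE])
    show "conjugate img.r \<circ> K \<circ> b1 (2 * g) \<in> End_ops E1"
      by (simp add: End K b1 dom.End_comp)
    fix x assume x: "x \<in> hcarrier E1"
    define z where "z = b1 (2 * g) x"
    have z: "z \<in> hcarrier E1" "b1 \<alpha> z = one.r x"
      using x fun_cong[OF split1, of x] b1 by (simp_all add: z_def dom.End_mem)
    have rx: "one.r x \<in> udom D1"
      using one.F_apply[OF x] by auto
    have m: "uapp D2 (U (p (one.r x))) \<in> hcarrier E2" "q (uapp D1 (one.r x)) \<in> hcarrier E1"
      using dom[OF rx(1)] rx(1) by (auto simp: dom.End_mem q)
    have "K z = Uadj (uapp D2 (U (p (one.r x)))) - q (uapp D1 (one.r x))"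
      using K(2)[OF z(1)] z(2) rx by (simp add: b1_def)
    then have "U (K z) = uapp D2 (U (p (one.r x))) - U (q (uapp D1 (one.r x)))"
      using m by (simp add: adjointable_diff[OF U_adjointable(1)])
    then show "G x = (conjugate img.r \<circ> K \<circ> b1 (2 * g)) x"
      using G_apply[OF x] by (simp add: conjugate_apply z_def)
  qed
  note UL = adjointable_Uadj_comp[OF L(1)]
  have GL: "G = conjugate (b2 (2 * g)) \<circ> (Uadj \<circ> L) \<circ> one.r"
  proof (rule dom.End_ext[OF GE])
    show "conjugate (b2 (2 * g)) \<circ> (Uadj \<circ> L) \<circ> one.r \<in> End_ops E1"
      by (intro dom.End_comp(1) End adjointable_Uadj_comp L one.r_End)
    fix x assume x: "x \<in> hcarrier E1"
    have rx: "one.r x \<in> udom D1"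
      using one.F_apply[OF x] by auto
    have "b2 (2 * g) (L (one.r x)) = img.r (uapp D2 (U (p (one.r x))) - U (q (uapp D1 (one.r x))))"
      using L(2)[OF rx] fun_cong[OF split2] by (simp add: b2_def)
    then show "G x = (conjugate (b2 (2 * g)) \<circ> (Uadj \<circ> L) \<circ> one.r) x"
      using G_apply[OF x] adjointable_mem[OF L(1), of "one.r x"] rx by (simp add: conjugate_apply)
  qed
  have "\<epsilon> G = rp (img.lift two.R) 1 * \<epsilon> K * rp (one.lift one.R) (2 * g)"
    unfolding GK b1(4) rp2 
    by (simp only: one.lift_mult_emb(1)[OF End(2) K(1)] one.lift_mult_emb(2)[OF dom.End_comp(1)[OF End(2) K(1)] b1(3)])
  moreover have "\<epsilon> G = rp (img.lift two.R) (2 * g) * \<epsilon> (Uadj \<circ> L) * rp (one.lift one.R) 1"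
    unfolding GL rp2g rp1
    by (simp only: one.lift_mult_emb(1)[OF End(3) UL] one.lift_mult_emb(2)[OF dom.End_comp(1)[OF End(3) UL] one.r_End(1)])
  ultimately show ?thesis
    unfolding intertwines_def eG by blast
qed

end

lemma (in hilbert_module) op_inv:
  assumes "op_invertible E T"
  shows "op_inv E T \<in> End_ops E" "T \<circ> op_inv E T = id_op E" "op_inv E T \<circ> T = id_op E"
proof -
  obtain S where S: "S \<in> End_ops E" "T \<circ> S = id_op E" "S \<circ> T = id_op E"
    using assms by (auto simp: op_invertible_def)
  have "op_inv E T = S"
    unfolding op_inv_def
  proof (rule the_equality)
    fix S' assume S': "S' \<in> End_ops E \<and> T \<circ> S' = id_op E \<and> S' \<circ> T = id_op E"
    then have "S' = id_op E \<circ> S'"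
      by (simp only: id_op_comp(1))
    also have "\<dots> = S \<circ> (T \<circ> S')"
      unfolding S(3)[symmetric] by (simp only: comp_assoc)
    also have "\<dots> = S"
      using S' id_op_comp(2)[OF S(1)] by simp
    finally show "S' = S" .
  qed (use S in blast)
  with S show "op_inv E T \<in> End_ops E" "T \<circ> op_inv E T = id_op E" "op_inv E T \<circ> T = id_op E"
    by simp_all
qed

context embedded_regular
begin

text \<open>The case of the identity conjugation and \<open>p = q = a\<close>.\<close>

lemma Lip_intertwines:
  assumes a: "a \<in> Lip E \<alpha> D" and g: "\<alpha> = 1 - 2 * g" "0 \<le> \<alpha>" "0 < g"
  shows "intertwines g (lift R) (\<epsilon> F) (lift R) (\<epsilon> F) (\<epsilon> a) (\<epsilon> a)"
proof -
  have "unitary E E (id_op E)"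
    by (simp add: unitary_def End_id id_op_comp)
  then interpret c: conjugate_regular E D E D "id_op E" \<epsilon>
    by unfold_locales
  have conj_eq: "c.conjugate T = T" if "T \<in> End_ops E" for T
    using that by (simp add: c.conjugate_def End_id id_op_comp)
  have aE: "a \<in> End_ops E" and a_dom: "\<And>x. x \<in> udom D \<Longrightarrow> a x \<in> udom D"
    using a by (auto simp: Lip_def)
  define b where "b = bracket_power E D \<alpha>"
  have bE: "b \<in> End_ops E"
    using rp_lift(1)[OF g(2)] by (simp add: b_def)
  from a obtain K where K: "K \<in> End_ops E"
    "\<And>x. x \<in> udom (commutator E D a \<circ>\<^sub>u of_op E b) \<Longrightarrow> K x = uapp (commutator E D a \<circ>\<^sub>u of_op E b) x"
    by (auto simp: Lip_def bounded_op_def b_def)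
  from a obtain L where L: "L \<in> End_ops E"
    "\<And>x. x \<in> udom (of_op E b \<circ>\<^sub>u commutator E D a) \<Longrightarrow> L x = uapp (of_op E b \<circ>\<^sub>u commutator E D a) x"
    by (auto simp: Lip_def bounded_op_def b_def)
  have "intertwines g (c.img.lift R) (\<epsilon> (c.conjugate F)) (lift R) (\<epsilon> F) (\<epsilon> a) (\<epsilon> a)"
  proof (rule c.intertwinesI[OF g aE aE _ K(1) _ L(1)])
    show "id_op E (a x) \<in> udom D" if "x \<in> udom D" for x
      using a_dom[OF that] by (simp add: id_op_apply)
    show "K x = adj E E (id_op E) (uapp D (id_op E (a (bracket_power E D \<alpha> x)))) - a (uapp D (bracket_power E D \<alpha> x))"
      if "x \<in> hcarrier E" "bracket_power E D \<alpha> x \<in> udom D" for x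
      using K(2)[of x] that a_dom[of "b x"] End_mem_all[OF bE]
      by (simp add: ucomp_def udiff_def of_op_def commutator_def b_def End_id id_op_apply)
    show "L x = bracket_power E D \<alpha> (uapp D (id_op E (a x)) - id_op E (a (uapp D x)))" if "x \<in> udom D" for x
      using L(2)[of x] that a_dom[of x] End_mem_all[OF aE]
      by (simp add: ucomp_def udiff_def of_op_def commutator_def b_def id_op_apply)
  qed
  then show ?thesis
    by (simp add: c.img_lift conj_eq R_End F_End)
qed

end

section \<open>Closed ideals\<close>

text \<open>The square of the norm is \<open>\<parallel>(1 - h)\<^sup>n h (1 - h)\<^sup>n\<parallel> \<le> 1 / (n + 1)\<close> for \<open>h = x\<^sup>* x\<close>.\<close>

lemma mult_power_one_minus_tendsto:
  fixes x :: "'c::unital_cstar_algebra"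
  assumes "norm x \<le> 1"
  shows "(\<lambda>n. x * (1 - x\<^sup>\<star> * x) ^ n) \<longlonglongrightarrow> 0"
proof -
  define h where "h = x\<^sup>\<star> * x"
  have h: "pos h" "norm h \<le> 1"
    using assms pos_star_mult_self[of x] by (simp_all add: h_def cstar_identity power_le_one)
  have star: "((1 - h) ^ n)\<^sup>\<star> = (1 - h) ^ n" for n
    using pos_selfadjoint[OF h(1)] by (simp add: star_power star_simps)
  have "(norm (x * (1 - h) ^ n))\<^sup>2 = norm ((1 - h) ^ n * (h * (1 - h) ^ n))" for n
    unfolding cstar_identity[symmetric] star_mult star by (simp add: h_def mult.assoc)
  also have "\<dots> n \<le> 1 * norm (h * (1 - h) ^ n)" for n
    by (rule order_trans[OF norm_mult_ineq mult_right_mono]) (use norm_power_one_minus_le(1)[OF h] in auto)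
  finally have "norm (x * (1 - h) ^ n) \<le> sqrt (norm (h * (1 - h) ^ n))" for n
    by (intro real_le_rsqrt) simp
  moreover have "(\<lambda>n. sqrt (norm (h * (1 - h) ^ n))) \<longlonglongrightarrow> sqrt 0"
    using tendsto_norm_zero[OF decays_tendsto_0[OF decays_power_one_minus(2)[OF h]]] by (intro tendsto_real_sqrt) simp
  ultimately show ?thesis
    unfolding h_def[symmetric]
    using Lim_null_comparison[OF always_eventually, of "\<lambda>n. x * (1 - h) ^ n" "\<lambda>n. sqrt (norm (h * (1 - h) ^ n))"]
    by simp
qed

context closed_right_ideal
begin

lemma scaleR_iff: "t \<noteq> 0 \<Longrightarrow> t *\<^sub>R x \<in> I \<longleftrightarrow> x \<in> I"
  using scaleR[of "t *\<^sub>R x" "inverse t"] scaleR[of x t] by auto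

text \<open>\<open>x = lim x (1 - (1 - x\<^sup>* x)\<^sup>n)\<close> for \<open>\<parallel>x\<parallel> \<le> 1\<close>.\<close>

lemma mult_star_cancel:
  assumes "z * (x * (x\<^sup>\<star> * x)) \<in> I"
  shows "z * x \<in> I"
proof -
  define t where "t = 1 / (1 + norm x)"
  have t: "t > 0"
    unfolding t_def by (intro divide_pos_pos add_pos_nonneg) simp_all
  define y where "y = t *\<^sub>R x"
  have y: "norm y \<le> 1"
    using norm_ge_zero[of x] unfolding y_def t_def norm_scaleR by (simp add: divide_le_eq add_nonneg_nonneg not_less)
  define h where "h = y\<^sup>\<star> * y"
  have zyh: "z * (y * h) \<in> I"
    using scaleR[OF assms, of "t ^ 3"] by (simp add: h_def y_def star_scaleR power3_eq_cube mult.assoc)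
  have "z * (y - y * (1 - h) ^ n) \<in> I" for n
  proof (induction n)
    case (Suc n)
    have "z * (y - y * (1 - h) ^ Suc n) = z * (y - y * (1 - h) ^ n) + z * (y * h) * (1 - h) ^ n"
      by (simp add: algebra_simps)
    then show ?case
      using Suc mult[OF zyh] add by simp
  qed (simp add: zero)
  moreover have "(\<lambda>n. z * (y - y * (1 - h) ^ n)) \<longlonglongrightarrow> z * (y - 0)"
    unfolding h_def by (intro tendsto_intros mult_power_one_minus_tendsto y)
  ultimately have "z * y \<in> I"
    using lim by fastforce
  then show ?thesis
    using t by (simp add: y_def scaleR_iff)
qed

end

locale closed_ideal = closed_right_ideal +
  assumes star_mem: "x \<in> I \<Longrightarrow> x\<^sup>\<star> \<in> I"
begin

lemma left: "x \<in> I \<Longrightarrow> y * x \<in> I"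
  using star_mem[OF mult[OF star_mem, of x "y\<^sup>\<star>"]] by (simp add: star_simps)

text \<open>A commutator which lies in \<open>I\<close> after multiplication by \<open>x\<^sup>*\<close> on either side lies in \<open>I\<close>: with
  \<open>h = x\<^sup>* x\<close> and \<open>s\<^sub>n = 1 - (1 - h)\<^sup>n\<close>, the products \<open>[F, x] s\<^sub>n\<close> and \<open>x [F, s\<^sub>n]\<close> are built from \<open>[F, x] x\<^sup>*\<close>,
  \<open>x [F, x\<^sup>*]\<close> and \<open>x\<^sup>* [F, x]\<close>.\<close>

lemma commutator_mem:
  assumes F: "F\<^sup>\<star> = F" and right: "(F * x - x * F) * x\<^sup>\<star> \<in> I" and left': "x\<^sup>\<star> * (F * x - x * F) \<in> I"
  shows "F * x - x * F \<in> I"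
proof -
  define t where "t = 1 / (1 + norm x)"
  have t: "t > 0"
    unfolding t_def by (intro divide_pos_pos add_pos_nonneg) simp_all
  define y where "y = t *\<^sub>R x"
  have y: "norm y \<le> 1"
    using norm_ge_zero[of x] unfolding y_def t_def norm_scaleR by (simp add: divide_le_eq add_nonneg_nonneg not_less)
  define h where "h = y\<^sup>\<star> * y"
  define \<delta> where "\<delta> z = F * z - z * F" for z
  have dy: "\<delta> y = t *\<^sub>R (F * x - x * F)"
    by (simp add: \<delta>_def y_def algebra_simps)
  have R: "\<delta> y * y\<^sup>\<star> \<in> I" and L: "y\<^sup>\<star> * \<delta> y \<in> I"
    unfolding dy using scaleR[OF scaleR[OF right], of t t] scaleR[OF scaleR[OF left'], of t t]
    by (simp_all add: y_def star_scaleR)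
  have "(\<delta> y * y\<^sup>\<star>)\<^sup>\<star> = - (y * \<delta> (y\<^sup>\<star>))"
    by (simp add: \<delta>_def star_simps F algebra_simps)
  then have ydy: "y * \<delta> (y\<^sup>\<star>) \<in> I"
    using scaleR[OF star_mem[OF R], of "-1"] by simp
  have "y * \<delta> h = (y * \<delta> (y\<^sup>\<star>)) * y + y * (y\<^sup>\<star> * \<delta> y)"
    by (simp add: h_def \<delta>_def algebra_simps)
  then have ydh: "y * \<delta> h \<in> I"
    using mult[OF ydy] left[OF L] add by simp
  have dyh: "\<delta> y * h \<in> I"
    using mult[OF R, of y] by (simp add: h_def mult.assoc)
  define s where "s n = 1 - (1 - h) ^ n" for n
  have s_Suc: "s (Suc n) = h + (1 - h) * s n" for n
    by (simp add: s_def algebra_simps)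
  have "\<delta> y * s n \<in> I \<and> y * \<delta> (s n) \<in> I" for n
  proof (induction n)
    case 0
    then show ?case
      by (simp add: s_def \<delta>_def zero)
  next
    case (Suc n)
    have "\<delta> y * s (Suc n) = \<delta> y * s n + \<delta> y * h * (1 - s n)"
      by (simp add: s_Suc algebra_simps)
    moreover have "y * \<delta> (s (Suc n)) = y * \<delta> h * (1 - s n) + (1 - y * y\<^sup>\<star>) * (y * \<delta> (s n))"
      by (simp add: s_Suc \<delta>_def algebra_simps h_def)
    ultimately show ?case
      using Suc add mult[OF dyh] mult[OF ydh] left by simp
  qed
  then have "\<delta> y * s n + y * \<delta> (s n) \<in> I" for n
    using add by blast
  moreover have "\<delta> y * s n + y * \<delta> (s n) = \<delta> (y * s n)" for n
    by (simp add: \<delta>_def algebra_simps)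
  ultimately have mem: "\<delta> (y * s n) \<in> I" for n
    by simp
  have "(\<lambda>n. y - y * (1 - h) ^ n) \<longlonglongrightarrow> y - 0"
    unfolding h_def by (intro tendsto_intros mult_power_one_minus_tendsto y)
  then have ys: "(\<lambda>n. y * s n) \<longlonglongrightarrow> y"
    by (simp add: s_def right_diff_distrib)
  have "(\<lambda>n. \<delta> (y * s n)) \<longlonglongrightarrow> \<delta> y"
    unfolding \<delta>_def by (intro tendsto_intros ys)
  then have "\<delta> y \<in> I"
    by (rule lim[OF mem])
  then show ?thesis
    unfolding dy using t by (simp add: scaleR_iff)
qed

end

lemma (in hilbert_module) compact_ideal: "closed_ideal (emb E ` compact_ops E)"
proof -
  interpret closed_right_ideal "emb E ` compact_ops E"
    by (rule compact_right_ideal)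
  interpret emb: corner_embedding E "emb E"
    by (rule corner_embedding_emb)
  show ?thesis
    by unfold_locales (auto simp: compact_adj compact_End simp flip: emb.adjoint)
qed

section \<open>Locally compact resolvents\<close>

context embedded_regular
begin

text \<open>\<open>a r\<close> is the limit of \<open>a (1 - (1 - R)\<^sup>n) r\<close>, where \<open>1 - (1 - R)\<^sup>n\<close> is a multiple of \<open>R\<close>.\<close>

lemma lift_R_mem:
  assumes "closed_right_ideal I" "a \<in> End_ops E" "\<epsilon> (a \<circ> R) \<in> I" and s: "0 < s" "s \<le> 1"
  shows "\<epsilon> a * rp (lift R) s \<in> I"
proof -
  interpret B: bracket "lift R" "\<epsilon> F"
    by (rule bracket_lift)
  interpret closed_right_ideal I
    by fact
  define k where "k = 1 - lift R"
  have aR: "\<epsilon> a * lift R \<in> I"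
    using assms by (simp add: lift_mult_emb R_End)
  have "\<epsilon> a * ((1 - k ^ n) * rp (lift R) 1) \<in> I" for n
  proof (induction n)
    case (Suc n)
    have "\<epsilon> a * ((1 - k ^ Suc n) * rp (lift R) 1)
        = \<epsilon> a * ((1 - k ^ n) * rp (lift R) 1) + \<epsilon> a * lift R * (k ^ n * rp (lift R) 1)"
      by (simp add: k_def algebra_simps)
    then show ?case
      using Suc mult[OF aR] add by simp
  qed (simp add: zero)
  moreover have "(\<lambda>n. k ^ n * rp (lift R) 1) \<longlonglongrightarrow> 0"
  proof -
    have com: "k ^ n * rp (lift R) 1 = rp (lift R) 1 * k ^ n" for n
      by (rule rp_commute[OF B.R_pos]) (simp_all add: k_def power_commuting_commutes left_diff_distrib right_diff_distrib)
    have "(\<lambda>n. rp (lift R) 1 * (1 - (rp (lift R) 1)\<^sup>\<star> * rp (lift R) 1) ^ n) \<longlonglongrightarrow> 0"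
      by (rule mult_power_one_minus_tendsto) (rule B.rp_1)
    then show ?thesis
      unfolding com by (simp add: rp_star[OF B.R_pos] rp_2[OF B.R_pos] B.rp_mult k_def)
  qed
  then have "(\<lambda>n. \<epsilon> a * (rp (lift R) 1 - k ^ n * rp (lift R) 1)) \<longlonglongrightarrow> \<epsilon> a * (rp (lift R) 1 - 0)"
    by (intro tendsto_intros)
  then have "(\<lambda>n. \<epsilon> a * ((1 - k ^ n) * rp (lift R) 1)) \<longlonglongrightarrow> \<epsilon> a * rp (lift R) 1"
    by (simp add: left_diff_distrib)
  ultimately have "\<epsilon> a * rp (lift R) 1 \<in> I"
    by (rule lim)
  then show ?thesis
    using B.right_ideal_rp[OF assms(1) _ s] by blast
qed

end

lemma (in closed_right_ideal) scaleC: "x \<in> I \<Longrightarrow> c *\<^sub>C x \<in> I"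
  using mult[of x "c *\<^sub>C 1"] by (simp add: mult_scaleC_right)

context corner_embedding
begin

lemma op_closure_sequence:
  assumes T: "T \<in> op_closure E W" and W: "W \<subseteq> End_ops E"
  obtains S where "\<And>n::nat. S n \<in> W" "(\<lambda>n. \<epsilon> (S n)) \<longlonglongrightarrow> \<epsilon> T"
proof -
  have TE: "T \<in> End_ops E"
    using T by (auto simp: op_closure_def)
  have "\<exists>S. S \<in> W \<and> op_norm E (T - S) < inverse (real (Suc n))" for n
  proof -
    have "0 < inverse (real (Suc n))"
      by simp
    then show ?thesis
      using T unfolding op_closure_def by blast
  qed
  then obtain S where S: "\<And>n. S n \<in> W" "\<And>n. op_norm E (T - S n) < inverse (real (Suc n))"
    using choice[of "\<lambda>n S. S \<in> W \<and> op_norm E (T - S) < inverse (real (Suc n))"] by blast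
  have SE: "S n \<in> End_ops E" for n
    using S(1) W by blast
  have "(\<lambda>n. \<epsilon> (S n) - \<epsilon> T) \<longlonglongrightarrow> 0"
  proof (rule Lim_null_comparison[OF always_eventually LIMSEQ_inverse_real_of_nat], rule allI)
    show "norm (\<epsilon> (S n) - \<epsilon> T) \<le> inverse (real (Suc n))" for n
      using S(2)[of n] norm[OF End_minus(1)[OF TE SE[of n]]] minus[OF TE SE[of n]] by (simp add: norm_minus_commute)
  qed
  then have "(\<lambda>n. \<epsilon> (S n)) \<longlonglongrightarrow> \<epsilon> T"
    by (rule LIM_zero_cancel)
  with S(1) show ?thesis
    by (rule that)
qed

lemma closed_span_mem:
  assumes I: "closed_right_ideal I" and T: "T \<in> closed_span E W" and W: "W \<subseteq> End_ops E"
    and z: "\<And>S. S \<in> W \<Longrightarrow> z * \<epsilon> S \<in> I"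
  shows "z * \<epsilon> T \<in> I"
proof -
  interpret closed_right_ideal I
    by (rule I)
  have span: "S \<in> End_ops E \<and> z * \<epsilon> S \<in> I" if "S \<in> complex_vector.span W" for S
    using that
  proof (induction rule: complex_vector.span_induct_alt)
    case base
    show ?case
      unfolding corner_embedding.zero[OF corner_embedding_axioms] mult_zero_right
      using End_0(1) closed_right_ideal.zero[OF I] by blast
  next
    case (step c x y)
    have x: "x \<in> End_ops E" and y: "y \<in> End_ops E" "z * \<epsilon> y \<in> I"
      using step W by auto
    have "z * \<epsilon> (c *\<^sub>C x + y) = c *\<^sub>C (z * \<epsilon> x) + z * \<epsilon> y"
      unfolding plus[OF End_scale(1)[OF x] y(1)] corner_embedding.scale[OF corner_embedding_axioms x]
      by (simp add: distrib_left mult_scaleC_right)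
    moreover have "c *\<^sub>C (z * \<epsilon> x) + z * \<epsilon> y \<in> I"
      using step z y by (intro add scaleC) auto
    ultimately show ?case
      using End_plus(1)[OF End_scale(1)[OF x] y(1), of c] by (simp only:)
  qed
  obtain S where S: "\<And>n::nat. S n \<in> complex_vector.span W" "(\<lambda>n. \<epsilon> (S n)) \<longlonglongrightarrow> \<epsilon> T"
    using op_closure_sequence[of T "complex_vector.span W"] T span unfolding closed_span_def by blast
  have "(\<lambda>n. z * \<epsilon> (S n)) \<longlonglongrightarrow> z * \<epsilon> T"
    by (intro tendsto_intros S)
  then show ?thesis
    by (rule lim[rotated]) (use span S(1) in blast)
qed

end

section \<open>The bounded transform of a cycle\<close>

locale regular_cycle =
  fixes \<alpha> :: real and X :: "('e::complex_vector, 'b::cstar_algebra, 'a::cstar_algebra) corr"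
    and D :: "('e, 'e) unbounded_op"
  assumes \<alpha>: "0 \<le> \<alpha>" "\<alpha> < 1" and cycle: "cycle \<alpha> X D"
begin

sublocale embedded_regular X D "emb X"
proof -
  interpret hilbert_module X
    using cycle by (simp add: cycle_def correspondence_def)
  show "embedded_regular X D (emb X)"
    unfolding embedded_regular_def selfadjoint_regular_def selfadjoint_regular_axioms_def
    using cycle corner_embedding_emb hilbert_module_axioms by (simp add: cycle_def)
qed

abbreviation "I \<equiv> emb X ` compact_ops X"

sublocale closed_ideal I
  by (rule compact_ideal)

sublocale B: bracket "lift R" "emb X F"
  by (rule bracket_lift)

lemma rep_End: "rep X a \<in> End_ops X" "adj X X (rep X a) = rep X (a\<^sup>\<star>)"
  using cycle by (simp_all add: cycle_def correspondence_def)

lemma mem_I: "T \<in> End_ops X \<Longrightarrow> emb X T \<in> I \<longleftrightarrow> T \<in> compact_ops X"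
  using compact_End by (auto simp: inject)

lemma rep_R_compact: "rep X a \<circ> R \<in> compact_ops X"
proof -
  have "R \<circ> rep X (a\<^sup>\<star>) \<in> compact_ops X"
    using cycle by (simp add: cycle_def R_def)
  from compact_adj[OF this] show ?thesis
    by (simp add: End_comp R_End rep_End star_star)
qed

lemma rep_rp_mem: "0 < s \<Longrightarrow> s \<le> 1 \<Longrightarrow> emb X (rep X a) * rp (lift R) s \<in> I"
  using rep_R_compact by (intro lift_R_mem closed_right_ideal_axioms rep_End) auto

text \<open>For \<open>s\<close> in the Lipschitz algebra, \<open>[F, s] = \<langle>D\<rangle>\<^sup>-\<^sup>g Y\<close>; and \<open>A\<close> is contained in the closure of that algebra.\<close>

lemma rep_commutator_mem: "emb X (rep X a) * (emb X F * emb X (rep X b) - emb X (rep X b) * emb X F) \<in> I"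
proof -
  define g where "g = (1 - \<alpha>) / 2"
  have g: "\<alpha> = 1 - 2 * g" "0 < g" "2 * g \<le> 1"
    using \<alpha> by (simp_all add: g_def field_simps)
  have LipE: "Lip X \<alpha> D \<subseteq> End_ops X"
    by (auto simp: Lip_def)
  have "rep X b \<in> op_closure X (Lip X \<alpha> D)"
    using cycle by (auto simp: cycle_def)
  then obtain S where S: "\<And>n::nat. S n \<in> Lip X \<alpha> D" "(\<lambda>n. emb X (S n)) \<longlonglongrightarrow> emb X (rep X b)"
    using op_closure_sequence[OF _ LipE] by blast
  have "emb X (rep X a) * (emb X F * emb X (S n) - emb X (S n) * emb X F) \<in> I" for n
  proof -
    obtain Y where Y: "emb X F * emb X (S n) - emb X (S n) * emb X F = rp (lift R) g * Y"
      using B.commutator_rp(2)[OF g(2,3) Lip_intertwines[OF S(1) g(1) \<alpha>(1) g(2)]] by blast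
    show ?thesis
      unfolding Y mult.assoc[symmetric] using g by (intro mult rep_rp_mem) auto
  qed
  moreover have "(\<lambda>n. emb X (rep X a) * (emb X F * emb X (S n) - emb X (S n) * emb X F))
      \<longlonglongrightarrow> emb X (rep X a) * (emb X F * emb X (rep X b) - emb X (rep X b) * emb X F)"
    by (intro tendsto_intros S)
  ultimately show ?thesis
    by (rule lim)
qed

lemma commutator_F_mem: "emb X F * emb X (rep X a) - emb X (rep X a) * emb X F \<in> I"
proof (rule commutator_mem[OF B.F_star])
  have adj: "(emb X (rep X a))\<^sup>\<star> = emb X (rep X (a\<^sup>\<star>))"
    using adjoint[OF rep_End(1)] by (simp add: rep_End(2))
  show "(emb X (rep X a))\<^sup>\<star> * (emb X F * emb X (rep X a) - emb X (rep X a) * emb X F) \<in> I"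
    unfolding adj by (rule rep_commutator_mem)
  have "(emb X F * emb X (rep X a) - emb X (rep X a) * emb X F) * (emb X (rep X a))\<^sup>\<star>
      = (-1) *\<^sub>R (emb X (rep X a) * (emb X F * emb X (rep X (a\<^sup>\<star>)) - emb X (rep X (a\<^sup>\<star>)) * emb X F))\<^sup>\<star>"
    by (simp add: star_simps B.F_star flip: adj) (simp add: algebra_simps)
  also have "\<dots> \<in> I"
    by (intro scaleR star_mem rep_commutator_mem)
  finally show "(emb X F * emb X (rep X a) - emb X (rep X a) * emb X F) * (emb X (rep X a))\<^sup>\<star> \<in> I" .
qed

lemma commutator_F_compact: "(F \<circ> rep X a) - (rep X a \<circ> F) \<in> compact_ops X"
proof -
  note m = End_comp(1)[OF F_End(1) rep_End(1)] End_comp(1)[OF rep_End(1) F_End(1)]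
  have "emb X ((F \<circ> rep X a) - (rep X a \<circ> F)) \<in> I"
    using commutator_F_mem by (simp add: minus m comp F_End(1) rep_End(1))
  then show ?thesis
    using mem_I[OF End_minus(1)[OF m]] by blast
qed

lemma odd_F: "odd_op X F"
  unfolding odd_op_def
proof (intro allI impI)
  fix \<gamma> assume gr: "grading X = Some \<gamma>"
  then have \<gamma>E: "\<gamma> \<in> End_ops X"
    using cycle by (auto simp: cycle_def correspondence_def unitary_def)
  have \<gamma>: "\<gamma> x \<in> udom D" "uapp D (\<gamma> x) = - \<gamma> (uapp D x)" if "x \<in> udom D" for x
    using cycle gr that by (auto simp: cycle_def odd_unbounded_def)
  have neg: "uapp D (- x) = - uapp D x" "- x \<in> udom D" if "x \<in> udom D" for x
    using D_scaleC[OF that, of "-1"] dom_scaleC[OF that, of "-1"] by simp_all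
  have "\<gamma> \<circ> R = R \<circ> \<gamma>"
  proof (rule End_ext[OF End_comp(1)[OF \<gamma>E R_End(1)] End_comp(1)[OF R_End(1) \<gamma>E]])
    fix x assume x: "x \<in> hcarrier X"
    note Rx = R_props[OF x]
    have dom: "\<gamma> (R x) \<in> udom D" "uapp D (\<gamma> (R x)) \<in> udom D"
      using \<gamma> Rx neg by simp_all
    have "uapp D (uapp D (\<gamma> (R x))) = \<gamma> (uapp D (uapp D (R x)))"
      using \<gamma> Rx neg by simp
    then have "\<gamma> (R x) + uapp D (uapp D (\<gamma> (R x))) = \<gamma> (R x + uapp D (uapp D (R x)))"
      using End_add_apply[OF \<gamma>E dom_mem[OF Rx(1)] D_mem[OF Rx(2)]] by (simp only:)
    then show "(\<gamma> \<circ> R) x = (R \<circ> \<gamma>) x"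
      using R_eqI[OF dom] Rx(3) by simp
  qed
  from fun_cong[OF r_commute[OF \<gamma>E this]] have \<gamma>r: "\<gamma> (r x) = r (\<gamma> x)" for x
    by simp
  show "F \<circ> \<gamma> = - (\<gamma> \<circ> F)"
  proof (rule End_ext[OF End_comp(1)[OF F_End(1) \<gamma>E] End_uminus(1)[OF End_comp(1)[OF \<gamma>E F_End(1)]]])
    fix x assume x: "x \<in> hcarrier X"
    then show "(F \<circ> \<gamma>) x = (- (\<gamma> \<circ> F)) x"
      using F_apply[OF x] F_apply(2)[OF End_mem[OF \<gamma>E x]] \<gamma>[OF F_apply(1)[OF x]] by (simp add: \<gamma>r)
  qed
qed

lemma kasparov_bounded_transform: "kasparov_module X F"
  unfolding kasparov_module_def
proof (intro conjI allI)
  show "correspondence X"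
    using cycle by (simp add: cycle_def)
  show "F \<in> End_ops X" "odd_op X F" "(F \<circ> rep X a) - (rep X a \<circ> F) \<in> compact_ops X" for a
    by (rule F_End odd_F commutator_F_compact)+
  have "(adj X X F - F) \<circ> rep X a = 0" for a
    by (auto simp: F_End)
  then show "(adj X X F - F) \<circ> rep X a \<in> compact_ops X" for a
    using compact_zero by simp
  have "(id_op X - (F \<circ> F)) = R"
    by (simp add: F_F)
  then show "(id_op X - (F \<circ> F)) \<circ> rep X a \<in> compact_ops X" for a
    using cycle by (simp add: cycle_def R_def)
qed

end

lemma (in unitary_operator) conjugate_compact:
  assumes T: "T \<in> compact_ops E'"
  shows "conjugate T \<in> compact_ops E"
proof -
  interpret V: hilbert_pair E' E ..
  show ?thesis
  proof (rule compact_image[OF cod.hilbert_module_axioms dom.hilbert_module_axioms T, of _ 1])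
    show "conjugate (S + T) = conjugate S + conjugate T" if "S \<in> End_ops E'" "T \<in> End_ops E'" for S T
      by (rule conjugate_plus[OF that])
    fix x y assume xy: "x \<in> hcarrier E'" "y \<in> hcarrier E'"
    have "conjugate (rank_one E' x y) = rank_one E (Uadj x) (Uadj y)"
    proof (rule dom.End_ext)
      show "conjugate (rank_one E' x y) \<in> End_ops E" "rank_one E (Uadj x) (Uadj y) \<in> End_ops E"
        using xy conjugate_End cod.rank_one_End dom.rank_one_End by auto
      show "conjugate (rank_one E' x y) z = rank_one E (Uadj x) (Uadj y) z" if "z \<in> hcarrier E" for z
        using that xy V.ip_adj[OF U_adjointable(2), of y z]
        by (simp add: conjugate_apply rank_one_def V.adjointable_act[OF U_adjointable(2)] U_adjointable(3))
    qed
    then show "conjugate (rank_one E' x y) \<in> compact_ops E"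
      using xy by (simp add: dom.rank_one_compact)
  qed (simp_all add: conjugate_End op_norm_conjugate)
qed

section \<open>Conformal transformations\<close>

locale conformal = one: regular_cycle \<alpha> X1 D1 + two: regular_cycle \<alpha> X2 D2
  for \<alpha> and X1 X2 :: "('e::complex_vector, 'b::cstar_algebra, 'a::cstar_algebra) corr" and D1 D2 +
  fixes U \<mu> :: "'e \<Rightarrow> 'e"
  assumes conformal: "conformal_transformation \<alpha> X1 D1 X2 D2 U \<mu>"
begin

sublocale conjugate_regular X1 D1 X2 D2 U "emb X1"
proof -
  interpret unitary_operator X1 X2 U
    by unfold_locales (use conformal in \<open>simp add: conformal_transformation_def\<close>)
  show "conjugate_regular X1 D1 X2 D2 U (emb X1)"
    by unfold_locales
qed

lemma conjugate_rep: "conjugate (rep X2 a) = rep X1 a"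
proof -
  have "U \<circ> rep X1 a = rep X2 a \<circ> U"
    using conformal by (simp add: conformal_transformation_def)
  then have "conjugate (rep X2 a) = (Uadj \<circ> U) \<circ> rep X1 a"
    by (simp only: conjugate_def comp_assoc)
  then show ?thesis
    by (simp add: U_comp one.id_op_comp one.rep_End)
qed

definition "F2 = conjugate two.F"

lemma F2_End: "F2 \<in> End_ops X1"
  by (simp add: F2_def conjugate_End two.F_End)

lemma F2_commutator_compact: "(F2 \<circ> rep X1 a) - (rep X1 a \<circ> F2) \<in> compact_ops X1"
proof -
  note m = two.End_comp(1)[OF two.F_End(1) two.rep_End(1), of a] two.End_comp(1)[OF two.rep_End(1) two.F_End(1), of a]
  have "conjugate ((two.F \<circ> rep X2 a) - (rep X2 a \<circ> two.F)) \<in> compact_ops X1"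
    by (rule conjugate_compact[OF two.commutator_F_compact])
  also have "conjugate ((two.F \<circ> rep X2 a) - (rep X2 a \<circ> two.F)) = conjugate (two.F \<circ> rep X2 a) - conjugate (rep X2 a \<circ> two.F)"
    using conjugate_plus[OF two.End_minus(1)[OF m] m(2)] by simp
  finally show ?thesis
    unfolding conjugate_comp[OF two.F_End(1) two.rep_End(1)] conjugate_comp[OF two.rep_End(1) two.F_End(1)] conjugate_rep F2_def .
qed

definition "\<Delta> = emb X1 F2 - emb X1 one.F"

lemma \<mu>_inv: "op_invertible X1 \<mu>"
  using conformal by (simp add: conformal_transformation_def)

text \<open>The vectors \<open>\<mu>\<^bsup>-1*\<^esup> x\<close> with \<open>x\<close> in the domain of \<open>D\<^sub>1\<close> are in the domain of \<open>\<mu> D\<^sub>1 \<mu>\<^sup>*\<close>; the hypotheses on \<open>m\<close> are evaluated there.\<close>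

lemma conformal_intertwines:
  assumes m: "m \<in> conformal_set \<alpha> X1 D1 X2 D2 U \<mu>" and g: "\<alpha> = 1 - 2 * g" "0 \<le> \<alpha>" "0 < g"
  shows "intertwines g (img.lift two.R) (emb X1 F2) (one.lift one.R) (emb X1 one.F)
    (emb X1 (m \<circ> adj X1 X1 (op_inv X1 \<mu>))) (emb X1 (m \<circ> \<mu>))"
proof -
  define \<nu> where "\<nu> = adj X1 X1 (op_inv X1 \<mu>)"
  note inv = one.op_inv[OF \<mu>_inv]
  have \<mu>E: "\<mu> \<in> End_ops X1"
    using \<mu>_inv by (auto simp: op_invertible_def)
  have \<nu>E: "\<nu> \<in> End_ops X1"
    unfolding \<nu>_def by (rule one.End_adj[OF inv(1)])
  have mE: "m \<in> End_ops X1"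
    using m by (auto simp: conformal_set_def)
  define \<mu>' where "\<mu>' = adj X1 X1 \<mu>"
  have \<mu>'E: "\<mu>' \<in> End_ops X1"
    unfolding \<mu>'_def by (rule one.End_adj[OF \<mu>E])
  have "\<mu>' \<circ> \<nu> = id_op X1"
    using one.End_comp(2)[OF inv(1) \<mu>E] by (simp add: inv one.End_id \<mu>'_def \<nu>_def)
  from fun_cong[OF this] have \<mu>\<nu>: "\<mu>' (\<nu> x) = x" if "x \<in> hcarrier X1" for x
    using that by (simp add: one.id_op_apply)
  define b1 b2 where "b1 = bracket_power X1 D1 \<alpha>" and "b2 = bracket_power X2 D2 \<alpha>"
  have b1: "b1 \<in> End_ops X1" and b2: "b2 \<in> End_ops X2"
    using one.rp_lift(1)[OF g(2)] img.rp_lift(1)[OF g(2)] by (simp_all add: b1_def b2_def)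
  let ?d = "conformal_defect X1 D1 X2 D2 U \<mu> m"
  from m have incl: "udom (D1 \<circ>\<^sub>u of_op X1 \<mu>') \<subseteq> udom (D2 \<circ>\<^sub>u of_op X1 U \<circ>\<^sub>u of_op X1 m)"
    by (simp add: conformal_set_def \<mu>'_def)
  from m obtain K where K: "K \<in> End_ops X1"
    "\<And>x. x \<in> udom (?d \<circ>\<^sub>u of_op X1 \<nu> \<circ>\<^sub>u of_op X1 b1) \<Longrightarrow> K x = uapp (?d \<circ>\<^sub>u of_op X1 \<nu> \<circ>\<^sub>u of_op X1 b1) x"
    by (auto simp: conformal_set_def bounded_op_def b1_def \<nu>_def)
  from m obtain L where L: "L \<in> adjointable X1 X2"
    "\<And>x. x \<in> udom (of_op X2 b2 \<circ>\<^sub>u of_op X1 U \<circ>\<^sub>u ?d) \<Longrightarrow> L x = uapp (of_op X2 b2 \<circ>\<^sub>u of_op X1 U \<circ>\<^sub>u ?d) x"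
    by (auto simp: conformal_set_def bounded_op_def b2_def)
  have dom: "U (m (\<nu> x)) \<in> udom D2" if x: "x \<in> udom D1" for x
  proof -
    have "\<nu> x \<in> udom (D1 \<circ>\<^sub>u of_op X1 \<mu>')"
      using x by (simp add: ucomp_def of_op_def \<mu>\<nu> one.End_mem[OF \<nu>E])
    then show ?thesis
      using incl by (auto simp: ucomp_def of_op_def)
  qed
  have defect: "\<nu> x \<in> udom ?d" "uapp ?d (\<nu> x) = Uadj (uapp D2 (U (m (\<nu> x)))) - m (\<mu> (uapp D1 x))"
    if x: "x \<in> udom D1" for x
    using dom[OF x] x unfolding conformal_defect_def \<mu>'_def[symmetric]
    by (simp_all add: ucomp_def udiff_def of_op_def \<mu>\<nu> one.End_mem[OF \<nu>E] one.End_mem[OF mE] one.End_mem[OF \<mu>E] one.End_mem[OF \<mu>'E])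
  show ?thesis
    unfolding F2_def \<nu>_def[symmetric]
  proof (rule intertwinesI[OF g one.End_comp(1)[OF mE \<nu>E] one.End_comp(1)[OF mE \<mu>E] _ K(1)])
    show "U ((m \<circ> \<nu>) x) \<in> udom D2" if "x \<in> udom D1" for x
      using dom[OF that] by simp
    show "K x = Uadj (uapp D2 (U ((m \<circ> \<nu>) (bracket_power X1 D1 \<alpha> x)))) - (m \<circ> \<mu>) (uapp D1 (bracket_power X1 D1 \<alpha> x))"
      if "x \<in> hcarrier X1" "bracket_power X1 D1 \<alpha> x \<in> udom D1" for x
      unfolding b1_def[symmetric]
      using K(2)[of x] that(1) defect[OF that(2)[folded b1_def]] one.End_mem[OF \<nu>E] one.End_mem[OF b1]
      by (simp add: ucomp_def of_op_def)
    show "L \<circ> \<nu> \<in> adjointable X1 X2"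
      by (rule adjointable_comp(1)[OF one.hilbert_module_axioms one.hilbert_module_axioms two.hilbert_module_axioms \<nu>E L(1)])
    show "(L \<circ> \<nu>) x = bracket_power X2 D2 \<alpha> (uapp D2 (U ((m \<circ> \<nu>) x)) - U ((m \<circ> \<mu>) (uapp D1 x)))" if x: "x \<in> udom D1" for x
    proof -
      have mem: "m (\<mu> (uapp D1 x)) \<in> hcarrier X1" "uapp D2 (U (m (\<nu> x))) \<in> hcarrier X2"
        using dom[OF x] x one.End_mem[OF mE] one.End_mem[OF \<mu>E] by simp_all
      have "L (\<nu> x) = b2 (U (uapp ?d (\<nu> x)))"
        using L(2)[of "\<nu> x"] defect[OF x] mem by (simp add: ucomp_def of_op_def)
      then show ?thesis
        using mem by (simp add: defect(2)[OF x] b2_def adjointable_diff[OF U_adjointable(1)])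
    qed
  qed
qed

lemma rep_Delta_conformal_mem:
  assumes m: "m \<in> conformal_set \<alpha> X1 D1 X2 D2 U \<mu>"
  shows "emb X1 (rep X1 a) * \<Delta> * emb X1 m \<in> one.I"
proof -
  define g where "g = (1 - \<alpha>) / 2"
  have g: "\<alpha> = 1 - 2 * g" "0 < g" "2 * g \<le> 1"
    using one.\<alpha> by (simp_all add: g_def field_simps)
  interpret P: bracket_pair "one.lift one.R" "emb X1 one.F" "img.lift two.R" "emb X1 F2" g
    unfolding F2_def bracket_pair_def bracket_pair_axioms_def using one.bracket_lift img.bracket_lift g by blast
  define \<nu> where "\<nu> = op_inv X1 \<mu>"
  note inv = one.op_inv[OF \<mu>_inv, folded \<nu>_def]
  have \<mu>E: "\<mu> \<in> End_ops X1"
    using \<mu>_inv by (auto simp: op_invertible_def)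
  note \<nu>'E = one.End_adj[OF inv(1)] and \<mu>'E = one.End_adj[OF \<mu>E]
  have \<nu>\<mu>: "adj X1 X1 \<nu> \<circ> adj X1 X1 \<mu> = id_op X1"
    using one.End_comp(2)[OF \<mu>E inv(1)] by (simp add: inv one.End_id)
  have m_Lip: "m \<in> End_ops X1" "m \<circ> \<mu> \<in> Lip X1 \<alpha> D1" "m \<circ> adj X1 X1 \<nu> \<in> Lip X1 \<alpha> D1"
    using m by (auto simp: conformal_set_def \<nu>_def)
  note mE = m_Lip(1) and m\<mu>E = one.End_comp(1)[OF m_Lip(1) \<mu>E] and m\<nu>E = one.End_comp(1)[OF m_Lip(1) \<nu>'E]
  define p q where "p = emb X1 (m \<circ> adj X1 X1 \<nu>)" and "q = emb X1 (m \<circ> \<mu>)"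
  have \<nu>'_cancel: "adj X1 X1 \<nu> \<circ> (adj X1 X1 \<mu> \<circ> T) = T" if "T \<in> End_ops X1" for T
    using that \<nu>\<mu> one.id_op_comp(1)[OF that] by (metis comp_assoc)
  have q_def': "q = p * ((one.lift \<mu>)\<^sup>\<star> * one.lift \<mu>)"
    unfolding p_def q_def one.lift_star[OF \<mu>E] one.lift_mult[OF \<mu>'E \<mu>E]
    using one.lift_mult_emb(2)[OF m\<nu>E one.End_comp(1)[OF \<mu>'E \<mu>E]] \<nu>'_cancel[OF \<mu>E] by (simp add: comp_assoc)
  have "emb X1 (rep X1 a) * (emb X1 F2 - emb X1 one.F) * p * q\<^sup>\<star> * p \<in> one.I"
  proof (rule P.perturbation_in_ideal)
    show "intertwines g (img.lift two.R) (emb X1 F2) (one.lift one.R) (emb X1 one.F) p q"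
      unfolding p_def q_def \<nu>_def by (rule conformal_intertwines[OF m g(1) one.\<alpha>(1) g(2)])
    show "intertwines g (one.lift one.R) (emb X1 one.F) (one.lift one.R) (emb X1 one.F) p p"
      "intertwines g (one.lift one.R) (emb X1 one.F) (one.lift one.R) (emb X1 one.F) q q"
      unfolding p_def q_def by (rule one.Lip_intertwines[OF m_Lip(3) g(1) one.\<alpha>(1) g(2)]
        one.Lip_intertwines[OF m_Lip(2) g(1) one.\<alpha>(1) g(2)])+
    show "one.lift \<nu> * one.lift \<mu> = 1" "one.lift \<mu> * one.lift \<nu> = 1"
      using inv \<mu>E by (simp_all add: one.lift_mult one.lift_id)
    show "q = p * ((one.lift \<mu>)\<^sup>\<star> * one.lift \<mu>)"
      by (rule q_def')
    show "closed_right_ideal one.I"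
      by (rule one.closed_right_ideal_axioms)
    show "emb X1 (rep X1 a) * rp (one.lift one.R) 1 \<in> one.I"
      by (rule one.rep_rp_mem) simp_all
    have "conjugate (rep X2 a \<circ> two.R) \<in> compact_ops X1"
      by (rule conjugate_compact[OF two.rep_R_compact])
    then show "emb X1 (rep X1 a) * rp (img.lift two.R) 1 \<in> one.I"
      using img.lift_R_mem[OF one.closed_right_ideal_axioms two.rep_End(1), of a 1] by (simp add: conjugate_rep)
  qed
  from one.mult[OF this, of "emb X1 (adj X1 X1 \<mu>)"]
  have "emb X1 (rep X1 a) * \<Delta> * (p * q\<^sup>\<star> * p) * emb X1 (adj X1 X1 \<mu>) \<in> one.I"
    unfolding \<Delta>_def mult.assoc .
  also have "emb X1 (rep X1 a) * \<Delta> * (p * q\<^sup>\<star> * p) * emb X1 (adj X1 X1 \<mu>)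
      = emb X1 (rep X1 a) * \<Delta> * (emb X1 m * ((emb X1 m)\<^sup>\<star> * emb X1 m))"
  proof -
    have q': "q\<^sup>\<star> = emb X1 (adj X1 X1 \<mu> \<circ> adj X1 X1 m)"
      unfolding q_def using one.adjoint[OF m\<mu>E] one.End_comp(2)[OF mE \<mu>E] by simp
    have m': "(emb X1 m)\<^sup>\<star> = emb X1 (adj X1 X1 m)" and m'E: "adj X1 X1 m \<in> End_ops X1"
      using one.adjoint[OF mE] one.End_adj[OF mE] by simp_all
    have "p * q\<^sup>\<star> * p * emb X1 (adj X1 X1 \<mu>) = emb X1 m * (emb X1 (adj X1 X1 m) * emb X1 m)"
      unfolding q' p_def
      by (simp add: one.End_comp(1) mE m'E \<mu>'E \<nu>'E \<nu>'_cancel comp_assoc \<nu>\<mu> one.id_op_comp flip: one.comp)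
    then show ?thesis
      by (simp add: m' mult.assoc)
  qed
  finally show ?thesis
    by (rule one.mult_star_cancel)
qed

text \<open>\<open>A\<close> lies in the closed span of \<open>\<M> A\<close>.\<close>

lemma rep_Delta_rep_mem: "emb X1 (rep X1 a) * \<Delta> * emb X1 (rep X1 b) \<in> one.I"
proof (rule one.closed_span_mem[OF one.closed_right_ideal_axioms])
  let ?M = "conformal_set \<alpha> X1 D1 X2 D2 U \<mu>"
  show "rep X1 b \<in> closed_span X1 {m \<circ> rep X1 a | a m. m \<in> ?M}"
    using conformal by (auto simp: conformal_transformation_def)
  show "{m \<circ> rep X1 a | a m. m \<in> ?M} \<subseteq> End_ops X1"
    using one.End_comp(1) one.rep_End(1) by (auto simp: conformal_set_def)
  fix S assume "S \<in> {m \<circ> rep X1 a | a m. m \<in> ?M}"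
  then obtain m a' where m: "m \<in> ?M" and S: "S = m \<circ> rep X1 a'"
    by blast
  then have "m \<in> End_ops X1"
    by (simp add: conformal_set_def)
  then have "emb X1 (rep X1 a) * \<Delta> * emb X1 S = emb X1 (rep X1 a) * \<Delta> * emb X1 m * emb X1 (rep X1 a')"
    unfolding S by (simp add: one.comp one.rep_End(1) mult.assoc)
  then show "emb X1 (rep X1 a) * \<Delta> * emb X1 S \<in> one.I"
    using one.mult[OF rep_Delta_conformal_mem[OF m]] by simp
qed

text \<open>For \<open>x = a\<close>, the element \<open>\<Delta> x x\<^sup>* x\<close> differs from \<open>x \<Delta> x\<^sup>* x\<close> by \<open>[\<Delta>, x] x\<^sup>* x\<close>, and both are compact.\<close>

theorem Delta_rep_compact: "(F2 - one.F) \<circ> rep X1 a \<in> compact_ops X1"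
proof -
  define x where "x = emb X1 (rep X1 a)"
  have x': "x\<^sup>\<star> = emb X1 (rep X1 (a\<^sup>\<star>))"
    using one.adjoint[OF one.rep_End(1)] by (simp add: one.rep_End(2) x_def)
  have "emb X1 F2 * x - x * emb X1 F2 \<in> one.I"
    using F2_commutator_compact[of a] one.mem_I F2_End one.rep_End(1)
      one.minus[OF one.End_comp(1)[OF F2_End one.rep_End(1)] one.End_comp(1)[OF one.rep_End(1) F2_End], of a a]
      one.comp[OF F2_End one.rep_End(1), of a] one.comp[OF one.rep_End(1) F2_End, of a]
    by (metis image_eqI x_def)
  from one.diff[OF this one.commutator_F_mem[of a]] have "\<Delta> * x - x * \<Delta> \<in> one.I"
    unfolding x_def[symmetric] by (simp add: \<Delta>_def algebra_simps)
  moreover have "x * \<Delta> * (x\<^sup>\<star> * x) \<in> one.I"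
    using one.mult[OF rep_Delta_rep_mem[of a "a\<^sup>\<star>"], of x] unfolding x'[symmetric] x_def[symmetric] mult.assoc .
  ultimately have "(\<Delta> * x - x * \<Delta>) * (x\<^sup>\<star> * x) + x * \<Delta> * (x\<^sup>\<star> * x) \<in> one.I"
    using one.add one.mult by blast
  then have "\<Delta> * (x * (x\<^sup>\<star> * x)) \<in> one.I"
    by (simp add: algebra_simps)
  then have "\<Delta> * x \<in> one.I"
    by (rule one.mult_star_cancel)
  moreover have "\<Delta> * x = emb X1 ((F2 - one.F) \<circ> rep X1 a)"
    using one.comp[OF one.End_minus(1)[OF F2_End one.F_End(1)] one.rep_End(1)] one.minus[OF F2_End one.F_End(1)]
    by (simp add: \<Delta>_def x_def)
  ultimately show ?thesis
    using one.mem_I[OF one.End_comp(1)[OF one.End_minus(1)[OF F2_End one.F_End(1)] one.rep_End(1)]] by simp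
qed

end

section \<open>The module of continuous paths\<close>

definition unit_clamp :: "real \<Rightarrow> real" where
  "unit_clamp s = max 0 (min 1 s)"

definition to_unit :: "real \<Rightarrow> unit_interval" where
  "to_unit s = Abs_unit_interval (unit_clamp s)"

lemma unit_clamp_simps [simp]:
  "unit_clamp (unit_clamp s) = unit_clamp s" "0 \<le> unit_clamp s" "unit_clamp s \<le> 1"
  "unit_clamp (Rep_unit_interval t) = Rep_unit_interval t" "unit_clamp 0 = 0" "unit_clamp 1 = 1"
  using Rep_unit_interval[of t] by (auto simp: unit_clamp_def)

lemma Rep_to_unit [simp]: "Rep_unit_interval (to_unit s) = unit_clamp s" "to_unit (Rep_unit_interval t) = t"
  "to_unit (unit_clamp s) = to_unit s"
  by (simp_all add: to_unit_def Abs_unit_interval_inverse Rep_unit_interval_inverse)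

lemma unit_clamp_tendsto: "S \<longlonglongrightarrow> s \<Longrightarrow> (\<lambda>n. unit_clamp (S n)) \<longlonglongrightarrow> unit_clamp s"
  unfolding unit_clamp_def by (intro tendsto_intros)

lemma to_unit_tendsto:
  assumes "S \<longlonglongrightarrow> s"
  shows "(\<lambda>n. to_unit (S n)) \<longlonglongrightarrow> to_unit s"
  using tendsto_dist[OF unit_clamp_tendsto[OF assms] tendsto_const[of "unit_clamp s"]]
  unfolding tendsto_dist_iff[of _ "to_unit s"] by (simp add: dist_unit_interval_def)

lemma continuous_Rep_unit_interval: "continuous_on UNIV Rep_unit_interval"
  unfolding continuous_on_iff by (auto simp: dist_unit_interval_def)

definition val :: "(real \<Rightarrow> 'a \<times> 'b \<times> 'e) \<Rightarrow> real \<Rightarrow> 'e" where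
  "val x s = snd (snd (x s))"

text \<open>The ambient space prescribed for homotopies has two further components, which are set to zero.\<close>

definition mk :: "(real \<Rightarrow> 'e) \<Rightarrow> real \<Rightarrow> 'a::zero \<times> 'b::zero \<times> 'e" where
  "mk f = (\<lambda>s. (0, 0, f s))"

lemma val_simps [simp]:
  fixes x y :: "real \<Rightarrow> 'a::complex_vector \<times> 'b::complex_vector \<times> 'e::complex_vector"
  shows "val (mk f :: real \<Rightarrow> 'a \<times> 'b \<times> 'e) = f" "val (x + y) s = val x s + val y s" "val (x - y) s = val x s - val y s"
    "val (c *\<^sub>C x) s = c *\<^sub>C val x s" "val (0 :: real \<Rightarrow> 'a \<times> 'b \<times> 'e) s = 0" "val (- x) s = - val x s"
  by (auto simp: val_def mk_def scaleC_fun_def scaleC_prod_def)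

context hilbert_module
begin

text \<open>Continuous paths on \<open>[0,1]\<close>, extended to the real line as constants to the left and to the right.\<close>

definition is_path :: "(real \<Rightarrow> 'e) \<Rightarrow> bool" where
  "is_path f \<longleftrightarrow> (\<forall>s. f s \<in> hcarrier E) \<and> (\<forall>s. f (unit_clamp s) = f s) \<and>
    (\<forall>S s. S \<longlonglongrightarrow> s \<longrightarrow> (\<lambda>n. hnorm E (f (S n) - f s)) \<longlonglongrightarrow> 0)"

lemma is_path_mem: "is_path f \<Longrightarrow> f s \<in> hcarrier E"
  and is_path_clamp: "is_path f \<Longrightarrow> f (unit_clamp s) = f s"
  and is_path_tendsto: "is_path f \<Longrightarrow> S \<longlonglongrightarrow> s \<Longrightarrow> (\<lambda>n. hnorm E (f (S n) - f s)) \<longlonglongrightarrow> 0"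
  by (auto simp: is_path_def)

lemma hnorm_null_dominated:
  assumes "\<And>n. hnorm E (f n) \<le> b n" "b \<longlonglongrightarrow> l" "l = 0"
  shows "(\<lambda>n. hnorm E (f n)) \<longlonglongrightarrow> 0"
  by (rule Lim_null_comparison[OF always_eventually assms(2)[unfolded assms(3)]]) (use assms(1) in simp)

lemma is_path_const: "x \<in> hcarrier E \<Longrightarrow> is_path (\<lambda>_. x)"
  by (simp add: is_path_def)

lemma is_path_add:
  assumes "is_path f" "is_path g"
  shows "is_path (\<lambda>s. f s + g s)"
  unfolding is_path_def
proof (intro conjI allI impI)
  fix S s assume S: "S \<longlonglongrightarrow> (s::real)"
  have "hnorm E (f (S n) + g (S n) - (f s + g s)) \<le> hnorm E (f (S n) - f s) + hnorm E (g (S n) - g s)" for n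
    using hnorm_triangle[of "f (S n) - f s" "g (S n) - g s"] assms by (simp add: is_path_mem algebra_simps)
  moreover have "(\<lambda>n. hnorm E (f (S n) - f s) + hnorm E (g (S n) - g s)) \<longlonglongrightarrow> 0 + 0"
    by (intro tendsto_add is_path_tendsto assms S)
  ultimately show "(\<lambda>n. hnorm E (f (S n) + g (S n) - (f s + g s))) \<longlonglongrightarrow> 0"
    by (rule hnorm_null_dominated) simp
qed (use assms in \<open>simp_all add: is_path_mem is_path_clamp\<close>)

lemma is_path_op:
  assumes f: "is_path f" and T: "T \<in> End_ops E"
  shows "is_path (\<lambda>s. T (f s))"
  unfolding is_path_def
proof (intro conjI allI impI)
  fix S s assume S: "S \<longlonglongrightarrow> (s::real)"
  have "hnorm E (T (f (S n)) - T (f s)) \<le> op_norm E T * hnorm E (f (S n) - f s)" for n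
    using op_norm_bound[OF T, of "f (S n) - f s"] f by (simp add: is_path_mem End_diff_apply[OF T])
  moreover have "(\<lambda>n. op_norm E T * hnorm E (f (S n) - f s)) \<longlonglongrightarrow> op_norm E T * 0"
    by (intro tendsto_intros is_path_tendsto f S)
  ultimately show "(\<lambda>n. hnorm E (T (f (S n)) - T (f s))) \<longlonglongrightarrow> 0"
    by (rule hnorm_null_dominated) simp
qed (use f T in \<open>simp_all add: is_path_mem is_path_clamp End_mem\<close>)

lemma is_path_scaleC:
  assumes f: "is_path f" and g: "\<And>S s. S \<longlonglongrightarrow> s \<Longrightarrow> (\<lambda>n. g (S n)) \<longlonglongrightarrow> (g s :: complex)" "\<And>s. g (unit_clamp s) = g s"
  shows "is_path (\<lambda>s. g s *\<^sub>C f s)"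
  unfolding is_path_def
proof (intro conjI allI impI)
  fix S s assume S: "S \<longlonglongrightarrow> (s::real)"
  have "hnorm E (g (S n) *\<^sub>C f (S n) - g s *\<^sub>C f s) \<le> cmod (g (S n)) * hnorm E (f (S n) - f s) + cmod (g (S n) - g s) * hnorm E (f s)" for n
  proof -
    have "g (S n) *\<^sub>C f (S n) - g s *\<^sub>C f s = g (S n) *\<^sub>C (f (S n) - f s) + (g (S n) - g s) *\<^sub>C f s"
      by (simp add: complex_vector.scale_right_diff_distrib complex_vector.scale_left_diff_distrib)
    then show ?thesis
      using hnorm_triangle[of "g (S n) *\<^sub>C (f (S n) - f s)" "(g (S n) - g s) *\<^sub>C f s"] f
      by (simp add: is_path_mem hnorm_scaleC)
  qed
  moreover have "(\<lambda>n. cmod (g (S n)) * hnorm E (f (S n) - f s) + cmod (g (S n) - g s) * hnorm E (f s)) \<longlonglongrightarrow> cmod (g s) * 0 + cmod (g s - g s) * hnorm E (f s)"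
    by (intro tendsto_intros is_path_tendsto f S g(1))
  ultimately show "(\<lambda>n. hnorm E (g (S n) *\<^sub>C f (S n) - g s *\<^sub>C f s)) \<longlonglongrightarrow> 0"
    by (rule hnorm_null_dominated) simp
qed (use f g in \<open>simp_all add: is_path_mem is_path_clamp\<close>)

lemma is_path_act:
  assumes f: "is_path f"
  shows "is_path (\<lambda>s. hact E (f s) (apply_bcontfun b (to_unit s)))"
  unfolding is_path_def
proof (intro conjI allI impI)
  fix S s assume S: "S \<longlonglongrightarrow> (s::real)"
  let ?b = "\<lambda>s. apply_bcontfun b (to_unit s)"
  have "continuous_on UNIV (apply_bcontfun b)"
    using apply_bcontfun[of b] by (simp add: bcontfun_def)
  then have "isCont (apply_bcontfun b) (to_unit s)"
    unfolding continuous_on_eq_continuous_at[OF open_UNIV] by blast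
  then have b: "(\<lambda>n. ?b (S n)) \<longlonglongrightarrow> ?b s"
    by (rule isCont_tendsto_compose) (rule to_unit_tendsto[OF S])
  have "hnorm E (hact E (f (S n)) (?b (S n)) - hact E (f s) (?b s))
      \<le> hnorm E (f (S n) - f s) * norm (?b (S n)) + hnorm E (f s) * norm (?b (S n) - ?b s)" for n
  proof -
    have m: "f (S n) \<in> hcarrier E" "f s \<in> hcarrier E"
      using f by (simp_all add: is_path_mem)
    have "hact E (f (S n) - f s) (?b (S n)) = hact E (f (S n)) (?b (S n)) - hact E (f s) (?b (S n))"
      using act_add_left[of "f (S n) - f s" "f s" "?b (S n)"] m by simp
    moreover have "hact E (f s) (?b (S n) - ?b s) = hact E (f s) (?b (S n)) - hact E (f s) (?b s)"
      using act_add_right[of "f s" "?b (S n) - ?b s" "?b s"] m by simp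
    ultimately have eq: "hact E (f (S n)) (?b (S n)) - hact E (f s) (?b s)
        = hact E (f (S n) - f s) (?b (S n)) + hact E (f s) (?b (S n) - ?b s)"
      by simp
    show ?thesis
      unfolding eq using m
      by (intro order_trans[OF hnorm_triangle] add_mono hnorm_act_le) auto
  qed
  moreover have "(\<lambda>n. hnorm E (f (S n) - f s) * norm (?b (S n)) + hnorm E (f s) * norm (?b (S n) - ?b s))
      \<longlonglongrightarrow> 0 * norm (?b s) + hnorm E (f s) * norm (?b s - ?b s)"
    by (intro tendsto_intros is_path_tendsto f S b)
  ultimately show "(\<lambda>n. hnorm E (hact E (f (S n)) (?b (S n)) - hact E (f s) (?b s))) \<longlonglongrightarrow> 0"
    by (rule hnorm_null_dominated) simp
qed (use f in \<open>simp_all add: is_path_mem is_path_clamp\<close>)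

lemma ip_path_tendsto:
  assumes "is_path f" "is_path g" "S \<longlonglongrightarrow> s"
  shows "(\<lambda>n. hip E (f (S n)) (g (S n))) \<longlonglongrightarrow> hip E (f s) (g s)"
proof -
  note m = is_path_mem[OF assms(1)] is_path_mem[OF assms(2)]
  have "(\<lambda>n. (hnorm E (f (S n) - f s) * (hnorm E (g (S n) - g s) + hnorm E (g s)))) \<longlonglongrightarrow> 0 * (0 + hnorm E (g s))"
    by (intro tendsto_intros is_path_tendsto assms)
  then have 0: "(\<lambda>n. (hnorm E (f (S n) - f s) * (hnorm E (g (S n) - g s) + hnorm E (g s)))) \<longlonglongrightarrow> 0"
    by simp
  have "(\<lambda>n. hip E (f (S n) - f s) (g (S n))) \<longlonglongrightarrow> 0"
  proof (rule Lim_null_comparison[OF always_eventually 0], rule allI)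
    fix n
    have "norm (hip E (f (S n) - f s) (g (S n))) \<le> hnorm E (f (S n) - f s) * hnorm E (g (S n))"
      using m by (intro Cauchy_Schwarz) auto
    also have "hnorm E (g (S n)) \<le> hnorm E (g (S n) - g s) + hnorm E (g s)"
      using hnorm_triangle[of "g (S n) - g s" "g s"] m by simp
    finally show "norm (hip E (f (S n) - f s) (g (S n))) \<le> hnorm E (f (S n) - f s) * (hnorm E (g (S n) - g s) + hnorm E (g s))"
      by (simp add: mult_left_mono)
  qed
  from tendsto_add[OF this ip_tendsto(2)[OF m(2) m(2) m(1) is_path_tendsto[OF assms(2,3)], of s]]
  show ?thesis
    by (simp add: ip_diff_left m)
qed

definition path_ip :: "(real \<Rightarrow> 'e) \<Rightarrow> (real \<Rightarrow> 'e) \<Rightarrow> unit_interval \<Rightarrow>\<^sub>C 'b" where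
  "path_ip f g = Bcontfun (\<lambda>t. hip E (f (Rep_unit_interval t)) (g (Rep_unit_interval t)))"

lemma path_ip_apply:
  assumes "is_path f" "is_path g"
  shows "apply_bcontfun (path_ip f g) t = hip E (f (Rep_unit_interval t)) (g (Rep_unit_interval t))"
proof -
  have cont: "continuous_on UNIV (\<lambda>s. hip E (f s) (g s))"
    unfolding continuous_on_sequentially using ip_path_tendsto[OF assms] by (auto simp: comp_def)
  have "bounded ((\<lambda>s. hip E (f s) (g s)) ` {0..1})"
    by (intro compact_imp_bounded compact_continuous_image continuous_on_subset[OF cont]) auto
  moreover have "range (\<lambda>t. hip E (f (Rep_unit_interval t)) (g (Rep_unit_interval t))) \<subseteq> (\<lambda>s. hip E (f s) (g s)) ` {0..1}"
    using Rep_unit_interval by auto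
  ultimately have "(\<lambda>t. hip E (f (Rep_unit_interval t)) (g (Rep_unit_interval t))) \<in> bcontfun"
    unfolding bcontfun_def
    using continuous_on_compose2[OF cont continuous_Rep_unit_interval] bounded_subset by blast
  then show ?thesis
    by (simp add: path_ip_def Bcontfun_inverse)
qed

end

locale path_space = hilbert_module X
  for X :: "('e::complex_vector, 'b::cstar_algebra, 'a::cstar_algebra) corr"
begin

definition "paths = (mk ` {f. is_path f} :: (real \<Rightarrow> 'a \<times> 'b \<times> 'e) set)"

definition pointwise :: "('e \<Rightarrow> 'e) \<Rightarrow> (real \<Rightarrow> 'a \<times> 'b \<times> 'e) \<Rightarrow> real \<Rightarrow> 'a \<times> 'b \<times> 'e" where
  "pointwise T = (\<lambda>x. if x \<in> paths then mk (\<lambda>s. T (val x s)) else 0)"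

definition path_corr :: "('e, 'b, 'a) homotopy_corr" where
  "path_corr = \<lparr>hcarrier = paths, hip = (\<lambda>x y. path_ip (val x) (val y)),
     hact = (\<lambda>x b. mk (\<lambda>s. hact X (val x s) (apply_bcontfun b (to_unit s)))),
     rep = (\<lambda>a. pointwise (rep X a)), grading = map_option pointwise (grading X)\<rparr>"

lemma path_corr_simps: "hcarrier path_corr = paths" "hip path_corr x y = path_ip (val x) (val y)"
  "hact path_corr x b = mk (\<lambda>s. hact X (val x s) (apply_bcontfun b (to_unit s)))"
  "rep path_corr a = pointwise (rep X a)" "grading path_corr = map_option pointwise (grading X)"
  by (simp_all add: path_corr_def)

lemma is_path_val: "x \<in> paths \<Longrightarrow> is_path (val x)"
  by (auto simp: paths_def)

lemma mk_val: "x \<in> paths \<Longrightarrow> mk (val x) = x"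
  by (auto simp: paths_def)

lemma mk_mem: "is_path f \<Longrightarrow> mk f \<in> paths"
  by (auto simp: paths_def)

lemma path_eqI: "x \<in> paths \<Longrightarrow> y \<in> paths \<Longrightarrow> (\<And>s. val x s = val y s) \<Longrightarrow> x = y"
  using mk_val by (metis ext)

lemma val_mem: "x \<in> paths \<Longrightarrow> val x s \<in> hcarrier X"
  using is_path_val is_path_mem by blast

lemma val_clamp: "x \<in> paths \<Longrightarrow> val x (unit_clamp s) = val x s"
  using is_path_val is_path_clamp by blast

lemma path_ip_val: "x \<in> paths \<Longrightarrow> y \<in> paths \<Longrightarrow> apply_bcontfun (hip path_corr x y) (to_unit s) = hip X (val x s) (val y s)"
  by (simp add: path_corr_simps path_ip_apply is_path_val val_clamp)

lemma bcontfun_eqI': "(\<And>s. apply_bcontfun f (to_unit s) = apply_bcontfun g (to_unit s)) \<Longrightarrow> f = g"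
  by (rule bcontfun_eqI) (metis Rep_to_unit(2))

lemma paths_subspace: "complex_vector.subspace paths"
  unfolding complex_vector.subspace_def
proof (intro conjI ballI allI)
  have "(0 :: real \<Rightarrow> 'a \<times> 'b \<times> 'e) = mk (\<lambda>_. 0)"
    by (auto simp: mk_def zero_prod_def)
  then show "0 \<in> paths"
    using mk_mem[OF is_path_const[OF zero_mem]] by simp
  fix x y assume x: "x \<in> paths"
  have "c *\<^sub>C x = mk (\<lambda>s. c *\<^sub>C val x s)" for c
    by (subst mk_val[OF x, symmetric]) (auto simp: mk_def scaleC_fun_def scaleC_prod_def complex_vector.scale_zero_right)
  then show "c *\<^sub>C x \<in> paths" for c
    using mk_mem[OF is_path_scaleC[OF is_path_val[OF x], of "\<lambda>_. c"]] by simp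
  assume y: "y \<in> paths"
  have "x + y = mk (\<lambda>s. val x s + val y s)"
    by (subst mk_val[OF x, symmetric], subst mk_val[OF y, symmetric]) (auto simp: mk_def)
  then show "x + y \<in> paths"
    using mk_mem[OF is_path_add[OF is_path_val[OF x] is_path_val[OF y]]] by simp
qed

lemmas paths_add = complex_vector.subspace_add[OF paths_subspace]
  and paths_diff = complex_vector.subspace_diff[OF paths_subspace]
  and paths_scale = complex_vector.subspace_scale[OF paths_subspace]
  and paths_zero = complex_vector.subspace_0[OF paths_subspace]

lemma paths_act: "x \<in> paths \<Longrightarrow> hact path_corr x b \<in> paths"
  by (simp add: path_corr_simps mk_mem is_path_act is_path_val)

lemma hnorm_val_le:
  assumes x: "x \<in> paths"
  shows "hnorm X (val x s) \<le> hnorm path_corr x"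
  unfolding hnorm_def using norm_bounded[of "hip path_corr x x" "to_unit s"] by (simp add: path_ip_val x)

lemma hnorm_path_le:
  assumes x: "x \<in> paths" and e: "e \<ge> 0" and le: "\<And>s. hnorm X (val x s) \<le> e"
  shows "hnorm path_corr x \<le> e"
proof -
  have "norm (hip path_corr x x) \<le> e\<^sup>2"
  proof (rule norm_bound)
    fix t
    have "norm (apply_bcontfun (hip path_corr x x) (to_unit (Rep_unit_interval t))) = (hnorm X (val x (Rep_unit_interval t)))\<^sup>2"
      by (simp only: path_ip_val[OF x x] hnorm_square)
    also have "\<dots> \<le> e\<^sup>2"
      by (intro power_mono le) simp
    finally show "norm (apply_bcontfun (hip path_corr x x) t) \<le> e\<^sup>2"
      by simp
  qed
  then show ?thesis
    unfolding hnorm_def using e real_le_lsqrt by blast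
qed

text \<open>The limit exists pointwise, and the convergence is uniform.\<close>

lemma paths_complete:
  assumes x: "\<And>n::nat. x n \<in> paths" and C: "\<forall>e>0. \<exists>N. \<forall>m\<ge>N. \<forall>n\<ge>N. hnorm path_corr (x m - x n) < e"
  shows "\<exists>y\<in>paths. (\<lambda>n. hnorm path_corr (x n - y)) \<longlonglongrightarrow> 0"
proof -
  have le: "hnorm X (val (x m) s - val (x n) s) \<le> hnorm path_corr (x m - x n)" for m n s
    using hnorm_val_le[OF paths_diff[OF x x], of m n s] by simp
  have "\<exists>y\<in>hcarrier X. (\<lambda>n. hnorm X (val (x n) s - y)) \<longlonglongrightarrow> 0" for s
  proof (rule complete)
    show "val (x n) s \<in> hcarrier X" for n
      by (rule val_mem[OF x])
    show "\<forall>e>0. \<exists>N. \<forall>m\<ge>N. \<forall>n\<ge>N. hnorm X (val (x m) s - val (x n) s) < e"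
      using C le by (meson order_le_less_trans)
  qed
  then have "\<forall>s. \<exists>y. y \<in> hcarrier X \<and> (\<lambda>n. hnorm X (val (x n) s - y)) \<longlonglongrightarrow> 0"
    by blast
  from choice[OF this] obtain y0 where y0: "\<And>s. y0 s \<in> hcarrier X" "\<And>s. (\<lambda>n. hnorm X (val (x n) s - y0 s)) \<longlonglongrightarrow> 0"
    by blast
  define y where "y s = y0 (unit_clamp s)" for s
  have y: "y s \<in> hcarrier X" "(\<lambda>n. hnorm X (val (x n) s - y s)) \<longlonglongrightarrow> 0" for s
    using y0(1) y0(2)[of "unit_clamp s"] by (simp_all add: y_def val_clamp[OF x])
  have unif: "\<exists>N. \<forall>n\<ge>N. \<forall>s. hnorm X (val (x n) s - y s) \<le> e" if e: "e > 0" for e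
  proof -
    obtain N where N: "\<And>m n. m \<ge> N \<Longrightarrow> n \<ge> N \<Longrightarrow> hnorm path_corr (x m - x n) < e"
      using C e by blast
    have "hnorm X (val (x n) s - y s) \<le> e" if n: "n \<ge> N" for n s
    proof (rule LIMSEQ_le_const[of "\<lambda>m. e + hnorm X (val (x m) s - y s)"])
      show "(\<lambda>m. e + hnorm X (val (x m) s - y s)) \<longlonglongrightarrow> e"
        using tendsto_add[OF tendsto_const[of e] y(2)[of s]] by simp
      have "hnorm X (val (x n) s - y s) \<le> e + hnorm X (val (x m) s - y s)" if m: "m \<ge> N" for m
        using hnorm_diff_triangle[OF val_mem[OF x[of n]] val_mem[OF x[of m]] y(1), of s s s] le[of n s m] N[OF n m] by simp
      then show "\<exists>N. \<forall>m\<ge>N. hnorm X (val (x n) s - y s) \<le> e + hnorm X (val (x m) s - y s)"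
        by blast
    qed
    then show ?thesis
      by blast
  qed
  have path: "is_path y"
    unfolding is_path_def
  proof (intro conjI allI impI)
    show "y s \<in> hcarrier X" "y (unit_clamp s) = y s" for s
      by (rule y(1)) (simp add: y_def)
    fix S s assume S: "S \<longlonglongrightarrow> (s :: real)"
    show "(\<lambda>n. hnorm X (y (S n) - y s)) \<longlonglongrightarrow> 0"
    proof (rule LIMSEQ_I)
      fix e :: real assume e: "0 < e"
      then obtain N where N: "\<And>s. hnorm X (val (x N) s - y s) \<le> e / 4"
        using unif[of "e / 4"] by auto
      obtain M where M: "\<And>n. n \<ge> M \<Longrightarrow> hnorm X (val (x N) (S n) - val (x N) s) < e / 4"
        using LIMSEQ_D[OF is_path_tendsto[OF is_path_val[OF x[of N]] S], of "e / 4"] e by auto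
      have "hnorm X (y (S n) - y s) < e" if n: "n \<ge> M" for n
        using hnorm_diff_triangle[OF y(1) val_mem[OF x[of N]] y(1), of "S n" s "S n"]
          hnorm_diff_triangle[OF val_mem[OF x[of N]] val_mem[OF x[of N]] y(1), of "S n" s s]
          hnorm_minus_commute[OF y(1) val_mem[OF x[of N]], of "S n" "S n"]
          N[of "S n"] N[of s] M[OF n] e by linarith
      then show "\<exists>M. \<forall>n\<ge>M. norm (hnorm X (y (S n) - y s) - 0) < e"
        by auto
    qed
  qed
  have "(\<lambda>n. hnorm path_corr (x n - mk y)) \<longlonglongrightarrow> 0"
  proof (rule LIMSEQ_I)
    fix e :: real assume e: "0 < e"
    then obtain N where N: "\<And>n s. n \<ge> N \<Longrightarrow> hnorm X (val (x n) s - y s) \<le> e / 2"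
      using unif[of "e / 2"] by auto
    have "hnorm path_corr (x n - mk y) \<le> e / 2" if "n \<ge> N" for n
      using N[OF that] e by (intro hnorm_path_le paths_diff x mk_mem path) auto
    then show "\<exists>N. \<forall>n\<ge>N. norm (hnorm path_corr (x n - mk y) - 0) < e"
      using e by (intro exI[of _ N]) (force simp: hnorm_def)
  qed
  then show ?thesis
    using mk_mem[OF path] by blast
qed

lemma hilbert_module_paths: "hilbert_module path_corr"
proof
  fix x y z :: "real \<Rightarrow> 'a \<times> 'b \<times> 'e" and b c :: "unit_interval \<Rightarrow>\<^sub>C 'b" and k
  show "complex_vector.subspace (hcarrier path_corr)"
    by (simp add: path_corr_simps paths_subspace)
  assume "x \<in> hcarrier path_corr"
  then have x: "x \<in> paths"
    by (simp add: path_corr_simps)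
  show "hact path_corr x b \<in> hcarrier path_corr"
    using paths_act[OF x] by (simp add: path_corr_simps)
  show "hact path_corr x (b + c) = hact path_corr x b + hact path_corr x c"
    by (rule path_eqI) (simp_all add: x paths_act paths_add, simp add: path_corr_simps act_add_right val_mem x)
  show "hact path_corr x (b * c) = hact path_corr (hact path_corr x b) c"
    by (rule path_eqI) (simp_all add: x paths_act, simp add: path_corr_simps act_mult val_mem x)
  show "hact path_corr (k *\<^sub>C x) b = k *\<^sub>C hact path_corr x b"
    by (rule path_eqI) (simp_all add: x paths_act paths_scale, simp add: path_corr_simps act_scaleC_left val_mem x)
  show "hact path_corr x (k *\<^sub>C b) = k *\<^sub>C hact path_corr x b"
    by (rule path_eqI) (simp_all add: x paths_act paths_scale, simp add: path_corr_simps act_scaleC_right val_mem x)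
  have "cstar_positive (apply_bcontfun (hip path_corr x x) (to_unit (Rep_unit_interval t)))" for t
    unfolding path_ip_val[OF x x] by (rule ip_positive[OF val_mem[OF x]])
  then show "cstar_positive (hip path_corr x x)"
    by (intro cstar_positive_bcontfun) simp
  show "x = 0" if "hip path_corr x x = 0"
  proof (rule path_eqI[OF x paths_zero])
    show "val x s = val (0 :: real \<Rightarrow> 'a \<times> 'b \<times> 'e) s" for s
      using path_ip_val[OF x x, of s] that ip_definite[OF val_mem[OF x]] by simp
  qed
  assume "y \<in> hcarrier path_corr"
  then have y: "y \<in> paths"
    by (simp add: path_corr_simps)
  show "hact path_corr (x + y) b = hact path_corr x b + hact path_corr y b"
    by (rule path_eqI) (simp_all add: x y paths_act paths_add, simp add: path_corr_simps act_add_left val_mem x y)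
  show "hip path_corr x (k *\<^sub>C y) = k *\<^sub>C hip path_corr x y"
    by (rule bcontfun_eqI') (simp add: path_ip_val x y paths_scale ip_scaleC val_mem)
  show "hip path_corr x (hact path_corr y b) = hip path_corr x y * b"
    by (rule bcontfun_eqI') (simp add: path_ip_val x y paths_act, simp add: path_corr_simps ip_act val_mem x y)
  show "hip path_corr y x = (hip path_corr x y)\<^sup>\<star>"
    by (rule bcontfun_eqI') (simp add: path_ip_val x y ip_star[OF val_mem[OF x] val_mem[OF y]])
  assume "z \<in> hcarrier path_corr"
  then have z: "z \<in> paths"
    by (simp add: path_corr_simps)
  show "hip path_corr x (y + z) = hip path_corr x y + hip path_corr x z"
    by (rule bcontfun_eqI') (simp add: path_ip_val x y z paths_add ip_add val_mem)
next
  fix x :: "nat \<Rightarrow> real \<Rightarrow> 'a \<times> 'b \<times> 'e"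
  assume "\<And>n. x n \<in> hcarrier path_corr" "\<forall>e>0. \<exists>N. \<forall>m\<ge>N. \<forall>n\<ge>N. hnorm path_corr (x m - x n) < e"
  then show "\<exists>y\<in>hcarrier path_corr. (\<lambda>n. hnorm path_corr (x n - y)) \<longlonglongrightarrow> 0"
    using paths_complete[of x] by (simp add: path_corr_simps)
qed

end

section \<open>The straight-line homotopy\<close>

context path_space
begin

sublocale H: hilbert_module path_corr
  by (rule hilbert_module_paths)

lemma path_op_eqI:
  assumes "S \<in> End_ops path_corr" "T \<in> End_ops path_corr" "\<And>x s. x \<in> paths \<Longrightarrow> val (S x) s = val (T x) s"
  shows "S = T"
proof (rule H.End_ext[OF assms(1,2)])
  fix x assume "x \<in> hcarrier path_corr"
  then show "S x = T x"
    using H.End_mem[OF assms(1)] H.End_mem[OF assms(2)] assms(3) by (intro path_eqI) (simp_all add: path_corr_simps)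
qed

text \<open>Inner products of paths are computed pointwise, hence so are adjoints.\<close>

lemma path_op_End:
  assumes T: "\<And>x. x \<in> paths \<Longrightarrow> T x \<in> paths" "\<And>x. x \<notin> paths \<Longrightarrow> T x = 0"
    and S: "\<And>x. x \<in> paths \<Longrightarrow> S x \<in> paths" "\<And>x. x \<notin> paths \<Longrightarrow> S x = 0"
    and adj: "\<And>x y s. x \<in> paths \<Longrightarrow> y \<in> paths \<Longrightarrow> hip X (val (T x) s) (val y s) = hip X (val x s) (val (S y) s)"
  shows "T \<in> End_ops path_corr" "adj path_corr path_corr T = S"
proof -
  have om: "T \<in> op_maps path_corr path_corr" "S \<in> op_maps path_corr path_corr"
    using T S by (auto simp: op_maps_def path_corr_simps)
  have "is_adjoint path_corr path_corr T S"
    unfolding is_adjoint_def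
  proof (intro ballI)
    fix x y assume "x \<in> hcarrier path_corr" "y \<in> hcarrier path_corr"
    then have xy: "x \<in> paths" "y \<in> paths"
      by (simp_all add: path_corr_simps)
    show "hip path_corr (T x) y = hip path_corr x (S y)"
      by (rule bcontfun_eqI') (simp add: path_ip_val xy T S adj)
  qed
  with om show "T \<in> End_ops path_corr" "adj path_corr path_corr T = S"
    using H.self.adjointableI H.self.adj_eqI by blast+
qed

lemma pointwise_mem: "T \<in> End_ops X \<Longrightarrow> x \<in> paths \<Longrightarrow> pointwise T x \<in> paths"
  by (simp add: pointwise_def mk_mem is_path_op is_path_val)

lemma val_pointwise: "x \<in> paths \<Longrightarrow> val (pointwise T x) s = T (val x s)"
  by (simp add: pointwise_def)

lemma pointwise_End:
  assumes T: "T \<in> End_ops X"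
  shows "pointwise T \<in> End_ops path_corr" "adj path_corr path_corr (pointwise T) = pointwise (adj X X T)"
proof -
  note * = path_op_End[of "pointwise T" "pointwise (adj X X T)"]
  have off: "x \<notin> paths \<Longrightarrow> pointwise S x = 0" for S x
    by (simp add: pointwise_def)
  have ip: "hip X (val (pointwise T x) s) (val y s) = hip X (val x s) (val (pointwise (adj X X T) y) s)"
    if "x \<in> paths" "y \<in> paths" for x y s
    using that self.ip_adj[OF T val_mem val_mem] by (simp add: val_pointwise)
  show "pointwise T \<in> End_ops path_corr"
    by (rule *(1)[OF pointwise_mem[OF T] off pointwise_mem[OF End_adj[OF T]] off ip])
  show "adj path_corr path_corr (pointwise T) = pointwise (adj X X T)"
    by (rule *(2)[OF pointwise_mem[OF T] off pointwise_mem[OF End_adj[OF T]] off ip])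
qed

lemma pointwise_comp:
  assumes "S \<in> End_ops X" "T \<in> End_ops X"
  shows "pointwise (S \<circ> T) = pointwise S \<circ> pointwise T"
  by (rule path_op_eqI[OF pointwise_End(1)[OF End_comp(1)[OF assms]] H.End_comp(1)[OF pointwise_End(1)[OF assms(1)] pointwise_End(1)[OF assms(2)]]])
    (simp add: val_pointwise pointwise_mem assms)

lemma pointwise_plus:
  assumes "S \<in> End_ops X" "T \<in> End_ops X"
  shows "pointwise (S + T) = pointwise S + pointwise T"
  by (rule path_op_eqI[OF pointwise_End(1)[OF End_plus(1)[OF assms]] H.End_plus(1)[OF pointwise_End(1)[OF assms(1)] pointwise_End(1)[OF assms(2)]]])
    (simp add: val_pointwise)

lemma pointwise_scale:
  assumes "T \<in> End_ops X"
  shows "pointwise (c *\<^sub>C T) = c *\<^sub>C pointwise T"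
  by (rule path_op_eqI[OF pointwise_End(1)[OF End_scale(1)[OF assms]] H.End_scale(1)[OF pointwise_End(1)[OF assms]]])
    (simp add: val_pointwise scaleC_fun_def[of c T] scaleC_fun_def[of c "pointwise T"])

lemma pointwise_minus:
  assumes "S \<in> End_ops X" "T \<in> End_ops X"
  shows "pointwise (S - T) = pointwise S - pointwise T"
  using pointwise_plus[OF End_minus(1)[OF assms] assms(2)] by simp

lemma pointwise_id: "pointwise (id_op X) = id_op path_corr"
  by (rule path_op_eqI[OF pointwise_End(1)[OF End_id(1)] H.End_id(1)])
    (simp add: val_pointwise id_op_apply val_mem H.id_op_apply path_corr_simps)

lemma op_norm_pointwise:
  assumes T: "T \<in> End_ops X"
  shows "op_norm path_corr (pointwise T) \<le> op_norm X T"
proof (rule H.op_norm_le)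
  fix x assume "x \<in> hcarrier path_corr"
  then have x: "x \<in> paths"
    by (simp add: path_corr_simps)
  show "hnorm path_corr (pointwise T x) \<le> op_norm X T * hnorm path_corr x"
  proof (rule hnorm_path_le[OF pointwise_mem[OF T x]])
    show "hnorm X (val (pointwise T x) s) \<le> op_norm X T * hnorm path_corr x" for s
      unfolding val_pointwise[OF x]
      by (rule order_trans[OF op_norm_bound[OF T val_mem[OF x]] mult_left_mono[OF hnorm_val_le[OF x] op_norm_nonneg[OF T]]])
  qed (simp add: op_norm_nonneg T)
qed (rule op_norm_nonneg[OF T])

text \<open>A rank-one operator acts pointwise as the rank-one operator of two constant paths.\<close>

lemma pointwise_compact:
  assumes K: "K \<in> compact_ops X"
  shows "pointwise K \<in> compact_ops path_corr"
proof (rule compact_image[OF hilbert_module_axioms hilbert_module_paths K, of _ 1])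
  show "pointwise (S + T) = pointwise S + pointwise T" if "S \<in> End_ops X" "T \<in> End_ops X" for S T
    by (rule pointwise_plus[OF that])
  fix x y assume xy: "x \<in> hcarrier X" "y \<in> hcarrier X"
  have m: "mk (\<lambda>_. x) \<in> hcarrier path_corr" "mk (\<lambda>_. y) \<in> hcarrier path_corr"
    using xy by (simp_all add: path_corr_simps mk_mem is_path_const)
  have "pointwise (rank_one X x y) = rank_one path_corr (mk (\<lambda>_. x)) (mk (\<lambda>_. y))"
  proof (rule path_op_eqI[OF pointwise_End(1)[OF rank_one_End(1)[OF xy]] H.rank_one_End(1)[OF m]])
    fix z s assume z: "z \<in> paths"
    have "val (rank_one path_corr (mk (\<lambda>_. x)) (mk (\<lambda>_. y)) z) s = hact X x (apply_bcontfun (hip path_corr (mk (\<lambda>_. y)) z) (to_unit s))"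
      using z by (simp add: rank_one_def path_corr_simps)
    then show "val (pointwise (rank_one X x y) z) s = val (rank_one path_corr (mk (\<lambda>_. x)) (mk (\<lambda>_. y)) z) s"
      using z m(2) by (simp add: path_ip_val val_pointwise rank_one_def val_mem path_corr_simps(1))
  qed
  then show "pointwise (rank_one X x y) \<in> compact_ops path_corr"
    using H.rank_one_compact[OF m] by (simp only:)
qed (simp_all add: pointwise_End op_norm_pointwise)

text \<open>Multiplication by the parameter of the path.\<close>

definition param :: "(real \<Rightarrow> 'a \<times> 'b \<times> 'e) \<Rightarrow> real \<Rightarrow> 'a \<times> 'b \<times> 'e" where
  "param = (\<lambda>x. if x \<in> paths then mk (\<lambda>s. complex_of_real (unit_clamp s) *\<^sub>C val x s) else 0)"

lemma val_param: "x \<in> paths \<Longrightarrow> val (param x) s = complex_of_real (unit_clamp s) *\<^sub>C val x s"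
  by (simp add: param_def)

lemma param_mem: "x \<in> paths \<Longrightarrow> param x \<in> paths"
  unfolding param_def by (auto intro!: mk_mem is_path_scaleC is_path_val tendsto_of_real unit_clamp_tendsto)

lemma param_End: "param \<in> End_ops path_corr" "adj path_corr path_corr param = param"
proof -
  have off: "x \<notin> paths \<Longrightarrow> param x = 0" for x
    by (simp add: param_def)
  have ip: "hip X (val (param x) s) (val y s) = hip X (val x s) (val (param y) s)" if "x \<in> paths" "y \<in> paths" for x y s
    using that by (simp add: val_param ip_scaleC ip_scaleC_left val_mem)
  show "param \<in> End_ops path_corr" "adj path_corr path_corr param = param"
    using path_op_End[OF param_mem off param_mem off ip] by blast+
qed

lemma param_commute:
  assumes "T \<in> End_ops X"
  shows "param \<circ> pointwise T = pointwise T \<circ> param"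
  by (rule path_op_eqI[OF H.End_comp(1)[OF param_End(1) pointwise_End(1)[OF assms]] H.End_comp(1)[OF pointwise_End(1)[OF assms] param_End(1)]])
    (simp add: val_pointwise val_param param_mem pointwise_mem assms End_scaleC_apply val_mem)

lemma correspondence_paths:
  assumes "correspondence X"
  shows "correspondence path_corr"
  unfolding correspondence_def
proof (intro conjI allI impI)
  show "hilbert_module path_corr"
    by (rule hilbert_module_paths)
  have rE: "rep X a \<in> End_ops X" for a
    using assms by (simp add: correspondence_def)
  show "rep path_corr a \<in> End_ops path_corr" for a
    by (simp add: path_corr_simps pointwise_End rE)
  show "rep path_corr (a + b) = rep path_corr a + rep path_corr b" "rep path_corr (c *\<^sub>C a) = c *\<^sub>C rep path_corr a"
    "rep path_corr (a * b) = rep path_corr a \<circ> rep path_corr b"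
    "rep path_corr (a\<^sup>\<star>) = adj path_corr path_corr (rep path_corr a)" for a b c
    unfolding path_corr_simps pointwise_End(2)[OF rE] pointwise_plus[OF rE rE, symmetric]
      pointwise_comp[OF rE rE, symmetric] pointwise_scale[OF rE, symmetric]
    using assms by (auto simp: correspondence_def)
  have gE: "\<gamma> \<in> End_ops X" if "grading X = Some \<gamma>" for \<gamma>
    using assms that by (auto simp: correspondence_def unitary_def)
  show "unitary path_corr path_corr \<gamma>" "adj path_corr path_corr \<gamma> = \<gamma>" if gr: "grading path_corr = Some \<gamma>" for \<gamma>
  proof -
    from gr obtain \<gamma>' where \<gamma>': "grading X = Some \<gamma>'" "\<gamma> = pointwise \<gamma>'"
      by (auto simp: path_corr_simps)
    have u: "adj X X \<gamma>' = \<gamma>'" "\<gamma>' \<circ> \<gamma>' = id_op X"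
      using assms \<gamma>'(1) by (auto simp: correspondence_def unitary_def)
    show 1: "adj path_corr path_corr \<gamma> = \<gamma>"
      unfolding \<gamma>'(2) pointwise_End(2)[OF gE[OF \<gamma>'(1)]] u ..
    have "\<gamma> \<circ> \<gamma> = id_op path_corr"
      unfolding \<gamma>'(2) pointwise_comp[OF gE[OF \<gamma>'(1)] gE[OF \<gamma>'(1)], symmetric] u pointwise_id ..
    moreover have "\<gamma> \<in> End_ops path_corr"
      unfolding \<gamma>'(2) by (rule pointwise_End(1)[OF gE[OF \<gamma>'(1)]])
    ultimately show "unitary path_corr path_corr \<gamma>"
      by (simp add: unitary_def 1)
  qed
  show "even_op path_corr (rep path_corr a)" for a
    unfolding even_op_def
  proof (intro allI impI)
    fix \<gamma> assume "grading path_corr = Some \<gamma>"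
    then obtain \<gamma>' where \<gamma>': "grading X = Some \<gamma>'" "\<gamma> = pointwise \<gamma>'"
      by (auto simp: path_corr_simps)
    then have "rep X a \<circ> \<gamma>' = \<gamma>' \<circ> rep X a"
      using assms by (auto simp: correspondence_def even_op_def)
    then show "rep path_corr a \<circ> \<gamma> = \<gamma> \<circ> rep path_corr a"
      unfolding \<gamma>'(2) path_corr_simps pointwise_comp[OF rE gE[OF \<gamma>'(1)], symmetric] pointwise_comp[OF gE[OF \<gamma>'(1)] rE, symmetric]
      by (rule arg_cong)
  qed
qed

end

locale compact_perturbation = path_space X
  for X :: "('e::complex_vector, 'b::cstar_algebra, 'a::cstar_algebra) corr" +
  fixes F \<Delta> :: "'e \<Rightarrow> 'e"
  assumes kasparov: "kasparov_module X F" and F_selfadjoint: "adj X X F = F"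
    and \<Delta>_End: "\<Delta> \<in> End_ops X" and \<Delta>_selfadjoint: "adj X X \<Delta> = \<Delta>"
    and \<Delta>_odd: "odd_op X \<Delta>" and \<Delta>_compact: "\<Delta> \<circ> rep X a \<in> compact_ops X"
begin

definition "G = pointwise F + (param \<circ> pointwise \<Delta>)"

lemma corr: "correspondence X" and F_End: "F \<in> End_ops X" and rep_End: "rep X a \<in> End_ops X"
  and rep_star: "rep X (a\<^sup>\<star>) = adj X X (rep X a)"
  using kasparov by (auto simp: kasparov_module_def correspondence_def)

lemma param_\<Delta>_End: "param \<circ> pointwise \<Delta> \<in> End_ops path_corr" "adj path_corr path_corr (param \<circ> pointwise \<Delta>) = param \<circ> pointwise \<Delta>"
proof -
  note e = param_End(1) pointwise_End(1)[OF \<Delta>_End]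
  show "param \<circ> pointwise \<Delta> \<in> End_ops path_corr"
    by (rule H.End_comp(1)[OF e])
  show "adj path_corr path_corr (param \<circ> pointwise \<Delta>) = param \<circ> pointwise \<Delta>"
    unfolding H.End_comp(2)[OF e] param_End(2) pointwise_End(2)[OF \<Delta>_End] \<Delta>_selfadjoint
    by (rule param_commute[OF \<Delta>_End, symmetric])
qed

lemma G_End: "G \<in> End_ops path_corr" "adj path_corr path_corr G = G"
  unfolding G_def using H.End_plus[OF pointwise_End(1)[OF F_End] param_\<Delta>_End(1)] pointwise_End(2)[OF F_End] F_selfadjoint param_\<Delta>_End(2)
  by simp_all

lemma val_G: "x \<in> paths \<Longrightarrow> val (G x) s = F (val x s) + complex_of_real (unit_clamp s) *\<^sub>C \<Delta> (val x s)"
  using pointwise_mem[OF \<Delta>_End, of x] by (simp add: G_def val_pointwise val_param)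

text \<open>A computation modulo compacts with \<open>G = F + m \<Delta>\<close>: the multiplication \<open>m\<close> by the parameter commutes with pointwise
  operators, and \<open>\<Delta> a\<close> and \<open>a \<Delta>\<close> are compact.\<close>

lemma G_mem:
  fixes a :: 'a
  defines "e \<equiv> emb path_corr" and "J \<equiv> emb path_corr ` compact_ops path_corr"
  shows "(e (id_op path_corr) - e G * e G) * e (rep path_corr a) \<in> J"
    and "e G * e (rep path_corr a) - e (rep path_corr a) * e G \<in> J"
proof -
  interpret e: corner_embedding path_corr e
    unfolding e_def by (rule H.corner_embedding_emb)
  interpret closed_ideal J
    unfolding J_def by (rule H.compact_ideal)
  have J: "e (pointwise K) \<in> J" if "K \<in> compact_ops X" for K
    unfolding e_def J_def using pointwise_compact[OF that] by blast
  define f d m where "f = e (pointwise F)" and "d = e (pointwise \<Delta>)" and "m = e param"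
  define c where "c b = e (rep path_corr b)" for b
  note PE = pointwise_End(1)[OF F_End] pointwise_End(1)[OF \<Delta>_End] pointwise_End(1)[OF rep_End]
  have c: "c b = e (pointwise (rep X b))" for b
    by (simp add: c_def path_corr_simps)
  have eG: "e G = f + m * d"
    unfolding G_def e.plus[OF PE(1) param_\<Delta>_End(1)] e.comp[OF param_End(1) PE(2)] by (simp add: f_def m_def d_def)
  have mT: "e (pointwise T) * m = m * e (pointwise T)" if "T \<in> End_ops X" for T
    using e.comp[OF param_End(1) pointwise_End(1)[OF that]] e.comp[OF pointwise_End(1)[OF that] param_End(1)]
    by (simp add: m_def param_commute[OF that])
  have mcom: "f * m = m * f" "d * m = m * d" "c b * m = m * c b" for b
    using mT[OF F_End] mT[OF \<Delta>_End] mT[OF rep_End] by (simp_all add: f_def d_def c)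
  have dc: "d * c b \<in> J" for b
    using J[OF \<Delta>_compact[of b]] unfolding d_def c pointwise_comp[OF \<Delta>_End rep_End] e.comp[OF PE(2,3)] .
  have cd: "c b * d \<in> J" for b
  proof -
    have "d\<^sup>\<star> = d" "(c (b\<^sup>\<star>))\<^sup>\<star> = c b"
      using e.adjoint[OF PE(2)] e.adjoint[OF PE(3), of "b\<^sup>\<star>"] End_adj_adj[OF rep_End]
      by (simp_all add: d_def c pointwise_End(2)[OF \<Delta>_End] pointwise_End(2)[OF rep_End] pointwise_End(2)[OF End_adj[OF rep_End]] \<Delta>_selfadjoint rep_star)
    then show ?thesis
      using star_mem[OF dc[of "b\<^sup>\<star>"]] by (simp add: star_mult)
  qed
  have fc: "f * c b - c b * f \<in> J" for b
  proof -
    have K: "(F \<circ> rep X b) - (rep X b \<circ> F) \<in> compact_ops X"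
      using kasparov by (simp add: kasparov_module_def)
    note m = End_comp(1)[OF F_End rep_End[of b]] End_comp(1)[OF rep_End[of b] F_End]
    show ?thesis
      using J[OF K] unfolding pointwise_minus[OF m] pointwise_comp[OF F_End rep_End] pointwise_comp[OF rep_End F_End]
        e.minus[OF H.End_comp(1)[OF PE(1) PE(3)] H.End_comp(1)[OF PE(3) PE(1)]] e.comp[OF PE(1,3)] e.comp[OF PE(3,1)] f_def c .
  qed
  have uc: "(e.unit - f * f) * c b \<in> J" for b
  proof -
    have K: "(id_op X - (F \<circ> F)) \<circ> rep X b \<in> compact_ops X"
      using kasparov by (simp add: kasparov_module_def)
    note FF = End_comp(1)[OF F_End F_End]
    note m = End_minus(1)[OF End_id(1) FF]
    show ?thesis
      using J[OF K] unfolding pointwise_comp[OF m rep_End] pointwise_minus[OF End_id(1) FF] pointwise_id pointwise_comp[OF F_End F_End]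
        e.comp[OF H.End_minus(1)[OF H.End_id(1) H.End_comp(1)[OF PE(1) PE(1)]] PE(3)]
        e.minus[OF H.End_id(1) H.End_comp(1)[OF PE(1) PE(1)]] e.comp[OF PE(1,1)] f_def c e.unit_def .
  qed
  have fdc: "f * (d * c b) \<in> J" and ddc: "d * (d * c b) \<in> J" and dfc: "d * (f * c b) \<in> J" for b
  proof -
    show "f * (d * c b) \<in> J" "d * (d * c b) \<in> J"
      by (rule left[OF dc])+
    have "d * (f * c b - c b * f) + d * c b * f \<in> J"
      by (rule add[OF left[OF fc] mult[OF dc]])
    then show "d * (f * c b) \<in> J"
      by (simp add: algebra_simps)
  qed
  have "(e.unit - e G * e G) * c a
      = (e.unit - f * f) * c a - m * (f * (d * c a)) - m * (d * (f * c a)) - m * (m * (d * (d * c a)))"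
    unfolding eG by (simp add: algebra_simps) (metis (no_types) mcom mult.assoc)
  also have "\<dots> \<in> J"
    by (intro diff left uc fdc dfc ddc)
  finally show "(e (id_op path_corr) - e G * e G) * e (rep path_corr a) \<in> J"
    by (simp add: e.unit_def c_def)
  have "e G * c a - c a * e G = (f * c a - c a * f) + (m * (d * c a) - m * (c a * d))"
    unfolding eG by (simp add: algebra_simps) (metis (no_types) mcom mult.assoc)
  also have "\<dots> \<in> J"
    by (intro add diff left fc dc cd)
  finally show "e G * e (rep path_corr a) - e (rep path_corr a) * e G \<in> J"
    by (simp add: c_def)
qed

lemma odd_G: "odd_op path_corr G"
  unfolding odd_op_def
proof (intro allI impI)
  fix \<gamma> assume "grading path_corr = Some \<gamma>"
  then obtain \<gamma>' where \<gamma>': "grading X = Some \<gamma>'" "\<gamma> = pointwise \<gamma>'"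
    by (auto simp: path_corr_simps)
  have gE: "\<gamma>' \<in> End_ops X"
    using corr \<gamma>' by (auto simp: correspondence_def unitary_def)
  have "F \<circ> \<gamma>' = - (\<gamma>' \<circ> F)" "\<Delta> \<circ> \<gamma>' = - (\<gamma>' \<circ> \<Delta>)"
    using kasparov \<Delta>_odd \<gamma>'(1) by (auto simp: kasparov_module_def odd_op_def)
  from fun_cong[OF this(1)] fun_cong[OF this(2)] have odd: "F (\<gamma>' x) = - \<gamma>' (F x)" "\<Delta> (\<gamma>' x) = - \<gamma>' (\<Delta> x)" for x
    by simp_all
  note gP = pointwise_End(1)[OF gE]
  show "G \<circ> \<gamma> = - (\<gamma> \<circ> G)"
    unfolding \<gamma>'(2)
  proof (rule path_op_eqI[OF H.End_comp(1)[OF G_End(1) gP] H.End_uminus(1)[OF H.End_comp(1)[OF gP G_End(1)]]])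
    fix x s assume x: "x \<in> paths"
    have Gx: "G x \<in> paths"
      using H.End_mem[OF G_End(1)] x by (simp add: path_corr_simps)
    show "val ((G \<circ> pointwise \<gamma>') x) s = val ((- (pointwise \<gamma>' \<circ> G)) x) s"
      using x Gx val_mem[OF x, of s]
      by (simp add: val_G val_pointwise pointwise_mem gE odd End_add_apply[OF gE] End_scaleC_apply[OF gE] End_mem F_End \<Delta>_End)
  qed
qed

lemma kasparov_G: "kasparov_module path_corr G"
  unfolding kasparov_module_def
proof (intro conjI allI)
  interpret e: corner_embedding path_corr "emb path_corr"
    by (rule H.corner_embedding_emb)
  show "correspondence path_corr" "G \<in> End_ops path_corr" "odd_op path_corr G"
    by (rule correspondence_paths corr G_End odd_G)+
  fix a
  have rE: "rep path_corr a \<in> End_ops path_corr"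
    by (simp add: path_corr_simps pointwise_End rep_End)
  have "(adj path_corr path_corr G - G) \<circ> rep path_corr a = 0"
    by (auto simp: G_End)
  then show "(adj path_corr path_corr G - G) \<circ> rep path_corr a \<in> compact_ops path_corr"
    using H.compact_zero by simp
  have iff: "T \<in> compact_ops path_corr" if "T \<in> End_ops path_corr" "emb path_corr T \<in> emb path_corr ` compact_ops path_corr" for T
    using that H.compact_End e.inject by auto
  note GG = H.End_comp(1)[OF G_End(1) G_End(1)]
  note m = H.End_minus(1)[OF H.End_id(1) GG]
  show "(id_op path_corr - (G \<circ> G)) \<circ> rep path_corr a \<in> compact_ops path_corr"
    using G_mem(1)[of a] by (intro iff H.End_comp(1)[OF m rE])
      (simp only: e.comp[OF m rE] e.minus[OF H.End_id(1) GG] e.comp[OF G_End(1) G_End(1)])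
  note m = H.End_comp(1)[OF G_End(1) rE] H.End_comp(1)[OF rE G_End(1)]
  show "(G \<circ> rep path_corr a) - (rep path_corr a \<circ> G) \<in> compact_ops path_corr"
    using G_mem(2)[of a] by (intro iff H.End_minus(1)[OF m])
      (simp only: e.minus[OF m] e.comp[OF G_End(1) rE] e.comp[OF rE G_End(1)])
qed

text \<open>The evaluation at \<open>t\<close>, followed by the unitary \<open>V\<close>.\<close>

lemma evaluates:
  fixes X' :: "('f::complex_vector, 'b, 'a) corr"
  assumes V: "unitary_operator X X' V" and t: "0 \<le> t" "t \<le> 1" and even: "is_even X \<longleftrightarrow> is_even X'"
    and rep: "\<And>a x. x \<in> hcarrier X \<Longrightarrow> V (rep X a x) = rep X' a (V x)"
    and gr: "\<And>\<gamma> \<gamma>' x. grading X = Some \<gamma> \<Longrightarrow> grading X' = Some \<gamma>' \<Longrightarrow> x \<in> hcarrier X \<Longrightarrow> V (\<gamma> x) = \<gamma>' (V x)"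
    and F': "\<And>x. x \<in> hcarrier X \<Longrightarrow> V (F x + complex_of_real t *\<^sub>C \<Delta> x) = F' (V x)"
  shows "evaluates_to (Abs_unit_interval t) path_corr G X' F'"
proof -
  interpret V: unitary_operator X X' V
    by (rule V)
  have clamp: "unit_clamp t = t" "Abs_unit_interval t = to_unit t"
    using t by (simp_all add: unit_clamp_def to_unit_def)
  have gE: "\<gamma> \<in> End_ops X" if "grading X = Some \<gamma>" for \<gamma>
    using corr that by (auto simp: correspondence_def unitary_def)
  let ?\<pi> = "\<lambda>x :: real \<Rightarrow> 'a \<times> 'b \<times> 'e. V (val x t)"
  show ?thesis
    unfolding evaluates_to_def clamp(2)
  proof (intro conjI exI[of _ ?\<pi>] ballI allI impI)
    show "is_even path_corr = is_even X'"
      using even by (auto simp: path_corr_simps)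
    show "?\<pi> ` hcarrier path_corr = hcarrier X'"
    proof (intro equalityI subsetI)
      show "y \<in> hcarrier X'" if "y \<in> ?\<pi> ` hcarrier path_corr" for y
        using that val_mem by (auto simp: path_corr_simps)
      fix y assume "y \<in> hcarrier X'"
      then obtain x where x: "x \<in> hcarrier X" "y = V x"
        using V.U_image by auto
      then have "y = ?\<pi> (mk (\<lambda>_. x))" "mk (\<lambda>_. x) \<in> hcarrier path_corr"
        by (simp_all add: path_corr_simps mk_mem is_path_const)
      then show "y \<in> ?\<pi> ` hcarrier path_corr"
        by (rule image_eqI)
    qed
    fix x assume "x \<in> hcarrier path_corr"
    then have x: "x \<in> paths"
      by (simp add: path_corr_simps)
    note vx = val_mem[OF x, of t]
    show "?\<pi> (c *\<^sub>C x) = c *\<^sub>C ?\<pi> x" for c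
      by (simp add: V.adjointable_scaleC[OF V.U_adjointable(1) vx])
    show "?\<pi> (hact path_corr x f) = hact X' (?\<pi> x) (apply_bcontfun f (to_unit t))" for f
      by (simp add: path_corr_simps V.adjointable_act[OF V.U_adjointable(1) vx])
    show "?\<pi> (rep path_corr a x) = rep X' a (?\<pi> x)" for a
      by (simp add: path_corr_simps val_pointwise x rep vx)
    show "?\<pi> (G x) = F' (?\<pi> x)"
      using F'[OF vx] by (simp add: val_G x clamp)
    show "?\<pi> (\<gamma> x) = \<gamma>' (?\<pi> x)" if "grading path_corr = Some \<gamma> \<and> grading X' = Some \<gamma>'" for \<gamma> \<gamma>'
      using that gr vx by (auto simp: path_corr_simps val_pointwise x)
    fix y assume "y \<in> hcarrier path_corr"
    then have y: "y \<in> paths"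
      by (simp add: path_corr_simps)
    show "?\<pi> (x + y) = ?\<pi> x + ?\<pi> y"
      by (simp add: V.adjointable_add[OF V.U_adjointable(1) vx val_mem[OF y]])
    show "hip X' (?\<pi> x) (?\<pi> y) = apply_bcontfun (hip path_corr x y) (to_unit t)"
      by (simp add: path_ip_val x y V.ip_U vx val_mem)
  qed
qed

end

context conformal
begin

lemma conformal_props:
  "is_even X1 \<longleftrightarrow> is_even X2" "U \<circ> rep X1 a = rep X2 a \<circ> U"
  "grading X1 = Some \<gamma>1 \<Longrightarrow> grading X2 = Some \<gamma>2 \<Longrightarrow> U \<circ> \<gamma>1 = \<gamma>2 \<circ> U"
  using conformal unfolding conformal_transformation_def by blast+

lemma odd_F2: "odd_op X1 F2"
  unfolding odd_op_def
proof (intro allI impI)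
  fix \<gamma>1 assume g1: "grading X1 = Some \<gamma>1"
  then obtain \<gamma>2 where g2: "grading X2 = Some \<gamma>2"
    using conformal_props(1) by auto
  have g1E: "\<gamma>1 \<in> End_ops X1"
    using one.cycle g1 by (auto simp: cycle_def correspondence_def unitary_def)
  have g2E: "\<gamma>2 \<in> End_ops X2"
    using two.cycle g2 by (auto simp: cycle_def correspondence_def unitary_def)
  from fun_cong[OF conformal_props(3)[OF g1 g2]] have Ug: "U (\<gamma>1 x) = \<gamma>2 (U x)" for x
    by simp
  have "two.F \<circ> \<gamma>2 = - (\<gamma>2 \<circ> two.F)"
    using two.odd_F g2 by (simp add: odd_op_def)
  from fun_cong[OF this] have F\<gamma>: "two.F (\<gamma>2 y) = - \<gamma>2 (two.F y)" for y
    by simp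
  interpret V: hilbert_pair X2 X1 ..
  show "F2 \<circ> \<gamma>1 = - (\<gamma>1 \<circ> F2)"
  proof (rule one.End_ext[OF one.End_comp(1)[OF F2_End g1E] one.End_uminus(1)[OF one.End_comp(1)[OF g1E F2_End]]])
    fix x assume x: "x \<in> hcarrier X1"
    define z where "z = two.F (U x)"
    have z: "z \<in> hcarrier X2"
      using x by (simp add: z_def two.End_mem[OF two.F_End(1)])
    have "Uadj (\<gamma>2 z) = Uadj (U (\<gamma>1 (Uadj z)))"
      using z by (simp add: Ug)
    then have "Uadj (\<gamma>2 z) = \<gamma>1 (Uadj z)"
      using z by (simp add: one.End_mem[OF g1E])
    moreover have "Uadj (- \<gamma>2 z) = - Uadj (\<gamma>2 z)"
      using V.adjointable_scaleC[OF U_adjointable(2) two.End_mem[OF g2E z], of "-1"] by simp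
    ultimately show "(F2 \<circ> \<gamma>1) x = (- (\<gamma>1 \<circ> F2)) x"
      by (simp add: F2_def conjugate_apply Ug F\<gamma> z_def)
  qed
qed

lemma homotopic: "homotopic (X1, one.F) (X2, two.F)"
proof -
  have dE: "F2 - one.F \<in> End_ops X1"
    by (rule one.End_minus(1)[OF F2_End one.F_End(1)])
  have F2_adj: "adj X1 X1 F2 = F2"
    unfolding F2_def conjugate_End(2)[OF two.F_End(1)] two.F_End(2) ..
  interpret P: compact_perturbation X1 one.F "F2 - one.F"
  proof
    show "kasparov_module X1 one.F"
      by (rule one.kasparov_bounded_transform)
    show "adj X1 X1 one.F = one.F" "F2 - one.F \<in> End_ops X1"
      by (rule one.F_End dE)+
    show "adj X1 X1 (F2 - one.F) = F2 - one.F"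
      unfolding one.End_minus(2)[OF F2_End one.F_End(1)] F2_adj one.F_End(2) ..
    show "(F2 - one.F) \<circ> rep X1 a \<in> compact_ops X1" for a
      by (rule Delta_rep_compact)
    show "odd_op X1 (F2 - one.F)"
      unfolding odd_op_def
    proof (intro allI impI)
      fix \<gamma> assume gr: "grading X1 = Some \<gamma>"
      then have gE: "\<gamma> \<in> End_ops X1"
        using one.cycle by (auto simp: cycle_def correspondence_def unitary_def)
      have "F2 \<circ> \<gamma> = - (\<gamma> \<circ> F2)" "one.F \<circ> \<gamma> = - (\<gamma> \<circ> one.F)"
        using odd_F2 one.odd_F gr by (auto simp: odd_op_def)
      from fun_cong[OF this(1)] fun_cong[OF this(2)]
      show "(F2 - one.F) \<circ> \<gamma> = - (\<gamma> \<circ> (F2 - one.F))"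
        unfolding one.End_comp_plus(2)[OF gE F2_End one.F_End(1)] by (auto simp: fun_eq_iff)
    qed
  qed
  interpret I: unitary_operator X1 X1 "id_op X1"
    by unfold_locales (simp add: unitary_def one.End_id one.id_op_comp)
  have "evaluates_to (Abs_unit_interval 0) P.path_corr P.G X1 one.F"
  proof (rule P.evaluates[OF I.unitary_operator_axioms])
    show "id_op X1 (rep X1 a x) = rep X1 a (id_op X1 x)" if "x \<in> hcarrier X1" for a x
      using that by (simp add: one.id_op_apply one.End_mem[OF one.rep_End(1)])
    show "id_op X1 (\<gamma> x) = \<gamma>' (id_op X1 x)"
      if "grading X1 = Some \<gamma>" "grading X1 = Some \<gamma>'" "x \<in> hcarrier X1" for \<gamma> \<gamma>' x
      using that one.cycle by (auto simp: one.id_op_apply cycle_def correspondence_def unitary_def one.End_mem)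
    show "id_op X1 (one.F x + complex_of_real 0 *\<^sub>C (F2 - one.F) x) = one.F (id_op X1 x)" if "x \<in> hcarrier X1" for x
      using that one.End_mem[OF one.F_End(1) that] by (simp add: one.id_op_apply complex_vector.scale_zero_left)
  qed simp_all
  moreover have "evaluates_to (Abs_unit_interval 1) P.path_corr P.G X2 two.F"
  proof (rule P.evaluates[OF unitary_operator_axioms])
    show "is_even X1 \<longleftrightarrow> is_even X2"
      by (rule conformal_props(1))
    show "U (rep X1 a x) = rep X2 a (U x)" for a x
      using fun_cong[OF conformal_props(2), of a x] by simp
    show "U (\<gamma> x) = \<gamma>' (U x)" if "grading X1 = Some \<gamma>" "grading X2 = Some \<gamma>'" for \<gamma> \<gamma>' x
      using fun_cong[OF conformal_props(3)[OF that], of x] by simp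
    show "U (one.F x + complex_of_real 1 *\<^sub>C (F2 - one.F) x) = two.F (U x)" if "x \<in> hcarrier X1" for x
      using that by (simp add: scaleC_one F2_def conjugate_apply two.End_mem[OF two.F_End(1)])
  qed simp_all
  ultimately show ?thesis
    unfolding homotopic_def prod.case
    using one.kasparov_bounded_transform two.kasparov_bounded_transform P.kasparov_G by blast
qed

end

theorem theorem2p11:
  fixes X1 X2 :: "('e::complex_vector, 'b::cstar_algebra, 'a::cstar_algebra) corr"
    and D1 D2 :: "('e, 'e) unbounded_op"
    and U \<mu> :: "'e \<Rightarrow> 'e"
    and \<alpha> :: real
  assumes "0 \<le> \<alpha>" and "\<alpha> < 1"
    and "cycle \<alpha> X1 D1" and "cycle \<alpha> X2 D2"
    and "conformal_transformation \<alpha> X1 D1 X2 D2 U \<mu>"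
  shows "(\<forall>a. ((adj X1 X2 U \<circ> bounded_transform X2 D2 \<circ> U) - bounded_transform X1 D1) \<circ> rep X1 a
            \<in> compact_ops X1)
    \<and> kk_class X1 (bounded_transform X1 D1) \<in> KK (is_even X1)
    \<and> kk_class X1 (bounded_transform X1 D1) = kk_class X2 (bounded_transform X2 D2)
    \<and> cycle_class X1 D1 = cycle_class X2 D2"
proof -
  interpret conformal \<alpha> X1 X2 D1 D2 U \<mu>
    by unfold_locales (fact assms)+
  have 12: "equivclp homotopic (X1, bounded_transform X1 D1) (X2, bounded_transform X2 D2)"
    using homotopic by (rule r_into_equivclp)
  have "equivclp homotopic (X1, bounded_transform X1 D1) N \<longleftrightarrow> equivclp homotopic (X2, bounded_transform X2 D2) N" for N
    using equivclp_trans[OF 12] equivclp_trans[OF equivclp_sym[OF 12]] by blast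
  then have kk: "kk_class X1 (bounded_transform X1 D1) = kk_class X2 (bounded_transform X2 D2)"
    by (auto simp: kk_class_def kk_rel_def)
  have "(X1, bounded_transform X1 D1) \<in> kasparov_modules (is_even X1)"
    using one.kasparov_bounded_transform by (simp add: kasparov_modules_def)
  then have "kk_class X1 (bounded_transform X1 D1) \<in> KK (is_even X1)"
    unfolding KK_def kk_class_def by (rule quotientI)
  with kk Delta_rep_compact show ?thesis
    by (simp add: cycle_class_def F2_def conjugate_def)
qed

end
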